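(* Assume the General Setup and Assumption 2.1 with the two summability conditions there replaced by $\sum_{n\ge1}n\,\varpi_{q,p}(n)<\infty$ and $\sum_{r\ge1}r\,(\beta_q(r))^\delta<\infty$, and suppose $q_1$ is linear. Let $k$ be such that $r_k=i_1$ (so $q_1,\dots,q_{i_1}$ are exactly the linear polynomials). Let $G=G(x_1,\dots,x_{i_1})$ satisfy the same Hölder and growth bounds as $F$ (with the same $K,\kappa,\iota$) and $\int G\,d\nu_1\cdots d\nu_k=0$ (variables grouped as $y_i=(x_{r_{i-1}+1},\dots,x_{r_i})$). Put $G_n=G(X(q_1(n)),\dots,X(q_{i_1}(n)))$ and $\sigma^2=\lim_{N\to\infty}\frac1N\mathrm{Var}(\sum_{n=1}^NG_n)$ (this limit exists). For $i=1,\dots,k$ let $Y^{(i)}=\{Y^{(i)}(n)\}_{n\ge1}$ be mutually independent processes such that $Y^{(i)}$ has the same distribution as $\{(X(n+d_{1,i}),\dots,X(n+d_{r_i-r_{i-1},i}))\}_{n\ge1}$, where $d_{j,i}=q_{r_{i-1}+j}-q_{r_{i-1}+1}$ (a constant). Let $Z_n=G(Y^{(1)}(q_1(n)),Y^{(2)}(q_{r_1+1}(n)),\dots,Y^{(k)}(q_{r_{k-1}+1}(n)))$ and $\Sigma_N=\sum_{n=1}^NZ_n$. Then $s^2=\lim_{N\to\infty}\frac1N\mathrm{Var}\,\Sigma_N$ exists; $\sigma^2>0$ if and only if $s^2>0$; and these hold if and only if there is no representation $Z_n=V_{n+1}-V_n$ ($n\ge0$) with $\{V_n\}_{n\ge0}$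 a square integrable weakly (wide sense) stationary process.
   Context: General Setup. Let $(\Omega,\mathcal F,P)$ be a probability space, $\{X(n)\}_{n\ge0}$ an $\mathbb R^\wp$-valued process, and $\{\mathcal F_{k,l}\}_{-\infty\le k\le l\le\infty}$ sub-$\sigma$-algebras with $\mathcal F_{k,l}\subset\mathcal F_{k',l'}$ if $k'\le k$, $l\le l'$. For sub-$\sigma$-algebras $\mathcal G,\mathcal H$ put $\varpi_{q,p}(\mathcal G,\mathcal H)=\sup\{\|E[g|\mathcal G]-Eg\|_p: g\in L^q(\Omega,\mathcal H,P),\|g\|_q\le1\}$, $\varpi_{q,p}(n)=\sup_{k\ge0}\varpi_{q,p}(\mathcal F_{-\infty,k},\mathcal F_{k+n,\infty})$ and $\beta_q(r)=\sup_{k\ge0}\|X(k)-E(X(k)|\mathcal F_{k-r,k+r})\|_q$. Let $q_1,\dots,q_\ell$ be nonconstant polynomials with $q_i(\mathbb N)\subset\mathbb N$ and $q_1(n)<\dots<q_\ell(n)$ for all large $n$; each difference $q_{i+1}-q_i$ is then either a positive constant or tends to $\infty$. Let $0<r_1<\dots<r_{\hat\ell-1}<\ell$ be all indices $i$ with $q_{i+1}(n)-q_i(n)\to\infty$, and $r_0=0$, $r_{\hat\ell}=\ell$. Let $\hat D=\{q_i-q_{r_s+1}:0\le s\le\hat\ell-1,\ r_s<i\le r_{s+1}\}$ (a finite set of nonnegative integers containing $0$). Stationarity: all $X(n)$ have a common distribution $\mu$, and for $k\le 2|\hat D|$ and $n_1\le\dots\le n_k$ the joint law of $(X(n_1),\dots,X(n_k))$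 depends only on the differences $n_{j}-n_{j-1}$. For $1\le i\le\hat\ell$ let $\nu_i$ be the law of $(X(0),X(q_{r_{i-1}+2}-q_{r_{i-1}+1}),\dots,X(q_{r_i}-q_{r_{i-1}+1}))$. Put $\gamma_\theta=(\int|x|^\theta d\mu(x))^{1/\theta}$. $F:(\mathbb R^\wp)^\ell\to\mathbb R$ satisfies, for some $K,\iota>0$, $\kappa\in(0,1]$: $|F(x)-F(z)|\le K[1+\sum_{i}(|x_i|^\iota+|z_i|^\iota)]\sum_i|x_i-z_i|^\kappa$ and $|F(x)|\le K[1+\sum_i|x_i|^\iota]$. Assumption 2.1: with $d=(\hat\ell-1)|\hat D|\wp$ there are $1\le p,q<\infty$ and $\delta,m>0$ with $\delta<\kappa-d/p$, $\sum_{n\ge1}\varpi_{q,p}(n)<\infty$, $\sum_{r\ge1}\beta_q(r)^\delta<\infty$, $\gamma_m<\infty$, $\gamma_{2q\iota}<\infty$, and $\frac12\ge\frac1p+\frac{\iota+2}m+\frac\delta q$. Degrees: $0=i_0<i_1<\dots<i_v=\ell$ and $m_1<\dots<m_v$ are such that $\deg q_i=m_k$ for $i_{k-1}<i\le i_k$ (each $i_k$ is some $r_s$). *)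

theory Defs
  imports "HOL-Probability.Probability" "HOL-Computational_Algebra.Polynomial"
begin

definition enn_powr :: "ennreal \<Rightarrow> real \<Rightarrow> ennreal" where
  "enn_powr x a = (if x = \<top> then \<top> else ennreal (enn2real x powr a))"

definition lpnorm :: "'a measure \<Rightarrow> real \<Rightarrow> ('a \<Rightarrow> 'b::real_normed_vector) \<Rightarrow> ennreal" where
  "lpnorm M p f = enn_powr (\<integral>\<^sup>+ w. ennreal (norm (f w) powr p) \<partial>M) (1 / p)"

definition cond_exp_vec :: "'a measure \<Rightarrow> 'a measure \<Rightarrow> ('a \<Rightarrow> real ^ 'd) \<Rightarrow> 'a \<Rightarrow> real ^ 'd" where
  "cond_exp_vec M F f w = (\<chi> i. real_cond_exp M F (\<lambda>x. f x $ i) w)"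

definition var :: "'a measure \<Rightarrow> ('a \<Rightarrow> real) \<Rightarrow> real" where
  "var M f = (\<integral>w. (f w - (\<integral>x. f x \<partial>M))\<^sup>2 \<partial>M)"

definition cov :: "'a measure \<Rightarrow> ('a \<Rightarrow> real) \<Rightarrow> ('a \<Rightarrow> real) \<Rightarrow> real" where
  "cov M f g = (\<integral>w. (f w - (\<integral>x. f x \<partial>M)) * (g w - (\<integral>x. g x \<partial>M)) \<partial>M)"

definition varpi_sa :: "'a measure \<Rightarrow> real \<Rightarrow> real \<Rightarrow> 'a measure \<Rightarrow> 'a measure \<Rightarrow> ennreal" where
  "varpi_sa M q p G H =
     (SUP g \<in> {g. g \<in> borel_measurable H \<and> lpnorm M q g \<le> 1}.
        lpnorm M p (\<lambda>w. real_cond_exp M G g w - (\<integral>x. g x \<partial>M)))"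

definition idx :: "ereal set" where
  "idx = {-\<infinity>, \<infinity>} \<union> range (\<lambda>z::int. ereal (real_of_int z))"

definition varpi :: "'a measure \<Rightarrow> (ereal \<Rightarrow> ereal \<Rightarrow> 'a measure) \<Rightarrow> real \<Rightarrow> real \<Rightarrow> nat \<Rightarrow> ennreal" where
  "varpi M Fam q p n =
     (SUP k \<in> (UNIV :: nat set). varpi_sa M q p (Fam (-\<infinity>) (ereal (real k)))
                                            (Fam (ereal (real k + real n)) \<infinity>))"

definition beta :: "'a measure \<Rightarrow> (ereal \<Rightarrow> ereal \<Rightarrow> 'a measure) \<Rightarrow> (nat \<Rightarrow> 'a \<Rightarrow> real ^ 'd)
                     \<Rightarrow> real \<Rightarrow> nat \<Rightarrow> ennreal" where
  "beta M Fam X q r =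
     (SUP k \<in> (UNIV :: nat set).
        lpnorm M q (\<lambda>w. X k w - cond_exp_vec M (Fam (ereal (real k - real r)) (ereal (real k + real r))) (X k) w))"

text \<open>Value of a polynomial mapping N into N, as a natural number.\<close>
definition qv :: "real poly \<Rightarrow> nat \<Rightarrow> nat" where
  "qv P n = nat \<lfloor>poly P (real n)\<rfloor>"

definition Rset :: "(nat \<Rightarrow> real poly) \<Rightarrow> nat \<Rightarrow> nat set" where
  "Rset q l = {i. 1 \<le> i \<and> i < l \<and>
       filterlim (\<lambda>n::nat. poly (q (i+1)) (real n) - poly (q i) (real n)) at_top sequentially}"

definition lhat :: "(nat \<Rightarrow> real poly) \<Rightarrow> nat \<Rightarrow> nat" where
  "lhat q l = card (Rset q l) + 1"

definition rr :: "(nat \<Rightarrow> real poly) \<Rightarrow> nat \<Rightarrow> nat \<Rightarrow> nat" where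
  "rr q l s = (if s = 0 then 0
               else if s \<le> card (Rset q l) then sorted_list_of_set (Rset q l) ! (s - 1)
               else l)"

definition Dhat :: "(nat \<Rightarrow> real poly) \<Rightarrow> nat \<Rightarrow> real set" where
  "Dhat q l = {poly (q i - q (rr q l s + 1)) 0 | s i.
                 s \<le> lhat q l - 1 \<and> rr q l s < i \<and> i \<le> rr q l (s + 1)}"

definition blk :: "(nat \<Rightarrow> real poly) \<Rightarrow> nat \<Rightarrow> nat \<Rightarrow> nat" where
  "blk q l j = (LEAST s. j \<le> rr q l s)"

definition Bl :: "(nat \<Rightarrow> real poly) \<Rightarrow> nat \<Rightarrow> nat \<Rightarrow> nat set" where
  "Bl q l s = {rr q l (s - 1) + 1 .. rr q l s}"

text \<open>The constant offset q_j - q_{r_{s-1}+1} for j in block s.\<close>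
definition doff :: "(nat \<Rightarrow> real poly) \<Rightarrow> nat \<Rightarrow> nat \<Rightarrow> nat" where
  "doff q l j = nat \<lfloor>poly (q j - q (rr q l (blk q l j - 1) + 1)) 0\<rfloor>"

definition nu :: "'a measure \<Rightarrow> (nat \<Rightarrow> 'a \<Rightarrow> real ^ 'd) \<Rightarrow> (nat \<Rightarrow> real poly) \<Rightarrow> nat \<Rightarrow> nat
                   \<Rightarrow> (nat \<Rightarrow> real ^ 'd) measure" where
  "nu M X q l s = distr M (PiM (Bl q l s) (\<lambda>_. borel)) (\<lambda>w. \<lambda>j\<in>Bl q l s. X (doff q l j) w)"

definition hoelder_growth :: "nat \<Rightarrow> real \<Rightarrow> real \<Rightarrow> real \<Rightarrow> ((nat \<Rightarrow> real ^ 'd) \<Rightarrow> real) \<Rightarrow> bool" where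
  "hoelder_growth L K iota kappa F \<longleftrightarrow>
     (\<forall>x z. \<bar>F x - F z\<bar> \<le> K * (1 + (\<Sum>i=1..L. norm (x i) powr iota + norm (z i) powr iota))
                                * (\<Sum>i=1..L. norm (x i - z i) powr kappa)) \<and>
     (\<forall>x. \<bar>F x\<bar> \<le> K * (1 + (\<Sum>i=1..L. norm (x i) powr iota)))"

definition weakly_stationary :: "'b measure \<Rightarrow> (nat \<Rightarrow> 'b \<Rightarrow> real) \<Rightarrow> bool" where
  "weakly_stationary N V \<longleftrightarrow>
     (\<forall>n. V n \<in> borel_measurable N \<and> integrable N (\<lambda>w. (V n w)\<^sup>2)) \<and>
     (\<forall>n. (\<integral>w. V n w \<partial>N) = (\<integral>w. V 0 w \<partial>N)) \<and>
     (\<forall>n m h. cov N (V (n + h)) (V (m + h)) = cov N (V n) (V m))"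

end

theory Submission
  imports Defs
begin

text \<open>Let block \<open>s\<close> consist of the linear polynomials with the \<open>s\<close>-th smallest slope. Integrating
  out the blocks one after the other, beginning with the largest slope, writes \<open>G\<close> as a sum of functions
  \<open>G\<^sub>s\<close> that are centred in block \<open>s\<close> given the earlier blocks. A chaining argument over dyadic grids
  yields a summable rate for the covariances of the summands \<open>G\<^sub>s(n)\<close>, whose times cluster near
  \<open>slope s * n\<close>. The sum of \<open>G\<^sub>s(n)\<close> over the times after those entering all other sums is almost
  uncorrelated with the rest, so the limiting variance vanishes iff each \<open>G\<^sub>s\<close> alone contributes zero.
  As the times tend to infinity the blocks become independent, so the covariances of \<open>G\<^sub>s\<close> converge
  to those of the independent block processes, where different \<open>s\<close> are orthogonal and the contributions add
  up to \<open>s\<^sup>2\<close>. For a weakly stationary sequence \<open>Z\<close> with weighted summable covariances, zero limiting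
  variance makes the averages of the partial sums converge in \<open>L\<^sup>2\<close>, and the negative of their limit
  starts the process \<open>V\<close>.\<close>

section \<open>Averages over double arrays\<close>

text \<open>Mixing controls the conditional expectation of one fixed function of the future, whereas
  \<open>Gs s\<close> has the random earlier blocks as a further argument. Uniformity in that
  argument costs their dimension d: a grid of mesh 2^(-n) has about 2^(n d) cells per unit volume, a
  p-norm over cells costs 2^(n d / p), and the Hoelder increment gains 2^(-kappa n). The gap between
  kappa and d / p makes the levels summable.

  The two limiting variances are in general different numbers: in the original process the
  covariances of \<open>Gs s\<close> at n and \<open>Gs s'\<close> at m need not vanish when
  \<open>slope s * n\<close> and \<open>slope s' * m\<close> are close. Only the diagonal
  contributions \<open>D s\<close> agree with those of the independent blocks, so only positivity is
  compared.

  Limits of covariances are found without a rate, through sums of products of bounded Lipschitz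
  functions. At most one block of each of the two factors moves at a given rate, which is why
  stationarity for \<open>2 * card (Dhat q l)\<close> times suffices. The weight n in the
  summability conditions makes the variances of the partial sums of \<open>Z\<close> converge in the
  degenerate case.\<close>

lemma summable_of_weighted:
  fixes f :: "nat \<Rightarrow> real"
  assumes "summable (\<lambda>n. real n * \<bar>f n\<bar>)"
  shows "summable f"
proof (rule summable_comparison_test_ev[OF _ assms])
  show "\<forall>\<^sub>F n in sequentially. norm (f n) \<le> real n * \<bar>f n\<bar>"
    using eventually_ge_at_top[of 1]
  proof eventually_elim
    case (elim n)
    then show ?case using mult_right_mono[of 1 "real n" "\<bar>f n\<bar>"] by simp
  qed
qed

lemma cesaro_null:
  fixes x :: "nat \<Rightarrow> real"
  assumes "x \<longlonglongrightarrow> 0"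
  shows "(\<lambda>N. (\<Sum>n=1..N. x n) / real N) \<longlonglongrightarrow> 0"
proof (rule LIMSEQ_I)
  fix e :: real assume e: "e > 0"
  obtain N0 where N0: "\<And>n. n \<ge> N0 \<Longrightarrow> \<bar>x n\<bar> < e / 2"
    using LIMSEQ_D[OF assms, of "e / 2"] e by auto
  define C where "C = (\<Sum>n=1..N0. \<bar>x n\<bar>)"
  obtain N1 :: nat where N1: "2 * C / e < real N1" using reals_Archimedean2 by blast
  have "norm ((\<Sum>n=1..N. x n) / real N - 0) < e" if N: "N \<ge> max 1 N1" for N
  proof -
    have "\<bar>\<Sum>n=1..N. x n\<bar> \<le> (\<Sum>n=1..N. (if n \<in> {1..N0} then \<bar>x n\<bar> else 0) + e / 2)"
      by (rule order_trans[OF sum_abs sum_mono]) (use N0 e in \<open>auto simp: less_imp_le\<close>)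
    also have "\<dots> = (\<Sum>n\<in>{1..N} \<inter> {1..N0}. \<bar>x n\<bar>) + N * (e / 2)"
      by (simp add: sum.distrib sum.inter_restrict del: atLeastAtMost_iff Int_atLeastAtMost)
    also have "\<dots> \<le> C + N * (e / 2)"
      unfolding C_def by (intro add_right_mono sum_mono2) auto
    finally have "\<bar>\<Sum>n=1..N. x n\<bar> \<le> C + N * (e / 2)" .
    moreover have "C < N * (e / 2)"
    proof -
      have "2 * C / e < real N" using N1 N by simp
      then show ?thesis using e by (simp add: field_simps)
    qed
    ultimately show ?thesis using N e by (simp add: field_simps)
  qed
  then show "\<exists>N0. \<forall>N\<ge>N0. norm ((\<Sum>n=1..N. x n) / real N - 0) < e" by blast
qed

text \<open>An e/4 argument for the Cauchy property; no candidate for the limit is required. It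
  serves twice: after discarding distant pairs in a double average, and after replacing a function
  by a sum of products.\<close>

lemma convergent_if_approximable:
  fixes x :: "nat \<Rightarrow> real"
  assumes "\<And>e. e > 0 \<Longrightarrow> \<exists>y. convergent y \<and> (\<exists>N0. \<forall>N\<ge>N0. \<bar>x N - y N\<bar> \<le> e)"
  shows "convergent x"
proof -
  have "Cauchy x"
  proof (rule metric_CauchyI)
    fix e :: real assume e: "e > 0"
    obtain y N0 where y: "convergent y" "\<And>N. N \<ge> N0 \<Longrightarrow> \<bar>x N - y N\<bar> \<le> e / 4"
      using assms[of "e / 4"] e by auto
    obtain N1 where N1: "\<And>m n. m \<ge> N1 \<Longrightarrow> n \<ge> N1 \<Longrightarrow> dist (y m) (y n) < e / 4"
      using convergent_Cauchy[OF y(1)] e unfolding Cauchy_def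
      by (meson divide_pos_pos zero_less_numeral)
    have "dist (x m) (x n) < e" if "m \<ge> max N0 N1" "n \<ge> max N0 N1" for m n
      using y(2)[of m] y(2)[of n] N1[of m n] that e unfolding dist_real_def by (simp, linarith)
    then show "\<exists>M. \<forall>m\<ge>M. \<forall>n\<ge>M. dist (x m) (x n) < e" by blast
  qed
  then show ?thesis by (simp add: Cauchy_convergent_iff)
qed

text \<open>Once the drift \<open>N * (S / P)\<close> is removed, the partial sums are periodic in
  \<open>N\<close>, hence bounded, and division by \<open>N\<close> kills them.\<close>

lemma cesaro_periodic:
  fixes g :: "nat \<Rightarrow> real"
  assumes P: "P > 0" and per: "\<And>n. g (n + P) = g n"
  shows "(\<lambda>N. (\<Sum>n=1..N. g n) / real N) \<longlonglongrightarrow> (\<Sum>n=1..P. g n) / P"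
proof -
  define S where "S = (\<Sum>n=1..P. g n)"
  define d where "d N = (\<Sum>n=1..N. g n) - real N * (S / P)" for N
  have win: "(\<Sum>n=N+1..N+P. g n) = S" for N
  proof (induction N)
    case 0 then show ?case by (simp add: S_def)
  next
    case (Suc N)
    have "(\<Sum>n=Suc N+1..Suc N+P. g n) + g (N+1) = (\<Sum>n=N+1..N+P. g n) + g (N + 1 + P)"
      using P by (simp add: sum.atLeast_Suc_atMost[of "Suc N"])
    then show ?case using Suc per[of "N+1"] by simp
  qed
  have dper: "d (N + P) = d N" for N
  proof -
    have "{1..N+P} = {1..N} \<union> {N+1..N+P}" by auto
    then have "(\<Sum>n=1..N+P. g n) = (\<Sum>n=1..N. g n) + (\<Sum>n=N+1..N+P. g n)"
      by (simp add: sum.union_disjoint)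
    moreover have "(\<Sum>n=N+1..N+P. g n) = S" by (rule win)
    ultimately show ?thesis using P by (simp add: d_def field_simps)
  qed
  have dmod: "d N = d (N mod P)" for N
  proof -
    have "d (r + P * t) = d r" for r t
    proof (induction t)
      case (Suc t)
      have "d (r + P * Suc t) = d ((r + P * t) + P)" by (simp add: algebra_simps)
      then show ?case using dper Suc by simp
    qed simp
    then show ?thesis by (metis mod_mult_div_eq)
  qed
  have "(\<lambda>N. d N / real N) \<longlonglongrightarrow> 0"
  proof (rule tendsto_rabs_zero_cancel)
    define B where "B = (\<Sum>r<P. \<bar>d r\<bar>)"
    have "\<bar>d N\<bar> \<le> B" for N
      unfolding B_def by (subst dmod, rule member_le_sum[of "N mod P" "{..<P}" "\<lambda>r. \<bar>d r\<bar>"]) (use P in auto)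
    then have "\<bar>d N / real N\<bar> \<le> B / real N" for N by (auto intro!: divide_right_mono)
    then show "(\<lambda>N. \<bar>d N / real N\<bar>) \<longlonglongrightarrow> 0"
      by (intro tendsto_sandwich[OF _ _ tendsto_const lim_const_over_n[of B]]) auto
  qed
  then have "(\<lambda>N. d N / real N + S / P) \<longlonglongrightarrow> S / P" by (auto intro: tendsto_eq_intros)
  moreover have "\<forall>\<^sub>F N in sequentially. d N / real N + S / P = (\<Sum>n=1..N. g n) / real N"
    using eventually_gt_at_top[of 0] by eventually_elim (use P in \<open>simp add: d_def field_simps\<close>)
  ultimately show ?thesis
    unfolding S_def by (rule Lim_transform_eventually)
qed

text \<open>\<open>f\<close> differs from the periodic function
  \<open>\<lambda>n. l (n mod P)\<close> by a null sequence, because the finitely many residues have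
  a common threshold \<open>T\<close>.\<close>

lemma cesaro_asymp_periodic:
  fixes f :: "nat \<Rightarrow> real"
  assumes P: "P > 0" and conv: "\<And>r. r < P \<Longrightarrow> convergent (\<lambda>t. f (r + P * t))"
  shows "convergent (\<lambda>N. (\<Sum>n=1..N. f n) / real N)"
proof -
  obtain l where l: "\<And>r. r < P \<Longrightarrow> (\<lambda>t. f (r + P * t)) \<longlonglongrightarrow> l r"
    using conv unfolding convergent_def by metis
  define g where "g n = l (n mod P)" for n
  have "(\<lambda>n. f n - g n) \<longlonglongrightarrow> 0"
  proof (rule LIMSEQ_I)
    fix e :: real assume e: "e > 0"
    have "\<forall>r\<in>{..<P}. eventually (\<lambda>t. \<bar>f (r + P * t) - l r\<bar> < e) sequentially"
      using l tendstoD[OF l e] by (auto simp: dist_real_def)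
    then have "eventually (\<lambda>t. \<forall>r\<in>{..<P}. \<bar>f (r + P * t) - l r\<bar> < e) sequentially"
      by (intro eventually_ball_finite) auto
    then obtain T where T: "\<And>t r. t \<ge> T \<Longrightarrow> r < P \<Longrightarrow> \<bar>f (r + P * t) - l r\<bar> < e"
      unfolding eventually_sequentially by auto
    have "norm (f n - g n - 0) < e" if n: "n \<ge> P * T" for n
    proof -
      have "n div P \<ge> T" using n P by (simp add: less_eq_div_iff_mult_less_eq mult.commute)
      from T[OF this, of "n mod P"] show ?thesis using P by (simp add: g_def)
    qed
    then show "\<exists>no. \<forall>n\<ge>no. norm (f n - g n - 0) < e" by blast
  qed
  from cesaro_null[OF this] cesaro_periodic[OF P, of g]
  have "(\<lambda>N. (\<Sum>n=1..N. f n - g n) / real N + (\<Sum>n=1..N. g n) / real N) \<longlonglongrightarrow> 0 + (\<Sum>n=1..P. g n) / P"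
    by (intro tendsto_add) (auto simp: g_def)
  then show ?thesis
    unfolding convergent_def by (auto simp: sum_subtractf add_divide_distrib[symmetric])
qed

section \<open>Covariance arrays that decay with the separation of two times\<close>

lemma sum_inj_le_suminf:
  fixes k0 :: "nat \<Rightarrow> real"
  assumes "summable k0" "\<And>u. k0 u \<ge> 0" "finite S" "inj_on h S"
  shows "(\<Sum>m\<in>S. k0 (h m)) \<le> suminf k0"
proof -
  have "(\<Sum>m\<in>S. k0 (h m)) = sum k0 (h ` S)" using assms(4) by (simp add: sum.reindex)
  also have "\<dots> \<le> suminf k0" using assms by (intro sum_le_suminf) auto
  finally show ?thesis .
qed

text \<open>A covariance-like double array that decays with the separation of the times \<open>A * n\<close> and
  \<open>A' * m\<close>; the second terms in the bounds account for the distance of the later time to the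
  other times entering the same summand.\<close>
locale decaying_array =
  fixes c :: "nat \<Rightarrow> nat \<Rightarrow> real" and A A' :: nat and k0 :: "nat \<Rightarrow> real"
  assumes A_pos: "A > 0" "A' > 0"
    and k0_nonneg: "\<And>u. k0 u \<ge> 0" and k0_sum: "summable (\<lambda>u. real u * k0 u)"
    and bound1: "\<And>n m. A' * m \<le> A * n \<Longrightarrow> \<bar>c n m\<bar> \<le> k0 (A * n - A' * m) + k0 n"
    and bound2: "\<And>n m. A * n \<le> A' * m \<Longrightarrow> \<bar>c n m\<bar> \<le> k0 (A' * m - A * n) + k0 m"
begin

lemma k0_summable: "summable k0"
  by (rule summable_of_weighted) (use k0_sum in \<open>simp add: k0_nonneg\<close>)

lemma k0_le: "k0 u \<le> suminf k0"
  using sum_le_suminf[OF k0_summable, of "{u}"] k0_nonneg by auto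

lemma c_le: "\<bar>c n m\<bar> \<le> 2 * suminf k0"
  using bound1[of m n] bound2[of n m] k0_le[of n] k0_le[of m] k0_le[of "A * n - A' * m"] k0_le[of "A' * m - A * n"]
  by (cases "A' * m \<le> A * n") auto

lemma weighted_sum_le: "finite S \<Longrightarrow> (\<Sum>n\<in>S. real n * k0 n) \<le> (\<Sum>u. real u * k0 u)"
  using k0_nonneg by (intro sum_le_suminf[OF k0_sum]) auto

text \<open>\<open>sep\<close> puts every time \<open>A' * m\<close> before every time
  \<open>A * n\<close>. A separation \<open>v\<close> is attained by at most \<open>v\<close> pairs,
  because \<open>n - n1\<close> lies between 1 and \<open>v\<close> and, together with
  \<open>v\<close>, determines the pair; this produces the weight \<open>u\<close> in the bound.
  Each secondary term \<open>k0 n\<close> is counted \<open>N' <= A * n\<close> times.\<close>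

lemma cross_sum_bounded:
  assumes sep: "A' * N' \<le> A * n1"
  shows "(\<Sum>n\<in>{n1<..N}. \<Sum>m\<in>{1..N'}. \<bar>c n m\<bar>) \<le> (1 + A) * (\<Sum>u. real u * k0 u)"
proof -
  have lt: "A' * m < A * n" if "n \<in> {n1<..N}" "m \<in> {1..N'}" for n m
  proof -
    have "A' * m \<le> A' * N'" using that by simp
    also have "\<dots> \<le> A * n1" by (rule sep)
    also have "\<dots> < A * n" using that A_pos by simp
    finally show ?thesis .
  qed
  have "(\<Sum>n\<in>{n1<..N}. \<Sum>m\<in>{1..N'}. \<bar>c n m\<bar>)
    \<le> (\<Sum>n\<in>{n1<..N}. \<Sum>m\<in>{1..N'}. k0 (A * n - A' * m) + k0 n)"
    using lt by (intro sum_mono bound1) (auto simp: less_imp_le)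
  also have "\<dots> = (\<Sum>n\<in>{n1<..N}. \<Sum>m\<in>{1..N'}. k0 (A * n - A' * m)) + (\<Sum>n\<in>{n1<..N}. N' * k0 n)"
    by (simp add: sum.distrib)
  also have "(\<Sum>n\<in>{n1<..N}. N' * k0 n) \<le> (\<Sum>n\<in>{n1<..N}. A * (real n * k0 n))"
  proof (rule sum_mono)
    fix n assume n: "n \<in> {n1<..N}"
    have "N' \<le> A' * N'" using A_pos by simp
    also have "\<dots> \<le> A * n1" by (rule sep)
    also have "\<dots> \<le> A * n" using n by simp
    finally have "real N' \<le> real A * real n" by (metis of_nat_le_iff of_nat_mult)
    then show "N' * k0 n \<le> A * (real n * k0 n)"
      using k0_nonneg[of n] by (simp add: mult.assoc[symmetric] mult_right_mono)
  qed
  also have "\<dots> \<le> A * (\<Sum>u. real u * k0 u)"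
    by (simp add: sum_distrib_left[symmetric] weighted_sum_le mult_left_mono)
  also have "(\<Sum>n\<in>{n1<..N}. \<Sum>m\<in>{1..N'}. k0 (A * n - A' * m)) \<le> (\<Sum>u. real u * k0 u)"
  proof -
    let ?S = "{n1<..N} \<times> {1..N'}"
    let ?h = "\<lambda>(n, m). (A * n - A' * m, n - n1)"
    have "(\<Sum>n\<in>{n1<..N}. \<Sum>m\<in>{1..N'}. k0 (A * n - A' * m)) = (\<Sum>z\<in>?S. k0 (fst (?h z)))"
      by (simp add: sum.cartesian_product split_def)
    also have "\<dots> = (\<Sum>z\<in>?h ` ?S. k0 (fst z))"
    proof (subst sum.reindex)
      show "inj_on ?h ?S"
      proof (rule inj_onI, clarify)
        fix n m n' m' assume a: "n \<in> {n1<..N}" "m \<in> {1..N'}" "n' \<in> {n1<..N}" "m' \<in> {1..N'}"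
          and e1: "A * n - A' * m = A * n' - A' * m'" and e2: "n - n1 = n' - n1"
        have "n = n'" using a e2 by auto
        moreover have "A' * m = A' * m'"
          using e1 lt[of n m] lt[of n m'] a unfolding \<open>n = n'\<close> by linarith
        ultimately show "n = n' \<and> m = m'" using A_pos by simp
      qed
    qed (simp add: o_def)
    also have "\<dots> \<le> (\<Sum>z\<in>(SIGMA v:{..A * N}. {1..v}). k0 (fst z))"
    proof (intro sum_mono2)
      show "?h ` ?S \<subseteq> (SIGMA v:{..A * N}. {1..v})"
      proof clarify
        fix n m assume a: "n \<in> {n1<..N}" "m \<in> {1..N'}"
        have "A' * m \<le> A' * N'" using a by simp
        then have "A' * m \<le> A * n1" using sep by linarith
        moreover have "A * n - A * n1 \<ge> n - n1" using A_pos
          by (metis diff_mult_distrib2 mult_le_mono1 Suc_leI One_nat_def nat_mult_1)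
        moreover have "A * n \<le> A * N" using a by simp
        ultimately have "A * n - A' * m \<le> A * N" "n - n1 \<le> A * n - A' * m" by linarith+
        then show "A * n - A' * m \<in> {..A * N} \<and> n - n1 \<in> {1..A * n - A' * m}"
          using a by auto
      qed
    qed (use k0_nonneg in auto)
    also have "\<dots> = (\<Sum>v\<in>{..A * N}. real v * k0 v)"
    proof -
      have "(\<Sum>z\<in>(SIGMA v:{..A * N}. {1..v}). k0 (fst z)) = (\<Sum>v\<in>{..A * N}. \<Sum>i\<in>{1..v}. k0 v)"
        by (subst sum.Sigma) (auto simp: split_def)
      then show ?thesis by simp
    qed
    also have "\<dots> \<le> (\<Sum>u. real u * k0 u)" by (rule weighted_sum_le) simp
    finally show ?thesis .
  qed
  finally show ?thesis by (simp add: algebra_simps)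
qed

text \<open>One of the two truncated differences is zero, so the sum is the distance of the two
  times.\<close>

definition sep :: "nat \<Rightarrow> nat \<Rightarrow> nat" where
  "sep n m = (A * n - A' * m) + (A' * m - A * n)"

text \<open>The index \<open>m\<close> is not cut off at the side \<open>N\<close> of the square, so
  that a sum over the window depends on \<open>n\<close> alone and can be asymptotically periodic in
  \<open>n\<close>.\<close>

definition near :: "nat \<Rightarrow> nat \<Rightarrow> nat set" where
  "near U n = {m. m \<ge> 1 \<and> sep n m \<le> U}"

lemma finite_near: "finite (near U n)"
proof (rule finite_subset)
  show "near U n \<subseteq> {..A * n + U}"
  proof
    fix m assume "m \<in> near U n"
    then have "A' * m \<le> A * n + U" by (auto simp: near_def sep_def)
    moreover have "m \<le> A' * m" using A_pos by simp
    ultimately have "m \<le> A * n + U" by linarith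
    then show "m \<in> {..A * n + U}" by simp
  qed
qed simp

text \<open>For fixed \<open>n\<close> the separation is injective in \<open>m\<close> on either
  side of the diagonal, so the distant \<open>m\<close> see the tail of \<open>k0\<close> beyond
  \<open>U\<close> at most twice. The secondary terms \<open>k0 n\<close> and \<open>k0 m\<close>
  occur at most \<open>A * n\<close> and \<open>A' * m\<close> times, which bounds their total
  independently of \<open>N\<close>.\<close>

lemma far_sum_bounded:
  "(\<Sum>n=1..N. \<Sum>m\<in>{1..N} - near U n. \<bar>c n m\<bar>)
     \<le> N * (2 * (\<Sum>v. k0 (v + U))) + (A + A') * (\<Sum>u. real u * k0 u)"
proof -
  have "(\<Sum>n=1..N. \<Sum>m\<in>{1..N} - near U n. \<bar>c n m\<bar>)
    \<le> (\<Sum>n=1..N. (\<Sum>m\<in>{1..N} - near U n. k0 (sep n m)) +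
         ((\<Sum>m\<in>{m\<in>{1..N}. A' * m \<le> A * n}. k0 n) + (\<Sum>m\<in>{m\<in>{1..N}. A * n < A' * m}. k0 m)))"
  proof (rule sum_mono)
    fix n
    have "(\<Sum>m\<in>{1..N} - near U n. \<bar>c n m\<bar>)
      \<le> (\<Sum>m\<in>{1..N} - near U n. k0 (sep n m) + ((if A' * m \<le> A * n then k0 n else 0) + (if A * n < A' * m then k0 m else 0)))"
    proof (rule sum_mono)
      fix m
      show "\<bar>c n m\<bar> \<le> k0 (sep n m) + ((if A' * m \<le> A * n then k0 n else 0) + (if A * n < A' * m then k0 m else 0))"
        using bound1[of m n] bound2[of n m] by (cases "A' * m \<le> A * n") (auto simp: sep_def)
    qed
    also have "\<dots> = (\<Sum>m\<in>{1..N} - near U n. k0 (sep n m)) +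
      ((\<Sum>m\<in>{1..N} - near U n. (if A' * m \<le> A * n then k0 n else 0)) + (\<Sum>m\<in>{1..N} - near U n. (if A * n < A' * m then k0 m else 0)))"
      by (simp add: sum.distrib)
    also have "\<dots> \<le> (\<Sum>m\<in>{1..N} - near U n. k0 (sep n m)) +
         ((\<Sum>m\<in>{1..N}. (if A' * m \<le> A * n then k0 n else 0)) + (\<Sum>m\<in>{1..N}. (if A * n < A' * m then k0 m else 0)))"
      using k0_nonneg by (intro add_left_mono add_mono sum_mono2) auto
    also have "(\<Sum>m\<in>{1..N}. (if A' * m \<le> A * n then k0 n else 0)) = (\<Sum>m\<in>{m\<in>{1..N}. A' * m \<le> A * n}. k0 n)"
      by (rule sum.inter_filter[symmetric]) simp
    also have "(\<Sum>m\<in>{1..N}. (if A * n < A' * m then k0 m else 0)) = (\<Sum>m\<in>{m\<in>{1..N}. A * n < A' * m}. k0 m)"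
      by (rule sum.inter_filter[symmetric]) simp
    finally show "(\<Sum>m\<in>{1..N} - near U n. \<bar>c n m\<bar>) \<le> (\<Sum>m\<in>{1..N} - near U n. k0 (sep n m)) +
         ((\<Sum>m\<in>{m\<in>{1..N}. A' * m \<le> A * n}. k0 n) + (\<Sum>m\<in>{m\<in>{1..N}. A * n < A' * m}. k0 m))" .
  qed
  also have "\<dots> = (\<Sum>n=1..N. (\<Sum>m\<in>{1..N} - near U n. k0 (sep n m))) +
      ((\<Sum>n=1..N. \<Sum>m\<in>{m\<in>{1..N}. A' * m \<le> A * n}. k0 n) + (\<Sum>n=1..N. \<Sum>m\<in>{m\<in>{1..N}. A * n < A' * m}. k0 m))"
    by (simp add: sum.distrib)
  also have "(\<Sum>n=1..N. (\<Sum>m\<in>{1..N} - near U n. k0 (sep n m))) \<le> (\<Sum>n=1..N. 2 * (\<Sum>v. k0 (v + U)))"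
  proof (rule sum_mono)
    fix n
    let ?S = "{1..N} - near U n" and ?k = "\<lambda>v. k0 (v + U)"
    have sm: "summable ?k" using k0_summable by (simp add: summable_iff_shift)
    have "(\<Sum>m\<in>?S. k0 (sep n m)) = (\<Sum>m\<in>{m\<in>?S. A' * m \<le> A * n}. k0 (sep n m)) + (\<Sum>m\<in>{m\<in>?S. \<not> A' * m \<le> A * n}. k0 (sep n m))"
      by (subst sum.union_disjoint[symmetric]) (auto intro!: sum.cong)
    also have "(\<Sum>m\<in>{m\<in>?S. A' * m \<le> A * n}. k0 (sep n m)) = (\<Sum>m\<in>{m\<in>?S. A' * m \<le> A * n}. ?k (A * n - A' * m - U))"
      by (rule sum.cong) (auto simp: sep_def near_def)
    also have "\<dots> \<le> suminf ?k"
    proof (rule sum_inj_le_suminf[OF sm])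
      show "inj_on (\<lambda>m. A * n - A' * m - U) {m \<in> ?S. A' * m \<le> A * n}"
      proof (rule inj_onI)
        fix x y assume "x \<in> {m \<in> ?S. A' * m \<le> A * n}" "y \<in> {m \<in> ?S. A' * m \<le> A * n}"
          and "A * n - A' * x - U = A * n - A' * y - U"
        then have "A' * x = A' * y" unfolding sep_def near_def mem_Collect_eq Diff_iff atLeastAtMost_iff by linarith
        then show "x = y" using A_pos by simp
      qed
    qed (use k0_nonneg in auto)
    also have "(\<Sum>m\<in>{m\<in>?S. \<not> A' * m \<le> A * n}. k0 (sep n m)) = (\<Sum>m\<in>{m\<in>?S. \<not> A' * m \<le> A * n}. ?k (A' * m - A * n - U))"
      by (rule sum.cong) (auto simp: sep_def near_def)
    also have "\<dots> \<le> suminf ?k"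
    proof (rule sum_inj_le_suminf[OF sm])
      show "inj_on (\<lambda>m. A' * m - A * n - U) {m \<in> ?S. \<not> A' * m \<le> A * n}"
      proof (rule inj_onI)
        fix x y assume "x \<in> {m \<in> ?S. \<not> A' * m \<le> A * n}" "y \<in> {m \<in> ?S. \<not> A' * m \<le> A * n}"
          and "A' * x - A * n - U = A' * y - A * n - U"
        then have "A' * x = A' * y" unfolding sep_def near_def mem_Collect_eq Diff_iff atLeastAtMost_iff by linarith
        then show "x = y" using A_pos by simp
      qed
    qed (use k0_nonneg in auto)
    finally show "(\<Sum>m\<in>?S. k0 (sep n m)) \<le> 2 * suminf ?k" by simp
  qed
  also have "(\<Sum>n=1..N. 2 * (\<Sum>v. k0 (v + U))) = N * (2 * (\<Sum>v. k0 (v + U)))" by simp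
  also have "(\<Sum>n=1..N. \<Sum>m\<in>{m\<in>{1..N}. A' * m \<le> A * n}. k0 n) \<le> (\<Sum>n=1..N. A * (real n * k0 n))"
  proof (rule sum_mono)
    fix n
    have "card {m\<in>{1..N}. A' * m \<le> A * n} \<le> card {1..A * n}"
    proof (rule card_mono)
      show "{m\<in>{1..N}. A' * m \<le> A * n} \<subseteq> {1..A * n}"
      proof
        fix m assume "m \<in> {m\<in>{1..N}. A' * m \<le> A * n}"
        moreover have "m \<le> A' * m" using A_pos by simp
        ultimately show "m \<in> {1..A * n}"
          unfolding mem_Collect_eq atLeastAtMost_iff by linarith
      qed
    qed simp
    then have "real (card {m\<in>{1..N}. A' * m \<le> A * n}) \<le> real A * real n"
      by (metis card_atLeastAtMost diff_Suc_1 of_nat_le_iff of_nat_mult)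
    then show "(\<Sum>m\<in>{m\<in>{1..N}. A' * m \<le> A * n}. k0 n) \<le> A * (real n * k0 n)"
      using k0_nonneg[of n] by (simp add: mult.assoc[symmetric] mult_right_mono)
  qed
  also have "\<dots> \<le> A * (\<Sum>u. real u * k0 u)"
    by (simp add: sum_distrib_left[symmetric] weighted_sum_le mult_left_mono)
  also have "(\<Sum>n=1..N. \<Sum>m\<in>{m\<in>{1..N}. A * n < A' * m}. k0 m) = (\<Sum>m=1..N. \<Sum>n\<in>{n\<in>{1..N}. A * n < A' * m}. k0 m)"
    by (rule sum.swap_restrict) auto
  also have "\<dots> \<le> (\<Sum>n=1..N. A' * (real n * k0 n))"
  proof (rule sum_mono)
    fix m
    have "card {n\<in>{1..N}. A * n < A' * m} \<le> card {1..A' * m}"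
    proof (rule card_mono)
      show "{n\<in>{1..N}. A * n < A' * m} \<subseteq> {1..A' * m}"
      proof
        fix n assume "n \<in> {n\<in>{1..N}. A * n < A' * m}"
        moreover have "n \<le> A * n" using A_pos by simp
        ultimately show "n \<in> {1..A' * m}"
          unfolding mem_Collect_eq atLeastAtMost_iff by linarith
      qed
    qed simp
    then have "real (card {n\<in>{1..N}. A * n < A' * m}) \<le> real A' * real m"
      by (metis card_atLeastAtMost diff_Suc_1 of_nat_le_iff of_nat_mult)
    then show "(\<Sum>n\<in>{n\<in>{1..N}. A * n < A' * m}. k0 m) \<le> A' * (real m * k0 m)"
      using k0_nonneg[of m] by (simp add: mult.assoc[symmetric] mult_right_mono)
  qed
  also have "\<dots> \<le> A' * (\<Sum>u. real u * k0 u)"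
    by (simp add: sum_distrib_left[symmetric] weighted_sum_le mult_left_mono)
  finally show ?thesis by (simp add: algebra_simps)
qed

text \<open>For a near pair with \<open>n <= N < m\<close>, the inequality \<open>A <= A'\<close>
  forces \<open>A' * (m - n) <= U\<close>. Both indices then lie within \<open>U\<close> of the
  edge, which leaves at most \<open>U * U\<close> pairs.\<close>

lemma boundary_sum_bounded:
  assumes le: "A \<le> A'"
  shows "(\<Sum>n=1..N. \<Sum>m\<in>near U n - {1..N}. \<bar>c n m\<bar>) \<le> real (U * U) * (2 * suminf k0)"
proof -
  have fin: "finite (SIGMA n:{1..N}. near U n - {1..N})"
    using finite_near by auto
  have "(\<Sum>n=1..N. \<Sum>m\<in>near U n - {1..N}. \<bar>c n m\<bar>) = (\<Sum>z\<in>(SIGMA n:{1..N}. near U n - {1..N}). \<bar>c (fst z) (snd z)\<bar>)"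
    by (subst sum.Sigma) (auto simp: finite_near split_def)
  also have "\<dots> \<le> (\<Sum>z\<in>(SIGMA n:{1..N}. near U n - {1..N}). 2 * suminf k0)"
    by (intro sum_mono c_le)
  also have "\<dots> = card (SIGMA n:{1..N}. near U n - {1..N}) * (2 * suminf k0)" by simp
  also have "\<dots> \<le> real (U * U) * (2 * suminf k0)"
  proof (rule mult_right_mono)
    have "card (SIGMA n:{1..N}. near U n - {1..N}) \<le> card ({N<..N+U} \<times> {N<..N+U})"
    proof (rule card_inj_on_le)
      \<comment> \<open>Reflection at the edge: \<open>n\<close> is counted downwards from
        \<open>N\<close>, so that both coordinates land in \<open>{N<..N+U}\<close>.\<close>
      let ?f = "\<lambda>(n, m). (N + (N + 1 - n), m)"
      show "inj_on ?f (SIGMA n:{1..N}. near U n - {1..N})" by (auto simp: inj_on_def)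
      show "?f ` (SIGMA n:{1..N}. near U n - {1..N}) \<subseteq> {N<..N+U} \<times> {N<..N+U}"
      proof clarify
        fix n m assume n: "n \<in> {1..N}" and m: "m \<in> near U n" "m \<notin> {1..N}"
        have mN: "m > N" using m by (auto simp: near_def)
        have u: "A' * m \<le> A * n + U" using m by (auto simp: near_def sep_def)
        have "A * n \<le> A' * n" using le by simp
        then have "A' * (m - n) \<le> U" using u unfolding diff_mult_distrib2 by linarith
        moreover have "m - n \<le> A' * (m - n)" using A_pos by simp
        ultimately have "m - n \<le> U" by linarith
        then show "N + (N + 1 - n) \<in> {N<..N + U} \<and> m \<in> {N<..N + U}" using n mN by auto
      qed
    qed simp
    then show "real (card (SIGMA n:{1..N}. near U n - {1..N})) \<le> real (U * U)"
      by (simp add: card_cartesian_product del: of_nat_mult)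
    show "0 \<le> 2 * suminf k0" using suminf_nonneg[OF k0_summable] k0_nonneg by simp
  qed
  finally show ?thesis .
qed

text \<open>By the choice of \<open>U\<close> the far pairs cost at most \<open>2 * (e / 4)\<close>
  per index \<open>n\<close>. The secondary terms and the pairs cut off at the edge contribute a
  constant \<open>C\<close>, which is negligible after division by \<open>N\<close>.\<close>

lemma average_approx:
  assumes le: "A \<le> A'" and e: "e > 0"
  shows "\<exists>U N0. \<forall>N\<ge>N0. \<bar>(\<Sum>n=1..N. \<Sum>m=1..N. c n m) / N - (\<Sum>n=1..N. \<Sum>m\<in>near U n. c n m) / N\<bar> \<le> e"
proof -
  have "(\<lambda>U. \<Sum>v. k0 (v + U)) \<longlonglongrightarrow> 0" by (rule suminf_exist_split2[OF k0_summable])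
  from LIMSEQ_D[OF this, of "e / 4"] obtain U where U: "(\<Sum>v. k0 (v + U)) < e / 4"
    using e by (auto dest: abs_ge_self[THEN le_less_trans] simp del: divide_const_simps less_divide_eq_numeral1)
  define C where "C = (A + A') * (\<Sum>u. real u * k0 u) + real (U * U) * (2 * suminf k0)"
  obtain N1 :: nat where N1: "2 * C / e < real N1" using reals_Archimedean2 by blast
  have "\<bar>(\<Sum>n=1..N. \<Sum>m=1..N. c n m) / N - (\<Sum>n=1..N. \<Sum>m\<in>near U n. c n m) / N\<bar> \<le> e"
    if N: "N \<ge> max 1 N1" for N
  proof -
    have "(\<Sum>m=1..N. c n m) - (\<Sum>m\<in>near U n. c n m)
       = (\<Sum>m\<in>{1..N} - near U n. c n m) - (\<Sum>m\<in>near U n - {1..N}. c n m)" for n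
    proof -
      have "(\<Sum>m\<in>{1..N} - near U n. c n m) = (\<Sum>m=1..N. c n m) - (\<Sum>m\<in>{1..N} \<inter> near U n. c n m)"
        by (metis Diff_Int2 Diff_Int_distrib Diff_eq_empty_iff Int_lower1 Un_Diff Un_Diff_Int add_diff_cancel_right' finite_atLeastAtMost sum.Int_Diff inf.idem add.commute)
      moreover have "(\<Sum>m\<in>near U n - {1..N}. c n m) = (\<Sum>m\<in>near U n. c n m) - (\<Sum>m\<in>near U n \<inter> {1..N}. c n m)"
        using sum.Int_Diff[OF finite_near, of "c n" U n "{1..N}"] by simp
      ultimately show ?thesis by (simp add: Int_commute)
    qed
    then have "\<bar>(\<Sum>n=1..N. \<Sum>m=1..N. c n m) - (\<Sum>n=1..N. \<Sum>m\<in>near U n. c n m)\<bar>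
      = \<bar>\<Sum>n=1..N. (\<Sum>m\<in>{1..N} - near U n. c n m) - (\<Sum>m\<in>near U n - {1..N}. c n m)\<bar>"
      by (simp add: sum_subtractf[symmetric])
    also have "\<dots> \<le> (\<Sum>n=1..N. (\<Sum>m\<in>{1..N} - near U n. \<bar>c n m\<bar>) + (\<Sum>m\<in>near U n - {1..N}. \<bar>c n m\<bar>))"
      by (rule order_trans[OF sum_abs sum_mono])
         (rule order_trans[OF abs_triangle_ineq4 add_mono[OF sum_abs sum_abs]])
    also have "\<dots> \<le> N * (2 * (\<Sum>v. k0 (v + U))) + C"
      using far_sum_bounded[of N U] boundary_sum_bounded[OF le, of U N] unfolding C_def sum.distrib by simp
    also have "\<dots> \<le> N * (2 * (e / 4)) + C" using U by (intro add_right_mono mult_left_mono) auto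
    also have "\<dots> \<le> N * e"
    proof -
      have "2 * C / e < real N" using N1 N by simp
      then show ?thesis using e by (simp add: field_simps)
    qed
    finally have "\<bar>(\<Sum>n=1..N. \<Sum>m=1..N. c n m) - (\<Sum>n=1..N. \<Sum>m\<in>near U n. c n m)\<bar> \<le> N * e" .
    then show ?thesis using N by (simp add: diff_divide_distrib[symmetric] abs_divide divide_le_eq mult.commute)
  qed
  then show ?thesis by blast
qed

text \<open>Advancing the indices by \<open>P * t\<close> and \<open>P' * t\<close> preserves
  separations. The assumption \<open>big\<close> keeps the window of \<open>r + P * t\<close> at or
  above \<open>P' * t\<close>, so each of its members is the shift of a natural number.\<close>

lemma near_shift:
  assumes AP: "A * P = A' * P'" and big: "A * r \<ge> U"
  shows "near U (r + P * t) = (\<lambda>m. m + P' * t) ` {m. m + P' * t \<ge> 1 \<and> sep r m \<le> U}"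
proof -
  have APt: "A * (P * t) = A' * (P' * t)" by (metis AP mult.assoc)
  have sh: "sep (r + P * t) (m + P' * t) = sep r m" for m
    by (simp add: sep_def add_mult_distrib2 APt)
  show ?thesis
  proof (intro equalityI subsetI)
    fix m assume m: "m \<in> near U (r + P * t)"
    have "A * (r + P * t) \<le> A' * m + U" using m by (auto simp: near_def sep_def)
    then have "A' * (P' * t) \<le> A' * m" using big unfolding add_mult_distrib2 APt by linarith
    then have "m = (m - P' * t) + P' * t" using A_pos by simp
    moreover from this m sh[of "m - P' * t"] have "sep r (m - P' * t) \<le> U" by (simp add: near_def)
    ultimately show "m \<in> (\<lambda>m. m + P' * t) ` {m. m + P' * t \<ge> 1 \<and> sep r m \<le> U}"
      using m by (auto simp: near_def intro!: image_eqI[of _ _ "m - P' * t"])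
  qed (auto simp: near_def sh)
qed

lemma near_sum_tendsto:
  assumes AP: "A * P = A' * P'" "P' > 0"
    and lim: "\<And>n m. (\<lambda>t. c (n + P * t) (m + P' * t)) \<longlonglongrightarrow> lc n m"
  shows "(\<lambda>t. \<Sum>m\<in>near U (r + P * t). c (r + P * t) m) \<longlonglongrightarrow> (\<Sum>m\<in>{m. sep (r + P * U) m \<le> U}. lc (r + P * U) m)"
proof -
  have Ppos: "P > 0" using AP A_pos by (metis mult_eq_0_iff neq0_conv)
  \<comment> \<open>Passing from \<open>r\<close> to \<open>r + P * U\<close> makes
    \<open>near_shift\<close> applicable and only drops the first \<open>U\<close> values of
    \<open>t\<close>.\<close>
  define r' where "r' = r + P * U"
  have big: "A * r' \<ge> U"
  proof -
    have "U \<le> P * U" using Ppos by simp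
    also have "\<dots> \<le> r'" by (simp add: r'_def)
    also have "\<dots> \<le> A * r'" using A_pos by simp
    finally show ?thesis .
  qed
  have "(\<lambda>t. \<Sum>m\<in>{m. sep r' m \<le> U}. c (r' + P * t) (m + P' * t)) \<longlonglongrightarrow> (\<Sum>m\<in>{m. sep r' m \<le> U}. lc r' m)"
    by (intro tendsto_sum lim)
  moreover have "\<forall>\<^sub>F t in sequentially. (\<Sum>m\<in>{m. sep r' m \<le> U}. c (r' + P * t) (m + P' * t)) =
      (\<Sum>m\<in>near U (r + P * (t + U)). c (r + P * (t + U)) m)"
    using eventually_ge_at_top[of 1]
  proof eventually_elim
    fix t :: nat assume t: "t \<ge> 1"
    have "r + P * (t + U) = r' + P * t" by (simp add: r'_def algebra_simps)
    moreover have "{m. m + P' * t \<ge> 1 \<and> sep r' m \<le> U} = {m. sep r' m \<le> U}"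
      using t AP(2) by (auto simp: Suc_le_eq)
    ultimately show "(\<Sum>m\<in>{m. sep r' m \<le> U}. c (r' + P * t) (m + P' * t)) =
      (\<Sum>m\<in>near U (r + P * (t + U)). c (r + P * (t + U)) m)"
      by (simp add: near_shift[OF AP(1) big] sum.reindex)
  qed
  ultimately have "(\<lambda>t. \<Sum>m\<in>near U (r + P * (t + U)). c (r + P * (t + U)) m) \<longlonglongrightarrow> (\<Sum>m\<in>{m. sep r' m \<le> U}. lc r' m)"
    by (rule Lim_transform_eventually)
  then show ?thesis unfolding r'_def by (rule LIMSEQ_offset)
qed

text \<open>The window sums converge along each residue class modulo \<open>P\<close>, so
  \<open>cesaro_asymp_periodic\<close> gives convergence of their averages, and
  \<open>average_approx\<close> carries it over to the full square.\<close>

lemma average_convergent: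
  assumes le: "A \<le> A'" and AP: "A * P = A' * P'" "P' > 0"
    and conv: "\<And>n m. convergent (\<lambda>t. c (n + P * t) (m + P' * t))"
  shows "convergent (\<lambda>N. (\<Sum>n=1..N. \<Sum>m=1..N. c n m) / N)"
proof (rule convergent_if_approximable)
  fix e :: real assume "e > 0"
  from average_approx[OF le this] obtain U N0 where
    *: "\<And>N. N \<ge> N0 \<Longrightarrow> \<bar>(\<Sum>n=1..N. \<Sum>m=1..N. c n m) / N - (\<Sum>n=1..N. \<Sum>m\<in>near U n. c n m) / N\<bar> \<le> e"
    by blast
  obtain lc where lc: "\<And>n m. (\<lambda>t. c (n + P * t) (m + P' * t)) \<longlonglongrightarrow> lc n m"
    using conv unfolding convergent_def by metis
  have "P > 0" using AP A_pos by (metis mult_eq_0_iff neq0_conv)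
  then have "convergent (\<lambda>N. (\<Sum>n=1..N. \<Sum>m\<in>near U n. c n m) / real N)"
    using near_sum_tendsto[OF AP lc] by (intro cesaro_asymp_periodic) (auto simp: convergent_def)
  with * show "\<exists>y. convergent y \<and> (\<exists>N0. \<forall>N\<ge>N0. \<bar>(\<Sum>n=1..N. \<Sum>m=1..N. c n m) / N - y N\<bar> \<le> e)" by blast
qed

lemma average_null:
  assumes AA: "A = A'" and null: "\<And>n m. (\<lambda>t. c (n + t) (m + t)) \<longlonglongrightarrow> 0"
  shows "(\<lambda>N. (\<Sum>n=1..N. \<Sum>m=1..N. c n m) / N) \<longlonglongrightarrow> 0"
proof (rule LIMSEQ_I)
  fix e :: real assume e: "e > 0"
  have le: "A \<le> A'" using AA by simp
  from average_approx[OF le, of "e/2"] e obtain U N0 where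
    N0: "\<And>N. N \<ge> N0 \<Longrightarrow> \<bar>(\<Sum>n=1..N. \<Sum>m=1..N. c n m) / N - (\<Sum>n=1..N. \<Sum>m\<in>near U n. c n m) / N\<bar> \<le> e/2"
    by auto
  have "(\<lambda>n. \<Sum>m\<in>near U (0 + 1 * n). c (0 + 1 * n) m) \<longlonglongrightarrow> (\<Sum>m\<in>{m. sep (0 + 1 * U) m \<le> U}. 0)"
    by (rule near_sum_tendsto[where P=1 and P'=1]) (use null AA in auto)
  then have "(\<lambda>n. \<Sum>m\<in>near U n. c n m) \<longlonglongrightarrow> 0" by simp
  from LIMSEQ_D[OF cesaro_null[OF this], of "e/2"] e obtain N1 where
    N1: "\<And>N. N \<ge> N1 \<Longrightarrow> \<bar>(\<Sum>n=1..N. \<Sum>m\<in>near U n. c n m) / N\<bar> < e/2" by auto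
  have "norm ((\<Sum>n=1..N. \<Sum>m=1..N. c n m) / N - 0) < e" if "N \<ge> max N0 N1" for N
    using N0[of N] N1[of N] that unfolding real_norm_def by linarith
  then show "\<exists>no. \<forall>N\<ge>no. norm ((\<Sum>n=1..N. \<Sum>m=1..N. c n m) / N - 0) < e" by blast
qed

end

section \<open>Density of product functions\<close>

text \<open>All summands are compared with the largest value \<open>t\<close> among 1 and the
  \<open>u a\<close>.\<close>

lemma powr_one_plus_sum_le:
  fixes u :: "'i \<Rightarrow> real"
  assumes A: "finite A" and u: "\<And>a. a \<in> A \<Longrightarrow> u a \<ge> 0" and m: "m \<ge> 0"
  shows "(1 + (\<Sum>a\<in>A. u a)) powr m \<le> (1 + card A) powr m * (1 + (\<Sum>a\<in>A. u a powr m))"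
proof -
  define t where "t = Max (insert 1 (u ` A))"
  have fin: "finite (insert 1 (u ` A))" using A by simp
  have t1: "t \<ge> 1" unfolding t_def by (intro Max_ge fin) simp
  have tu: "u a \<le> t" if "a \<in> A" for a unfolding t_def using that by (intro Max_ge fin) simp
  have "1 + (\<Sum>a\<in>A. u a) \<le> t + (\<Sum>a\<in>A. t)" using t1 tu by (intro add_mono sum_mono) auto
  also have "\<dots> = (1 + card A) * t" by (simp add: algebra_simps)
  finally have "(1 + (\<Sum>a\<in>A. u a)) powr m \<le> ((1 + card A) * t) powr m"
    using u m by (intro powr_mono2) (auto simp: sum_nonneg)
  also have "\<dots> = (1 + card A) powr m * t powr m" using t1 by (simp add: powr_mult)
  also have "t powr m \<le> 1 + (\<Sum>a\<in>A. u a powr m)"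
  proof -
    have "t \<in> insert 1 (u ` A)" unfolding t_def by (rule Max_in[OF fin]) simp
    then consider "t = 1" | a where "a \<in> A" "t = u a" by auto
    then show ?thesis
    proof cases
      case 1 then show ?thesis by (simp add: sum_nonneg)
    next
      case 2
      then have "t powr m \<le> (\<Sum>a\<in>A. u a powr m)"
        using A by (simp add: member_le_sum[of a A "\<lambda>a. u a powr m"])
      then show ?thesis by simp
    qed
  qed
  finally show ?thesis by (simp add: mult_left_mono)
qed

text \<open>The class is closed under products, so it generates an algebra for Stone-Weierstrass;
  the Lipschitz bound makes the replacement of \<open>X\<close> by a window approximation cost no
  more than an L1 distance.\<close>

definition bounded_lipschitz :: "('b::real_normed_vector \<Rightarrow> real) set" where
  "bounded_lipschitz = {f. (\<exists>B. \<forall>x. \<bar>f x\<bar> \<le> B) \<and> (\<exists>C. \<forall>x y. \<bar>f x - f y\<bar> \<le> C * norm (x - y))}"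

lemma bounded_lipschitz_const: "(\<lambda>_. c) \<in> bounded_lipschitz"
  unfolding bounded_lipschitz_def mem_Collect_eq
  by (intro conjI exI[of _ "\<bar>c\<bar>"]) auto

lemma bounded_lipschitzE:
  assumes "f \<in> bounded_lipschitz"
  obtains B C where "B \<ge> 0" "C \<ge> 0" "\<And>x. \<bar>f x\<bar> \<le> B" "\<And>x y. \<bar>f x - f y\<bar> \<le> C * norm (x - y)"
proof -
  obtain B C where B: "\<And>x. \<bar>f x\<bar> \<le> B" and C: "\<And>x y. \<bar>f x - f y\<bar> \<le> C * norm (x - y)"
    using assms unfolding bounded_lipschitz_def by blast
  show ?thesis
  proof (rule that[of "\<bar>B\<bar>" "\<bar>C\<bar>"])
    show "\<bar>f x\<bar> \<le> \<bar>B\<bar>" for x using B[of x] by simp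
    show "\<bar>f x - f y\<bar> \<le> \<bar>C\<bar> * norm (x - y)" for x y
      by (rule order_trans[OF C mult_right_mono]) auto
  qed auto
qed

lemma bounded_lipschitz_mult:
  assumes "f \<in> bounded_lipschitz" "g \<in> bounded_lipschitz"
  shows "(\<lambda>x. f x * g x) \<in> bounded_lipschitz"
proof -
  obtain B C where f: "B \<ge> 0" "C \<ge> 0" "\<And>x. \<bar>f x\<bar> \<le> B" "\<And>x y. \<bar>f x - f y\<bar> \<le> C * norm (x - y)"
    by (rule bounded_lipschitzE[OF assms(1)]) auto
  obtain B' C' where g: "B' \<ge> 0" "C' \<ge> 0" "\<And>x. \<bar>g x\<bar> \<le> B'" "\<And>x y. \<bar>g x - g y\<bar> \<le> C' * norm (x - y)"
    by (rule bounded_lipschitzE[OF assms(2)]) auto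
  have "\<bar>f x * g x\<bar> \<le> B * B'" for x
    using f(1,3) g(3) by (simp add: abs_mult mult_mono)
  moreover have "\<bar>f x * g x - f y * g y\<bar> \<le> (B * C' + B' * C) * norm (x - y)" for x y
  proof -
    have "f x * g x - f y * g y = f x * (g x - g y) + g y * (f x - f y)" by (simp add: algebra_simps)
    also have "\<bar>\<dots>\<bar> \<le> \<bar>f x\<bar> * \<bar>g x - g y\<bar> + \<bar>g y\<bar> * \<bar>f x - f y\<bar>"
      by (metis abs_mult abs_triangle_ineq)
    also have "\<dots> \<le> B * (C' * norm (x - y)) + B' * (C * norm (x - y))"
      using f g by (intro add_mono mult_mono) auto
    finally show ?thesis by (simp add: algebra_simps)
  qed
  ultimately show ?thesis unfolding bounded_lipschitz_def by blast
qed

lemma bounded_lipschitz_continuous: "f \<in> bounded_lipschitz \<Longrightarrow> continuous_on UNIV f"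
proof -
  assume "f \<in> bounded_lipschitz"
  then obtain C where f: "C \<ge> 0" "\<And>x y. \<bar>f x - f y\<bar> \<le> C * norm (x - y)"
    by (elim bounded_lipschitzE) blast
  then have "C-lipschitz_on UNIV f" by (intro lipschitz_onI) (auto simp: dist_norm)
  then show ?thesis by (rule lipschitz_on_continuous_on)
qed

lemma bounded_lipschitz_measurable: "f \<in> bounded_lipschitz \<Longrightarrow> f \<in> borel_measurable borel"
  by (intro borel_measurable_continuous_onI bounded_lipschitz_continuous)

lemma bounded_lipschitz_clamp:
  "(\<lambda>v::real^'d. max (- R) (min R (v $ i))) \<in> bounded_lipschitz"
proof -
  have "\<bar>max (- R) (min R (v $ i))\<bar> \<le> \<bar>R\<bar>" for v :: "real^'d" by auto
  moreover have "\<bar>max (- R) (min R (v $ i)) - max (- R) (min R (w $ i))\<bar> \<le> 1 * norm (v - w)" for v w :: "real^'d"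
  proof -
    have "\<bar>max (- R) (min R (v $ i)) - max (- R) (min R (w $ i))\<bar> \<le> \<bar>(v - w) $ i\<bar>" by auto
    also have "\<dots> \<le> norm (v - w)" by (rule component_le_norm_cart)
    finally show ?thesis by simp
  qed
  ultimately show ?thesis unfolding bounded_lipschitz_def by blast
qed

text \<open>Each generator has a factor for every index in \<open>A\<close>, possibly the constant
  1, so the product of two generators is again a generator. On generators, independence of groups of
  coordinates turns into factorisation of the mean.\<close>

inductive_set product_sums :: "'i set \<Rightarrow> (('i \<Rightarrow> 'b::real_normed_vector) \<Rightarrow> real) set" for A where
  product: "(\<And>a. a \<in> A \<Longrightarrow> g a \<in> bounded_lipschitz) \<Longrightarrow> (\<lambda>x. c * (\<Prod>a\<in>A. g a (x a))) \<in> product_sums A"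
| add: "f \<in> product_sums A \<Longrightarrow> g \<in> product_sums A \<Longrightarrow> (\<lambda>x. f x + g x) \<in> product_sums A"

lemma product_sums_const: "(\<lambda>_. c) \<in> product_sums A"
  using product_sums.product[of A "\<lambda>_ _. 1" c] bounded_lipschitz_const[of 1] by simp

lemma product_sums_mult:
  assumes "f \<in> product_sums A" "g \<in> product_sums A"
  shows "(\<lambda>x. f x * g x) \<in> product_sums A"
  using assms
proof (induction f)
  case (product f c)
  from product(2,1) show ?case
  proof (induction g)
    case (product g d)
    have "(\<lambda>x. (c * d) * (\<Prod>a\<in>A. f a (x a) * g a (x a))) \<in> product_sums A"
      by (rule product_sums.product) (use product in \<open>auto intro: bounded_lipschitz_mult\<close>)
    then show ?case by (simp add: prod.distrib algebra_simps)
  next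
    case (add g h)
    then show ?case using product_sums.add by (simp add: distrib_left)
  qed
next
  case (add f h)
  then show ?case using product_sums.add by (simp add: distrib_right)
qed

lemma product_sums_coord:
  assumes "finite A" "a \<in> A" "h \<in> bounded_lipschitz"
  shows "(\<lambda>x. h (x a)) \<in> product_sums A"
proof -
  have "(\<lambda>x. 1 * (\<Prod>b\<in>A. (if b = a then h else (\<lambda>_. 1)) (x b))) \<in> product_sums A"
    by (rule product_sums.product) (use assms bounded_lipschitz_const in auto)
  moreover have "(\<Prod>b\<in>A. (if b = a then h else (\<lambda>_. 1)) (x b)) = h (x a)" for x
    using assms by (subst prod.remove[of _ a]) (auto intro!: prod.neutral)
  ultimately show ?thesis by simp
qed

text \<open>Coordinates outside \<open>A\<close> are pinned to zero, so the set is a product of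
  compact sets and Tychonoff's theorem applies in the function space.\<close>

lemma compact_box_fun:
  "compact {x :: 'i \<Rightarrow> real^'d. \<forall>a. if a \<in> A then \<forall>i. \<bar>x a $ i\<bar> \<le> R else x a = 0}" (is "compact ?S")
proof -
  let ?C = "\<lambda>a. if a \<in> A then cbox (\<chi> i. - R) (\<chi> i. R) else {0} :: (real^'d) set"
  have "?S = Pi\<^sub>E UNIV ?C"
    unfolding PiE_UNIV_domain Pi_def mem_Collect_eq
    by (intro Collect_cong all_cong1) (auto simp: mem_box_cart abs_le_iff minus_le_iff)
  moreover have "compactin (product_topology (\<lambda>i. euclidean) UNIV) (Pi\<^sub>E UNIV ?C)"
    unfolding compactin_PiE by (auto simp: compact_cbox)
  ultimately show ?thesis by (simp add: euclidean_product_topology)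
qed

text \<open>The weight \<open>1 + (\<Sum>a\<in>A. norm (x a) powr m)\<close> makes the approximation uniform over all random
  vectors with bounded \<open>m\<close>-th moments.\<close>
lemma product_sums_dense:
  fixes H :: "('i::countable \<Rightarrow> real^'d) \<Rightarrow> real"
  assumes A: "finite A" and cont: "continuous_on UNIV H"
    and dep: "\<And>x z. (\<And>a. a \<in> A \<Longrightarrow> x a = z a) \<Longrightarrow> H x = H z"
    and growth: "\<And>x. \<bar>H x\<bar> \<le> C * (1 + (\<Sum>a\<in>A. norm (x a))) powr e"
    and C: "C > 0" and em: "0 \<le> e" "e < m" and \<epsilon>: "\<epsilon> > 0"
  shows "\<exists>f\<in>product_sums A. \<forall>x. \<bar>H x - f x\<bar> \<le> \<epsilon> * (1 + (\<Sum>a\<in>A. norm (x a) powr m))"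
proof -
  \<comment> \<open>The constants give \<open>D * s powr e <= s powr m\<close> whenever
    \<open>s >= R\<close>: outside the box the weight absorbs the growth of
    \<open>H\<close>.\<close>
  define D where "D = 4 * C * (1 + card A) powr m / \<epsilon>"
  have D: "D > 0" using C \<epsilon> by (simp add: D_def)
  define R where "R = D powr (1 / (m - e))"
  have R: "R > 0" using D by (simp add: R_def)
  define S where "S = {x :: 'i \<Rightarrow> real^'d. \<forall>a. if a \<in> A then \<forall>i. \<bar>x a $ i\<bar> \<le> R else x a = 0}"
  \<comment> \<open>The retraction onto the box. A continuous function on the box becomes bounded on
    the whole space when composed with it.\<close>
  define cl :: "('i \<Rightarrow> real^'d) \<Rightarrow> 'i \<Rightarrow> real^'d" where
    "cl x a = (if a \<in> A then (\<chi> i. max (- R) (min R (x a $ i))) else 0)" for x a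
  have clS: "cl x \<in> S" for x using R by (auto simp: S_def cl_def)
  have cl_norm: "norm (cl x a) \<le> norm (x a)" for x a
    using R by (auto simp: cl_def intro!: norm_le_componentwise_cart)
  \<comment> \<open>The functions on the box whose pull-back along \<open>cl\<close> is already a
    sum of products. They form a function ring, and the coordinates, clamped by \<open>cl\<close>,
    separate points.\<close>
  define Rg where "Rg = {f. (\<lambda>x. f (cl x)) \<in> product_sums A \<and> continuous_on S f}"
  interpret function_ring_on Rg S
  proof
    show "compact S" unfolding S_def by (rule compact_box_fun)
    fix x y assume xy: "x \<in> S" "y \<in> S" "x \<noteq> y"
    then obtain a i where a: "a \<in> A" "x a $ i \<noteq> y a $ i"
      by (auto simp: S_def fun_eq_iff vec_eq_iff) (metis zero_index)
    have "(\<lambda>x. x a $ i) \<in> Rg"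
      using product_sums_coord[OF A a(1) bounded_lipschitz_clamp[of R i]] a(1)
      by (auto simp: Rg_def cl_def intro!: continuous_intros continuous_on_subset[OF continuous_on_product_coordinates])
    with a(2) show "\<exists>f\<in>Rg. f x \<noteq> f y" by (intro bexI[of _ "\<lambda>x. x a $ i"])
  qed (auto simp: Rg_def intro: product_sums_const product_sums.add product_sums_mult
      continuous_on_const continuous_on_add continuous_on_mult)
  obtain g where g: "g \<in> Rg" "\<And>x. x \<in> S \<Longrightarrow> \<bar>H x - g x\<bar> < \<epsilon> / 2"
    using Stone_Weierstrass_basic[OF continuous_on_subset[OF cont], of "\<epsilon> / 2"] \<epsilon> by auto
  have "\<bar>H x - g (cl x)\<bar> \<le> \<epsilon> * (1 + (\<Sum>a\<in>A. norm (x a) powr m))" for x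
  proof (cases "\<forall>a\<in>A. \<forall>i. \<bar>x a $ i\<bar> \<le> R")
    case True
    then have "H x = H (cl x)"
    proof (intro dep)
      fix a assume "a \<in> A"
      then have "max (- R) (min R (x a $ i)) = x a $ i" for i
        using True by (auto simp: abs_le_iff max_def min_def dest!: bspec[of _ _ a] spec[of _ i])
      then show "x a = cl x a" using \<open>a \<in> A\<close> by (simp add: cl_def vec_eq_iff)
    qed
    then have "\<bar>H x - g (cl x)\<bar> \<le> \<epsilon> * 1" using g(2)[OF clS[of x]] \<epsilon> by simp
    also have "\<dots> \<le> \<epsilon> * (1 + (\<Sum>a\<in>A. norm (x a) powr m))"
      using \<epsilon> by (intro mult_left_mono) (auto simp: sum_nonneg)
    finally show ?thesis .
  next
    case False
    then obtain a i where a: "a \<in> A" "R < \<bar>x a $ i\<bar>" by (auto simp: not_le)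
    define s where "s = 1 + (\<Sum>a\<in>A. norm (x a))"
    have "R < norm (x a)" using a(2) component_le_norm_cart[of "x a" i] by linarith
    also have "\<dots> \<le> (\<Sum>a\<in>A. norm (x a))" using A a by (intro member_le_sum) auto
    finally have sR: "R \<le> s" by (simp add: s_def)
    have s: "s > 0" using R sR by linarith
    have cls: "(1 + (\<Sum>a\<in>A. norm (cl x a))) powr e \<le> s powr e"
      unfolding s_def using em cl_norm by (intro powr_mono2 add_left_mono sum_mono) (auto simp: add_nonneg_nonneg sum_nonneg)
    have "\<bar>H x - g (cl x)\<bar> \<le> \<bar>H x\<bar> + \<bar>H (cl x)\<bar> + \<epsilon> / 2"
      using g(2)[OF clS[of x]] by linarith
    also have "\<dots> \<le> C * s powr e + C * s powr e + \<epsilon> / 2"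
      using growth[of x] order_trans[OF growth[of "cl x"] mult_left_mono[OF cls]] C
      unfolding s_def by (intro add_mono) auto
    also have "\<dots> = 2 * C * s powr e + \<epsilon> / 2" by simp
    also have "2 * C * s powr e \<le> \<epsilon> / (2 * (1 + card A) powr m) * s powr m"
    proof -
      have "D = R powr (m - e)" using D em by (simp add: R_def powr_powr)
      also have "\<dots> \<le> s powr (m - e)" using R sR em by (intro powr_mono2) auto
      finally have "D * s powr e \<le> s powr (m - e) * s powr e" by (intro mult_right_mono) auto
      then have "D * s powr e \<le> s powr m" by (simp add: powr_add[symmetric])
      then show ?thesis using \<epsilon> unfolding D_def by (simp add: field_simps)
    qed
    also have "\<dots> \<le> \<epsilon> / (2 * (1 + card A) powr m) * ((1 + card A) powr m * (1 + (\<Sum>a\<in>A. norm (x a) powr m)))"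
      unfolding s_def using \<epsilon> em A by (intro mult_left_mono powr_one_plus_sum_le) auto
    also have "\<dots> = \<epsilon> / 2 * (1 + (\<Sum>a\<in>A. norm (x a) powr m))" by simp
    finally have "\<bar>H x - g (cl x)\<bar> \<le> \<epsilon> / 2 * (1 + (\<Sum>a\<in>A. norm (x a) powr m)) + \<epsilon> / 2 * 1" by simp
    also have "\<dots> \<le> \<epsilon> / 2 * (1 + (\<Sum>a\<in>A. norm (x a) powr m)) + \<epsilon> / 2 * (1 + (\<Sum>a\<in>A. norm (x a) powr m))"
      using \<epsilon> by (intro add_left_mono mult_left_mono) (auto simp: sum_nonneg)
    finally show ?thesis by simp
  qed
  then show ?thesis using g(1) by (intro bexI[of _ "\<lambda>x. g (cl x)"]) (auto simp: Rg_def)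
qed

section \<open>Mixing processes\<close>

text \<open>This elementary inequality replaces Hoelder's inequality throughout: after rescaling
  \<open>U\<close> to have mean at most one, taking expectations bounds the mixed moment.\<close>
lemma powr_mult_powr_le:
  fixes B U :: real
  assumes "B \<ge> 1" "U \<ge> 0" "e \<ge> 0" "th \<ge> 0" "m > 0" "e / m + th \<le> 1"
  shows "B powr e * U powr th \<le> 1 + B powr m + U"
proof -
  define z where "z = max (B powr m) (max U 1)"
  have z: "z \<ge> 1" "B powr m \<le> z" "U \<le> z" by (auto simp: z_def)
  have "B powr e = (B powr m) powr (e / m)" using assms by (simp add: powr_powr)
  also have "\<dots> \<le> z powr (e / m)" using assms z by (intro powr_mono2) auto
  finally have "B powr e * U powr th \<le> z powr (e / m) * z powr th"
    using assms z by (intro mult_mono powr_mono2) auto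
  also have "\<dots> \<le> z powr 1"
    unfolding powr_add[symmetric] using assms z by (intro powr_mono) auto
  also have "\<dots> = z" using z by simp
  also have "z \<le> 1 + B powr m + U" using assms by (auto simp: z_def)
  finally show ?thesis .
qed

lemma lpnorm_le_ennrealD:
  fixes f :: "'a \<Rightarrow> 'b::{real_normed_vector, second_countable_topology}"
  assumes f[measurable]: "f \<in> borel_measurable M" and r: "r > 0" and b: "b \<ge> 0"
    and le: "lpnorm M r f \<le> ennreal b"
  shows "integrable M (\<lambda>w. norm (f w) powr r)" "(\<integral>w. norm (f w) powr r \<partial>M) \<le> b powr r"
proof -
  define I where "I = (\<integral>\<^sup>+ w. ennreal (norm (f w) powr r) \<partial>M)"
  have Itop: "I \<noteq> \<top>"
    using le unfolding lpnorm_def enn_powr_def I_def[symmetric] by (auto simp: top_unique split: if_splits)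
  have "ennreal (enn2real I powr (1 / r)) \<le> ennreal b"
    using le Itop unfolding lpnorm_def enn_powr_def I_def[symmetric] by auto
  then have le': "enn2real I powr (1 / r) \<le> b" using b by simp
  have "enn2real I = (enn2real I powr (1 / r)) powr r" using r by (simp add: powr_powr)
  also have "\<dots> \<le> b powr r" using le' r by (intro powr_mono2) auto
  finally have Ib: "enn2real I \<le> b powr r" .
  show int: "integrable M (\<lambda>w. norm (f w) powr r)"
    using Itop by (intro integrableI_nonneg) (auto simp: I_def less_top)
  have "(\<integral>w. norm (f w) powr r \<partial>M) = enn2real I"
    unfolding I_def by (rule integral_eq_nn_integral) auto
  with Ib show "(\<integral>w. norm (f w) powr r \<partial>M) \<le> b powr r" by simp
qed

lemma lpnorm_finite_integrable:
  fixes f :: "'a \<Rightarrow> 'b::{real_normed_vector, second_countable_topology}"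
  assumes "f \<in> borel_measurable M" "r > 0" "lpnorm M r f < \<top>"
  shows "integrable M (\<lambda>w. norm (f w) powr r)"
proof -
  have "lpnorm M r f \<le> ennreal (enn2real (lpnorm M r f))" using assms(3) by simp
  from lpnorm_le_ennrealD(1)[OF assms(1,2) _ this] show ?thesis by simp
qed

lemma lpnorm_le_one:
  fixes g :: "'a \<Rightarrow> real"
  assumes "integrable M (\<lambda>w. \<bar>g w\<bar> powr r)" "(\<integral>w. \<bar>g w\<bar> powr r \<partial>M) \<le> 1" "r > 0"
  shows "lpnorm M r g \<le> 1"
proof -
  have "(\<integral>\<^sup>+ w. ennreal (norm (g w) powr r) \<partial>M) = ennreal (\<integral>w. \<bar>g w\<bar> powr r \<partial>M)"
    using assms by (subst nn_integral_eq_integral) auto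
  moreover have "(\<integral>w. \<bar>g w\<bar> powr r \<partial>M) powr (1 / r) \<le> 1 powr (1 / r)"
    using assms by (intro powr_mono2) auto
  ultimately show ?thesis
    unfolding lpnorm_def enn_powr_def by (simp add: ennreal_le_1)
qed

lemma summable_enn2real:
  assumes "(\<Sum>n. f n) < (\<top>::ennreal)"
  shows "summable (\<lambda>n. enn2real (f n))" "f n < \<top>"
proof -
  have fin: "f n < \<top>" for n
    using ennreal_suminf_lessD[OF assms] .
  show "f n < \<top>" by (rule fin)
  show "summable (\<lambda>n. enn2real (f n))"
    by (rule summable_suminf_not_top) (use assms fin in \<open>auto simp: less_top[symmetric]\<close>)
qed

lemma measurable_vec_componentI:
  fixes f :: "'a \<Rightarrow> real^'d"
  assumes "\<And>i. (\<lambda>w. f w $ i) \<in> borel_measurable M"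
  shows "f \<in> borel_measurable M"
proof (subst borel_measurable_euclidean_space, intro ballI)
  fix b :: "real^'d" assume "b \<in> Basis"
  then obtain i where "b = axis i 1" by (auto simp: Basis_vec_def)
  then show "(\<lambda>x. f x \<bullet> b) \<in> borel_measurable M" using assms[of i] by (simp add: inner_axis)
qed

lemma measurable_vec_nth [measurable (raw)]:
  fixes f :: "'a \<Rightarrow> real^'d"
  shows "f \<in> borel_measurable M \<Longrightarrow> (\<lambda>w. f w $ i) \<in> borel_measurable M"
  by (rule borel_measurable_continuous_on[where f="\<lambda>v. v $ i"]) (auto intro: continuous_intros)

lemma (in prob_space) sigma_finite_subalgebraI:
  "subalgebra M F \<Longrightarrow> sigma_finite_subalgebra M F"
proof -
  assume "subalgebra M F"
  then interpret finite_measure_subalgebra M F by unfold_locales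
  show ?thesis by unfold_locales
qed

text \<open>Jensen's inequality for conditional expectations, applied to
  \<open>1 + \<bar>f\<bar>\<close> because \<open>powr_convex\<close> gives convexity on the open
  half line only.\<close>

lemma (in prob_space) cond_exp_moment:
  fixes f :: "'a \<Rightarrow> real"
  assumes F: "subalgebra M F" and r: "r \<ge> 1" and f[measurable]: "f \<in> borel_measurable M"
    and int: "integrable M (\<lambda>w. (1 + \<bar>f w\<bar>) powr r)"
  shows "integrable M (\<lambda>w. \<bar>real_cond_exp M F f w\<bar> powr r)"
    "expectation (\<lambda>w. \<bar>real_cond_exp M F f w\<bar> powr r) \<le> expectation (\<lambda>w. (1 + \<bar>f w\<bar>) powr r)"
proof -
  interpret sigma_finite_subalgebra M F by (rule sigma_finite_subalgebraI[OF F])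
  have le: "1 + \<bar>x\<bar> \<le> (1 + \<bar>x\<bar>) powr r" for x :: real
    using powr_mono[of 1 r "1 + \<bar>x\<bar>"] r by simp
  have inth: "integrable M (\<lambda>w. 1 + \<bar>f w\<bar>)"
    by (rule Bochner_Integration.integrable_bound[OF int]) (use le in auto)
  have intf: "integrable M f"
    by (rule Bochner_Integration.integrable_bound[OF inth]) auto
  have conv: "convex_on {0<..} (\<lambda>x::real. x powr r)" by (rule powr_convex[OF r])
  have J: "AE w in M. real_cond_exp M F (\<lambda>w. 1 + \<bar>f w\<bar>) w powr r \<le> real_cond_exp M F (\<lambda>w. (1 + \<bar>f w\<bar>) powr r) w"
    by (rule real_cond_exp_jensens_inequality(2)[where I="{0<..}"]) (use inth int conv in auto)
  have up: "AE w in M. real_cond_exp M F f w \<le> real_cond_exp M F (\<lambda>w. 1 + \<bar>f w\<bar>) w"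
    by (rule real_cond_exp_mono) (use inth intf in auto)
  have "AE w in M. real_cond_exp M F (\<lambda>w. (- 1) * f w) w \<le> real_cond_exp M F (\<lambda>w. 1 + \<bar>f w\<bar>) w"
    by (rule real_cond_exp_mono) (use inth intf in auto)
  with real_cond_exp_cmult[OF intf, of "- 1"]
  have lo: "AE w in M. - real_cond_exp M F f w \<le> real_cond_exp M F (\<lambda>w. 1 + \<bar>f w\<bar>) w"
    by eventually_elim simp
  have main: "AE w in M. \<bar>real_cond_exp M F f w\<bar> powr r \<le> real_cond_exp M F (\<lambda>w. (1 + \<bar>f w\<bar>) powr r) w"
    using J up lo
  proof eventually_elim
    case (elim w)
    have "\<bar>real_cond_exp M F f w\<bar> powr r \<le> real_cond_exp M F (\<lambda>w. 1 + \<bar>f w\<bar>) w powr r"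
      using elim r by (intro powr_mono2) auto
    with elim show ?case by simp
  qed
  have intE: "integrable M (real_cond_exp M F (\<lambda>w. (1 + \<bar>f w\<bar>) powr r))" using int by auto
  show i1: "integrable M (\<lambda>w. \<bar>real_cond_exp M F f w\<bar> powr r)"
    by (rule Bochner_Integration.integrable_bound[OF intE]) (use main in auto)
  have "expectation (\<lambda>w. \<bar>real_cond_exp M F f w\<bar> powr r) \<le> expectation (real_cond_exp M F (\<lambda>w. (1 + \<bar>f w\<bar>) powr r))"
    by (rule integral_mono_AE[OF i1 intE main])
  also have "\<dots> = expectation (\<lambda>w. (1 + \<bar>f w\<bar>) powr r)" by (rule real_cond_exp_int(2)[OF int])
  finally show "expectation (\<lambda>w. \<bar>real_cond_exp M F f w\<bar> powr r) \<le> expectation (\<lambda>w. (1 + \<bar>f w\<bar>) powr r)" .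
qed

lemma one_plus_powr_le: 
  fixes x :: real assumes "x \<ge> 0" "r \<ge> 0" shows "(1 + x) powr r \<le> 2 powr r * (1 + x powr r)"
  using powr_one_plus_sum_le[of "{()}" "\<lambda>_. x" r] assms by simp

lemma idx_simps [simp]:
  "- \<infinity> \<in> idx" "\<infinity> \<in> idx" "ereal (real n) \<in> idx" "ereal (real n - real k) \<in> idx" "ereal (real n + real k) \<in> idx"
proof -
  have *: "ereal (real_of_int z) \<in> idx" for z by (auto simp: idx_def)
  show "ereal (real n) \<in> idx" "ereal (real n - real k) \<in> idx" "ereal (real n + real k) \<in> idx"
    using *[of "int n"] *[of "int n - int k"] *[of "int n + int k"] by simp_all
qed (auto simp: idx_def)

text \<open>Only \<open>delta < kappa\<close> is recorded here; the gap that depends on the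
  dimension enters as a premise of \<open>rate_bound\<close>.\<close>

locale mixing_process = prob_space M for M :: "'a measure" +
  fixes Fam :: "ereal \<Rightarrow> ereal \<Rightarrow> 'a measure" and X :: "nat \<Rightarrow> 'a \<Rightarrow> real^'d"
    and iota kappa p qe delta m :: real
  assumes Fam_sub: "\<forall>a\<in>idx. \<forall>b\<in>idx. a \<le> b \<longrightarrow> subalgebra M (Fam a b)"
    and Fam_mono: "\<forall>a\<in>idx. \<forall>b\<in>idx. \<forall>a'\<in>idx. \<forall>b'\<in>idx.
                     a' \<le> a \<longrightarrow> a \<le> b \<longrightarrow> b \<le> b' \<longrightarrow> sets (Fam a b) \<subseteq> sets (Fam a' b')"
    and X_meas: "\<forall>n. X n \<in> borel_measurable M"
    and X_ident: "\<forall>n. distr M borel (X n) = distr M borel (X 0)"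
    and iota_pos: "iota > 0" and kappa: "0 < kappa" "kappa \<le> 1"
    and pq: "1 \<le> p" "1 \<le> qe"
    and delta_pos: "delta > 0" and m_pos: "m > 0" and delta_lt_kappa: "delta < kappa"
    and sum_varpi: "(\<Sum>n. ennreal (real n) * varpi M Fam qe p n) < \<top>"
    and sum_beta: "(\<Sum>r. ennreal (real r) * enn_powr (beta M Fam X qe r) delta) < \<top>"
    and gamma_m: "lpnorm M m (X 0) < \<top>"
    and gamma_2qi: "lpnorm M (2 * qe * iota) (X 0) < \<top>"
    and exps: "1 / 2 \<ge> 1 / p + (iota + 2) / m + delta / qe"
begin

lemma X_measurable [measurable]: "X n \<in> borel_measurable M"
  using X_meas by blast

lemma exps_nonneg: "1 / p \<ge> 0" "delta / qe \<ge> 0"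
  using pq delta_pos by auto

lemma m_ge: "m \<ge> 2 * iota + 4"
proof -
  have "(iota + 2) / m \<le> 1 / 2" using exps exps_nonneg by linarith
  then show ?thesis using m_pos by (simp add: field_simps)
qed

text \<open>Twice the exponent condition. The power \<open>2 * iota + 4\<close> of an envelope has
  room for two factors of growth \<open>iota\<close> and for the extra powers lost in Hoelder
  differences and in the weights of the chaining; \<open>exps_p\<close> is the counterpart for the
  exponent \<open>1 / p\<close>.\<close>

lemma exps_delta: "(2 * iota + 4) / m + delta / qe \<le> 1"
proof -
  have "(2 * iota + 4) / m = 2 * ((iota + 2) / m)" by (simp add: algebra_simps add_divide_distrib)
  then show ?thesis using exps exps_nonneg by linarith
qed

lemma exps_p: "(2 * iota + 4) / m + 1 / p \<le> 1"
proof -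
  have "(2 * iota + 4) / m = 2 * ((iota + 2) / m)" by (simp add: algebra_simps add_divide_distrib)
  then show ?thesis using exps exps_nonneg by linarith
qed

lemma X_integral_ident:
  assumes [measurable]: "f \<in> borel_measurable borel"
  shows "integrable M (\<lambda>w. f (X k w) :: real) \<longleftrightarrow> integrable M (\<lambda>w. f (X 0 w))"
    "expectation (\<lambda>w. f (X k w)) = expectation (\<lambda>w. f (X 0 w))"
proof -
  have "distr M borel (X k) = distr M borel (X 0)" using X_ident by blast
  then have "integrable (distr M borel (X k)) f = integrable (distr M borel (X 0)) f"
    "integral\<^sup>L (distr M borel (X k)) f = integral\<^sup>L (distr M borel (X 0)) f" by auto
  then show "integrable M (\<lambda>w. f (X k w)) \<longleftrightarrow> integrable M (\<lambda>w. f (X 0 w))"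
    "expectation (\<lambda>w. f (X k w)) = expectation (\<lambda>w. f (X 0 w))"
    by (auto simp: integrable_distr_eq integral_distr)
qed

definition past :: "nat \<Rightarrow> 'a measure" where "past T = Fam (- \<infinity>) (ereal (real T))"
definition future :: "nat \<Rightarrow> 'a measure" where "future T = Fam (ereal (real T)) \<infinity>"
definition window :: "nat \<Rightarrow> nat \<Rightarrow> 'a measure" where
  "window r k = Fam (ereal (real k - real r)) (ereal (real k + real r))"
text \<open>The localised version of \<open>X k\<close>: it is measurable with respect to the past
  or the future of a time \<open>T\<close> as soon as \<open>k\<close> keeps the distance
  \<open>r\<close> from \<open>T\<close> on the proper side. \<open>X k\<close> itself is not
  assumed adapted.\<close>

definition Xr :: "nat \<Rightarrow> nat \<Rightarrow> 'a \<Rightarrow> real^'d" where "Xr r k = cond_exp_vec M (window r k) (X k)"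

lemma subalgebras: "subalgebra M (past T)" "subalgebra M (future T)" "subalgebra M (window r k)"
  unfolding past_def future_def window_def
  by (auto intro!: Fam_sub[rule_format])

lemma window_subset_past: "k + r \<le> T \<Longrightarrow> sets (window r k) \<subseteq> sets (past T)"
  unfolding past_def window_def by (rule Fam_mono[rule_format]) auto

lemma window_subset_future: "T + r \<le> k \<Longrightarrow> sets (window r k) \<subseteq> sets (future T)"
  unfolding future_def window_def by (rule Fam_mono[rule_format]) auto

lemma future_mono: "T \<le> U \<Longrightarrow> sets (future U) \<subseteq> sets (future T)"
  unfolding future_def by (rule Fam_mono[rule_format]) auto

lemma measurable_sub_mono:
  assumes "f \<in> measurable A N" "sets A \<subseteq> sets B" "subalgebra M A" "subalgebra M B"
  shows "f \<in> measurable B N"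
  using assms unfolding measurable_def subalgebra_def by auto

lemma Xr_window: "Xr r k \<in> borel_measurable (window r k)"
  unfolding Xr_def by (rule measurable_vec_componentI) (simp add: cond_exp_vec_def)

lemma Xr_past: "k + r \<le> T \<Longrightarrow> Xr r k \<in> borel_measurable (past T)"
  using measurable_sub_mono[OF Xr_window window_subset_past] subalgebras by blast

lemma Xr_future: "T + r \<le> k \<Longrightarrow> Xr r k \<in> borel_measurable (future T)"
  using measurable_sub_mono[OF Xr_window window_subset_future] subalgebras by blast

lemma Xr_measurable [measurable]: "Xr r k \<in> borel_measurable M"
  using measurable_from_subalg[OF subalgebras(3) Xr_window] .

lemma X_integrable_m: "integrable M (\<lambda>w. norm (X k w) powr m)"
  using lpnorm_finite_integrable[OF X_measurable m_pos gamma_m]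
    X_integral_ident(1)[of "\<lambda>x. norm x powr m" k] by simp

text \<open>Conditional Jensen bounds each component, and the norm is at most the l1 norm. Identical
  distribution of the \<open>X k\<close> makes the bound uniform in \<open>r\<close> and
  \<open>k\<close>.\<close>

lemma Xr_moment_ge1:
  assumes s: "s \<ge> 1" and int: "integrable M (\<lambda>w. norm (X 0 w) powr s)"
  shows "\<exists>\<Gamma>. \<forall>r k. integrable M (\<lambda>w. norm (Xr r k w) powr s) \<and> expectation (\<lambda>w. norm (Xr r k w) powr s) \<le> \<Gamma>"
proof -
  define \<Gamma>1 where "\<Gamma>1 = 2 powr s * (1 + expectation (\<lambda>w. norm (X 0 w) powr s))"
  define c where "c = (1 + CARD('d)) powr s"
  have comp: "integrable M (\<lambda>w. \<bar>Xr r k w $ i\<bar> powr s) \<and> expectation (\<lambda>w. \<bar>Xr r k w $ i\<bar> powr s) \<le> \<Gamma>1" for r k i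
  proof -
    have intk: "integrable M (\<lambda>w. norm (X k w) powr s)"
      using X_integral_ident(1)[of "\<lambda>x. norm x powr s" k] int by simp
    have le: "(1 + \<bar>X k w $ i\<bar>) powr s \<le> 2 powr s * (1 + norm (X k w) powr s)" for w
    proof -
      have "(1 + \<bar>X k w $ i\<bar>) powr s \<le> (1 + norm (X k w)) powr s"
        using s by (intro powr_mono2 add_left_mono component_le_norm_cart) auto
      also have "\<dots> \<le> 2 powr s * (1 + norm (X k w) powr s)" using s by (intro one_plus_powr_le) auto
      finally show ?thesis .
    qed
    have inti: "integrable M (\<lambda>w. (1 + \<bar>X k w $ i\<bar>) powr s)"
      by (rule Bochner_Integration.integrable_bound[where f="\<lambda>w. 2 powr s * (1 + norm (X k w) powr s)"])
         (use intk le in auto)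
    have "expectation (\<lambda>w. (1 + \<bar>X k w $ i\<bar>) powr s) \<le> expectation (\<lambda>w. 2 powr s * (1 + norm (X k w) powr s))"
      using inti intk le by (intro integral_mono) auto
    also have "\<dots> = 2 powr s * (1 + expectation (\<lambda>w. norm (X k w) powr s))" using intk by (simp add: prob_space)
    also have "\<dots> = \<Gamma>1" unfolding \<Gamma>1_def using X_integral_ident(2)[of "\<lambda>x. norm x powr s" k] by simp
    finally have "expectation (\<lambda>w. (1 + \<bar>X k w $ i\<bar>) powr s) \<le> \<Gamma>1" .
    have mk: "(\<lambda>w. X k w $ i) \<in> borel_measurable M" by measurable
    have eq: "Xr r k w $ i = real_cond_exp M (window r k) (\<lambda>w. X k w $ i) w" for w
      by (simp add: Xr_def cond_exp_vec_def)
    show ?thesis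
      unfolding eq using cond_exp_moment[OF subalgebras(3)[of r k] s mk inti] \<open>_ \<le> \<Gamma>1\<close> by linarith
  qed
  have le: "norm (Xr r k w) powr s \<le> c * (1 + (\<Sum>i\<in>UNIV. \<bar>Xr r k w $ i\<bar> powr s))" for r k w
  proof -
    have "norm (Xr r k w) powr s \<le> (1 + (\<Sum>i\<in>UNIV. \<bar>Xr r k w $ i\<bar>)) powr s"
      using s norm_le_l1_cart[of "Xr r k w"] by (intro powr_mono2) auto
    also have "\<dots> \<le> c * (1 + (\<Sum>i\<in>UNIV. \<bar>Xr r k w $ i\<bar> powr s))"
      unfolding c_def using s by (intro powr_one_plus_sum_le) auto
    finally show ?thesis .
  qed
  have "integrable M (\<lambda>w. norm (Xr r k w) powr s) \<and> expectation (\<lambda>w. norm (Xr r k w) powr s) \<le> c * (1 + CARD('d) * \<Gamma>1)" for r k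
  proof
    have int2: "integrable M (\<lambda>w. c * (1 + (\<Sum>i\<in>UNIV. \<bar>Xr r k w $ i\<bar> powr s)))" using comp by simp
    show int1: "integrable M (\<lambda>w. norm (Xr r k w) powr s)"
      by (rule Bochner_Integration.integrable_bound[OF int2]) (use order_trans[OF le abs_ge_self] in auto)
    have "expectation (\<lambda>w. norm (Xr r k w) powr s) \<le> expectation (\<lambda>w. c * (1 + (\<Sum>i\<in>UNIV. \<bar>Xr r k w $ i\<bar> powr s)))"
      by (intro integral_mono int1 int2 le)
    also have "\<dots> = c * (1 + (\<Sum>i\<in>UNIV. expectation (\<lambda>w. \<bar>Xr r k w $ i\<bar> powr s)))"
      using comp by (simp add: prob_space)
    also have "\<dots> \<le> c * (1 + (\<Sum>i\<in>(UNIV::'d set). \<Gamma>1))"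
      using comp by (intro mult_left_mono add_left_mono sum_mono) (auto simp: c_def)
    finally show "expectation (\<lambda>w. norm (Xr r k w) powr s) \<le> c * (1 + CARD('d) * \<Gamma>1)" by simp
  qed
  then show ?thesis by blast
qed

lemma Xr_moment_m:
  "\<exists>\<Gamma>. \<forall>r k. integrable M (\<lambda>w. norm (Xr r k w) powr m) \<and> expectation (\<lambda>w. norm (Xr r k w) powr m) \<le> \<Gamma>"
  using m_ge iota_pos by (intro Xr_moment_ge1 X_integrable_m) auto

text \<open>Jensen requires an exponent of at least 1. If \<open>qe * iota\<close> is smaller, the
  \<open>m\<close>-th moment dominates.\<close>

lemma Xr_moment_qi:
  "\<exists>\<Gamma>. \<forall>r k. integrable M (\<lambda>w. norm (Xr r k w) powr (qe * iota)) \<and> expectation (\<lambda>w. norm (Xr r k w) powr (qe * iota)) \<le> \<Gamma>"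
proof (cases "qe * iota \<ge> 1")
  case True
  have 2: "integrable M (\<lambda>w. norm (X 0 w) powr (2 * qe * iota))"
    using gamma_2qi pq iota_pos by (intro lpnorm_finite_integrable) auto
  have "integrable M (\<lambda>w. norm (X 0 w) powr (qe * iota))"
  proof (rule Bochner_Integration.integrable_bound[where f="\<lambda>w. 1 + 1 powr m + norm (X 0 w) powr (2 * qe * iota)"])
    show "AE w in M. norm (norm (X 0 w) powr (qe * iota)) \<le> norm (1 + 1 powr m + norm (X 0 w) powr (2 * qe * iota))"
    proof (rule AE_I2)
      fix w
      show "norm (norm (X 0 w) powr (qe * iota)) \<le> norm (1 + 1 powr m + norm (X 0 w) powr (2 * qe * iota))"
        using powr_mult_powr_le[of 1 "norm (X 0 w) powr (2 * qe * iota)" 0 "1 / 2" m] m_pos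
        by (simp add: powr_powr mult.commute)
    qed
  qed (use 2 in auto)
  with True show ?thesis by (intro Xr_moment_ge1)
next
  case False
  obtain \<Gamma> where \<Gamma>: "\<And>r k. integrable M (\<lambda>w. norm (Xr r k w) powr m)" "\<And>r k. expectation (\<lambda>w. norm (Xr r k w) powr m) \<le> \<Gamma>"
    using Xr_moment_m by blast
  have le: "norm (Xr r k w) powr (qe * iota) \<le> 2 + norm (Xr r k w) powr m" for r k w
    using powr_mult_powr_le[of 1 "norm (Xr r k w) powr m" 0 "qe * iota / m" m] m_pos m_ge pq iota_pos False
    by (simp add: powr_powr)
  have int: "integrable M (\<lambda>w. norm (Xr r k w) powr (qe * iota))" for r k
    by (rule Bochner_Integration.integrable_bound[where f="\<lambda>w. 2 + norm (Xr r k w) powr m"]) (use \<Gamma> le in auto)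
  have "expectation (\<lambda>w. norm (Xr r k w) powr (qe * iota)) \<le> 2 + \<Gamma>" for r k
  proof -
    have "expectation (\<lambda>w. norm (Xr r k w) powr (qe * iota)) \<le> expectation (\<lambda>w. 2 + norm (Xr r k w) powr m)"
      using int \<Gamma> le by (intro integral_mono) auto
    also have "\<dots> \<le> 2 + \<Gamma>" using \<Gamma> by (simp add: prob_space)
    finally show ?thesis .
  qed
  with int show ?thesis by blast
qed

text \<open>The last summand keeps the rate positive, so that one can divide by it.\<close>
definition rho :: "nat \<Rightarrow> real" where
  "rho r = enn2real (varpi M Fam qe p r) + enn2real (enn_powr (beta M Fam X qe r) delta) + 1 / (real r + 1) ^ 3"

lemma rho_pos: "rho r > 0"
  unfolding rho_def by (intro add_nonneg_pos add_nonneg_nonneg) auto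

lemma rho_summable: "summable (\<lambda>r. real r * rho r)"
proof -
  have 1: "summable (\<lambda>r. real r * enn2real (varpi M Fam qe p r))"
    using summable_enn2real(1)[OF sum_varpi] by (simp add: enn2real_mult)
  have 2: "summable (\<lambda>r. real r * enn2real (enn_powr (beta M Fam X qe r) delta))"
    using summable_enn2real(1)[OF sum_beta] by (simp add: enn2real_mult)
  have 3: "summable (\<lambda>r. real r * (1 / (real r + 1) ^ 3))"
  proof (rule summable_comparison_test')
    show "summable (\<lambda>r. 1 / (real (Suc r))\<^sup>2)" using inverse_squares_sums sums_summable by simp
    show "norm (real n * (1 / (real n + 1) ^ 3)) \<le> 1 / (real (Suc n))\<^sup>2" for n
    proof -
      have "real n * (1 / (real n + 1) ^ 3) \<le> (real n + 1) * (1 / (real n + 1) ^ 3)"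
        by (intro mult_right_mono) auto
      also have "\<dots> = 1 / (real (Suc n))\<^sup>2"
        by (simp add: power2_eq_square power3_eq_cube add.commute)
      finally show ?thesis by simp
    qed
  qed
  show ?thesis using summable_add[OF summable_add[OF 1 2] 3] by (simp add: rho_def algebra_simps)
qed

lemma rho_summable': "summable rho"
  by (rule summable_of_weighted) (use rho_summable rho_pos[THEN less_imp_le] in simp)

text \<open>The weight in \<open>sum_varpi\<close> vanishes at zero, so finiteness of
  \<open>varpi\<close> is available from \<open>r = 1\<close> on. The same restriction reappears
  wherever \<open>rho\<close> is used as a rate.\<close>

lemma varpi_le_rho:
  assumes "r \<ge> 1" shows "varpi M Fam qe p r \<le> ennreal (rho r)"
proof -
  have "ennreal (real r) * varpi M Fam qe p r < \<top>" by (rule summable_enn2real(2)[OF sum_varpi])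
  then have "varpi M Fam qe p r < \<top>" using assms by (auto simp: ennreal_mult_less_top)
  then have "varpi M Fam qe p r = ennreal (enn2real (varpi M Fam qe p r))" by simp
  also have "\<dots> \<le> ennreal (rho r)" unfolding rho_def by (intro ennreal_leI) auto
  finally show ?thesis .
qed

text \<open>\<open>rho\<close> dominates \<open>beta powr delta\<close> and not \<open>beta\<close>
  itself, which explains the exponent \<open>qe / delta\<close>.\<close>

lemma X_diff_Xr:
  assumes r: "r \<ge> 1"
  shows "integrable M (\<lambda>w. norm (X k w - Xr r k w) powr qe)"
    "expectation (\<lambda>w. norm (X k w - Xr r k w) powr qe) \<le> rho r powr (qe / delta)"
proof -
  let ?b = "beta M Fam X qe r"
  have "ennreal (real r) * enn_powr ?b delta < \<top>" by (rule summable_enn2real(2)[OF sum_beta])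
  then have "enn_powr ?b delta < \<top>" using r by (auto simp: ennreal_mult_less_top)
  then have btop: "?b \<noteq> \<top>" by (auto simp: enn_powr_def)
  have "enn2real ?b powr delta \<le> rho r"
    using btop unfolding rho_def enn_powr_def by auto
  then have "(enn2real ?b powr delta) powr (qe / delta) \<le> rho r powr (qe / delta)"
    using pq delta_pos by (intro powr_mono2) auto
  then have b: "enn2real ?b powr qe \<le> rho r powr (qe / delta)" using delta_pos by (simp add: powr_powr)
  have "lpnorm M qe (\<lambda>w. X k w - Xr r k w) \<le> ?b"
    unfolding beta_def Xr_def window_def by (rule SUP_upper) simp
  also have "\<dots> = ennreal (enn2real ?b)" using btop by (simp add: less_top)
  finally have le: "lpnorm M qe (\<lambda>w. X k w - Xr r k w) \<le> ennreal (enn2real ?b)" .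
  have "integrable M (\<lambda>w. norm (X k w - Xr r k w) powr qe) \<and>
    expectation (\<lambda>w. norm (X k w - Xr r k w) powr qe) \<le> enn2real ?b powr qe"
    using lpnorm_le_ennrealD[OF _ _ _ le] pq by auto
  with b show "integrable M (\<lambda>w. norm (X k w - Xr r k w) powr qe)"
    "expectation (\<lambda>w. norm (X k w - Xr r k w) powr qe) \<le> rho r powr (qe / delta)" by auto
qed

text \<open>By homogeneity: \<open>h / lam\<close> lies in the unit ball over which
  \<open>varpi_sa\<close> takes its supremum, and enlarging the future from \<open>U\<close> to
  \<open>T + r\<close> leaves exactly the gap \<open>r\<close>.\<close>

lemma cond_exp_past_bound:
  assumes r: "r \<ge> 1" and U: "T + r \<le> U" and h: "h \<in> borel_measurable (future U)" and lam: "lam > 0"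
    and int: "integrable M (\<lambda>w. \<bar>h w\<bar> powr qe)" and le: "expectation (\<lambda>w. \<bar>h w\<bar> powr qe) \<le> lam powr qe"
  shows "integrable M h"
    "integrable M (\<lambda>w. \<bar>real_cond_exp M (past T) h w - expectation h\<bar> powr p)"
    "expectation (\<lambda>w. \<bar>real_cond_exp M (past T) h w - expectation h\<bar> powr p) \<le> (rho r * lam) powr p"
proof -
  interpret sub: sigma_finite_subalgebra M "past T" by (rule sigma_finite_subalgebraI[OF subalgebras(1)])
  have hM[measurable]: "h \<in> borel_measurable M" using measurable_from_subalg[OF subalgebras(2) h] .
  show inth: "integrable M h"
  proof (rule Bochner_Integration.integrable_bound[where f="\<lambda>w. 2 + \<bar>h w\<bar> powr qe"])
    show "AE w in M. norm (h w) \<le> norm (2 + \<bar>h w\<bar> powr qe)"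
    proof (rule AE_I2)
      fix w
      have "\<bar>h w\<bar> \<le> 2 + \<bar>h w\<bar> powr qe"
        using powr_mult_powr_le[of 1 "\<bar>h w\<bar> powr qe" 0 "1 / qe" 1] pq by (simp add: powr_powr)
      then show "norm (h w) \<le> norm (2 + \<bar>h w\<bar> powr qe)" by simp
    qed
  qed (use int in auto)
  define g where "g w = h w / lam" for w
  have gq: "\<bar>g w\<bar> powr qe = \<bar>h w\<bar> powr qe / lam powr qe" for w
    using lam by (simp add: g_def abs_divide powr_divide)
  have g1: "lpnorm M qe g \<le> 1"
    by (rule lpnorm_le_one) (use int le lam pq in \<open>auto simp: gq\<close>)
  have gm: "g \<in> borel_measurable (future (T + r))"
  proof -
    have "h \<in> borel_measurable (future (T + r))"
      using measurable_sub_mono[OF h future_mono[OF U]] subalgebras by blast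
    then show ?thesis unfolding g_def by simp
  qed
  have "lpnorm M p (\<lambda>w. real_cond_exp M (past T) g w - expectation g)
      \<le> varpi_sa M qe p (past T) (future (T + r))"
    unfolding varpi_sa_def using g1 gm by (intro SUP_upper) auto
  also have "\<dots> \<le> varpi M Fam qe p r"
    unfolding varpi_def past_def future_def of_nat_add by (rule SUP_upper) simp
  also have "\<dots> \<le> ennreal (rho r)" by (rule varpi_le_rho[OF r])
  finally have le1: "lpnorm M p (\<lambda>w. real_cond_exp M (past T) g w - expectation g) \<le> ennreal (rho r)" .
  have gM[measurable]: "g \<in> borel_measurable M" unfolding g_def by measurable
  have 1: "integrable M (\<lambda>w. \<bar>real_cond_exp M (past T) g w - expectation g\<bar> powr p)"
     "expectation (\<lambda>w. \<bar>real_cond_exp M (past T) g w - expectation g\<bar> powr p) \<le> rho r powr p"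
    using lpnorm_le_ennrealD[OF _ _ _ le1] pq rho_pos[of r] by auto
  have Eg: "expectation g = expectation h / lam" unfolding g_def by simp
  have ae: "AE w in M. \<bar>real_cond_exp M (past T) h w - expectation h\<bar> powr p
     = lam powr p * \<bar>real_cond_exp M (past T) g w - expectation g\<bar> powr p"
    using sub.real_cond_exp_cdiv[OF inth, of lam, folded g_def]
  proof eventually_elim
    case (elim w)
    have "\<bar>real_cond_exp M (past T) h w - expectation h\<bar> = lam * \<bar>real_cond_exp M (past T) g w - expectation g\<bar>"
      using lam elim by (simp add: Eg diff_divide_distrib[symmetric])
    then show ?case using lam by (simp add: powr_mult)
  qed
  show "integrable M (\<lambda>w. \<bar>real_cond_exp M (past T) h w - expectation h\<bar> powr p)"
    by (subst integrable_cong_AE[OF _ _ ae]) (use 1 in auto)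
  have "expectation (\<lambda>w. \<bar>real_cond_exp M (past T) h w - expectation h\<bar> powr p)
     = lam powr p * expectation (\<lambda>w. \<bar>real_cond_exp M (past T) g w - expectation g\<bar> powr p)"
    by (subst integral_cong_AE[OF _ _ ae]) auto
  also have "\<dots> \<le> lam powr p * rho r powr p" using 1 by (intro mult_left_mono) auto
  finally show "expectation (\<lambda>w. \<bar>real_cond_exp M (past T) h w - expectation h\<bar> powr p) \<le> (rho r * lam) powr p"
    using lam rho_pos[of r] by (simp add: powr_mult mult.commute)
qed

end

section \<open>Decorrelation of functions of the process\<close>

text \<open>Integration of \<open>powr_mult_powr_le\<close> gives \<open>1 + \<Gamma> + 1\<close>,
  the origin of the factor \<open>2 + \<Gamma>\<close> in the later constants.\<close>

lemma (in prob_space) mixed_moment: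
  fixes f B U :: "'a \<Rightarrow> real"
  assumes [measurable]: "f \<in> borel_measurable M"
    and B: "\<And>w. B w \<ge> 1" "integrable M (\<lambda>w. B w powr m)" "expectation (\<lambda>w. B w powr m) \<le> \<Gamma>"
    and U: "\<And>w. U w \<ge> 0" "integrable M U" "expectation U \<le> 1"
    and ex: "e \<ge> 0" "th \<ge> 0" "m > 0" "e / m + th \<le> 1" and c: "c \<ge> 0"
    and le: "\<And>w. \<bar>f w\<bar> \<le> c * (B w powr e * U w powr th)"
  shows "integrable M f" "expectation (\<lambda>w. \<bar>f w\<bar>) \<le> c * (2 + \<Gamma>)" "\<bar>expectation f\<bar> \<le> c * (2 + \<Gamma>)"
proof -
  have le': "\<bar>f w\<bar> \<le> c * (1 + B w powr m + U w)" for w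
    using le[of w] mult_left_mono[OF powr_mult_powr_le[OF B(1)[of w] U(1)[of w] ex] c] by linarith
  have int: "integrable M (\<lambda>w. c * (1 + B w powr m + U w))" using B U by simp
  show i: "integrable M f"
    by (rule Bochner_Integration.integrable_bound[OF int]) (use order_trans[OF le' abs_ge_self] in auto)
  have "expectation (\<lambda>w. \<bar>f w\<bar>) \<le> expectation (\<lambda>w. c * (1 + B w powr m + U w))"
    by (intro integral_mono int le') (use i in simp)
  also have "\<dots> = c * (1 + expectation (\<lambda>w. B w powr m) + expectation U)"
    using B U by (simp add: prob_space)
  also have "\<dots> \<le> c * (2 + \<Gamma>)" using B U c by (intro mult_left_mono) auto
  finally show "expectation (\<lambda>w. \<bar>f w\<bar>) \<le> c * (2 + \<Gamma>)" .
  with integral_abs_bound[of M f] show "\<bar>expectation f\<bar> \<le> c * (2 + \<Gamma>)" by linarith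
qed

lemma hoelder_growth_nonneg:
  fixes g :: "(nat \<Rightarrow> real^'d) \<Rightarrow> real"
  assumes "hoelder_growth L K iota kappa g" shows "K \<ge> 0"
proof -
  have "\<bar>g (\<lambda>_. 0)\<bar> \<le> K * (1 + (\<Sum>i=1..L. norm ((0::real^'d)) powr iota))"
    using assms unfolding hoelder_growth_def by blast
  then have "0 \<le> K * (1 + (\<Sum>i=1..L. norm ((0::real^'d)) powr iota))" by linarith
  then show ?thesis by simp
qed

text \<open>The Hoelder bound forces \<open>g\<close> to factor through the coordinates
  \<open>1..L\<close>; this is what permits setting all other coordinates to zero.\<close>

lemma hoelder_growth_cong:
  assumes "hoelder_growth L K iota kappa g" "\<And>i. i \<in> {1..L} \<Longrightarrow> x i = z i"
  shows "g x = g z"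
proof -
  have "\<bar>g x - g z\<bar> \<le> K * (1 + (\<Sum>i=1..L. norm (x i) powr iota + norm (z i) powr iota))
                                * (\<Sum>i=1..L. norm (x i - z i) powr kappa)"
    using assms unfolding hoelder_growth_def by blast
  also have "(\<Sum>i=1..L. norm (x i - z i) powr kappa) = 0" using assms(2) by simp
  finally show ?thesis by simp
qed

text \<open>Continuity in the product topology, from which measurability of \<open>g\<close> along
  random vectors follows by coordinatewise measurability.\<close>

lemma hoelder_growth_continuous:
  fixes g :: "(nat \<Rightarrow> real^'d) \<Rightarrow> real"
  assumes hg: "hoelder_growth L K iota kappa g" and pos: "iota > 0" "kappa > 0"
  shows "continuous_on UNIV g"
proof -
  have "(g \<longlongrightarrow> g z) (at z)" for z
  proof (rule LIM_zero_cancel, rule Lim_null_comparison)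
    let ?bd = "\<lambda>x. K * (1 + (\<Sum>i=1..L. norm (x i) powr iota + norm (z i) powr iota)) * (\<Sum>i=1..L. norm (x i - z i) powr kappa)"
    show "\<forall>\<^sub>F x in at z. norm (g x - g z) \<le> ?bd x"
      using hg unfolding hoelder_growth_def by auto
    have comp: "((\<lambda>x. x i) \<longlongrightarrow> z i) (at z)" for i
      using continuous_on_product_coordinates[of i] unfolding continuous_on_def by blast
    have "(?bd \<longlongrightarrow> K * (1 + (\<Sum>i=1..L. norm (z i) powr iota + norm (z i) powr iota)) * (\<Sum>i=1..L. norm (z i - z i) powr kappa)) (at z)"
      using pos by (intro tendsto_intros comp tendsto_powr2) auto
    then show "(?bd \<longlongrightarrow> 0) (at z)" by simp
  qed
  then show ?thesis by (simp add: continuous_on_def)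
qed

lemma measurable_fun_composition:
  fixes g :: "('i::countable \<Rightarrow> real^'d) \<Rightarrow> real"
  assumes "continuous_on UNIV g" "\<And>i. (\<lambda>w. f w i) \<in> borel_measurable N"
  shows "(\<lambda>w. g (f w)) \<in> borel_measurable N"
  using borel_measurable_continuous_onI[OF assms(1)] measurable_coordinatewise_then_product[of f N]
    assms(2) measurable_compose by blast

lemma hoelder_growth_bound:
  assumes hg: "hoelder_growth L K iota kappa g" and "iota > 0" and B: "B \<ge> 1" "\<And>i. i \<in> {1..L} \<Longrightarrow> norm (x i) \<le> B"
  shows "\<bar>g x\<bar> \<le> K * (1 + real L) * B powr iota"
proof -
  have K: "K \<ge> 0" by (rule hoelder_growth_nonneg[OF hg])
  have B1: "1 \<le> B powr iota" using B assms by (simp add: ge_one_powr_ge_zero)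
  have "\<bar>g x\<bar> \<le> K * (1 + (\<Sum>i=1..L. norm (x i) powr iota))" using hg unfolding hoelder_growth_def by blast
  also have "\<dots> \<le> K * (B powr iota + (\<Sum>i=1..L. B powr iota))"
    using assms B B1 K by (intro mult_left_mono add_mono sum_mono powr_mono2) auto
  finally show ?thesis by (simp add: algebra_simps)
qed

text \<open>The exponent \<open>kappa\<close> is lowered to \<open>delta\<close> by spending one
  power of \<open>B\<close>: the distance is at most \<open>2 * B\<close> and
  \<open>kappa - delta <= 1\<close>. Powers of \<open>B\<close> are cheap, while
  \<open>delta\<close> is the exponent for which \<open>beta\<close> is summable.\<close>

lemma hoelder_growth_diff_bound:
  assumes hg: "hoelder_growth L K iota kappa g" and ex: "iota > 0" "0 < delta" "delta \<le> kappa" "kappa \<le> 1"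
    and B: "B \<ge> 1" "\<And>i. i \<in> {1..L} \<Longrightarrow> norm (x i) \<le> B" "\<And>i. i \<in> {1..L} \<Longrightarrow> norm (z i) \<le> B"
  shows "\<bar>g x - g z\<bar> \<le> 2 * K * (1 + 2 * real L) * B powr (iota + 1) * (\<Sum>i=1..L. norm (x i - z i) powr delta)"
proof -
  have K: "K \<ge> 0" by (rule hoelder_growth_nonneg[OF hg])
  have B1: "1 \<le> B powr iota" using B assms by (simp add: ge_one_powr_ge_zero)
  have 1: "1 + (\<Sum>i=1..L. norm (x i) powr iota + norm (z i) powr iota) \<le> B powr iota + (\<Sum>i=1..L. B powr iota + B powr iota)"
    using assms B1 by (intro add_mono sum_mono powr_mono2) auto
  have 2: "norm (x i - z i) powr kappa \<le> 2 * B * norm (x i - z i) powr delta" if "i \<in> {1..L}" for i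
  proof -
    have n: "norm (x i - z i) \<le> 2 * B" using B(2,3)[OF that] norm_triangle_ineq4[of "x i" "z i"] by linarith
    have "norm (x i - z i) powr kappa = norm (x i - z i) powr (kappa - delta) * norm (x i - z i) powr delta"
      by (simp add: powr_add[symmetric])
    also have "norm (x i - z i) powr (kappa - delta) \<le> (2 * B) powr (kappa - delta)"
      using n ex by (intro powr_mono2) auto
    also have "(2 * B) powr (kappa - delta) \<le> (2 * B) powr 1" using ex B by (intro powr_mono) auto
    finally show ?thesis using B by (simp add: mult_right_mono)
  qed
  have "\<bar>g x - g z\<bar> \<le> K * (1 + (\<Sum>i=1..L. norm (x i) powr iota + norm (z i) powr iota)) * (\<Sum>i=1..L. norm (x i - z i) powr kappa)"
    using hg unfolding hoelder_growth_def by blast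
  also have "\<dots> \<le> K * (B powr iota + (\<Sum>i=1..L. B powr iota + B powr iota)) * (\<Sum>i=1..L. 2 * B * norm (x i - z i) powr delta)"
    using K 1 2 by (intro mult_mono mult_left_mono sum_mono mult_nonneg_nonneg sum_nonneg add_nonneg_nonneg) auto
  also have "\<dots> = 2 * K * (1 + 2 * real L) * (B powr iota * B) * (\<Sum>i=1..L. norm (x i - z i) powr delta)"
    by (simp add: sum_distrib_left[symmetric] algebra_simps)
  also have "B powr iota * B = B powr (iota + 1)" using B by (simp add: powr_add)
  finally show ?thesis .
qed

text \<open>The integrated coordinates enter only through \<open>E\<close>, whose mean is at most
  \<open>L * \<Gamma>\<close>. The two points compared share the same \<open>\<eta>\<close>, so
  \<open>E\<close> occurs twice and the constant grows by the factor
  \<open>1 + 2 * L * \<Gamma>\<close>. The class is therefore stable under integrating out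
  blocks.\<close>

lemma (in prob_space) hoelder_growth_integral:
  fixes g :: "(nat \<Rightarrow> real^'d) \<Rightarrow> real" and \<eta> :: "nat \<Rightarrow> 'a \<Rightarrow> real^'d"
  assumes hg: "hoelder_growth L K iota kappa g" and pos: "iota > 0" "kappa > 0"
    and [measurable]: "\<And>j. \<eta> j \<in> borel_measurable M"
    and int: "\<And>j. integrable M (\<lambda>w. norm (\<eta> j w) powr iota)"
    and \<Gamma>: "\<And>j. expectation (\<lambda>w. norm (\<eta> j w) powr iota) \<le> \<Gamma>"
  shows "hoelder_growth L (K * (1 + 2 * real L * \<Gamma>)) iota kappa
      (\<lambda>v. expectation (\<lambda>w. g (\<lambda>j. if j \<in> Q then \<eta> j w else v j)))"
    and "integrable M (\<lambda>w. g (\<lambda>j. if j \<in> Q then \<eta> j w else v j))"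
proof -
  define y where "y v w = (\<lambda>j. if j \<in> Q then \<eta> j w else v j)" for v w
  define E where "E w = (\<Sum>i=1..L. norm (\<eta> i w) powr iota)" for w
  have K: "K \<ge> 0" by (rule hoelder_growth_nonneg[OF hg])
  have \<Gamma>0: "\<Gamma> \<ge> 0" using order_trans[OF _ \<Gamma>[of 0]] by (simp add: integral_nonneg)
  have E0: "E w \<ge> 0" for w unfolding E_def by (simp add: sum_nonneg)
  have intE: "integrable M E" unfolding E_def using int by auto
  have EE: "expectation E \<le> real L * \<Gamma>"
  proof -
    have "expectation E = (\<Sum>i=1..L. expectation (\<lambda>w. norm (\<eta> i w) powr iota))"
      unfolding E_def using int by simp
    also have "\<dots> \<le> (\<Sum>i=1..L. \<Gamma>)" by (intro sum_mono \<Gamma>)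
    finally show ?thesis by simp
  qed
  have meas[measurable]: "(\<lambda>w. g (y v w)) \<in> borel_measurable M" for v
    by (rule measurable_fun_composition[OF hoelder_growth_continuous[OF hg pos]]) (auto simp: y_def)
  have ycomp: "(\<Sum>i=1..L. norm (y v w i) powr iota) \<le> (\<Sum>i=1..L. norm (v i) powr iota) + E w" for v w
    unfolding E_def sum.distrib[symmetric] by (intro sum_mono) (auto simp: y_def)
  have growth: "\<bar>g (y v w)\<bar> \<le> K * (1 + (\<Sum>i=1..L. norm (v i) powr iota) + E w)" for v w
  proof -
    have "\<bar>g (y v w)\<bar> \<le> K * (1 + (\<Sum>i=1..L. norm (y v w i) powr iota))" using hg unfolding hoelder_growth_def by blast
    also have "\<dots> \<le> K * (1 + ((\<Sum>i=1..L. norm (v i) powr iota) + E w))" using K ycomp by (intro mult_left_mono) auto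
    finally show ?thesis by (simp add: add.assoc)
  qed
  have intg: "integrable M (\<lambda>w. g (y v w))" for v
    by (rule Bochner_Integration.integrable_bound[where f="\<lambda>w. K * (1 + (\<Sum>i=1..L. norm (v i) powr iota) + E w)"])
       (use intE order_trans[OF growth abs_ge_self] in auto)
  then show "integrable M (\<lambda>w. g (\<lambda>j. if j \<in> Q then \<eta> j w else v j))" unfolding y_def .
  show "hoelder_growth L (K * (1 + 2 * real L * \<Gamma>)) iota kappa (\<lambda>v. expectation (\<lambda>w. g (\<lambda>j. if j \<in> Q then \<eta> j w else v j)))"
    unfolding hoelder_growth_def y_def[symmetric]
  proof (intro conjI allI)
    fix x z :: "nat \<Rightarrow> real^'d"
    define s where "s = (\<Sum>i=1..L. norm (x i) powr iota + norm (z i) powr iota)"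
    define t where "t = (\<Sum>i=1..L. norm (x i - z i) powr kappa)"
    have s0: "s \<ge> 0" and t0: "t \<ge> 0" unfolding s_def t_def by (auto intro!: sum_nonneg)
    have ptw: "\<bar>g (y x w) - g (y z w)\<bar> \<le> K * (1 + s + 2 * E w) * t" for w
    proof -
      have "\<bar>g (y x w) - g (y z w)\<bar> \<le> K * (1 + (\<Sum>i=1..L. norm (y x w i) powr iota + norm (y z w i) powr iota))
           * (\<Sum>i=1..L. norm (y x w i - y z w i) powr kappa)" using hg unfolding hoelder_growth_def by blast
      also have "\<dots> \<le> K * (1 + (s + 2 * E w)) * t"
      proof (intro mult_mono mult_left_mono add_left_mono)
        show "(\<Sum>i=1..L. norm (y x w i) powr iota + norm (y z w i) powr iota) \<le> s + 2 * E w"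
          using ycomp[of x w] ycomp[of z w] by (simp add: s_def sum.distrib)
        show "(\<Sum>i=1..L. norm (y x w i - y z w i) powr kappa) \<le> t"
          unfolding t_def by (intro sum_mono) (auto simp: y_def)
      qed (use K s0 E0[of w] in \<open>auto intro!: sum_nonneg add_nonneg_nonneg\<close>)
      finally show ?thesis by (simp add: add.assoc)
    qed
    have "\<bar>expectation (\<lambda>w. g (y x w)) - expectation (\<lambda>w. g (y z w))\<bar> = \<bar>expectation (\<lambda>w. g (y x w) - g (y z w))\<bar>"
      using intg by simp
    also have "\<dots> \<le> expectation (\<lambda>w. \<bar>g (y x w) - g (y z w)\<bar>)" by (rule integral_abs_bound)
    also have "\<dots> \<le> expectation (\<lambda>w. K * (1 + s + 2 * E w) * t)"
      using intg intE ptw by (intro integral_mono) auto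
    also have "\<dots> = K * (1 + s + 2 * expectation E) * t" using intE by (simp add: prob_space)
    also have "\<dots> \<le> K * ((1 + 2 * real L * \<Gamma>) * (1 + s)) * t"
    proof (intro mult_right_mono mult_left_mono)
      have "1 + s + 2 * expectation E \<le> 1 + s + 2 * (real L * \<Gamma>)" using EE by simp
      also have "\<dots> \<le> (1 + 2 * real L * \<Gamma>) * (1 + s)" using \<Gamma>0 s0 by (simp add: algebra_simps)
      finally show "1 + s + 2 * expectation E \<le> (1 + 2 * real L * \<Gamma>) * (1 + s)" .
    qed (use K t0 in auto)
    finally show "\<bar>expectation (\<lambda>w. g (y x w)) - expectation (\<lambda>w. g (y z w))\<bar>
       \<le> K * (1 + 2 * real L * \<Gamma>) * (1 + (\<Sum>i=1..L. norm (x i) powr iota + norm (z i) powr iota)) * (\<Sum>i=1..L. norm (x i - z i) powr kappa)"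
      by (simp add: s_def t_def mult.assoc)
  next
    fix x :: "nat \<Rightarrow> real^'d"
    define s where "s = (\<Sum>i=1..L. norm (x i) powr iota)"
    have s0: "s \<ge> 0" unfolding s_def by (auto intro!: sum_nonneg)
    have "\<bar>expectation (\<lambda>w. g (y x w))\<bar> \<le> expectation (\<lambda>w. \<bar>g (y x w)\<bar>)" by (rule integral_abs_bound)
    also have "\<dots> \<le> expectation (\<lambda>w. K * (1 + s + E w))"
      using intg intE growth[of x] unfolding s_def by (intro integral_mono) auto
    also have "\<dots> = K * (1 + s + expectation E)" using intE by (simp add: prob_space)
    also have "\<dots> \<le> K * ((1 + 2 * real L * \<Gamma>) * (1 + s))"
    proof (intro mult_left_mono)
      have "real L * \<Gamma> \<ge> 0" using \<Gamma>0 by simp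
      then have "1 + s + expectation E \<le> 1 + s + 2 * (real L * \<Gamma>)" using EE by linarith
      also have "\<dots> \<le> (1 + 2 * real L * \<Gamma>) * (1 + s)" using \<Gamma>0 s0 by (simp add: algebra_simps)
      finally show "1 + s + expectation E \<le> (1 + 2 * real L * \<Gamma>) * (1 + s)" .
    qed (use K in auto)
    finally show "\<bar>expectation (\<lambda>w. g (y x w))\<bar> \<le> K * (1 + 2 * real L * \<Gamma>) * (1 + (\<Sum>i=1..L. norm (x i) powr iota))"
      by (simp add: s_def mult.assoc)
  qed
qed

context mixing_process begin

text \<open>One scale of the chaining argument: the supremum over the cells \<open>v\<close> of the centred
  conditional expectations is replaced by a weighted \<open>p\<close>-norm over the cells.\<close>
lemma cell_decomposition_bound:
  fixes z :: "'a \<Rightarrow> 'v" and h :: "'v \<Rightarrow> 'a \<Rightarrow> real" and lam wt :: "'v \<Rightarrow> real"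
  assumes r: "r \<ge> 1" and U: "T + r \<le> U" and V: "finite V"
    and z: "\<And>w. z w \<in> V" "\<And>v. v \<in> V \<Longrightarrow> {w \<in> space M. z w = v} \<in> sets (past T)"
    and W: "W \<in> borel_measurable (past T)" "integrable M W"
    and h: "\<And>v. v \<in> V \<Longrightarrow> h v \<in> borel_measurable (future U)"
    and hint: "\<And>v. v \<in> V \<Longrightarrow> integrable M (\<lambda>w. \<bar>h v w\<bar> powr qe)"
    and hle: "\<And>v. v \<in> V \<Longrightarrow> expectation (\<lambda>w. \<bar>h v w\<bar> powr qe) \<le> lam v powr qe"
    and Wh: "\<And>v. v \<in> V \<Longrightarrow> integrable M (\<lambda>w. W w * h v w)"
    and pos: "\<And>v. lam v > 0" "\<And>v. wt v > 0" "Lam > 0"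
    and Lam: "(\<Sum>v\<in>V. (wt v * lam v) powr p) \<le> Lam powr p"
    and B: "\<And>w. B w \<ge> 1" "integrable M (\<lambda>w. B w powr m)" "expectation (\<lambda>w. B w powr m) \<le> \<Gamma>"
    and c: "c \<ge> 0" and e: "e \<ge> 0" "e / m + 1 / p \<le> 1"
    and Wle: "\<And>w. \<bar>W w\<bar> \<le> c * (wt (z w) * B w powr e)"
  shows "\<bar>expectation (\<lambda>w. W w * (h (z w) w - expectation (h (z w))))\<bar> \<le> c * Lam * rho r * (2 + \<Gamma>)"
proof -
  interpret sub: sigma_finite_subalgebra M "past T" by (rule sigma_finite_subalgebraI[OF subalgebras(1)])
  define D where "D v w = real_cond_exp M (past T) (h v) w - expectation (h v)" for v w
  have WM[measurable]: "W \<in> borel_measurable M" using measurable_from_subalg[OF subalgebras(1) W(1)] .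
  have hM[measurable]: "v \<in> V \<Longrightarrow> h v \<in> borel_measurable M" for v using measurable_from_subalg[OF subalgebras(2) h] .
  have DM[measurable]: "D v \<in> borel_measurable M" for v unfolding D_def by measurable
  note hb = cond_exp_past_bound[OF r U h pos(1) hint hle]
  define I where "I v w = (indicator {w \<in> space M. z w = v} w :: real)" for v w
  have Ipast: "v \<in> V \<Longrightarrow> I v \<in> borel_measurable (past T)" for v
    unfolding I_def using z(2) by (intro borel_measurable_indicator)
  have IM[measurable]: "v \<in> V \<Longrightarrow> I v \<in> borel_measurable M" for v
    using measurable_from_subalg[OF subalgebras(1) Ipast] .
  have Iint: "integrable M (\<lambda>w. I v w * f w)" if "v \<in> V" "integrable M f" for v and f :: "'a \<Rightarrow> real"
  proof (rule Bochner_Integration.integrable_bound[OF that(2)])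
    show "(\<lambda>w. I v w * f w) \<in> borel_measurable M"
      by (intro borel_measurable_times IM that borel_measurable_integrable)
    show "AE w in M. norm (I v w * f w) \<le> norm (f w)"
      by (auto simp: I_def split: split_indicator)
  qed
  have decomp: "f (z w) = (\<Sum>v\<in>V. I v w * f v)" if "w \<in> space M" for w and f :: "'v \<Rightarrow> real"
  proof -
    have "(\<Sum>v\<in>V. I v w * f v) = (\<Sum>v\<in>V. if v = z w then f v else 0)"
      using that by (intro sum.cong) (auto simp: I_def)
    then show ?thesis using z(1)[of w] V by simp
  qed
  have IW: "v \<in> V \<Longrightarrow> (\<lambda>w. I v w * W w) \<in> borel_measurable (past T)" for v
    using Ipast W(1) by (intro borel_measurable_times)
  have IWh: "integrable M (\<lambda>w. (I v w * W w) * h v w)" if "v \<in> V" for v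
    using Iint[OF that Wh[OF that]] by (simp add: mult.assoc)
  \<comment> \<open>\<open>I v * W\<close> is measurable with respect to the past, so on each cell
    \<open>h v\<close> may be exchanged for its conditional expectation.\<close>
  have cellint: "integrable M (\<lambda>w. I v w * (W w * D v w))" and
    cell: "expectation (\<lambda>w. I v w * (W w * (h v w - expectation (h v)))) = expectation (\<lambda>w. I v w * (W w * D v w))"
    if v: "v \<in> V" for v
  proof -
    have 1: "integrable M (\<lambda>w. (I v w * W w) * real_cond_exp M (past T) (h v) w)"
      "expectation (\<lambda>w. (I v w * W w) * real_cond_exp M (past T) (h v) w) = expectation (\<lambda>w. (I v w * W w) * h v w)"
      using sub.real_cond_exp_intg[OF IWh[OF v] IW[OF v] hM[OF v]] by auto
    have 2: "integrable M (\<lambda>w. (I v w * W w) * expectation (h v))" using Iint[OF v W(2)] by simp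
    have eqD: "I v w * (W w * D v w) = (I v w * W w) * real_cond_exp M (past T) (h v) w - (I v w * W w) * expectation (h v)" for w
      by (simp add: D_def algebra_simps)
    have eqh: "I v w * (W w * (h v w - expectation (h v))) = (I v w * W w) * h v w - (I v w * W w) * expectation (h v)" for w
      by (simp add: algebra_simps)
    show "integrable M (\<lambda>w. I v w * (W w * D v w))" unfolding eqD using 1 2 by simp
    show "expectation (\<lambda>w. I v w * (W w * (h v w - expectation (h v)))) = expectation (\<lambda>w. I v w * (W w * D v w))"
      unfolding eqD eqh using 1 2 IWh[OF v] by simp
  qed
  have cellint': "integrable M (\<lambda>w. I v w * (W w * (h v w - expectation (h v))))" if v: "v \<in> V" for v
  proof -
    have "integrable M (\<lambda>w. (I v w * W w) * h v w - (I v w * W w) * expectation (h v))"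
      using IWh[OF v] Iint[OF v W(2)] by simp
    then show ?thesis by (simp add: algebra_simps)
  qed
  have "expectation (\<lambda>w. W w * (h (z w) w - expectation (h (z w))))
      = expectation (\<lambda>w. \<Sum>v\<in>V. I v w * (W w * (h v w - expectation (h v))))"
    by (intro Bochner_Integration.integral_cong refl decomp)
  also have "\<dots> = (\<Sum>v\<in>V. expectation (\<lambda>w. I v w * (W w * D v w)))"
    using cellint' cell by simp
  also have "\<dots> = expectation (\<lambda>w. \<Sum>v\<in>V. I v w * (W w * D v w))"
    using cellint by simp
  finally have eq: "expectation (\<lambda>w. W w * (h (z w) w - expectation (h (z w)))) = expectation (\<lambda>w. \<Sum>v\<in>V. I v w * (W w * D v w))" .
  \<comment> \<open>The p-th power of a weighted p-norm over all cells, normalised to have mean at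
    most one. It dominates the term of the cell actually visited and enters
    \<open>mixed_moment\<close> with exponent \<open>1 / p\<close>.\<close>
  define V' where "V' w = (\<Sum>v\<in>V. (wt v * \<bar>D v w\<bar>) powr p) / (rho r * Lam) powr p" for w
  have rL: "rho r * Lam > 0" using pos rho_pos by simp
  have V'int: "integrable M V'"
    unfolding V'_def using hb(2) pos(2) by (auto simp: powr_mult less_imp_le D_def)
  have V'le: "expectation V' \<le> 1"
  proof -
    have "expectation V' = (\<Sum>v\<in>V. wt v powr p * expectation (\<lambda>w. \<bar>D v w\<bar> powr p)) / (rho r * Lam) powr p"
      unfolding V'_def using hb(2) pos(2) by (simp add: powr_mult less_imp_le D_def)
    also have "\<dots> \<le> (\<Sum>v\<in>V. wt v powr p * (rho r * lam v) powr p) / (rho r * Lam) powr p"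
      using hb(3) unfolding D_def by (intro divide_right_mono sum_mono mult_left_mono) auto
    also have "(\<Sum>v\<in>V. wt v powr p * (rho r * lam v) powr p) = rho r powr p * (\<Sum>v\<in>V. (wt v * lam v) powr p)"
      unfolding sum_distrib_left using pos rho_pos[of r] by (intro sum.cong) (auto simp: powr_mult less_imp_le)
    also have "rho r powr p * (\<Sum>v\<in>V. (wt v * lam v) powr p) / (rho r * Lam) powr p \<le> rho r powr p * Lam powr p / (rho r * Lam) powr p"
      using Lam by (intro divide_right_mono mult_left_mono) auto
    also have "\<dots> = 1" using rho_pos[of r] pos(3) by (simp add: powr_mult less_imp_le)
    finally show ?thesis .
  qed
  have "\<bar>\<Sum>v\<in>V. I v w * (W w * D v w)\<bar> \<le> (c * Lam * rho r) * (B w powr e * V' w powr (1 / p))" for w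
  proof (cases "w \<in> space M")
    case False
    then have "(\<Sum>v\<in>V. I v w * (W w * D v w)) = 0" by (simp add: I_def)
    then show ?thesis using c pos(3) rho_pos[of r] by simp
  next
    case True
    let ?d = "wt (z w) * \<bar>D (z w) w\<bar>"
    have "?d powr p \<le> (\<Sum>v\<in>V. (wt v * \<bar>D v w\<bar>) powr p)"
      by (rule member_le_sum[OF z(1)]) (use V in auto)
    then have "?d powr p / (rho r * Lam) powr p \<le> V' w" unfolding V'_def by (intro divide_right_mono) auto
    then have "(?d powr p / (rho r * Lam) powr p) powr (1 / p) \<le> V' w powr (1 / p)"
      using pq by (intro powr_mono2) auto
    moreover have "(?d powr p / (rho r * Lam) powr p) powr (1 / p) = ?d / (rho r * Lam)"
      using pq rL pos(2)[of "z w"] by (simp add: powr_divide[symmetric] powr_powr)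
    ultimately have d: "?d \<le> rho r * Lam * V' w powr (1 / p)" using rL by (simp add: field_simps)
    have "\<bar>\<Sum>v\<in>V. I v w * (W w * D v w)\<bar> = \<bar>W w\<bar> * \<bar>D (z w) w\<bar>"
      using decomp[OF True, of "\<lambda>v. W w * D v w"] by (metis abs_mult)
    also have "\<dots> \<le> c * (wt (z w) * B w powr e) * \<bar>D (z w) w\<bar>" by (intro mult_right_mono Wle) auto
    also have "\<dots> = (c * B w powr e) * ?d" by simp
    also have "\<dots> \<le> (c * B w powr e) * (rho r * Lam * V' w powr (1 / p))" using c by (intro mult_left_mono d) auto
    finally show ?thesis by (simp add: algebra_simps)
  qed
  from mixed_moment(3)[OF _ B _ V'int V'le e(1) _ m_pos e(2) _ this] show ?thesis
    unfolding eq using pq c pos(3) rho_pos[of r] by (auto simp: V'_def sum_nonneg)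
qed

end

section \<open>Chaining over dyadic grids\<close>

lemma sum_PiE_prod_const:
  fixes f :: "int \<Rightarrow> real"
  assumes "finite I" "finite A"
  shows "(\<Sum>c\<in>Pi\<^sub>E I (\<lambda>_. A). \<Prod>k\<in>I. f (c k)) = (\<Sum>a\<in>A. f a) ^ card I"
proof -
  have "infsum (\<lambda>c. \<Prod>k\<in>I. f (c k)) (Pi\<^sub>E I (\<lambda>_. A)) = (\<Prod>k\<in>I. infsum f A)"
    by (rule infsum_prod_PiE_abs) (use assms in auto)
  then show ?thesis using assms by (simp add: finite_PiE)
qed

text \<open>Integers are grouped into runs of length \<open>2 ^ n\<close>, on which the summand is
  at most \<open>(1 + u) powr (- \<theta>)\<close>; the two signs double the constant. The
  truncation level \<open>R\<close> does not enter the bound, so it can be sent to infinity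
  later.\<close>

lemma dyadic_grid_sum:
  assumes th: "\<theta> > 1"
  shows "\<exists>\<zeta>\<ge>1. \<forall>n R::nat. (\<Sum>c\<in>{- int (R * 2 ^ n)..int (R * 2 ^ n)}. (1 + \<bar>real_of_int c\<bar> / 2 ^ n) powr (- \<theta>)) \<le> \<zeta> * 2 ^ n"
proof -
  define f where "f u = (1 + real u) powr (- \<theta>)" for u :: nat
  have "summable (\<lambda>u. real (Suc u) powr (- \<theta>))"
    using th by (subst summable_Suc_iff) (simp add: summable_real_powr_iff)
  then have sf: "summable f" by (simp add: f_def[abs_def])
  define z0 where "z0 = suminf f"
  have z0: "1 \<le> z0" using sum_le_suminf[OF sf, of "{0}"] unfolding z0_def by (simp add: f_def)
  have main: "(\<Sum>c\<in>{- int (R * 2 ^ n)..int (R * 2 ^ n)}. (1 + \<bar>real_of_int c\<bar> / 2 ^ n) powr (- \<theta>)) \<le> (2 * z0) * 2 ^ n"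
    for n R :: nat
  proof -
    define F where "F c = (1 + \<bar>real_of_int c\<bar> / 2 ^ n) powr (- \<theta>)" for c
    define G where "G k = (1 + real k / 2 ^ n) powr (- \<theta>)" for k :: nat
    define S where "S = {..<(R + 1) * 2 ^ n}"
    have "{- int (R * 2 ^ n)..int (R * 2 ^ n)} \<subseteq> int ` S \<union> (\<lambda>k. - int k) ` S"
    proof
      fix c assume c: "c \<in> {- int (R * 2 ^ n)..int (R * 2 ^ n)}"
      have "\<bar>c\<bar> \<le> int (R * 2 ^ n)" using c by auto
      also have "\<dots> < int ((R + 1) * 2 ^ n)" by simp
      finally have "nat \<bar>c\<bar> \<in> S" unfolding S_def by (simp add: nat_less_iff)
      then show "c \<in> int ` S \<union> (\<lambda>k. - int k) ` S"
        by (cases "c \<ge> 0") (auto simp: image_iff intro!: bexI[of _ "nat \<bar>c\<bar>"])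
    qed
    then have "(\<Sum>c\<in>{- int (R * 2 ^ n)..int (R * 2 ^ n)}. F c) \<le> sum F (int ` S \<union> (\<lambda>k. - int k) ` S)"
      by (intro sum_mono2) (auto simp: S_def F_def)
    also have "\<dots> \<le> sum F (int ` S) + sum F ((\<lambda>k. - int k) ` S)"
      by (subst sum_Un) (auto simp: S_def F_def intro!: sum_nonneg)
    also have "\<dots> = 2 * (\<Sum>k\<in>S. G k)"
      by (subst (1 2) sum.reindex) (auto simp: inj_on_def F_def G_def)
    also have "(\<Sum>k\<in>S. G k) = (\<Sum>u<R + 1. \<Sum>k\<in>{u * 2 ^ n..<u * 2 ^ n + 2 ^ n}. G k)"
      unfolding S_def by (rule sum.nat_group[symmetric])
    also have "\<dots> \<le> (\<Sum>u<R + 1. \<Sum>k\<in>{u * 2 ^ n..<u * 2 ^ n + 2 ^ n}. f u)"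
    proof (intro sum_mono)
      fix u k :: nat assume k: "k \<in> {u * 2 ^ n..<u * 2 ^ n + 2 ^ n}"
      have "real u * 2 ^ n \<le> real k" using k by (metis atLeastLessThan_iff of_nat_le_iff of_nat_mult of_nat_numeral of_nat_power)
      then have "real u \<le> real k / 2 ^ n" by (simp add: field_simps)
      then show "G k \<le> f u" unfolding G_def f_def using th by (intro powr_mono2') auto
    qed
    also have "\<dots> = 2 ^ n * sum f {..<R + 1}" unfolding sum_distrib_left by simp
    also have "\<dots> \<le> 2 ^ n * z0" unfolding z0_def
      by (intro mult_left_mono sum_le_suminf sf) (auto simp: f_def)
    finally show ?thesis unfolding F_def by (simp add: algebra_simps)
  qed
  show ?thesis
    by (rule exI[of _ "2 * z0"]) (use z0 main in auto)
qed

text \<open>The leading factors come from \<open>hh_bound\<close>, the last one from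
  \<open>EE_moment\<close>. The constant lives outside the locale so that \<open>rate_bound\<close>
  can name it before the locale is interpreted.\<close>

definition chain_const :: "nat \<Rightarrow> real \<Rightarrow> real \<Rightarrow> nat \<Rightarrow> real \<Rightarrow> real \<Rightarrow> real" where
  "chain_const L K \<iota> d \<Gamma>q c1 = (K + 1) * 4 * (1 + real L + real L * c1 powr \<iota>) * (1 + real L * real d) * ((1 + real L) * (1 + real L * \<Gamma>q))"

text \<open>Coordinates in \<open>P\<close> are filled by the past vector \<open>\<xi>\<close>,
  those in \<open>Q\<close> by the future vector \<open>\<eta>\<close>; \<open>W\<close> is a past
  factor and \<open>B\<close> a common envelope. \<open>D0\<close> bounds the number of scalar past
  coordinates, and \<open>\<theta> * D0 <= p\<close> allows a decay of order \<open>p\<close> in the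
  norm to be shared among them, each receiving a summable exponent
  \<open>\<theta> > 1\<close>.\<close>

locale chain = mixing_process M Fam X iota kappa p qe delta m
  for M :: "'a measure" and Fam and X :: "nat \<Rightarrow> 'a \<Rightarrow> real^'d" and iota kappa p qe delta m :: real +
  fixes L :: nat and Kg cW \<Gamma> \<Gamma>q \<zeta> \<theta> :: real and D0 :: nat
    and g :: "(nat \<Rightarrow> real^'d) \<Rightarrow> real" and W :: "'a \<Rightarrow> real" and P Q :: "nat set"
    and \<xi> :: "'a \<Rightarrow> nat \<Rightarrow> real^'d" and \<eta> :: "nat \<Rightarrow> 'a \<Rightarrow> real^'d" and B :: "'a \<Rightarrow> real"
    and T U r :: nat
  assumes hg: "hoelder_growth L Kg iota kappa g"
    and th: "\<theta> > 1" "\<theta> * real D0 \<le> p" "real D0 / p < kappa"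
    and zeta: "\<zeta> \<ge> 1" "\<And>n R::nat. (\<Sum>c\<in>{- int (R * 2 ^ n)..int (R * 2 ^ n)}. (1 + \<bar>real_of_int c\<bar> / 2 ^ n) powr (- \<theta>)) \<le> \<zeta> * 2 ^ n"
    and P: "P \<subseteq> {1..L}" "card P * CARD('d) \<le> D0" and PQ: "P \<inter> Q = {}"
    and r: "r \<ge> 1" and TU: "T + r \<le> U"
    and \<xi>: "\<And>j. (\<lambda>w. \<xi> w j) \<in> borel_measurable (past T)" "\<And>j w. j \<notin> P \<Longrightarrow> \<xi> w j = 0"
    and \<eta>: "\<And>j. \<eta> j \<in> borel_measurable (future U)"
    and \<eta>q: "\<And>j. integrable M (\<lambda>w. norm (\<eta> j w) powr (qe * iota))"
        "\<And>j. expectation (\<lambda>w. norm (\<eta> j w) powr (qe * iota)) \<le> \<Gamma>q"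
    and BM[measurable]: "B \<in> borel_measurable M" and B1: "\<And>w. B w \<ge> 1"
    and Bint: "integrable M (\<lambda>w. B w powr m)" "expectation (\<lambda>w. B w powr m) \<le> \<Gamma>"
    and Bdom: "\<And>w j. norm (\<xi> w j) \<le> B w" "\<And>w j. norm (\<eta> j w) \<le> B w"
    and W: "W \<in> borel_measurable (past T)" "\<And>w. \<bar>W w\<bar> \<le> cW * B w powr iota"
begin

definition y :: "(nat \<Rightarrow> real^'d) \<Rightarrow> 'a \<Rightarrow> nat \<Rightarrow> real^'d" where
  "y v w = (\<lambda>j. if j \<in> Q then \<eta> j w else v j)"
definition ghat :: "(nat \<Rightarrow> real^'d) \<Rightarrow> real" where
  "ghat v = expectation (\<lambda>w. g (y v w))"
definition Ix :: "(nat \<times> 'd) set" where "Ix = P \<times> UNIV"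
text \<open>The index of the dyadic cell of side \<open>1 / 2 ^ n\<close> that contains the past
  vector clamped at \<open>R\<close>; clamping leaves finitely many cells. The lower corner of the
  cell is \<open>pt\<close>.\<close>

definition cell :: "nat \<Rightarrow> nat \<Rightarrow> 'a \<Rightarrow> nat \<times> 'd \<Rightarrow> int" where
  "cell R n w = (\<lambda>k\<in>Ix. \<lfloor>2 ^ n * max (- real R) (min (real R) (\<xi> w (fst k) $ snd k))\<rfloor>)"
definition pt :: "nat \<Rightarrow> (nat \<times> 'd \<Rightarrow> int) \<Rightarrow> nat \<Rightarrow> real^'d" where
  "pt n c j = (\<chi> i. if j \<in> P then real_of_int (c (j, i)) / 2 ^ n else 0)"
definition coarse :: "nat \<Rightarrow> (nat \<Rightarrow> real^'d) \<Rightarrow> nat \<Rightarrow> real^'d" where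
  "coarse n v j = (\<chi> i. real_of_int \<lfloor>2 ^ n * v j $ i\<rfloor> / 2 ^ n)"
definition nv :: "(nat \<Rightarrow> real^'d) \<Rightarrow> real" where "nv v = 1 + (\<Sum>j\<in>P. norm (v j))"
definition V :: "nat \<Rightarrow> nat \<Rightarrow> (nat \<times> 'd \<Rightarrow> int) set" where
  "V R n = Pi\<^sub>E Ix (\<lambda>_. {- int (R * 2 ^ n)..int (R * 2 ^ n)})"
definition c1 :: real where "c1 = 1 + real L * (1 + CARD('d))"
definition C2 :: real where "C2 = chain_const L Kg iota CARD('d) \<Gamma>q c1"
definition EE :: "'a \<Rightarrow> real" where "EE w = (\<Sum>i=1..L. norm (\<eta> i w) powr iota)"

lemma finite_P: "finite P" using P finite_subset by blast
lemma finite_Ix: "finite Ix" by (simp add: Ix_def finite_P)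
lemma finite_V: "finite (V R n)" by (simp add: V_def finite_Ix finite_PiE)
lemma Kg: "Kg \<ge> 0" by (rule hoelder_growth_nonneg[OF hg])
lemma c1: "c1 \<ge> 1" by (simp add: c1_def)
lemma nv1: "nv v \<ge> 1" by (simp add: nv_def sum_nonneg)
lemma cardP: "card P \<le> L" using card_mono[OF _ P(1)] by simp
lemma EE0: "EE w \<ge> 0" by (simp add: EE_def sum_nonneg)
lemma \<Gamma>q0: "\<Gamma>q \<ge> 0" using order_trans[OF _ \<eta>q(2)[of 0]] by (simp add: integral_nonneg)
lemma cW0: "cW \<ge> 0"
proof -
  obtain w where "w \<in> space M" using not_empty by blast
  have "0 \<le> cW * B w powr iota" using W(2)[of w] by linarith
  moreover have "B w powr iota > 0" using B1[of w] by (simp add: powr_gt_zero)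
  ultimately show ?thesis by (simp add: zero_le_mult_iff)
qed

lemma \<eta>M [measurable]: "\<eta> j \<in> borel_measurable M"
  using measurable_from_subalg[OF subalgebras(2) \<eta>] .
lemma \<xi>M [measurable]: "(\<lambda>w. \<xi> w j) \<in> borel_measurable M"
  using measurable_from_subalg[OF subalgebras(1) \<xi>(1)] .
lemma WM [measurable]: "W \<in> borel_measurable M"
  using measurable_from_subalg[OF subalgebras(1) W(1)] .

lemma B_integrable: "0 \<le> s \<Longrightarrow> s \<le> m \<Longrightarrow> integrable M (\<lambda>w. B w powr s)"
proof (rule Bochner_Integration.integrable_bound[OF Bint(1)])
  assume "0 \<le> s" "s \<le> m"
  then show "AE w in M. norm (B w powr s) \<le> norm (B w powr m)" using B1 by (auto intro!: powr_mono)
qed auto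

lemma W_integrable: "integrable M W"
proof (rule Bochner_Integration.integrable_bound[where f="\<lambda>w. cW * B w powr iota"])
  show "integrable M (\<lambda>w. cW * B w powr iota)" using B_integrable[of iota] m_ge iota_pos by simp
  show "AE w in M. norm (W w) \<le> norm (cW * B w powr iota)" using W(2) cW0 by (auto simp: abs_mult)
qed auto

lemma \<eta>_iota: "integrable M (\<lambda>w. norm (\<eta> j w) powr iota)" "expectation (\<lambda>w. norm (\<eta> j w) powr iota) \<le> \<Gamma>"
proof -
  have le: "norm (\<eta> j w) powr iota \<le> B w powr m" for w
  proof -
    have "norm (\<eta> j w) powr iota \<le> B w powr iota" using iota_pos Bdom by (intro powr_mono2) auto
    also have "\<dots> \<le> B w powr m" using B1 m_ge iota_pos by (intro powr_mono) auto
    finally show ?thesis .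
  qed
  show i: "integrable M (\<lambda>w. norm (\<eta> j w) powr iota)"
    by (rule Bochner_Integration.integrable_bound[OF Bint(1)]) (use le in auto)
  show "expectation (\<lambda>w. norm (\<eta> j w) powr iota) \<le> \<Gamma>"
    using integral_mono[OF i Bint(1) le] Bint(2) by linarith
qed

lemma hg_ghat: "hoelder_growth L (Kg * (1 + 2 * real L * \<Gamma>)) iota kappa ghat"
  and g_integrable: "integrable M (\<lambda>w. g (y v w))"
  using hoelder_growth_integral[OF hg iota_pos kappa(1) \<eta>M \<eta>_iota] unfolding ghat_def[abs_def] y_def by auto

lemma y_measurable:
  assumes "\<And>j. \<eta> j \<in> borel_measurable N" "\<And>j. (\<lambda>w. v w j) \<in> borel_measurable N"
  shows "(\<lambda>w. y (v w) w j) \<in> borel_measurable N"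
  using assms by (cases "j \<in> Q") (auto simp: y_def)

lemma g_future: "(\<lambda>w. g (y v w)) \<in> borel_measurable (future U)"
  by (rule measurable_fun_composition[OF hoelder_growth_continuous[OF hg iota_pos kappa(1)] y_measurable])
     (auto simp: \<eta>)

lemma g_composed_measurable:
  assumes "\<And>j. (\<lambda>w. v w j) \<in> borel_measurable M"
  shows "(\<lambda>w. g (y (v w) w)) \<in> borel_measurable M" "(\<lambda>w. ghat (v w)) \<in> borel_measurable M"
proof -
  show "(\<lambda>w. g (y (v w) w)) \<in> borel_measurable M"
    by (rule measurable_fun_composition[OF hoelder_growth_continuous[OF hg iota_pos kappa(1)] y_measurable])
       (auto simp: assms)
  show "(\<lambda>w. ghat (v w)) \<in> borel_measurable M"
    by (rule measurable_fun_composition[OF hoelder_growth_continuous[OF hg_ghat iota_pos kappa(1)] assms])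
qed

lemma coarse_close: "norm (v j - coarse n v j) \<le> CARD('d) / 2 ^ n"
proof -
  have "\<bar>x - real_of_int \<lfloor>2 ^ n * x\<rfloor> / 2 ^ n\<bar> \<le> 1 / 2 ^ n" for x :: real
  proof -
    have "x - real_of_int \<lfloor>2 ^ n * x\<rfloor> / 2 ^ n = (2 ^ n * x - real_of_int \<lfloor>2 ^ n * x\<rfloor>) / 2 ^ n"
      by (simp add: diff_divide_distrib)
    moreover have "0 \<le> 2 ^ n * x - real_of_int \<lfloor>2 ^ n * x\<rfloor>" "2 ^ n * x - real_of_int \<lfloor>2 ^ n * x\<rfloor> \<le> 1"
      by linarith+
    ultimately show ?thesis by (simp add: divide_right_mono)
  qed
  then have "(\<Sum>i\<in>UNIV. \<bar>(v j - coarse n v j) $ i\<bar>) \<le> (\<Sum>i\<in>(UNIV::'d set). 1 / 2 ^ n)"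
    by (intro sum_mono) (simp add: coarse_def)
  then show ?thesis using norm_le_l1_cart[of "v j - coarse n v j"] by simp
qed

lemma coarse_norm: "norm (coarse n v j) \<le> norm (v j) + CARD('d)"
proof -
  have "CARD('d) / 2 ^ n \<le> real CARD('d)" by (simp add: field_simps)
  then show ?thesis using coarse_close[of v j n] norm_triangle_ineq3[of "v j" "coarse n v j"] by linarith
qed

text \<open>Nested floors: halving and rounding down again gives the floor at the coarser level. The
  parent of a cell is thus a function of the cell, and an increment of the chain needs one cell
  index only.\<close>

lemma coarse_pt: "coarse n (pt (Suc n) (cell R (Suc n) w)) = pt n (cell R n w)"
proof -
  have fl: "\<lfloor>2 ^ n * (real_of_int \<lfloor>2 ^ Suc n * x\<rfloor> / 2 ^ Suc n)\<rfloor> = \<lfloor>2 ^ n * x\<rfloor>" for x :: real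
  proof -
    have "2 ^ n * (real_of_int \<lfloor>2 ^ Suc n * x\<rfloor> / 2 ^ Suc n) = real_of_int \<lfloor>2 ^ Suc n * x\<rfloor> / real_of_int 2"
      by (simp add: field_simps)
    then have "\<lfloor>2 ^ n * (real_of_int \<lfloor>2 ^ Suc n * x\<rfloor> / 2 ^ Suc n)\<rfloor> = \<lfloor>2 ^ Suc n * x\<rfloor> div 2"
      by (simp only: floor_divide_of_int_eq)
    also have "\<dots> = \<lfloor>(2 ^ Suc n * x) / real_of_int 2\<rfloor>" by (simp only: floor_divide_real_eq_div)
    also have "(2 ^ Suc n * x) / real_of_int 2 = 2 ^ n * x" by simp
    finally show ?thesis .
  qed
  show ?thesis
    unfolding coarse_def pt_def cell_def by (intro ext) (auto simp: vec_eq_iff Ix_def fl simp del: power_Suc times_divide_eq_right)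
qed

lemma pt_cell: "pt n (cell R n w) j = coarse n (\<lambda>j. \<chi> i. max (- real R) (min (real R) (\<xi> w j $ i))) j"
  by (cases "j \<in> P") (auto simp: pt_def cell_def coarse_def vec_eq_iff Ix_def \<xi>(2))

lemma clamp_norm: "norm ((\<chi> i. max (- real R) (min (real R) (x $ i))) :: real^'d) \<le> norm x"
  by (rule norm_le_componentwise_cart) auto

lemma pt_cell_norm: "norm (pt n (cell R n w) j) \<le> (1 + real CARD('d)) * B w"
proof -
  have "norm (pt n (cell R n w) j) \<le> norm (\<xi> w j) + CARD('d)"
    unfolding pt_cell using coarse_norm clamp_norm by (rule order_trans[OF _ add_right_mono])
  also have "\<dots> \<le> B w + CARD('d) * B w"
    using Bdom(1)[of w j] B1[of w] by (intro add_mono) auto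
  finally show ?thesis by (simp add: algebra_simps)
qed

lemma nv_le:
  fixes b :: real
  assumes "\<And>j. j \<in> P \<Longrightarrow> norm (v j) \<le> (1 + real CARD('d)) * b" "b \<ge> 1"
  shows "nv v \<le> c1 * b"
proof -
  have "(\<Sum>j\<in>P. norm (v j)) \<le> real (card P) * ((1 + real CARD('d)) * b)"
    using sum_bounded_above[of P "\<lambda>j. norm (v j)"] assms(1) by simp
  also have "\<dots> \<le> real L * ((1 + real CARD('d)) * b)"
    using cardP assms(2) by (intro mult_right_mono) auto
  finally show ?thesis using assms(2) by (simp add: nv_def c1_def algebra_simps)
qed

lemma nv_pt_cell: "nv (pt n (cell R n w)) \<le> c1 * B w"
  by (rule nv_le[OF pt_cell_norm B1])

lemma nv_coarse: "nv (coarse n v) \<le> c1 * nv v"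
proof (rule nv_le[OF _ nv1])
  fix j assume "j \<in> P"
  then have "norm (v j) \<le> (\<Sum>j\<in>P. norm (v j))" using finite_P by (intro member_le_sum) auto
  then have le: "norm (v j) \<le> nv v" by (simp add: nv_def)
  have "norm (coarse n v j) \<le> nv v + CARD('d) * nv v"
  proof -
    have "real CARD('d) * 1 \<le> real CARD('d) * nv v" by (intro mult_left_mono nv1) auto
    then show ?thesis using coarse_norm[of n v j] le by linarith
  qed
  then show "norm (coarse n v j) \<le> (1 + real CARD('d)) * nv v" by (simp add: algebra_simps)
qed

lemma y_sum_le:
  assumes "\<And>j. j \<notin> P \<Longrightarrow> v j = 0"
  shows "(\<Sum>i=1..L. norm (y v w i) powr iota) \<le> real L * nv v powr iota + EE w"
proof -
  have "norm (y v w i) powr iota \<le> nv v powr iota + norm (\<eta> i w) powr iota" for i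
  proof (cases "i \<in> Q")
    case False
    have "norm (v i) \<le> nv v"
    proof (cases "i \<in> P")
      case True
      then have "norm (v i) \<le> (\<Sum>j\<in>P. norm (v j))" using finite_P by (intro member_le_sum) auto
      then show ?thesis by (simp add: nv_def)
    next
      case False
      then show ?thesis using assms nv1[of v] by simp
    qed
    then have "norm (v i) powr iota \<le> nv v powr iota" using iota_pos by (intro powr_mono2) auto
    then show ?thesis using False by (simp add: y_def add_increasing2)
  qed (simp add: y_def)
  then have "(\<Sum>i=1..L. norm (y v w i) powr iota) \<le> (\<Sum>i=1..L. nv v powr iota + norm (\<eta> i w) powr iota)"
    by (intro sum_mono)
  then show ?thesis by (simp add: sum.distrib EE_def)
qed

lemma pt_zero: "j \<notin> P \<Longrightarrow> pt n c j = 0"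
  by (simp add: pt_def vec_eq_iff)

lemma coarse_zero: "v j = 0 \<Longrightarrow> coarse n v j = 0"
  by (simp add: coarse_def vec_eq_iff)

text \<open>The increment of the chain at level \<open>n\<close> as a function of the cell index
  alone; level 0 carries the value itself.\<close>

definition hh :: "nat \<Rightarrow> (nat \<times> 'd \<Rightarrow> int) \<Rightarrow> 'a \<Rightarrow> real" where
  "hh n c w = (case n of 0 \<Rightarrow> g (y (pt 0 c) w)
     | Suc k \<Rightarrow> g (y (pt (Suc k) c) w) - g (y (coarse k (pt (Suc k) c)) w))"

lemma hh_bound:
  "\<bar>hh n c w\<bar> \<le> (Kg + 1) * 4 * (1 + real L + real L * c1 powr iota) * (1 + real L * CARD('d))
      * 2 powr (- kappa * n) * nv (pt n c) powr iota * (1 + EE w)"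
proof -
  define a where "a = nv (pt n c) powr iota"
  have a1: "a \<ge> 1" unfolding a_def using nv1 iota_pos by (simp add: ge_one_powr_ge_zero)
  define b where "b = 1 + real L + real L * c1 powr iota"
  have b1: "b \<ge> 1 + real L" "b \<ge> 1" by (auto simp: b_def)
  show ?thesis
  proof (cases n)
    case 0
    have "\<bar>hh n c w\<bar> \<le> Kg * (1 + (\<Sum>i=1..L. norm (y (pt 0 c) w i) powr iota))"
      using hg 0 unfolding hoelder_growth_def hh_def by auto
    also have "\<dots> \<le> Kg * (1 + (real L * a + EE w))"
      using y_sum_le[of "pt 0 c" w] pt_zero Kg 0 unfolding a_def by (intro mult_left_mono add_left_mono) auto
    also have "\<dots> \<le> (Kg + 1) * (b * a * (1 + EE w))"
    proof (intro mult_mono)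
      have "1 + (real L * a + EE w) \<le> a + (real L * a + EE w * a)"
        using a1 EE0[of w] by (intro add_mono) (auto simp: mult_le_cancel_left1)
      also have "\<dots> \<le> (1 + real L) * a * (1 + EE w)" using a1 EE0[of w] by (simp add: algebra_simps)
      also have "\<dots> \<le> b * a * (1 + EE w)" using b1 a1 EE0[of w] by (intro mult_right_mono) auto
      finally show "1 + (real L * a + EE w) \<le> b * a * (1 + EE w)" .
    qed (use Kg a1 EE0[of w] in auto)
    also have "\<dots> = (Kg + 1) * b * a * (1 + EE w) * 1" by simp
    also have "\<dots> \<le> (Kg + 1) * b * a * (1 + EE w) * (4 * (1 + real L * CARD('d)))"
      using Kg b1 a1 EE0[of w] by (intro mult_left_mono mult_nonneg_nonneg) (auto simp: mult_le_cancel_left1 add_increasing)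
    finally show ?thesis using 0 unfolding a_def b_def by (simp add: algebra_simps)
  next
    case (Suc k)
    let ?v = "pt (Suc k) c" and ?v' = "coarse k (pt (Suc k) c)"
    have z: "\<And>j. j \<notin> P \<Longrightarrow> ?v j = 0" "\<And>j. j \<notin> P \<Longrightarrow> ?v' j = 0" using pt_zero coarse_zero by auto
    have a': "nv ?v' powr iota \<le> c1 powr iota * a"
    proof -
      have "nv ?v' powr iota \<le> (c1 * nv ?v) powr iota"
        using nv_coarse[of k ?v] nv1[of ?v'] iota_pos by (intro powr_mono2) auto
      then show ?thesis using c1 nv1[of ?v] Suc by (simp add: a_def powr_mult)
    qed
    have s: "1 + (\<Sum>i=1..L. norm (y ?v w i) powr iota + norm (y ?v' w i) powr iota) \<le> 2 * (b * a * (1 + EE w))"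
    proof -
      have "1 + (\<Sum>i=1..L. norm (y ?v w i) powr iota + norm (y ?v' w i) powr iota)
         \<le> a + ((real L * a + EE w) + (real L * (c1 powr iota * a) + EE w))"
      proof -
        have "(\<Sum>i=1..L. norm (y ?v w i) powr iota) \<le> real L * a + EE w"
          using y_sum_le[of ?v w] z(1) Suc by (simp add: a_def)
        moreover have "(\<Sum>i=1..L. norm (y ?v' w i) powr iota) \<le> real L * nv ?v' powr iota + EE w"
          using y_sum_le[of ?v' w] z(2) by simp
        moreover have "real L * nv ?v' powr iota \<le> real L * (c1 powr iota * a)"
          by (intro mult_left_mono a') auto
        ultimately show ?thesis unfolding sum.distrib using a1 by linarith
      qed
      also have "\<dots> = b * a + 2 * EE w" by (simp add: b_def algebra_simps)
      also have "\<dots> \<le> 2 * (b * a) + 2 * (b * a * EE w)"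
      proof -
        have "1 \<le> b * a" using a1 b1 by (metis mult_mono mult_1 zero_le_one order_trans)
        then have "EE w \<le> b * a * EE w" using EE0[of w] by (simp add: mult_le_cancel_right1)
        then show ?thesis using \<open>1 \<le> b * a\<close> by linarith
      qed
      finally show ?thesis by (simp add: algebra_simps)
    qed
    have t: "(\<Sum>i=1..L. norm (y ?v w i - y ?v' w i) powr kappa) \<le> real L * (CARD('d) * (2 * 2 powr (- kappa * n)))"
    proof -
      have "norm (y ?v w i - y ?v' w i) powr kappa \<le> CARD('d) * (2 * 2 powr (- kappa * n))" for i
      proof -
        have "norm (y ?v w i - y ?v' w i) \<le> CARD('d) / 2 ^ k"
          using coarse_close[of ?v i k] by (simp add: y_def)
        then have "norm (y ?v w i - y ?v' w i) powr kappa \<le> (CARD('d) / 2 ^ k) powr kappa"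
          using kappa by (intro powr_mono2) auto
        also have "\<dots> = real CARD('d) powr kappa * (2 powr (- real k)) powr kappa"
          by (simp add: powr_divide powr_minus_divide powr_realpow powr_mult[symmetric] divide_inverse)
             (simp add: powr_divide inverse_eq_divide powr_mult)?
        also have "\<dots> \<le> real CARD('d) * (2 * 2 powr (- kappa * n))"
        proof (rule mult_mono)
          have "1 \<le> real CARD('d)" by (simp add: Suc_le_eq)
          then show "real CARD('d) powr kappa \<le> real CARD('d)"
            using powr_mono[of kappa 1 "real CARD('d)"] kappa by simp
          have "(2 powr (- real k)) powr kappa = 2 powr kappa * 2 powr (- kappa * n)"
            using Suc by (simp add: powr_powr powr_add[symmetric] algebra_simps)
          also have "\<dots> \<le> 2 * 2 powr (- kappa * n)"
            using powr_mono[of kappa 1 "2::real"] kappa by (intro mult_right_mono) auto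
          finally show "(2 powr (- real k)) powr kappa \<le> 2 * 2 powr (- kappa * n)" .
        qed auto
        finally show ?thesis .
      qed
      from sum_mono[of "{1..L}", OF this] show ?thesis by simp
    qed
    have "\<bar>hh n c w\<bar> \<le> Kg * (1 + (\<Sum>i=1..L. norm (y ?v w i) powr iota + norm (y ?v' w i) powr iota))
        * (\<Sum>i=1..L. norm (y ?v w i - y ?v' w i) powr kappa)"
      using hg Suc unfolding hoelder_growth_def hh_def by auto
    also have "\<dots> \<le> (Kg + 1) * (2 * (b * a * (1 + EE w))) * (real L * (CARD('d) * (2 * 2 powr (- kappa * n))))"
      using s t Kg a1 b1 EE0[of w] by (intro mult_mono) (auto intro!: mult_nonneg_nonneg sum_nonneg add_nonneg_nonneg)
    also have "\<dots> = (Kg + 1) * 4 * b * (real L * CARD('d)) * 2 powr (- kappa * n) * a * (1 + EE w)" by simp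
    also have "\<dots> \<le> (Kg + 1) * 4 * b * (1 + real L * CARD('d)) * 2 powr (- kappa * n) * a * (1 + EE w)"
      using Kg a1 b1 EE0[of w] by (intro mult_right_mono mult_left_mono) auto
    finally show ?thesis unfolding a_def b_def .
  qed
qed

lemma EE_moment:
  "integrable M (\<lambda>w. (1 + EE w) powr qe)"
  "expectation (\<lambda>w. (1 + EE w) powr qe) \<le> ((1 + real L) * (1 + real L * \<Gamma>q)) powr qe"
proof -
  have le: "(1 + EE w) powr qe \<le> (1 + real L) powr qe * (1 + (\<Sum>i=1..L. norm (\<eta> i w) powr (qe * iota)))" for w
    using powr_one_plus_sum_le[of "{1..L}" "\<lambda>i. norm (\<eta> i w) powr iota" qe] pq
    by (simp add: EE_def powr_powr mult.commute)
  have [measurable]: "EE \<in> borel_measurable M" unfolding EE_def by measurable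
  have int: "integrable M (\<lambda>w. (1 + real L) powr qe * (1 + (\<Sum>i=1..L. norm (\<eta> i w) powr (qe * iota))))"
    using \<eta>q by simp
  show i: "integrable M (\<lambda>w. (1 + EE w) powr qe)"
    by (rule Bochner_Integration.integrable_bound[OF int]) (use order_trans[OF le abs_ge_self] in auto)
  have "expectation (\<lambda>w. (1 + EE w) powr qe) \<le> expectation (\<lambda>w. (1 + real L) powr qe * (1 + (\<Sum>i=1..L. norm (\<eta> i w) powr (qe * iota))))"
    by (intro integral_mono i int le)
  also have "\<dots> = (1 + real L) powr qe * (1 + (\<Sum>i=1..L. expectation (\<lambda>w. norm (\<eta> i w) powr (qe * iota))))"
    using \<eta>q by (simp add: prob_space)
  also have "\<dots> \<le> (1 + real L) powr qe * (1 + (\<Sum>i=1..L. \<Gamma>q))"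
    using \<eta>q by (intro mult_left_mono add_left_mono sum_mono) auto
  also have "\<dots> \<le> (1 + real L) powr qe * (1 + real L * \<Gamma>q) powr qe"
    using powr_mono[of 1 qe "1 + real L * \<Gamma>q"] pq \<Gamma>q0 by (intro mult_left_mono) auto
  also have "\<dots> = ((1 + real L) * (1 + real L * \<Gamma>q)) powr qe" using \<Gamma>q0 by (simp add: powr_mult)
  finally show "expectation (\<lambda>w. (1 + EE w) powr qe) \<le> ((1 + real L) * (1 + real L * \<Gamma>q)) powr qe" .
qed

definition lam :: "nat \<Rightarrow> (nat \<times> 'd \<Rightarrow> int) \<Rightarrow> real" where
  "lam n c = C2 * 2 powr (- kappa * n) * nv (pt n c) powr iota"
text \<open>The weight turns the growth \<open>nv powr iota\<close> of \<open>lam\<close> into the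
  decay \<open>nv powr (- 1)\<close>, which makes the p-norm over cells finite. The inverse weight
  is charged to the envelope of \<open>W\<close>.\<close>

definition wt :: "nat \<Rightarrow> (nat \<times> 'd \<Rightarrow> int) \<Rightarrow> real" where
  "wt n c = nv (pt n c) powr (- (iota + 1))"
definition Lam :: "nat \<Rightarrow> real" where
  "Lam n = C2 * 2 powr (- kappa * n) * (\<zeta> * 2 ^ n) powr (real D0 / p)"

lemma C2_pos: "C2 > 0"
  unfolding C2_def chain_const_def using Kg \<Gamma>q0
  by (intro mult_pos_pos) (auto intro: add_pos_nonneg add_nonneg_pos)

lemma pos: "lam n c > 0" "wt n c > 0" "Lam n > 0"
  using C2_pos nv1[of "pt n c"] zeta(1) by (auto simp: lam_def wt_def Lam_def powr_gt_zero)

lemma hh_moment: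
  "integrable M (\<lambda>w. \<bar>hh n c w\<bar> powr qe)" "expectation (\<lambda>w. \<bar>hh n c w\<bar> powr qe) \<le> lam n c powr qe"
proof -
  define a where "a = (Kg + 1) * 4 * (1 + real L + real L * c1 powr iota) * (1 + real L * CARD('d))
      * 2 powr (- kappa * n) * nv (pt n c) powr iota"
  have a0: "a \<ge> 0" unfolding a_def using Kg by (intro mult_nonneg_nonneg add_nonneg_nonneg) auto
  have le: "\<bar>hh n c w\<bar> powr qe \<le> a powr qe * (1 + EE w) powr qe" for w
  proof -
    have "\<bar>hh n c w\<bar> powr qe \<le> (a * (1 + EE w)) powr qe"
      unfolding a_def using pq hh_bound by (intro powr_mono2) auto
    then show ?thesis using a0 EE0[of w] by (simp add: powr_mult)
  qed
  have [measurable]: "hh n c \<in> borel_measurable M"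
    unfolding hh_def using g_integrable by (cases n) auto
  have int: "integrable M (\<lambda>w. a powr qe * (1 + EE w) powr qe)" using EE_moment by simp
  show i: "integrable M (\<lambda>w. \<bar>hh n c w\<bar> powr qe)"
    by (rule Bochner_Integration.integrable_bound[OF int]) (use order_trans[OF le abs_ge_self] in auto)
  have "expectation (\<lambda>w. \<bar>hh n c w\<bar> powr qe) \<le> a powr qe * expectation (\<lambda>w. (1 + EE w) powr qe)"
    using integral_mono[OF i int le] by simp
  also have "\<dots> \<le> a powr qe * ((1 + real L) * (1 + real L * \<Gamma>q)) powr qe"
    by (intro mult_left_mono EE_moment) auto
  also have "\<dots> = lam n c powr qe"
    using a0 \<Gamma>q0 unfolding lam_def C2_def chain_const_def a_def
    by (subst powr_mult[symmetric]) (auto simp: algebra_simps)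
  finally show "expectation (\<lambda>w. \<bar>hh n c w\<bar> powr qe) \<le> lam n c powr qe" .
qed

lemma hh_future: "hh n c \<in> borel_measurable (future U)"
  unfolding hh_def using g_future by (cases n) auto

lemma Wg_integrable: "integrable M (\<lambda>w. W w * g (y v w))" if v: "\<And>j. j \<notin> P \<Longrightarrow> v j = 0"
proof (rule Bochner_Integration.integrable_bound[where f="\<lambda>w. cW * (Kg * (1 + real L) * nv v powr iota) * B w powr (2 * iota)"])
  show "integrable M (\<lambda>w. cW * (Kg * (1 + real L) * nv v powr iota) * B w powr (2 * iota))"
    using B_integrable[of "2 * iota"] m_ge iota_pos by simp
  show "(\<lambda>w. W w * g (y v w)) \<in> borel_measurable M" using g_integrable by auto
  have "\<bar>W w * g (y v w)\<bar> \<le> cW * (Kg * (1 + real L) * nv v powr iota) * B w powr (2 * iota)" for w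
  proof -
    have nb: "norm (y v w i) \<le> nv v * B w" for i
    proof (cases "i \<in> Q")
      case True
      have "norm (\<eta> i w) \<le> 1 * B w" using Bdom by simp
      also have "\<dots> \<le> nv v * B w" using nv1[of v] B1[of w] by (intro mult_right_mono) auto
      finally show ?thesis using True by (simp add: y_def)
    next
      case False
      have "norm (v i) \<le> nv v"
      proof (cases "i \<in> P")
        case True
        then have "norm (v i) \<le> (\<Sum>j\<in>P. norm (v j))" using finite_P by (intro member_le_sum) auto
        then show ?thesis by (simp add: nv_def)
      qed (use v nv1[of v] in simp)
      also have "nv v * 1 \<le> nv v * B w" using nv1[of v] B1[of w] by (intro mult_left_mono) auto
      finally show ?thesis using False by (simp add: y_def)
    qed
    have nB: "1 \<le> nv v * B w"
      using mult_mono[OF nv1[of v] B1[of w]] nv1[of v] by simp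
    have "\<bar>g (y v w)\<bar> \<le> Kg * (1 + real L) * (nv v * B w) powr iota"
      by (rule hoelder_growth_bound[OF hg iota_pos nB nb])
    then have "\<bar>W w\<bar> * \<bar>g (y v w)\<bar> \<le> (cW * B w powr iota) * (Kg * (1 + real L) * (nv v * B w) powr iota)"
      using W(2)[of w] cW0 by (intro mult_mono) auto
    also have "\<dots> = cW * (Kg * (1 + real L) * nv v powr iota) * (B w powr iota * B w powr iota)"
      using nv1[of v] B1[of w] by (simp add: powr_mult)
    also have "B w powr iota * B w powr iota = B w powr (2 * iota)" by (simp add: powr_add[symmetric])
    finally show ?thesis by (simp add: abs_mult)
  qed
  then show "AE w in M. norm (W w * g (y v w)) \<le> norm (cW * (Kg * (1 + real L) * nv v powr iota) * B w powr (2 * iota))"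
    by (intro AE_I2) (auto intro: order_trans[OF _ abs_ge_self])
qed

lemma Whh_integrable: "integrable M (\<lambda>w. W w * hh n c w)"
proof (cases n)
  case 0
  then show ?thesis using Wg_integrable[of "pt 0 c"] pt_zero by (simp add: hh_def)
next
  case (Suc k)
  have "integrable M (\<lambda>w. W w * g (y (pt (Suc k) c) w) - W w * g (y (coarse k (pt (Suc k) c)) w))"
    by (intro Bochner_Integration.integrable_diff Wg_integrable pt_zero coarse_zero) auto
  then show ?thesis using Suc by (simp add: hh_def right_diff_distrib)
qed

lemma cell_in: "cell R n w \<in> V R n"
proof -
  have "\<lfloor>2 ^ n * max (- real R) (min (real R) x)\<rfloor> \<in> {- int (R * 2 ^ n)..int (R * 2 ^ n)}" for x :: real
  proof -
    define t where "t = max (- real R) (min (real R) x)"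
    have t: "- real R \<le> t" "t \<le> real R" by (auto simp: t_def)
    have "2 ^ n * t \<le> 2 ^ n * real R" "2 ^ n * (- real R) \<le> 2 ^ n * t" using t by (intro mult_left_mono; simp)+
    then have "\<lfloor>2 ^ n * t\<rfloor> \<le> \<lfloor>real_of_int (int (R * 2 ^ n))\<rfloor>" "\<lfloor>real_of_int (- int (R * 2 ^ n))\<rfloor> \<le> \<lfloor>2 ^ n * t\<rfloor>"
      by (intro floor_mono; simp add: mult.commute)+
    then show ?thesis unfolding t_def[symmetric] by (simp only: floor_of_int atLeastAtMost_iff)
  qed
  then show ?thesis unfolding cell_def V_def by (intro restrict_PiE_iff[THEN iffD2] ballI)
qed

lemma cell_past: "{w \<in> space M. cell R n w = c} \<in> sets (past T)" if c: "c \<in> V R n"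
proof -
  have sp: "space (past T) = space M" using subalgebras(1)[of T] by (simp add: subalgebra_def)
  have "{w \<in> space M. cell R n w = c}
     = {w \<in> space (past T). \<forall>k\<in>Ix. \<lfloor>2 ^ n * max (- real R) (min (real R) (\<xi> w (fst k) $ snd k))\<rfloor> = c k}"
  proof -
    have "cell R n w = c \<longleftrightarrow> (\<forall>k\<in>Ix. \<lfloor>2 ^ n * max (- real R) (min (real R) (\<xi> w (fst k) $ snd k))\<rfloor> = c k)" for w
      using c unfolding cell_def V_def by (auto simp: PiE_def extensional_def restrict_def fun_eq_iff)
    then show ?thesis using sp by auto
  qed
  also have "\<dots> \<in> sets (past T)"
  proof (rule sets.sets_Collect_finite_All)
    fix k assume "k \<in> Ix"
    note [measurable] = \<xi>(1)[of "fst k"]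
    show "{w \<in> space (past T). \<lfloor>2 ^ n * max (- real R) (min (real R) (\<xi> w (fst k) $ snd k))\<rfloor> = c k} \<in> sets (past T)"
      by measurable
  qed (rule finite_Ix)
  finally show ?thesis .
qed

text \<open>\<open>nv\<close> dominates \<open>1 + \<bar>x\<bar>\<close> for every scalar past
  coordinate \<open>x\<close>, and there are at most \<open>D0\<close> of these, so the decay of
  order \<open>p\<close> splits into a product of decays of order \<open>\<theta>\<close>.\<close>

lemma nv_powr_le:
  assumes c: "c \<in> V R n"
  shows "nv (pt n c) powr (- p) \<le> (\<Prod>k\<in>Ix. (1 + \<bar>real_of_int (c k)\<bar> / 2 ^ n) powr (- \<theta>))"
proof -
  have comp: "1 + \<bar>real_of_int (c k)\<bar> / 2 ^ n \<le> nv (pt n c)" if k: "k \<in> Ix" for k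
  proof -
    obtain j i where ji: "k = (j, i)" "j \<in> P" using k by (auto simp: Ix_def)
    have "\<bar>real_of_int (c k)\<bar> / 2 ^ n = \<bar>pt n c j $ i\<bar>" using ji by (simp add: pt_def)
    also have "\<dots> \<le> norm (pt n c j)" by (rule component_le_norm_cart)
    also have "\<dots> \<le> (\<Sum>j\<in>P. norm (pt n c j))" using finite_P ji by (intro member_le_sum) auto
    finally show ?thesis by (simp add: nv_def)
  qed
  have "\<theta> * real (card Ix) \<le> \<theta> * real D0"
    using P(2) th(1) unfolding Ix_def card_cartesian_product by (intro mult_left_mono of_nat_mono) auto
  then have "- p \<le> - \<theta> * real (card Ix)" using th(2) by linarith
  then have "nv (pt n c) powr (- p) \<le> nv (pt n c) powr (- \<theta> * real (card Ix))"
    using nv1 by (intro powr_mono)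
  also have "\<dots> = (nv (pt n c) powr (- \<theta>)) powr real (card Ix)" by (simp only: powr_powr)
  also have "\<dots> = (nv (pt n c) powr (- \<theta>)) ^ card Ix"
    using nv1[of "pt n c"] by (intro powr_realpow) auto
  also have "\<dots> = (\<Prod>k\<in>Ix. nv (pt n c) powr (- \<theta>))" by simp
  also have "\<dots> \<le> (\<Prod>k\<in>Ix. (1 + \<bar>real_of_int (c k)\<bar> / 2 ^ n) powr (- \<theta>))"
    using comp th(1) by (intro prod_mono conjI powr_mono2') (auto simp: add_pos_nonneg)
  finally show ?thesis .
qed

text \<open>\<open>wt * lam\<close> is a constant times \<open>nv powr (- 1)\<close>. The sum of its
  p-th powers is bounded by a product of one-dimensional grid sums, each at most
  \<open>\<zeta> * 2 ^ n\<close>; the p-th root leaves \<open>2 powr (n * D0 / p)\<close>.\<close>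

lemma Lam_sum: "(\<Sum>c\<in>V R n. (wt n c * lam n c) powr p) \<le> Lam n powr p"
proof -
  have wl: "(wt n c * lam n c) powr p = (C2 * 2 powr (- kappa * n)) powr p * nv (pt n c) powr (- p)" for c
  proof -
    have "wt n c * lam n c = C2 * 2 powr (- kappa * n) * (nv (pt n c) powr (- (iota + 1)) * nv (pt n c) powr iota)"
      by (simp add: wt_def lam_def)
    also have "nv (pt n c) powr (- (iota + 1)) * nv (pt n c) powr iota = nv (pt n c) powr (- 1)"
      by (simp add: powr_add[symmetric])
    finally have e: "wt n c * lam n c = C2 * 2 powr (- kappa * n) * nv (pt n c) powr (- 1)" .
    have "(wt n c * lam n c) powr p = (C2 * 2 powr (- kappa * n)) powr p * (nv (pt n c) powr (- 1)) powr p"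
      unfolding e by (rule powr_mult)
    then show ?thesis unfolding powr_powr by simp
  qed
  have "(\<Sum>c\<in>V R n. nv (pt n c) powr (- p)) \<le> (\<Sum>c\<in>V R n. \<Prod>k\<in>Ix. (1 + \<bar>real_of_int (c k)\<bar> / 2 ^ n) powr (- \<theta>))"
    by (intro sum_mono nv_powr_le)
  also have "\<dots> = (\<Sum>c\<in>{- int (R * 2 ^ n)..int (R * 2 ^ n)}. (1 + \<bar>real_of_int c\<bar> / 2 ^ n) powr (- \<theta>)) ^ card Ix"
    unfolding V_def by (rule sum_PiE_prod_const) (auto simp: finite_Ix)
  also have "\<dots> \<le> (\<zeta> * 2 ^ n) ^ card Ix" by (intro power_mono zeta sum_nonneg) auto
  also have "\<dots> \<le> (\<zeta> * 2 ^ n) ^ D0"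
  proof (rule power_increasing)
    show "card Ix \<le> D0" using P(2) by (simp add: Ix_def card_cartesian_product)
    have "1 * 1 \<le> \<zeta> * 2 ^ n" using zeta(1) by (intro mult_mono) auto
    then show "1 \<le> \<zeta> * 2 ^ n" by simp
  qed
  finally have "(\<Sum>c\<in>V R n. nv (pt n c) powr (- p)) \<le> (\<zeta> * 2 ^ n) ^ D0" .
  then have "(\<Sum>c\<in>V R n. (wt n c * lam n c) powr p) \<le> (C2 * 2 powr (- kappa * n)) powr p * (\<zeta> * 2 ^ n) ^ D0"
    unfolding wl sum_distrib_left[symmetric] by (intro mult_left_mono) auto
  also have "(\<zeta> * 2 ^ n) ^ D0 = ((\<zeta> * 2 ^ n) powr (real D0 / p)) powr p"
    using zeta(1) pq by (simp add: powr_powr powr_realpow)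
  also have "(C2 * 2 powr (- kappa * n)) powr p * \<dots> = Lam n powr p"
    unfolding Lam_def using C2_pos by (subst powr_mult[symmetric]) auto
  finally show ?thesis .
qed

text \<open>The inverse weight is at most \<open>(c1 * B) powr (iota + 1)\<close>; together with the
  growth of \<open>W\<close> this uses the power \<open>2 * iota + 1\<close> of the envelope, which
  \<open>exps_p\<close> admits.\<close>

lemma level_bound:
  "\<bar>expectation (\<lambda>w. W w * (hh n (cell R n w) w - expectation (hh n (cell R n w))))\<bar>
     \<le> cW * c1 powr (iota + 1) * Lam n * rho r * (2 + \<Gamma>)"
proof (rule cell_decomposition_bound[where V="V R n" and lam="lam n" and wt="wt n" and e="2 * iota + 1",
      OF r TU finite_V cell_in cell_past W(1) W_integrable hh_future hh_moment Whh_integrable pos Lam_sum B1 Bint])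
  show "(2 * iota + 1) / m + 1 / p \<le> 1"
  proof -
    have "(2 * iota + 1) / m \<le> (2 * iota + 4) / m" using m_pos by (intro divide_right_mono) auto
    then show ?thesis using exps_p by linarith
  qed
  fix w
  let ?v = "pt n (cell R n w)"
  have "wt n (cell R n w) * nv ?v powr (iota + 1) = 1"
    using nv1[of ?v] by (simp add: wt_def powr_add[symmetric])
  moreover have "nv ?v powr (iota + 1) \<le> (c1 * B w) powr (iota + 1)"
    using nv_pt_cell nv1[of ?v] iota_pos by (intro powr_mono2) auto
  ultimately have "1 \<le> wt n (cell R n w) * (c1 * B w) powr (iota + 1)"
    using mult_left_mono[of "nv ?v powr (iota + 1)" "(c1 * B w) powr (iota + 1)" "wt n (cell R n w)"] pos(2)[of n "cell R n w"] by simp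
  then have "cW * B w powr iota * 1 \<le> cW * B w powr iota * (wt n (cell R n w) * (c1 * B w) powr (iota + 1))"
    using cW0 by (intro mult_left_mono) auto
  also have "\<dots> = cW * c1 powr (iota + 1) * (wt n (cell R n w) * (B w powr iota * B w powr (iota + 1)))"
    using c1 B1[of w] by (simp add: powr_mult)
  also have "B w powr iota * B w powr (iota + 1) = B w powr (2 * iota + 1)" by (simp add: powr_add[symmetric])
  finally show "\<bar>W w\<bar> \<le> cW * c1 powr (iota + 1) * (wt n (cell R n w) * B w powr (2 * iota + 1))"
    using W(2)[of w] by simp
qed (use cW0 iota_pos in auto)

lemma telescope:
  "g (y (pt J (cell R J w)) w) - ghat (pt J (cell R J w))
     = (\<Sum>n\<le>J. hh n (cell R n w) w - expectation (hh n (cell R n w)))"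
proof (induction J)
  case 0
  then show ?case by (simp add: hh_def ghat_def)
next
  case (Suc J)
  have "hh (Suc J) c = (\<lambda>w. g (y (pt (Suc J) c) w) - g (y (coarse J (pt (Suc J) c)) w))" for c
    by (simp add: hh_def fun_eq_iff)
  then have "expectation (hh (Suc J) c) = ghat (pt (Suc J) c) - ghat (coarse J (pt (Suc J) c))" for c
    using g_integrable by (simp add: ghat_def)
  then have "expectation (hh (Suc J) (cell R (Suc J) w)) = ghat (pt (Suc J) (cell R (Suc J) w)) - ghat (pt J (cell R J w))"
    by (simp add: coarse_pt)
  moreover have "hh (Suc J) (cell R (Suc J) w) w = g (y (pt (Suc J) (cell R (Suc J) w)) w) - g (y (pt J (cell R J w)) w)"
    by (simp add: hh_def coarse_pt)
  ultimately show ?case using Suc by simp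
qed

definition bound_const :: real where
  "bound_const = cW * c1 powr (iota + 1) * (2 + \<Gamma>) * (C2 * \<zeta> powr (real D0 / p) * (1 / (1 - 2 powr (real D0 / p - kappa))))"

text \<open>A geometric series with ratio \<open>2 powr (D0 / p - kappa)\<close>, below 1 since the
  Hoelder gain per level beats the cost of the cells.\<close>

lemma sum_Lam: "(\<Sum>n\<le>J. Lam n) \<le> C2 * \<zeta> powr (real D0 / p) * (1 / (1 - 2 powr (real D0 / p - kappa)))"
proof -
  define x where "x = 2 powr (real D0 / p - kappa)"
  have x: "0 < x" "x < 1" unfolding x_def using th(3) by (auto simp: powr_less_one)
  have L: "Lam n = C2 * \<zeta> powr (real D0 / p) * x ^ n" for n
  proof -
    have "(\<zeta> * 2 ^ n) powr (real D0 / p) = \<zeta> powr (real D0 / p) * (2 powr real n) powr (real D0 / p)"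
      using zeta(1) by (simp add: powr_mult powr_realpow)
    moreover have "2 powr (- kappa * n) * (2 powr real n) powr (real D0 / p) = x powr real n"
      unfolding x_def by (simp add: powr_powr powr_add[symmetric] algebra_simps)
    ultimately show ?thesis using x by (simp add: Lam_def powr_realpow mult.assoc mult.left_commute)
  qed
  have "(\<Sum>n\<le>J. x ^ n) \<le> (\<Sum>n. x ^ n)"
    using x by (intro sum_le_suminf summable_geometric) auto
  also have "\<dots> = 1 / (1 - x)" using x by (intro suminf_geometric) auto
  finally have "(\<Sum>n\<le>J. x ^ n) \<le> 1 / (1 - x)" .
  then show ?thesis unfolding L sum_distrib_left[symmetric] x_def[symmetric]
    using C2_pos by (intro mult_left_mono) auto
qed

lemma \<Gamma>0: "\<Gamma> \<ge> 0"
  using order_trans[OF _ Bint(2)] by (simp add: integral_nonneg)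

lemma term_integrable: "integrable M (\<lambda>w. W w * (hh n (cell R n w) w - expectation (hh n (cell R n w))))"
proof -
  have "integrable M (\<lambda>w. \<Sum>c\<in>V R n. indicator {w \<in> space M. cell R n w = c} w * (W w * hh n c w - W w * expectation (hh n c)))"
  proof (intro Bochner_Integration.integrable_sum)
    fix c assume c: "c \<in> V R n"
    have "{w \<in> space M. cell R n w = c} \<in> sets M"
      using cell_past[OF c] subalgebras(1)[of T] unfolding subalgebra_def by blast
    moreover have "integrable M (\<lambda>w. W w * hh n c w - W w * expectation (hh n c))"
      using Whh_integrable W_integrable by simp
    ultimately show "integrable M (\<lambda>w. indicator {w \<in> space M. cell R n w = c} w * (W w * hh n c w - W w * expectation (hh n c)))"
      using integrable_mult_indicator[of "{w \<in> space M. cell R n w = c}" M "\<lambda>w. W w * hh n c w - W w * expectation (hh n c)"] by simp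
  qed
  also have "?this \<longleftrightarrow> ?thesis"
  proof (intro Bochner_Integration.integrable_cong refl)
    fix w assume w: "w \<in> space M"
    have "(\<Sum>c\<in>V R n. indicator {w \<in> space M. cell R n w = c} w * (W w * hh n c w - W w * expectation (hh n c)))
       = (\<Sum>c\<in>V R n. if c = cell R n w then W w * hh n c w - W w * expectation (hh n c) else 0)"
      using w by (intro sum.cong) auto
    then show "(\<Sum>c\<in>V R n. indicator {w \<in> space M. cell R n w = c} w * (W w * hh n c w - W w * expectation (hh n c)))
       = W w * (hh n (cell R n w) w - expectation (hh n (cell R n w)))"
      using cell_in[of R n w] finite_V by (simp add: right_diff_distrib)
  qed
  finally show ?thesis .
qed

lemma discretised_bound:
  "\<bar>expectation (\<lambda>w. W w * (g (y (pt J (cell R J w)) w) - ghat (pt J (cell R J w))))\<bar> \<le> bound_const * rho r"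
proof -
  have eq: "expectation (\<lambda>w. W w * (g (y (pt J (cell R J w)) w) - ghat (pt J (cell R J w))))
    = (\<Sum>n\<le>J. expectation (\<lambda>w. W w * (hh n (cell R n w) w - expectation (hh n (cell R n w)))))"
    unfolding telescope sum_distrib_left using term_integrable by (subst Bochner_Integration.integral_sum) auto
  have "\<bar>expectation (\<lambda>w. W w * (g (y (pt J (cell R J w)) w) - ghat (pt J (cell R J w))))\<bar>
      \<le> (\<Sum>n\<le>J. cW * c1 powr (iota + 1) * Lam n * rho r * (2 + \<Gamma>))"
    unfolding eq by (rule order_trans[OF sum_abs]) (intro sum_mono level_bound)
  also have "\<dots> = cW * c1 powr (iota + 1) * (2 + \<Gamma>) * (\<Sum>n\<le>J. Lam n) * rho r"
  proof -
    have "(\<Sum>n\<le>J. a * b * Lam n * d * e) = a * b * e * (\<Sum>n\<le>J. Lam n) * d" for a b d e :: real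
      by (simp add: sum_distrib_right[symmetric] sum_distrib_left[symmetric])
    then show ?thesis .
  qed
  also have "\<dots> \<le> bound_const * rho r"
    unfolding bound_const_def
  proof (rule mult_right_mono[OF mult_left_mono[OF sum_Lam]])
    show "0 \<le> cW * c1 powr (iota + 1) * (2 + \<Gamma>)" using cW0 \<Gamma>0 by (intro mult_nonneg_nonneg) auto
    show "0 \<le> rho r" using rho_pos[of r] by simp
  qed
  finally show ?thesis .
qed

lemma pt_cell_close:
  assumes "B w \<le> real R"
  shows "norm (pt n (cell R n w) j - \<xi> w j) \<le> CARD('d) / 2 ^ n"
proof -
  have "\<bar>\<xi> w j $ i\<bar> \<le> real R" for i
    using component_le_norm_cart[of "\<xi> w j" i] Bdom(1)[of w j] assms by linarith
  then have "\<xi> w j $ i \<le> real R" "- real R \<le> \<xi> w j $ i" for i by (meson abs_le_D1 abs_le_D2 minus_le_iff)+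
  then have "max (- real R) (min (real R) (\<xi> w j $ i)) = \<xi> w j $ i" for i
    by (simp add: min_absorb2 max_absorb2)
  then have "pt n (cell R n w) j = coarse n (\<xi> w) j" unfolding pt_cell by (simp add: coarse_def)
  then show ?thesis using coarse_close[of "\<xi> w" j n] by (simp add: norm_minus_commute)
qed

lemma y_norm: "(\<And>j. norm (v j) \<le> b) \<Longrightarrow> B w \<le> b \<Longrightarrow> norm (y v w i) \<le> b"
  using Bdom(2)[of i w] by (auto simp: y_def)

text \<open>At a fixed sample point clamping is inactive once \<open>J >= B w\<close>; from then on
  the corner is within \<open>CARD('d) / 2 ^ J\<close> of the past vector, and Hoelder continuity of
  \<open>g\<close> and \<open>ghat\<close> applies.\<close>

lemma discretised_tendsto:
  "(\<lambda>J. g (y (pt J (cell J J w)) w) - ghat (pt J (cell J J w))) \<longlonglongrightarrow> g (y (\<xi> w) w) - ghat (\<xi> w)"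
proof -
  define b where "b = (1 + real CARD('d)) * B w"
  have bB: "B w \<le> b" using B1[of w] by (simp add: b_def algebra_simps)
  have b1: "b \<ge> 1" using bB B1[of w] by linarith
  have close: "(\<lambda>J. norm (pt J (cell J J w) j - \<xi> w j)) \<longlonglongrightarrow> 0" for j
  proof (rule tendsto_sandwich[OF _ _ tendsto_const])
    obtain J0 :: nat where J0: "B w \<le> real J0" using real_arch_simple by blast
    show "\<forall>\<^sub>F J in sequentially. norm (pt J (cell J J w) j - \<xi> w j) \<le> CARD('d) / 2 ^ J"
      using eventually_ge_at_top[of J0]
    proof eventually_elim
      case (elim J)
      then have "real J0 \<le> real J" by simp
      then show ?case using J0 by (intro pt_cell_close) linarith
    qed
    show "(\<lambda>J. CARD('d) / 2 ^ J) \<longlonglongrightarrow> 0"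
      by (intro LIMSEQ_divide_realpow_zero) auto
  qed auto
  have conv: "(\<lambda>J. f (z J)) \<longlonglongrightarrow> f z0"
    if f: "hoelder_growth L K iota kappa f" and z: "\<And>J i. norm (z J i) \<le> b" "\<And>i. norm (z0 i) \<le> b"
      and c: "\<And>i. (\<lambda>J. norm (z J i - z0 i)) \<longlonglongrightarrow> 0" for f :: "(nat \<Rightarrow> real^'d) \<Rightarrow> real" and K z z0
  proof (rule LIM_zero_cancel, rule Lim_null_comparison)
    show "\<forall>\<^sub>F J in sequentially. norm (f (z J) - f z0)
       \<le> 2 * K * (1 + 2 * real L) * b powr (iota + 1) * (\<Sum>i=1..L. norm (z J i - z0 i) powr kappa)"
      using hoelder_growth_diff_bound[OF f iota_pos kappa(1) order_refl kappa(2) b1] z by auto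
    have "(\<lambda>J. 2 * K * (1 + 2 * real L) * b powr (iota + 1) * (\<Sum>i=1..L. norm (z J i - z0 i) powr kappa))
       \<longlonglongrightarrow> 2 * K * (1 + 2 * real L) * b powr (iota + 1) * (\<Sum>i=1..L. 0 powr kappa)"
      using kappa by (intro tendsto_intros tendsto_powr2 c) auto
    then show "(\<lambda>J. 2 * K * (1 + 2 * real L) * b powr (iota + 1) * (\<Sum>i=1..L. norm (z J i - z0 i) powr kappa)) \<longlonglongrightarrow> 0"
      by simp
  qed
  have n1: "norm (pt J (cell J J w) j) \<le> b" for J j unfolding b_def by (rule pt_cell_norm)
  have n2: "norm (\<xi> w j) \<le> b" for j using Bdom(1)[of w j] bB by linarith
  show ?thesis
  proof (intro tendsto_diff)
    show "(\<lambda>J. g (y (pt J (cell J J w)) w)) \<longlonglongrightarrow> g (y (\<xi> w) w)"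
    proof (rule conv[OF hg])
      show "(\<lambda>J. norm (y (pt J (cell J J w)) w i - y (\<xi> w) w i)) \<longlonglongrightarrow> 0" for i
        using close[of i] by (cases "i \<in> Q") (auto simp: y_def)
    qed (auto intro!: y_norm n1 n2 bB)
    show "(\<lambda>J. ghat (pt J (cell J J w))) \<longlonglongrightarrow> ghat (\<xi> w)"
      by (rule conv[OF hg_ghat n1 n2 close])
  qed
qed

lemma pt_cell_measurable: "(\<lambda>w. pt n (cell R n w) j) \<in> borel_measurable M"
proof (rule measurable_vec_componentI)
  fix i
  show "(\<lambda>w. pt n (cell R n w) j $ i) \<in> borel_measurable M"
    unfolding pt_cell coarse_def by simp
qed

text \<open>The grid spacing and the truncation level are sent to their limits simultaneously.\<close>
lemma chain_bound: "\<bar>expectation (\<lambda>w. W w * (g (y (\<xi> w) w) - ghat (\<xi> w)))\<bar> \<le> bound_const * rho r"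
proof -
  define f where "f J w = W w * (g (y (pt J (cell J J w)) w) - ghat (pt J (cell J J w)))" for J w
  define Kh where "Kh = Kg * (1 + 2 * real L * \<Gamma>)"
  define c where "c = cW * ((Kg + Kh) * (1 + real L) * (1 + real CARD('d)) powr iota)"
  \<comment> \<open>Corners of visited cells are bounded by \<open>(1 + CARD('d)) * B w\<close> at
    every level, so one power of \<open>B\<close> is an integrable majorant for all
    \<open>f J\<close>.\<close>
  have dom: "\<bar>W w * (g (y v w) - ghat v)\<bar> \<le> c * B w powr (2 * iota)"
    if v: "\<And>j. norm (v j) \<le> (1 + real CARD('d)) * B w" for v w
  proof -
    define b where "b = (1 + real CARD('d)) * B w"
    have bB: "B w \<le> b" using B1[of w] by (simp add: b_def algebra_simps)
    have b1: "b \<ge> 1" using bB B1[of w] by linarith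
    have "\<bar>g (y v w)\<bar> \<le> Kg * (1 + real L) * b powr iota"
      by (rule hoelder_growth_bound[OF hg iota_pos b1]) (use v bB in \<open>auto intro!: y_norm simp: b_def\<close>)
    moreover have "\<bar>ghat v\<bar> \<le> Kh * (1 + real L) * b powr iota"
      unfolding Kh_def by (rule hoelder_growth_bound[OF hg_ghat iota_pos b1]) (use v in \<open>auto simp: b_def\<close>)
    ultimately have "\<bar>g (y v w) - ghat v\<bar> \<le> (Kg + Kh) * (1 + real L) * b powr iota"
      by (simp add: algebra_simps)
    then have "\<bar>W w\<bar> * \<bar>g (y v w) - ghat v\<bar> \<le> (cW * B w powr iota) * ((Kg + Kh) * (1 + real L) * b powr iota)"
      using W(2)[of w] cW0 by (intro mult_mono) auto
    also have "\<dots> = c * (B w powr iota * B w powr iota)"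
      using B1[of w] by (simp add: c_def b_def powr_mult)
    also have "B w powr iota * B w powr iota = B w powr (2 * iota)" by (simp add: powr_add[symmetric])
    finally show ?thesis by (simp add: abs_mult)
  qed
  have lim: "(\<lambda>J. expectation (f J)) \<longlonglongrightarrow> expectation (\<lambda>w. W w * (g (y (\<xi> w) w) - ghat (\<xi> w)))"
  proof (rule integral_dominated_convergence)
    show "integrable M (\<lambda>w. c * B w powr (2 * iota))" using B_integrable[of "2 * iota"] m_ge iota_pos by simp
    show "AE w in M. (\<lambda>J. f J w) \<longlonglongrightarrow> W w * (g (y (\<xi> w) w) - ghat (\<xi> w))"
      unfolding f_def by (intro AE_I2 tendsto_mult tendsto_const discretised_tendsto)
    show "AE w in M. norm (f J w) \<le> c * B w powr (2 * iota)" for J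
      unfolding f_def real_norm_def by (intro AE_I2 dom pt_cell_norm)
    show "f J \<in> borel_measurable M" for J
      unfolding f_def using g_composed_measurable[OF pt_cell_measurable] by (intro borel_measurable_times borel_measurable_diff WM)
    show "(\<lambda>w. W w * (g (y (\<xi> w) w) - ghat (\<xi> w))) \<in> borel_measurable M"
      using g_composed_measurable[OF \<xi>M] by (intro borel_measurable_times borel_measurable_diff WM)
  qed
  show ?thesis
    by (rule LIMSEQ_le_const2[OF tendsto_rabs[OF lim]]) (use discretised_bound in \<open>auto simp: f_def[abs_def]\<close>)
qed

end

section \<open>Decorrelation of samples with the rate \<open>rho\<close>\<close>

context mixing_process begin

lemma moments: "\<exists>\<Gamma>\<ge>0. \<forall>r k. integrable M (\<lambda>w. norm (Xr r k w) powr m) \<and> expectation (\<lambda>w. norm (Xr r k w) powr m) \<le> \<Gamma>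
    \<and> expectation (\<lambda>w. norm (X k w) powr m) \<le> \<Gamma>"
proof -
  obtain \<Gamma> where \<Gamma>: "\<And>r k. integrable M (\<lambda>w. norm (Xr r k w) powr m)" "\<And>r k. expectation (\<lambda>w. norm (Xr r k w) powr m) \<le> \<Gamma>"
    using Xr_moment_m by blast
  define \<Gamma>' where "\<Gamma>' = max \<Gamma> (expectation (\<lambda>w. norm (X 0 w) powr m))"
  have "\<Gamma>' \<ge> 0" unfolding \<Gamma>'_def by (simp add: le_max_iff_disj integral_nonneg)
  moreover have "expectation (\<lambda>w. norm (Xr r k w) powr m) \<le> \<Gamma>'" for r k
    using \<Gamma>(2)[of r k] by (simp add: \<Gamma>'_def)
  moreover have "expectation (\<lambda>w. norm (X k w) powr m) \<le> \<Gamma>'" for k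
    using X_integral_ident(2)[of "\<lambda>x. norm x powr m" k] by (simp add: \<Gamma>'_def)
  ultimately show ?thesis using \<Gamma>(1) by blast
qed

text \<open>One random variable dominating the samples of both factors together with their window
  approximations, so that a single moment bound serves every estimate.\<close>

definition envelope :: "nat \<Rightarrow> (nat \<Rightarrow> nat) \<Rightarrow> (nat \<Rightarrow> nat) \<Rightarrow> nat \<Rightarrow> 'a \<Rightarrow> real" where
  "envelope L tw tg r w = 1 + (\<Sum>j=1..L. norm (X (tw j) w) + norm (Xr r (tw j) w) + norm (X (tg j) w) + norm (Xr r (tg j) w))"

lemma envelope_ge1: "envelope L tw tg r w \<ge> 1"
  unfolding envelope_def by (simp add: sum_nonneg)

lemma envelope_measurable [measurable]: "envelope L tw tg r \<in> borel_measurable M"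
  unfolding envelope_def by measurable

lemma envelope_dom:
  assumes "j \<in> {1..L}"
  shows "norm (X (tw j) w) \<le> envelope L tw tg r w" "norm (Xr r (tw j) w) \<le> envelope L tw tg r w"
    "norm (X (tg j) w) \<le> envelope L tw tg r w" "norm (Xr r (tg j) w) \<le> envelope L tw tg r w"
proof -
  have "norm (X (tw j) w) + norm (Xr r (tw j) w) + norm (X (tg j) w) + norm (Xr r (tg j) w)
      \<le> (\<Sum>j=1..L. norm (X (tw j) w) + norm (Xr r (tw j) w) + norm (X (tg j) w) + norm (Xr r (tg j) w))"
    by (rule member_le_sum[OF assms]) auto
  then have "norm (X (tw j) w) + norm (Xr r (tw j) w) + norm (X (tg j) w) + norm (Xr r (tg j) w) \<le> envelope L tw tg r w"
    by (simp add: envelope_def)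
  moreover have "norm (X (tw j) w) \<ge> 0" "norm (Xr r (tw j) w) \<ge> 0" "norm (X (tg j) w) \<ge> 0" "norm (Xr r (tg j) w) \<ge> 0" by auto
  ultimately show "norm (X (tw j) w) \<le> envelope L tw tg r w" "norm (Xr r (tw j) w) \<le> envelope L tw tg r w"
    "norm (X (tg j) w) \<le> envelope L tw tg r w" "norm (Xr r (tg j) w) \<le> envelope L tw tg r w" by linarith+
qed

text \<open>Identical distribution makes the bound independent of the times \<open>tw\<close>,
  \<open>tg\<close> and of \<open>r\<close>; the constants in \<open>rate_bound\<close> inherit this
  uniformity.\<close>

lemma envelope_moment:
  "\<exists>\<Gamma>\<ge>0. \<forall>tw tg r. integrable M (\<lambda>w. envelope L tw tg r w powr m) \<and> expectation (\<lambda>w. envelope L tw tg r w powr m) \<le> \<Gamma>"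
proof -
  obtain \<Gamma> where \<Gamma>0: "\<Gamma> \<ge> 0" and \<Gamma>: "\<And>r k. integrable M (\<lambda>w. norm (Xr r k w) powr m)"
    "\<And>r k. expectation (\<lambda>w. norm (Xr r k w) powr m) \<le> \<Gamma>" "\<And>k. expectation (\<lambda>w. norm (X k w) powr m) \<le> \<Gamma>"
    using moments by blast
  define Z where "Z = {1..L} \<times> {..<4::nat}"
  define \<Gamma>' where "\<Gamma>' = (1 + card Z) powr m * (1 + card Z * \<Gamma>)"
  have "integrable M (\<lambda>w. envelope L tw tg r w powr m) \<and> expectation (\<lambda>w. envelope L tw tg r w powr m) \<le> \<Gamma>'" for tw tg r
  proof
    define f where "f = (\<lambda>(j, i) w. if i = 0 then X (tw j) w else if i = 1 then Xr r (tw j) w else if i = (2::nat) then X (tg j) w else Xr r (tg j) w)"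
    have env: "envelope L tw tg r w = 1 + (\<Sum>z\<in>Z. norm (f z w))" for w
    proof -
      have "(\<Sum>z\<in>Z. norm (f z w)) = (\<Sum>j=1..L. \<Sum>i<4. norm (f (j, i) w))"
        by (simp add: Z_def sum.cartesian_product split_def)
      also have "{..<4::nat} = {0, 1, 2, 3}" by auto
      finally show ?thesis unfolding envelope_def by (simp add: f_def add.assoc)
    qed
    have fz: "f z = X (tw (fst z)) \<or> f z = Xr r (tw (fst z)) \<or> f z = X (tg (fst z)) \<or> f z = Xr r (tg (fst z))" for z
      by (cases z) (auto simp: f_def fun_eq_iff)
    have fi: "integrable M (\<lambda>w. norm (f z w) powr m)" and fe: "expectation (\<lambda>w. norm (f z w) powr m) \<le> \<Gamma>" for z
      using \<Gamma> X_integrable_m fz[of z] by (auto elim!: disjE)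
    have le: "envelope L tw tg r w powr m \<le> (1 + card Z) powr m * (1 + (\<Sum>z\<in>Z. norm (f z w) powr m))" for w
      unfolding env using m_pos by (intro powr_one_plus_sum_le) (auto simp: Z_def)
    have int: "integrable M (\<lambda>w. (1 + card Z) powr m * (1 + (\<Sum>z\<in>Z. norm (f z w) powr m)))" using fi by simp
    show i: "integrable M (\<lambda>w. envelope L tw tg r w powr m)"
      by (rule Bochner_Integration.integrable_bound[OF int]) (use order_trans[OF le abs_ge_self] in auto)
    have "expectation (\<lambda>w. envelope L tw tg r w powr m) \<le> expectation (\<lambda>w. (1 + card Z) powr m * (1 + (\<Sum>z\<in>Z. norm (f z w) powr m)))"
      by (intro integral_mono i int le)
    also have "\<dots> = (1 + card Z) powr m * (1 + (\<Sum>z\<in>Z. expectation (\<lambda>w. norm (f z w) powr m)))"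
      using fi by (simp add: prob_space)
    also have "\<dots> \<le> (1 + card Z) powr m * (1 + (\<Sum>z\<in>Z. \<Gamma>))"
      using fe by (intro mult_left_mono add_left_mono sum_mono) auto
    finally show "expectation (\<lambda>w. envelope L tw tg r w powr m) \<le> \<Gamma>'" by (simp add: \<Gamma>'_def)
  qed
  moreover have "\<Gamma>' \<ge> 0" using \<Gamma>0 by (simp add: \<Gamma>'_def)
  ultimately show ?thesis by blast
qed

text \<open>\<open>U i\<close> is the q-th power of the difference, normalised to mean at most one,
  so \<open>norm (Z i w) powr delta\<close> equals \<open>rho r * U i w powr (delta / qe)\<close>.
  This is how the rate becomes \<open>rho\<close> itself.\<close>

lemma difference_moment:
  fixes f B :: "'a \<Rightarrow> real" and Z :: "nat \<Rightarrow> 'a \<Rightarrow> real^'d"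
  assumes [measurable]: "f \<in> borel_measurable M"
    and B[measurable]: "B \<in> borel_measurable M" and B1: "\<And>w. B w \<ge> 1"
    and Bint: "integrable M (\<lambda>w. B w powr m)" "expectation (\<lambda>w. B w powr m) \<le> \<Gamma>"
    and Z[measurable]: "\<And>i. Z i \<in> borel_measurable M"
    and Zq: "\<And>i. integrable M (\<lambda>w. norm (Z i w) powr qe)" "\<And>i. expectation (\<lambda>w. norm (Z i w) powr qe) \<le> rho r powr (qe / delta)"
    and e: "0 \<le> e" "e \<le> 2 * iota + 4" and c: "c \<ge> 0"
    and le: "\<And>w. \<bar>f w\<bar> \<le> c * B w powr e * (\<Sum>i=1..L. norm (Z i w) powr delta)"
  shows "integrable M f" "expectation (\<lambda>w. \<bar>f w\<bar>) \<le> c * real L * (2 + \<Gamma>) * rho r"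
proof -
  define U where "U i w = norm (Z i w) powr qe / rho r powr (qe / delta)" for i w
  define h where "h i w = c * (B w powr e * norm (Z i w) powr delta)" for i w
  have ex: "e / m + delta / qe \<le> 1"
  proof -
    have "e / m \<le> (2 * iota + 4) / m" using e m_pos by (intro divide_right_mono) auto
    then show ?thesis using exps_delta by linarith
  qed
  have hU: "\<bar>h i w\<bar> \<le> c * rho r * (B w powr e * U i w powr (delta / qe))" for i w
  proof -
    have "U i w powr (delta / qe) = norm (Z i w) powr delta / rho r"
      unfolding U_def using rho_pos[of r] pq delta_pos by (simp add: powr_divide powr_powr)
    then show ?thesis unfolding h_def using rho_pos[of r] c by simp
  qed
  have Uint: "integrable M (U i)" "expectation (U i) \<le> 1" for i
    unfolding U_def using Zq rho_pos[of r] by (auto simp: divide_le_eq powr_gt_zero)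
  have hM: "h i \<in> borel_measurable M" for i unfolding h_def by measurable
  have hh: "integrable M (h i)" "expectation (\<lambda>w. \<bar>h i w\<bar>) \<le> c * rho r * (2 + \<Gamma>)" for i
    by (rule mixed_moment[OF hM B1 Bint _ Uint e(1) _ m_pos ex _ hU];
        use pq delta_pos c rho_pos[of r] in \<open>auto simp: U_def\<close>)+
  have fle: "\<bar>f w\<bar> \<le> (\<Sum>i=1..L. \<bar>h i w\<bar>)" for w
    using le[of w] c by (simp add: h_def sum_distrib_left abs_mult mult.assoc)
  have int: "integrable M (\<lambda>w. \<Sum>i=1..L. \<bar>h i w\<bar>)" using hh by auto
  show i: "integrable M f"
    by (rule Bochner_Integration.integrable_bound[OF int]) (use order_trans[OF fle abs_ge_self] in auto)
  have "expectation (\<lambda>w. \<bar>f w\<bar>) \<le> expectation (\<lambda>w. \<Sum>i=1..L. \<bar>h i w\<bar>)"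
    by (intro integral_mono int fle) (use i in auto)
  also have "\<dots> = (\<Sum>i=1..L. expectation (\<lambda>w. \<bar>h i w\<bar>))" using hh by simp
  also have "\<dots> \<le> (\<Sum>i=1..L. c * rho r * (2 + \<Gamma>))" by (intro sum_mono hh)
  finally show "expectation (\<lambda>w. \<bar>f w\<bar>) \<le> c * real L * (2 + \<Gamma>) * rho r" by (simp add: algebra_simps)
qed

definition sample :: "nat set \<Rightarrow> (nat \<Rightarrow> nat) \<Rightarrow> 'a \<Rightarrow> nat \<Rightarrow> real^'d" where
  "sample S t w j = (if j \<in> S then X (t j) w else 0)"
definition sample_r :: "nat \<Rightarrow> nat set \<Rightarrow> (nat \<Rightarrow> nat) \<Rightarrow> 'a \<Rightarrow> nat \<Rightarrow> real^'d" where
  "sample_r r S t w j = (if j \<in> S then Xr r (t j) w else 0)"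

lemma sample_measurable [measurable]:
  "(\<lambda>w. sample S t w j) \<in> borel_measurable M" "(\<lambda>w. sample_r r S t w j) \<in> borel_measurable M"
  by (cases "j \<in> S"; simp add: sample_def sample_r_def)+

lemma hg_measurable:
  assumes "hoelder_growth L K iota kappa g" "\<And>j. (\<lambda>w. v w j) \<in> borel_measurable N"
  shows "(\<lambda>w. g (v w)) \<in> borel_measurable N"
  by (rule measurable_fun_composition[OF hoelder_growth_continuous[OF assms(1) iota_pos kappa(1)] assms(2)])

lemma sample_diff_moment:
  assumes "r \<ge> 1"
  shows "integrable M (\<lambda>w. norm (sample S t w i - sample_r r S t w i) powr qe)"
    "expectation (\<lambda>w. norm (sample S t w i - sample_r r S t w i) powr qe) \<le> rho r powr (qe / delta)"
  using X_diff_Xr[OF assms, of "t i"] pq by (cases "i \<in> S"; simp add: sample_def sample_r_def)+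

lemma sample_dom:
  assumes "j \<in> {1..L}"
  shows "norm (sample S tw w j) \<le> envelope L tw tg r w" "norm (sample_r r S tw w j) \<le> envelope L tw tg r w"
    "norm (sample S tg w j) \<le> envelope L tw tg r w" "norm (sample_r r S tg w j) \<le> envelope L tw tg r w"
  using envelope_dom[OF assms, where tw=tw and tg=tg and r=r and w=w] envelope_ge1[of L tw tg r w]
  by (auto simp: sample_def sample_r_def)

lemma product_integrable:
  assumes g: "hoelder_growth L Kg iota kappa g" and W: "hoelder_growth L Kw iota kappa W"
    and [measurable]: "B \<in> borel_measurable M" and B: "\<And>w. B w \<ge> 1" "integrable M (\<lambda>w. B w powr m)" "expectation (\<lambda>w. B w powr m) \<le> \<Gamma>"
    and v: "\<And>j. (\<lambda>w. v w j) \<in> borel_measurable M" "\<And>j w. j \<in> {1..L} \<Longrightarrow> norm (v w j) \<le> B w"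
    and u: "\<And>j. (\<lambda>w. u w j) \<in> borel_measurable M" "\<And>j w. j \<in> {1..L} \<Longrightarrow> norm (u w j) \<le> B w"
  shows "integrable M (\<lambda>w. W (u w) * g (v w))" "\<bar>expectation (\<lambda>w. W (u w) * g (v w))\<bar> \<le> Kw * Kg * (1 + real L)\<^sup>2 * \<Gamma>"
proof -
  have K: "Kg \<ge> 0" "Kw \<ge> 0" using hoelder_growth_nonneg[OF g] hoelder_growth_nonneg[OF W] by auto
  have le: "\<bar>W (u w) * g (v w)\<bar> \<le> Kw * Kg * (1 + real L)\<^sup>2 * B w powr m" for w
  proof -
    have "\<bar>W (u w)\<bar> * \<bar>g (v w)\<bar> \<le> (Kw * (1 + real L) * B w powr iota) * (Kg * (1 + real L) * B w powr iota)"
      using hoelder_growth_bound[OF g iota_pos B(1)[of w] v(2)] hoelder_growth_bound[OF W iota_pos B(1)[of w] u(2)] K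
      by (intro mult_mono) auto
    also have "\<dots> = Kw * Kg * (1 + real L)\<^sup>2 * (B w powr iota * B w powr iota)"
      by (simp add: power2_eq_square)
    also have "\<dots> \<le> Kw * Kg * (1 + real L)\<^sup>2 * B w powr m"
      unfolding powr_add[symmetric] using K B(1) m_ge iota_pos by (intro mult_left_mono powr_mono) auto
    finally show ?thesis by (simp add: abs_mult)
  qed
  have m[measurable]: "(\<lambda>w. W (u w) * g (v w)) \<in> borel_measurable M"
    using hg_measurable[OF g v(1)] hg_measurable[OF W u(1)] by measurable
  have int: "integrable M (\<lambda>w. Kw * Kg * (1 + real L)\<^sup>2 * B w powr m)" using B by simp
  show i: "integrable M (\<lambda>w. W (u w) * g (v w))"
    by (rule Bochner_Integration.integrable_bound[OF int]) (use order_trans[OF le abs_ge_self] in auto)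
  have "\<bar>expectation (\<lambda>w. W (u w) * g (v w))\<bar> \<le> expectation (\<lambda>w. \<bar>W (u w) * g (v w)\<bar>)" by (rule integral_abs_bound)
  also have "\<dots> \<le> expectation (\<lambda>w. Kw * Kg * (1 + real L)\<^sup>2 * B w powr m)"
    by (intro integral_mono int le) (use i in auto)
  also have "\<dots> \<le> Kw * Kg * (1 + real L)\<^sup>2 * \<Gamma>" using B K by (auto intro!: mult_left_mono)
  finally show "\<bar>expectation (\<lambda>w. W (u w) * g (v w))\<bar> \<le> Kw * Kg * (1 + real L)\<^sup>2 * \<Gamma>" .
qed

lemma trivial_bound:
  "\<exists>C\<ge>0. \<forall>g W Sw Sg tw tg. hoelder_growth L Kg iota kappa g \<longrightarrow> hoelder_growth L Kw iota kappa W \<longrightarrow>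
     integrable M (\<lambda>w. W (sample Sw tw w) * g (sample Sg tg w)) \<and> \<bar>expectation (\<lambda>w. W (sample Sw tw w) * g (sample Sg tg w))\<bar> \<le> C"
proof -
  obtain \<Gamma> where \<Gamma>0: "\<Gamma> \<ge> 0" and \<Gamma>: "\<And>tw tg r. integrable M (\<lambda>w. envelope L tw tg r w powr m)"
      "\<And>tw tg r. expectation (\<lambda>w. envelope L tw tg r w powr m) \<le> \<Gamma>"
    using envelope_moment by blast
  have "integrable M (\<lambda>w. W (sample Sw tw w) * g (sample Sg tg w)) \<and> \<bar>expectation (\<lambda>w. W (sample Sw tw w) * g (sample Sg tg w))\<bar> \<le> \<bar>Kw * Kg * (1 + real L)\<^sup>2 * \<Gamma>\<bar>"
    if "hoelder_growth L Kg iota kappa g" "hoelder_growth L Kw iota kappa W" for g W Sw Sg tw tg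
    using product_integrable[OF that envelope_measurable envelope_ge1 \<Gamma>(1)[of tw tg 0] \<Gamma>(2)[of tw tg 0], of "sample Sg tg" "sample Sw tw"]
      sample_dom[of _ L] by fastforce
  then show ?thesis using abs_ge_zero by blast
qed

text \<open>Samples are replaced by window versions at a cost of order \<open>rho\<close>, and
  \<open>chain_bound\<close> controls the window versions up to their frozen mean
  \<open>ghat\<close>. Centring holds for the original samples only, so \<open>ghat\<close> is not
  zero, but it is again of order \<open>rho\<close>. The constant depends on no time, set or
  function, only on the growth constants.\<close>

lemma rate_bound:
  assumes D0: "real D0 / p < kappa - delta"
  shows "\<exists>C\<ge>0. \<forall>g W Sw P Q tw tg T r. hoelder_growth L Kg iota kappa g \<longrightarrow> hoelder_growth L Kw iota kappa W \<longrightarrow>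
     P \<subseteq> {1..L} \<longrightarrow> card P * CARD('d) \<le> D0 \<longrightarrow> P \<inter> Q = {} \<longrightarrow> Q \<subseteq> {1..L} \<longrightarrow> r \<ge> 1 \<longrightarrow>
     (\<forall>j\<in>Sw. tw j \<le> T) \<longrightarrow> (\<forall>j\<in>P. tg j \<le> T) \<longrightarrow> (\<forall>j\<in>Q. T + 3 * r \<le> tg j) \<longrightarrow>
     (\<forall>v. expectation (\<lambda>w. g (\<lambda>j. if j \<in> Q then X (tg j) w else if j \<in> P then v j else 0)) = 0) \<longrightarrow>
     \<bar>expectation (\<lambda>w. W (sample Sw tw w) * g (sample (P \<union> Q) tg w))\<bar> \<le> C * rho r"
proof -
  obtain \<Gamma> where \<Gamma>0: "\<Gamma> \<ge> 0" and \<Gamma>: "\<And>tw tg r. integrable M (\<lambda>w. envelope L tw tg r w powr m)"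
      "\<And>tw tg r. expectation (\<lambda>w. envelope L tw tg r w powr m) \<le> \<Gamma>"
    using envelope_moment by blast
  obtain \<Gamma>q0 where \<Gamma>q0: "\<And>r k. integrable M (\<lambda>w. norm (Xr r k w) powr (qe * iota))"
    "\<And>r k. expectation (\<lambda>w. norm (Xr r k w) powr (qe * iota)) \<le> \<Gamma>q0"
    using Xr_moment_qi by blast
  define \<Gamma>q where "\<Gamma>q = max 0 \<Gamma>q0"
  \<comment> \<open>\<open>p / D0\<close> exceeds 1 because
    \<open>D0 / p < kappa - delta < 1\<close>. For \<open>D0 = 0\<close> there are no past
    coordinates to sum over, and any exponent above 1 will do.\<close>
  define \<theta> where "\<theta> = (if D0 = 0 then 2 else p / real D0)"
  have D0p: "real D0 / p < 1" using D0 delta_pos kappa by linarith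
  have th: "\<theta> > 1" "\<theta> * real D0 \<le> p" "real D0 / p < kappa"
    using D0p D0 delta_pos pq by (auto simp: \<theta>_def divide_simps simp del: less_divide_eq divide_less_eq)
  obtain \<zeta> where zeta: "\<zeta> \<ge> 1" "\<And>n R::nat. (\<Sum>c\<in>{- int (R * 2 ^ n)..int (R * 2 ^ n)}. (1 + \<bar>real_of_int c\<bar> / 2 ^ n) powr (- \<theta>)) \<le> \<zeta> * 2 ^ n"
    using dyadic_grid_sum[OF th(1)] by blast
  define cW where "cW = Kw * (1 + real L)"
  \<comment> \<open>The value of \<open>bound_const\<close> after the interpretation below, written
    out in advance since it contains none of the times.\<close>
  define C0 where "C0 = cW * (1 + real L * (1 + CARD('d))) powr (iota + 1) * (2 + \<Gamma>) *
     (chain_const L Kg iota CARD('d) \<Gamma>q (1 + real L * (1 + CARD('d))) * \<zeta> powr (real D0 / p) * (1 / (1 - 2 powr (real D0 / p - kappa))))"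
  \<comment> \<open>\<open>cA\<close> pays for replacing the samples in one of the two factors,
    \<open>c3\<close> for the centring lost by the replacement.\<close>
  define cA where "cA = 2 * Kw * Kg * (1 + real L) * (1 + 2 * real L) * real L * (2 + \<Gamma>)"
  define c3 where "c3 = 2 * Kg * (1 + 2 * real L) * real L * (2 + \<Gamma>)"
  define C where "C = 2 * cA + C0 + cW * c3 * \<Gamma>"
  have key: "\<bar>expectation (\<lambda>w. W (sample Sw tw w) * g (sample (P \<union> Q) tg w))\<bar> \<le> \<bar>C\<bar> * rho r"
    if g: "hoelder_growth L Kg iota kappa g" and W: "hoelder_growth L Kw iota kappa W"
     and P: "P \<subseteq> {1..L}" "card P * CARD('d) \<le> D0" and PQ: "P \<inter> Q = {}" and Q: "Q \<subseteq> {1..L}" and r: "r \<ge> 1"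
     and tw: "\<And>j. j \<in> Sw \<Longrightarrow> tw j \<le> T" and tP: "\<And>j. j \<in> P \<Longrightarrow> tg j \<le> T" and tQ: "\<And>j. j \<in> Q \<Longrightarrow> T + 3 * r \<le> tg j"
     and cent: "\<And>v. expectation (\<lambda>w. g (\<lambda>j. if j \<in> Q then X (tg j) w else if j \<in> P then v j else 0)) = 0"
    for g W Sw P Q tw tg T r
  proof -
    define B where "B = envelope L tw tg r"
    define a where "a = sample Sw tw" define a' where "a' = sample_r r Sw tw"
    define x where "x = sample (P \<union> Q) tg" define x' where "x' = sample_r r (P \<union> Q) tg"
    have K: "Kg \<ge> 0" "Kw \<ge> 0" using hoelder_growth_nonneg[OF g] hoelder_growth_nonneg[OF W] by auto
    have B1: "B w \<ge> 1" for w unfolding B_def by (rule envelope_ge1)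
    have BM[measurable]: "B \<in> borel_measurable M" unfolding B_def by measurable
    have Bint: "integrable M (\<lambda>w. B w powr m)" "expectation (\<lambda>w. B w powr m) \<le> \<Gamma>" unfolding B_def by (rule \<Gamma>)+
    have dom: "norm (a w j) \<le> B w" "norm (a' w j) \<le> B w" "norm (x w j) \<le> B w" "norm (x' w j) \<le> B w" if "j \<in> {1..L}" for w j
      unfolding a_def a'_def x_def x'_def B_def using sample_dom[OF that] by auto
    have meas[measurable]: "(\<lambda>w. a w j) \<in> borel_measurable M" "(\<lambda>w. a' w j) \<in> borel_measurable M"
      "(\<lambda>w. x w j) \<in> borel_measurable M" "(\<lambda>w. x' w j) \<in> borel_measurable M" for j
      unfolding a_def a'_def x_def x'_def by measurable
    have gm[measurable]: "(\<lambda>w. g (x w)) \<in> borel_measurable M" "(\<lambda>w. g (x' w)) \<in> borel_measurable M"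
      "(\<lambda>w. W (a w)) \<in> borel_measurable M" "(\<lambda>w. W (a' w)) \<in> borel_measurable M"
      by (auto intro!: hg_measurable[OF g] hg_measurable[OF W])
    have int1: "integrable M (\<lambda>w. W (a w) * g (x w))" and int2: "integrable M (\<lambda>w. W (a' w) * g (x' w))"
      using product_integrable(1)[OF g W BM B1 Bint meas(3) dom(3) meas(1) dom(1)]
        product_integrable(1)[OF g W BM B1 Bint meas(4) dom(4) meas(2) dom(2)] by auto
    have ptw: "\<bar>W (a w) * (g (x w) - g (x' w))\<bar>
        \<le> 2 * Kw * Kg * (1 + real L) * (1 + 2 * real L) * B w powr (2 * iota + 1) * (\<Sum>i=1..L. norm (x w i - x' w i) powr delta)" for w
    proof -
      have "\<bar>W (a w)\<bar> * \<bar>g (x w) - g (x' w)\<bar> \<le> (Kw * (1 + real L) * B w powr iota)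
         * (2 * Kg * (1 + 2 * real L) * B w powr (iota + 1) * (\<Sum>i=1..L. norm (x w i - x' w i) powr delta))"
        using hoelder_growth_bound[OF W iota_pos B1[of w] dom(1)]
          hoelder_growth_diff_bound[OF g iota_pos delta_pos less_imp_le[OF delta_lt_kappa] kappa(2) B1[of w] dom(3) dom(4)] K
        by (intro mult_mono) auto
      also have "\<dots> = 2 * Kw * Kg * (1 + real L) * (1 + 2 * real L) * (B w powr iota * B w powr (iota + 1)) * (\<Sum>i=1..L. norm (x w i - x' w i) powr delta)"
        by (simp only: mult_ac)
      also have "B w powr iota * B w powr (iota + 1) = B w powr (2 * iota + 1)" by (simp add: powr_add[symmetric])
      finally show ?thesis by (simp add: abs_mult)
    qed
    have ptw': "\<bar>g (x' w) * (W (a w) - W (a' w))\<bar>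
        \<le> 2 * Kw * Kg * (1 + real L) * (1 + 2 * real L) * B w powr (2 * iota + 1) * (\<Sum>i=1..L. norm (a w i - a' w i) powr delta)" for w
    proof -
      have "\<bar>g (x' w)\<bar> * \<bar>W (a w) - W (a' w)\<bar> \<le> (Kg * (1 + real L) * B w powr iota)
         * (2 * Kw * (1 + 2 * real L) * B w powr (iota + 1) * (\<Sum>i=1..L. norm (a w i - a' w i) powr delta))"
        using hoelder_growth_bound[OF g iota_pos B1[of w] dom(4)]
          hoelder_growth_diff_bound[OF W iota_pos delta_pos less_imp_le[OF delta_lt_kappa] kappa(2) B1[of w] dom(1) dom(2)] K
        by (intro mult_mono) auto
      also have "\<dots> = 2 * Kw * Kg * (1 + real L) * (1 + 2 * real L) * (B w powr iota * B w powr (iota + 1)) * (\<Sum>i=1..L. norm (a w i - a' w i) powr delta)"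
        by (simp only: mult_ac)
      also have "B w powr iota * B w powr (iota + 1) = B w powr (2 * iota + 1)" by (simp add: powr_add[symmetric])
      finally show ?thesis by (simp add: abs_mult)
    qed
    have dX: "integrable M (\<lambda>w. norm (x w i - x' w i) powr qe)" "expectation (\<lambda>w. norm (x w i - x' w i) powr qe) \<le> rho r powr (qe / delta)"
      and dA: "integrable M (\<lambda>w. norm (a w i - a' w i) powr qe)" "expectation (\<lambda>w. norm (a w i - a' w i) powr qe) \<le> rho r powr (qe / delta)" for i
      unfolding x_def x'_def a_def a'_def by (rule sample_diff_moment[OF r])+
    have fm: "(\<lambda>w. W (a w) * (g (x w) - g (x' w))) \<in> borel_measurable M" "(\<lambda>w. g (x' w) * (W (a w) - W (a' w))) \<in> borel_measurable M"
      by measurable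
    have Zm: "(\<lambda>w. x w i - x' w i) \<in> borel_measurable M" "(\<lambda>w. a w i - a' w i) \<in> borel_measurable M" for i
      by measurable
    have ex: "0 \<le> 2 * iota + 1" "2 * iota + 1 \<le> 2 * iota + 4" "0 \<le> iota + 1" "iota + 1 \<le> 2 * iota + 4" using iota_pos by auto
    have c0: "0 \<le> 2 * Kw * Kg * (1 + real L) * (1 + 2 * real L)" using K by simp
    note s1 = difference_moment[OF fm(1) BM B1 Bint Zm(1) dX ex(1,2) c0 ptw, folded cA_def]
    note s2 = difference_moment[OF fm(2) BM B1 Bint Zm(2) dA ex(1,2) c0 ptw', folded cA_def]
    have step1: "\<bar>expectation (\<lambda>w. W (a w) * g (x w)) - expectation (\<lambda>w. W (a' w) * g (x' w))\<bar> \<le> 2 * cA * rho r"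
    proof -
      have "expectation (\<lambda>w. W (a w) * g (x w)) - expectation (\<lambda>w. W (a' w) * g (x' w))
        = expectation (\<lambda>w. W (a w) * g (x w) - W (a' w) * g (x' w))" using int1 int2 by simp
      also have "\<dots> = expectation (\<lambda>w. W (a w) * (g (x w) - g (x' w)) + g (x' w) * (W (a w) - W (a' w)))"
        by (simp add: algebra_simps)
      also have "\<dots> = expectation (\<lambda>w. W (a w) * (g (x w) - g (x' w))) + expectation (\<lambda>w. g (x' w) * (W (a w) - W (a' w)))"
        using s1 s2 by simp
      finally have eq: "expectation (\<lambda>w. W (a w) * g (x w)) - expectation (\<lambda>w. W (a' w) * g (x' w))
        = expectation (\<lambda>w. W (a w) * (g (x w) - g (x' w))) + expectation (\<lambda>w. g (x' w) * (W (a w) - W (a' w)))" .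
      have "\<bar>expectation (\<lambda>w. W (a w) * (g (x w) - g (x' w)))\<bar> \<le> cA * rho r"
        by (rule order_trans[OF integral_abs_bound s1(2)])
      moreover have "\<bar>expectation (\<lambda>w. g (x' w) * (W (a w) - W (a' w)))\<bar> \<le> cA * rho r"
        by (rule order_trans[OF integral_abs_bound s2(2)])
      ultimately show ?thesis unfolding eq by linarith
    qed
    define W' where "W' w = W (a' w)" for w
    define \<xi>' where "\<xi>' = sample_r r P tg"
    define \<eta>' where "\<eta>' j = (if j \<in> Q then Xr r (tg j) else (\<lambda>_. 0))" for j
    \<comment> \<open>Windows of radius \<open>r\<close> push the past up to \<open>T + r\<close>
      and the future down to \<open>T + 2 * r\<close>; of the gap \<open>3 * r\<close> a length
      \<open>r\<close> remains.\<close>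
    interpret ch: chain M Fam X iota kappa p qe delta m L Kg cW \<Gamma> \<Gamma>q \<zeta> \<theta> D0 g W' P Q \<xi>' \<eta>' B "T + r" "T + 2 * r" r
    proof unfold_locales
      show "hoelder_growth L Kg iota kappa g" by (rule g)
      show "(\<lambda>w. \<xi>' w j) \<in> borel_measurable (past (T + r))" for j
        using tP[of j] by (cases "j \<in> P") (auto simp: \<xi>'_def sample_r_def intro!: Xr_past)
      show "\<eta>' j \<in> borel_measurable (future (T + 2 * r))" for j
        using tQ[of j] by (auto simp: \<eta>'_def intro!: Xr_future)
      show "integrable M (\<lambda>w. norm (\<eta>' j w) powr (qe * iota))" "expectation (\<lambda>w. norm (\<eta>' j w) powr (qe * iota)) \<le> \<Gamma>q" for j
        using \<Gamma>q0[of r "tg j"] pq iota_pos by (auto simp: \<eta>'_def \<Gamma>q_def)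
      show "norm (\<xi>' w j) \<le> B w" for w j
        using P(1) dom(4)[of j w] B1[of w] by (auto simp: \<xi>'_def sample_r_def x'_def)
      show "norm (\<eta>' j w) \<le> B w" for w j
        using Q dom(4)[of j w] B1[of w] by (auto simp: \<eta>'_def sample_r_def x'_def)
      show "W' \<in> borel_measurable (past (T + r))" unfolding W'_def
      proof (rule hg_measurable[OF W])
        show "(\<lambda>w. a' w j) \<in> borel_measurable (past (T + r))" for j
          using tw[of j] by (cases "j \<in> Sw") (auto simp: a'_def sample_r_def intro!: Xr_past)
      qed
      show "\<bar>W' w\<bar> \<le> cW * B w powr iota" for w
        unfolding W'_def cW_def by (rule hoelder_growth_bound[OF W iota_pos B1 dom(2)])
      show "\<xi>' w j = 0" if "j \<notin> P" for j w using that by (simp add: \<xi>'_def sample_r_def)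
    qed (use th zeta P PQ r Bint B1 in auto)
    have C0: "ch.bound_const = C0"
      unfolding ch.bound_const_def ch.C2_def ch.c1_def C0_def ..
    have yx: "ch.y (\<xi>' w) w = x' w" for w
      using PQ by (auto simp: ch.y_def x'_def \<xi>'_def \<eta>'_def sample_r_def fun_eq_iff)
    have step2: "\<bar>expectation (\<lambda>w. W' w * (g (x' w) - ch.ghat (\<xi>' w)))\<bar> \<le> C0 * rho r"
      using ch.chain_bound unfolding yx C0 .
    \<comment> \<open>With the past frozen at the value for \<open>w0\<close>, the mean is compared
      with the vanishing mean for the unapproximated future. Frozen and integrated arguments are
      both dominated by \<open>B w0 * B w\<close>, which separates the parameter from the
      integration.\<close>
    have ghat_le: "\<bar>ch.ghat (\<xi>' w0)\<bar> \<le> c3 * rho r * B w0 powr (iota + 1)" for w0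
    proof -
      define v where "v = \<xi>' w0"
      define u where "u w j = (if j \<in> Q then X (tg j) w else if j \<in> P then v j else 0)" for w j
      have v0: "v j = 0" if "j \<notin> P" for j using that by (simp add: v_def \<xi>'_def sample_r_def)
      have vB: "norm (v j) \<le> B w0" for j unfolding v_def by (rule ch.Bdom)
      have B2: "B w0 * B w \<ge> 1" "B w0 \<le> B w0 * B w" "B w \<le> B w0 * B w" for w
        using B1[of w] B1[of w0] mult_mono[of 1 "B w0" 1 "B w"] by (auto simp: mult_le_cancel_left1 mult_le_cancel_right1)
      have um[measurable]: "(\<lambda>w. u w j) \<in> borel_measurable M" for j
        by (cases "j \<in> Q") (auto simp: u_def)
      have ym[measurable]: "(\<lambda>w. ch.y v w j) \<in> borel_measurable M" for j
        by (rule ch.y_measurable) auto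
      have ud: "norm (u w j) \<le> B w0 * B w" "norm (ch.y v w j) \<le> B w0 * B w" if "j \<in> {1..L}" for w j
        using dom(3)[OF that, of w] ch.Bdom(2)[of j w] vB[of j] B2[of w] v0[of j] unfolding u_def ch.y_def x_def sample_def
        by (auto split: if_splits intro: order_trans)
      have diff: "\<bar>g (u w) - g (ch.y v w)\<bar> \<le> (2 * Kg * (1 + 2 * real L) * B w0 powr (iota + 1)) * B w powr (iota + 1)
         * (\<Sum>i=1..L. norm (sample Q tg w i - sample_r r Q tg w i) powr delta)" for w
      proof -
        have "\<bar>g (u w) - g (ch.y v w)\<bar> \<le> 2 * Kg * (1 + 2 * real L) * (B w0 * B w) powr (iota + 1) * (\<Sum>i=1..L. norm (u w i - ch.y v w i) powr delta)"
          by (rule hoelder_growth_diff_bound[OF g iota_pos delta_pos less_imp_le[OF delta_lt_kappa] kappa(2) B2(1) ud])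
        also have "(\<Sum>i=1..L. norm (u w i - ch.y v w i) powr delta) = (\<Sum>i=1..L. norm (sample Q tg w i - sample_r r Q tg w i) powr delta)"
          by (intro sum.cong refl) (auto simp: u_def ch.y_def sample_def sample_r_def \<eta>'_def v0)
        finally show ?thesis by (simp add: powr_mult mult.assoc)
      qed
      have dm: "integrable M (\<lambda>w. g (u w) - g (ch.y v w))"
        "expectation (\<lambda>w. \<bar>g (u w) - g (ch.y v w)\<bar>) \<le> (2 * Kg * (1 + 2 * real L) * B w0 powr (iota + 1)) * real L * (2 + \<Gamma>) * rho r"
      proof -
        have f: "(\<lambda>w. g (u w) - g (ch.y v w)) \<in> borel_measurable M"
          using hg_measurable[OF g um] hg_measurable[OF g ym] by measurable
        have z: "(\<lambda>w. sample Q tg w i - sample_r r Q tg w i) \<in> borel_measurable M" for i by measurable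
        have c: "0 \<le> 2 * Kg * (1 + 2 * real L) * B w0 powr (iota + 1)" using K by simp
        show "integrable M (\<lambda>w. g (u w) - g (ch.y v w))"
          "expectation (\<lambda>w. \<bar>g (u w) - g (ch.y v w)\<bar>) \<le> (2 * Kg * (1 + 2 * real L) * B w0 powr (iota + 1)) * real L * (2 + \<Gamma>) * rho r"
          by (rule difference_moment[OF f BM B1 Bint z sample_diff_moment[OF r] ex(3,4) c diff])+
      qed
      have iy: "integrable M (\<lambda>w. g (ch.y v w))" by (rule ch.g_integrable)
      have iu: "integrable M (\<lambda>w. g (u w))"
        using Bochner_Integration.integrable_add[OF dm(1) iy] by simp
      have "ch.ghat v = - expectation (\<lambda>w. g (u w) - g (ch.y v w))"
        using iy iu cent[of v] unfolding ch.ghat_def u_def by simp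
      then have "\<bar>ch.ghat v\<bar> \<le> expectation (\<lambda>w. \<bar>g (u w) - g (ch.y v w)\<bar>)"
        using integral_abs_bound[of M "\<lambda>w. g (u w) - g (ch.y v w)"] by simp
      also have "\<dots> \<le> c3 * rho r * B w0 powr (iota + 1)" using dm(2) by (simp add: c3_def mult_ac)
      finally show ?thesis unfolding v_def .
    qed
    have gh_meas: "(\<lambda>w. W' w * ch.ghat (\<xi>' w)) \<in> borel_measurable M"
      using ch.g_composed_measurable(2)[OF ch.\<xi>M] ch.WM by measurable
    have gh_dom: "\<bar>W' w * ch.ghat (\<xi>' w)\<bar> \<le> cW * c3 * rho r * B w powr m" for w
    proof -
      have c30: "c3 \<ge> 0" using K \<Gamma>0 by (simp add: c3_def)
      have "\<bar>W' w\<bar> * \<bar>ch.ghat (\<xi>' w)\<bar> \<le> (cW * B w powr iota) * (c3 * rho r * B w powr (iota + 1))"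
        using ch.W(2)[of w] ghat_le[of w] ch.cW0 by (intro mult_mono) auto
      also have "\<dots> = cW * c3 * rho r * (B w powr iota * B w powr (iota + 1))" by (simp only: mult_ac)
      also have "\<dots> \<le> cW * c3 * rho r * B w powr m"
        unfolding powr_add[symmetric] using ch.cW0 c30 rho_pos[of r] B1[of w] m_ge iota_pos
        by (intro mult_left_mono powr_mono) auto
      finally show ?thesis by (simp add: abs_mult)
    qed
    have gh_int: "integrable M (\<lambda>w. W' w * ch.ghat (\<xi>' w))"
      by (rule Bochner_Integration.integrable_bound[where f="\<lambda>w. cW * c3 * rho r * B w powr m"])
         (use Bint gh_meas order_trans[OF gh_dom abs_ge_self] in auto)
    have step3: "\<bar>expectation (\<lambda>w. W' w * ch.ghat (\<xi>' w))\<bar> \<le> cW * c3 * \<Gamma> * rho r"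
    proof -
      have c30: "c3 \<ge> 0" using K \<Gamma>0 by (simp add: c3_def)
      have "\<bar>expectation (\<lambda>w. W' w * ch.ghat (\<xi>' w))\<bar> \<le> expectation (\<lambda>w. \<bar>W' w * ch.ghat (\<xi>' w)\<bar>)" by (rule integral_abs_bound)
      also have "\<dots> \<le> expectation (\<lambda>w. cW * c3 * rho r * B w powr m)"
        using gh_int Bint gh_dom by (intro integral_mono) auto
      also have "\<dots> = cW * c3 * rho r * expectation (\<lambda>w. B w powr m)" by simp
      also have "\<dots> \<le> cW * c3 * rho r * \<Gamma>" using ch.cW0 c30 rho_pos[of r] Bint by (intro mult_left_mono) auto
      finally show ?thesis by (simp add: mult_ac)
    qed
    have "expectation (\<lambda>w. W (a' w) * g (x' w)) = expectation (\<lambda>w. W' w * (g (x' w) - ch.ghat (\<xi>' w))) + expectation (\<lambda>w. W' w * ch.ghat (\<xi>' w))"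
      using int2 gh_int unfolding W'_def by (simp add: right_diff_distrib)
    then have "\<bar>expectation (\<lambda>w. W (a w) * g (x w))\<bar> \<le> 2 * cA * rho r + C0 * rho r + cW * c3 * \<Gamma> * rho r"
      using step1 step2 step3 by linarith
    then have "\<bar>expectation (\<lambda>w. W (a w) * g (x w))\<bar> \<le> C * rho r" by (simp add: C_def distrib_right)
    also have "\<dots> \<le> \<bar>C\<bar> * rho r" using rho_pos[of r] by (intro mult_right_mono) auto
    finally show ?thesis unfolding a_def x_def .
  qed
  show ?thesis
    by (intro exI[of _ "\<bar>C\<bar>"] conjI abs_ge_zero allI impI, rule key) auto
qed

end

section \<open>Limits along several slopes\<close>

lemma product_sums_bounded:
  assumes "f \<in> product_sums A" "finite A"
  shows "\<exists>B. \<forall>x. \<bar>f x\<bar> \<le> B"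
  using assms(1)
proof induction
  case (product g c)
  then have "\<forall>a\<in>A. \<exists>B. \<forall>x. \<bar>g a x\<bar> \<le> B" unfolding bounded_lipschitz_def by blast
  then obtain B where B: "\<And>a x. a \<in> A \<Longrightarrow> \<bar>g a x\<bar> \<le> B a" by metis
  have "\<bar>c * (\<Prod>a\<in>A. g a (x a))\<bar> \<le> \<bar>c\<bar> * (\<Prod>a\<in>A. B a)" for x
    unfolding abs_mult abs_prod by (intro mult_left_mono prod_mono) (use B in auto)
  then show ?case by blast
next
  case (add f g)
  then obtain B C where "\<And>x. \<bar>f x\<bar> \<le> B" "\<And>x. \<bar>g x\<bar> \<le> C" by blast
  then have "\<bar>f x + g x\<bar> \<le> B + C" for x by (metis abs_triangle_ineq add_mono order_trans)
  then show ?case by blast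
qed

lemma product_sums_measurable:
  fixes f :: "('i \<Rightarrow> 'b::{real_normed_vector,second_countable_topology}) \<Rightarrow> real"
  assumes "f \<in> product_sums A" "\<And>a. a \<in> A \<Longrightarrow> (\<lambda>w. z w a) \<in> borel_measurable N"
  shows "(\<lambda>w. f (z w)) \<in> borel_measurable N"
  using assms(1)
proof induction
  case (product g c)
  have "(\<lambda>w. g a (z w a)) \<in> borel_measurable N" if "a \<in> A" for a
    using measurable_compose[OF assms(2)[OF that] bounded_lipschitz_measurable[OF product[OF that]]] .
  then show ?case by (intro borel_measurable_times borel_measurable_prod) auto
qed auto

lemma prod_lipschitz_diff:
  fixes f :: "'i \<Rightarrow> 'b::real_normed_vector \<Rightarrow> real"
  assumes A: "finite A" and f: "\<And>a. a \<in> A \<Longrightarrow> f a \<in> bounded_lipschitz"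
  shows "\<exists>C\<ge>0. \<forall>x z. \<bar>\<Prod>a\<in>A. f a (x a)\<bar> \<le> C \<and> \<bar>(\<Prod>a\<in>A. f a (x a)) - (\<Prod>a\<in>A. f a (z a))\<bar> \<le> C * (\<Sum>a\<in>A. norm (x a - z a))"
  using A f
proof (induction A)
  case empty
  then show ?case by (intro exI[of _ 1]) auto
next
  case (insert b A)
  obtain C where C: "C \<ge> 0" "\<And>x. \<bar>\<Prod>a\<in>A. f a (x a)\<bar> \<le> C"
    "\<And>x z. \<bar>(\<Prod>a\<in>A. f a (x a)) - (\<Prod>a\<in>A. f a (z a))\<bar> \<le> C * (\<Sum>a\<in>A. norm (x a - z a))"
    using insert by auto
  obtain B D where B: "B \<ge> 0" "D \<ge> 0" "\<And>x. \<bar>f b x\<bar> \<le> B" "\<And>x y. \<bar>f b x - f b y\<bar> \<le> D * norm (x - y)"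
    using bounded_lipschitzE[of "f b"] insert.prems by auto
  define E where "E = B * C + D * C"
  have "\<bar>\<Prod>a\<in>insert b A. f a (x a)\<bar> \<le> E" for x
  proof -
    have "\<bar>f b (x b)\<bar> * \<bar>\<Prod>a\<in>A. f a (x a)\<bar> \<le> B * C" using B C by (intro mult_mono) auto
    also have "\<dots> \<le> E" using B C by (simp add: E_def)
    finally show ?thesis using insert by (simp add: abs_mult)
  qed
  moreover have "\<bar>(\<Prod>a\<in>insert b A. f a (x a)) - (\<Prod>a\<in>insert b A. f a (z a))\<bar> \<le> E * (\<Sum>a\<in>insert b A. norm (x a - z a))" for x z
  proof -
    let ?p = "\<lambda>x. \<Prod>a\<in>A. f a (x a)" and ?s = "\<Sum>a\<in>A. norm (x a - z a)"
    have s0: "?s \<ge> 0" by (simp add: sum_nonneg)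
    have "f b (x b) * ?p x - f b (z b) * ?p z = f b (x b) * (?p x - ?p z) + (f b (x b) - f b (z b)) * ?p z"
      by (simp add: algebra_simps)
    then have "\<bar>f b (x b) * ?p x - f b (z b) * ?p z\<bar> \<le> \<bar>f b (x b)\<bar> * \<bar>?p x - ?p z\<bar> + \<bar>f b (x b) - f b (z b)\<bar> * \<bar>?p z\<bar>"
      using abs_triangle_ineq[of "f b (x b) * (?p x - ?p z)" "(f b (x b) - f b (z b)) * ?p z"] by (simp only: abs_mult)
    also have "\<dots> \<le> B * (C * ?s) + (D * norm (x b - z b)) * C"
      using B C by (intro add_mono mult_mono) auto
    also have "\<dots> \<le> E * (norm (x b - z b) + ?s)"
      using B C s0 by (simp add: E_def algebra_simps)
    finally show ?thesis using insert by simp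
  qed
  moreover have "E \<ge> 0" using B C by (simp add: E_def)
  ultimately show ?case by blast
qed

context mixing_process begin

lemma rho_tendsto_0: "rho \<longlonglongrightarrow> 0"
  by (rule summable_LIMSEQ_zero[OF rho_summable'])

text \<open>\<open>mixed_moment\<close> with the trivial envelope 1, so that
  \<open>2 + \<Gamma>\<close> becomes 3.\<close>

lemma X_diff_Xr_L1:
  assumes r: "r \<ge> 1"
  shows "integrable M (\<lambda>w. norm (X k w - Xr r k w))" "expectation (\<lambda>w. norm (X k w - Xr r k w)) \<le> 3 * rho r powr (1 / delta)"
proof -
  define s where "s = rho r powr (1 / delta)"
  have s: "s > 0" unfolding s_def using rho_pos[of r] by (simp add: powr_gt_zero)
  have sq: "s powr qe = rho r powr (qe / delta)" unfolding s_def by (simp add: powr_powr)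
  have U: "integrable M (\<lambda>w. norm (X k w - Xr r k w) powr qe / s powr qe)"
    "expectation (\<lambda>w. norm (X k w - Xr r k w) powr qe / s powr qe) \<le> 1"
    unfolding sq using X_diff_Xr[OF r, of k] rho_pos[of r] by (auto simp: divide_le_eq powr_gt_zero)
  have le: "\<bar>norm (X k w - Xr r k w)\<bar> \<le> s * (1 powr 0 * (norm (X k w - Xr r k w) powr qe / s powr qe) powr (1 / qe))" for w
    using pq s by (simp add: powr_divide[symmetric] powr_powr)
  note mm = mixed_moment[OF _ _ _ _ _ U _ _ _ _ _ le, of 1 1]
  show "integrable M (\<lambda>w. norm (X k w - Xr r k w))"
    by (rule mm(1)) (use pq s in \<open>auto simp: prob_space\<close>)
  have "expectation (\<lambda>w. \<bar>norm (X k w - Xr r k w)\<bar>) \<le> s * (2 + 1)"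
    by (rule mm(2)) (use pq s in \<open>auto simp: prob_space\<close>)
  then show "expectation (\<lambda>w. norm (X k w - Xr r k w)) \<le> 3 * rho r powr (1 / delta)" by (simp add: s_def)
qed

text \<open>Since \<open>U\<close> is measurable with respect to the past, the covariance is the
  mean of \<open>U\<close> times the deviation \<open>D\<close> of the conditional expectation of
  \<open>V\<close>, and \<open>varpi\<close> controls \<open>D\<close> in the p-norm.\<close>

lemma covariance_bound:
  assumes r: "r \<ge> 1" "T + r \<le> S" and U: "U \<in> borel_measurable (past T)" "\<And>w. \<bar>U w\<bar> \<le> b"
    and V: "V \<in> borel_measurable (future S)" "\<And>w. \<bar>V w\<bar> \<le> b" and b: "b > 0"
  shows "\<bar>expectation (\<lambda>w. U w * V w) - expectation U * expectation V\<bar> \<le> 3 * b * b * rho r"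
proof -
  interpret sub: sigma_finite_subalgebra M "past T" by (rule sigma_finite_subalgebraI[OF subalgebras(1)])
  have UM[measurable]: "U \<in> borel_measurable M" using measurable_from_subalg[OF subalgebras(1) U(1)] .
  have VM[measurable]: "V \<in> borel_measurable M" using measurable_from_subalg[OF subalgebras(2) V(1)] .
  have intU: "integrable M U" by (rule integrable_const_bound[of _ b]) (use U in auto)
  have intV: "integrable M V" by (rule integrable_const_bound[of _ b]) (use V in auto)
  have UV: "\<bar>U w * V w\<bar> \<le> b * b" for w unfolding abs_mult using U(2) V(2) b by (intro mult_mono) auto
  have intUV: "integrable M (\<lambda>w. U w * V w)" by (rule integrable_const_bound[of _ "b * b"]) (use UV in auto)
  define D where "D w = real_cond_exp M (past T) V w - expectation V" for w
  have Vq: "integrable M (\<lambda>w. \<bar>V w\<bar> powr qe)" "expectation (\<lambda>w. \<bar>V w\<bar> powr qe) \<le> b powr qe"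
  proof -
    have le: "\<bar>V w\<bar> powr qe \<le> b powr qe" for w using V(2) pq by (intro powr_mono2) auto
    show i: "integrable M (\<lambda>w. \<bar>V w\<bar> powr qe)" by (rule integrable_const_bound[of _ "b powr qe"]) (use le in auto)
    show "expectation (\<lambda>w. \<bar>V w\<bar> powr qe) \<le> b powr qe"
      using integral_mono[OF i _ le] by (simp add: prob_space)
  qed
  note cb = cond_exp_past_bound[OF r V(1) b Vq]
  define l where "l = rho r * b"
  have l: "l > 0" using rho_pos b by (simp add: l_def)
  have Dm[measurable]: "D \<in> borel_measurable M" unfolding D_def by measurable
  have Q: "integrable M (\<lambda>w. \<bar>D w\<bar> powr p / l powr p)" "expectation (\<lambda>w. \<bar>D w\<bar> powr p / l powr p) \<le> 1"
    using cb(2,3) l by (auto simp: D_def l_def divide_le_eq)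
  have "\<bar>U w * D w\<bar> \<le> b * l * (1 powr 0 * (\<bar>D w\<bar> powr p / l powr p) powr (1 / p))" for w
  proof -
    have "(\<bar>D w\<bar> powr p / l powr p) powr (1 / p) = \<bar>D w\<bar> / l"
      using pq l by (simp add: powr_divide[symmetric] powr_powr)
    then show ?thesis using U(2)[of w] l by (simp add: abs_mult mult_right_mono)
  qed
  note mm = mixed_moment(3)[OF _ _ _ _ _ Q _ _ _ _ _ this, of 1 1]
  have main: "\<bar>expectation (\<lambda>w. U w * D w)\<bar> \<le> b * l * (2 + 1)"
    by (rule mm) (use pq b l in \<open>auto simp: prob_space\<close>)
  have "expectation (\<lambda>w. U w * D w) = expectation (\<lambda>w. U w * real_cond_exp M (past T) V w - U w * expectation V)"
    by (simp add: D_def right_diff_distrib)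
  also have "\<dots> = expectation (\<lambda>w. U w * V w) - expectation U * expectation V"
    using sub.real_cond_exp_intg[OF intUV U(1) VM] intU by simp
  finally show ?thesis using main by (simp add: l_def mult_ac)
qed

text \<open>Window approximation costs \<open>rho powr (1 / delta)\<close> per factor in L1, after
  which the past and future products are a distance \<open>r\<close> apart and
  \<open>covariance_bound\<close> applies. Only the limit zero matters here, so this cruder rate is
  sufficient.\<close>

lemma product_mixing:
  assumes A: "finite A1" "finite A2" "A1 \<inter> A2 = {}" and f: "\<And>a. a \<in> A1 \<union> A2 \<Longrightarrow> f a \<in> bounded_lipschitz"
  shows "\<exists>C\<ge>0. \<forall>\<tau> T r. r \<ge> 1 \<longrightarrow> (\<forall>a\<in>A1. \<tau> a \<le> T) \<longrightarrow> (\<forall>a\<in>A2. T + 3 * r \<le> \<tau> a) \<longrightarrow>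
    \<bar>expectation (\<lambda>w. \<Prod>a\<in>A1 \<union> A2. f a (X (\<tau> a) w)) - expectation (\<lambda>w. \<Prod>a\<in>A1. f a (X (\<tau> a) w)) * expectation (\<lambda>w. \<Prod>a\<in>A2. f a (X (\<tau> a) w))\<bar>
      \<le> C * (rho r + rho r powr (1 / delta))"
proof -
  obtain C1 where C1: "C1 \<ge> 0" "\<And>x. \<bar>\<Prod>a\<in>A1. f a (x a)\<bar> \<le> C1"
    "\<And>x z. \<bar>(\<Prod>a\<in>A1. f a (x a)) - (\<Prod>a\<in>A1. f a (z a))\<bar> \<le> C1 * (\<Sum>a\<in>A1. norm (x a - z a))"
    using prod_lipschitz_diff[OF A(1), of f] f by auto
  obtain C2 where C2: "C2 \<ge> 0" "\<And>x. \<bar>\<Prod>a\<in>A2. f a (x a)\<bar> \<le> C2"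
    "\<And>x z. \<bar>(\<Prod>a\<in>A2. f a (x a)) - (\<Prod>a\<in>A2. f a (z a))\<bar> \<le> C2 * (\<Sum>a\<in>A2. norm (x a - z a))"
    using prod_lipschitz_diff[OF A(2), of f] f by auto
  define b where "b = 1 + C1 + C2"
  have b: "b > 0" "C1 \<le> b" "C2 \<le> b" using C1(1) C2(1) by (auto simp: b_def)
  define n where "n = real (card A1) + real (card A2)"
  define C where "C = 3 * b * b + 6 * b * b * n"
  have C0: "C \<ge> 0" using b by (simp add: C_def n_def)
  have key: "\<bar>expectation (\<lambda>w. \<Prod>a\<in>A1 \<union> A2. f a (X (\<tau> a) w)) - expectation (\<lambda>w. \<Prod>a\<in>A1. f a (X (\<tau> a) w)) * expectation (\<lambda>w. \<Prod>a\<in>A2. f a (X (\<tau> a) w))\<bar>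
      \<le> C * (rho r + rho r powr (1 / delta))"
    if r: "r \<ge> 1" and t1: "\<And>a. a \<in> A1 \<Longrightarrow> \<tau> a \<le> T" and t2: "\<And>a. a \<in> A2 \<Longrightarrow> T + 3 * r \<le> \<tau> a" for \<tau> T r
  proof -
    define s where "s = rho r powr (1 / delta)"
    define U where "U w = (\<Prod>a\<in>A1. f a (X (\<tau> a) w))" for w
    define V where "V w = (\<Prod>a\<in>A2. f a (X (\<tau> a) w))" for w
    define U' where "U' w = (\<Prod>a\<in>A1. f a (Xr r (\<tau> a) w))" for w
    define V' where "V' w = (\<Prod>a\<in>A2. f a (Xr r (\<tau> a) w))" for w
    have fm: "a \<in> A1 \<union> A2 \<Longrightarrow> f a \<in> borel_measurable borel" for a using f bounded_lipschitz_measurable by blast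
    have [measurable]: "U \<in> borel_measurable M" "V \<in> borel_measurable M" "U' \<in> borel_measurable M" "V' \<in> borel_measurable M"
      unfolding U_def V_def U'_def V'_def
      by (auto intro!: borel_measurable_prod measurable_compose[OF _ fm])
    have bd: "\<bar>U w\<bar> \<le> b" "\<bar>V w\<bar> \<le> b" "\<bar>U' w\<bar> \<le> b" "\<bar>V' w\<bar> \<le> b" for w
      unfolding U_def V_def U'_def V'_def
      using C1(2)[of "\<lambda>a. X (\<tau> a) w"] C2(2)[of "\<lambda>a. X (\<tau> a) w"] C1(2)[of "\<lambda>a. Xr r (\<tau> a) w"] C2(2)[of "\<lambda>a. Xr r (\<tau> a) w"] b
      by linarith+
    have int: "integrable M U" "integrable M V" "integrable M U'" "integrable M V'"
      by (rule integrable_const_bound[of _ b]; use bd in simp)+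
    have bb: "\<bar>x * y\<bar> \<le> b * b" if "\<bar>x\<bar> \<le> b" "\<bar>y\<bar> \<le> b" for x y :: real
      unfolding abs_mult using that b by (intro mult_mono) auto
    have int2: "integrable M (\<lambda>w. U w * V w)" "integrable M (\<lambda>w. U' w * V' w)"
      by (rule integrable_const_bound[of _ "b * b"]; use bd bb in simp)+
    have U'p: "U' \<in> borel_measurable (past (T + r))"
      unfolding U'_def using t1 fm by (intro borel_measurable_prod measurable_compose[OF Xr_past]) auto
    have V'p: "V' \<in> borel_measurable (future (T + 2 * r))"
    proof -
      have "T + 2 * r + r \<le> \<tau> a" if "a \<in> A2" for a using t2[OF that] by simp
      then show ?thesis
        unfolding V'_def using fm by (intro borel_measurable_prod measurable_compose[OF Xr_future]) auto
    qed
    have cov: "\<bar>expectation (\<lambda>w. U' w * V' w) - expectation U' * expectation V'\<bar> \<le> 3 * b * b * rho r"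
      by (rule covariance_bound[OF r _ U'p bd(3) V'p bd(4) b(1)]) (use r in simp)
    have dU: "expectation (\<lambda>w. \<bar>U w - U' w\<bar>) \<le> b * card A1 * (3 * s)"
    proof -
      have le: "\<bar>U w - U' w\<bar> \<le> b * (\<Sum>a\<in>A1. norm (X (\<tau> a) w - Xr r (\<tau> a) w))" for w
        unfolding U_def U'_def using b
        by (intro order_trans[OF C1(3)[of "\<lambda>a. X (\<tau> a) w" "\<lambda>a. Xr r (\<tau> a) w"]] mult_right_mono) (auto simp: sum_nonneg)
      have "expectation (\<lambda>w. \<bar>U w - U' w\<bar>) \<le> expectation (\<lambda>w. b * (\<Sum>a\<in>A1. norm (X (\<tau> a) w - Xr r (\<tau> a) w)))"
        using int X_diff_Xr_L1(1)[OF r] le by (intro integral_mono) auto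
      also have "\<dots> = b * (\<Sum>a\<in>A1. expectation (\<lambda>w. norm (X (\<tau> a) w - Xr r (\<tau> a) w)))"
        using X_diff_Xr_L1(1)[OF r] by simp
      also have "\<dots> \<le> b * (\<Sum>a\<in>A1. 3 * s)" unfolding s_def
        using b by (intro mult_left_mono sum_mono X_diff_Xr_L1(2)[OF r]) auto
      finally show ?thesis by simp
    qed
    have dV: "expectation (\<lambda>w. \<bar>V w - V' w\<bar>) \<le> b * card A2 * (3 * s)"
    proof -
      have le: "\<bar>V w - V' w\<bar> \<le> b * (\<Sum>a\<in>A2. norm (X (\<tau> a) w - Xr r (\<tau> a) w))" for w
        unfolding V_def V'_def using b
        by (intro order_trans[OF C2(3)[of "\<lambda>a. X (\<tau> a) w" "\<lambda>a. Xr r (\<tau> a) w"]] mult_right_mono) (auto simp: sum_nonneg)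
      have "expectation (\<lambda>w. \<bar>V w - V' w\<bar>) \<le> expectation (\<lambda>w. b * (\<Sum>a\<in>A2. norm (X (\<tau> a) w - Xr r (\<tau> a) w)))"
        using int X_diff_Xr_L1(1)[OF r] le by (intro integral_mono) auto
      also have "\<dots> = b * (\<Sum>a\<in>A2. expectation (\<lambda>w. norm (X (\<tau> a) w - Xr r (\<tau> a) w)))"
        using X_diff_Xr_L1(1)[OF r] by simp
      also have "\<dots> \<le> b * (\<Sum>a\<in>A2. 3 * s)" unfolding s_def
        using b by (intro mult_left_mono sum_mono X_diff_Xr_L1(2)[OF r]) auto
      finally show ?thesis by simp
    qed
    have eU: "\<bar>expectation U - expectation U'\<bar> \<le> expectation (\<lambda>w. \<bar>U w - U' w\<bar>)"
      using int integral_abs_bound[of M "\<lambda>w. U w - U' w"] by simp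
    have eV: "\<bar>expectation V - expectation V'\<bar> \<le> expectation (\<lambda>w. \<bar>V w - V' w\<bar>)"
      using int integral_abs_bound[of M "\<lambda>w. V w - V' w"] by simp
    have e1: "\<bar>expectation U\<bar> \<le> b" "\<bar>expectation V'\<bar> \<le> b"
    proof -
      have "expectation (\<lambda>w. \<bar>U w\<bar>) \<le> b" "expectation (\<lambda>w. \<bar>V' w\<bar>) \<le> b"
        using integral_mono[of M "\<lambda>w. \<bar>U w\<bar>" "\<lambda>_. b"] integral_mono[of M "\<lambda>w. \<bar>V' w\<bar>" "\<lambda>_. b"] int bd
        by (auto simp: prob_space)
      then show "\<bar>expectation U\<bar> \<le> b" "\<bar>expectation V'\<bar> \<le> b"
        using integral_abs_bound[of M U] integral_abs_bound[of M V'] by linarith+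
    qed
    have d1: "\<bar>expectation (\<lambda>w. U w * V w) - expectation (\<lambda>w. U' w * V' w)\<bar> \<le> b * expectation (\<lambda>w. \<bar>V w - V' w\<bar>) + b * expectation (\<lambda>w. \<bar>U w - U' w\<bar>)"
    proof -
      have ptw: "\<bar>U w * V w - U' w * V' w\<bar> \<le> b * \<bar>V w - V' w\<bar> + b * \<bar>U w - U' w\<bar>" for w
      proof -
        have "U w * V w - U' w * V' w = U w * (V w - V' w) + V' w * (U w - U' w)" by (simp add: algebra_simps)
        then have "\<bar>U w * V w - U' w * V' w\<bar> \<le> \<bar>U w\<bar> * \<bar>V w - V' w\<bar> + \<bar>V' w\<bar> * \<bar>U w - U' w\<bar>"
          by (metis abs_mult abs_triangle_ineq)
        also have "\<dots> \<le> b * \<bar>V w - V' w\<bar> + b * \<bar>U w - U' w\<bar>"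
          using bd by (intro add_mono mult_right_mono) auto
        finally show ?thesis .
      qed
      have "\<bar>expectation (\<lambda>w. U w * V w) - expectation (\<lambda>w. U' w * V' w)\<bar> \<le> expectation (\<lambda>w. \<bar>U w * V w - U' w * V' w\<bar>)"
        using int2 integral_abs_bound[of M "\<lambda>w. U w * V w - U' w * V' w"] by simp
      also have "\<dots> \<le> expectation (\<lambda>w. b * \<bar>V w - V' w\<bar> + b * \<bar>U w - U' w\<bar>)"
        using int int2 ptw by (intro integral_mono) auto
      also have "\<dots> = b * expectation (\<lambda>w. \<bar>V w - V' w\<bar>) + b * expectation (\<lambda>w. \<bar>U w - U' w\<bar>)"
        using int by simp
      finally show ?thesis .
    qed
    have d2: "\<bar>expectation U * expectation V - expectation U' * expectation V'\<bar> \<le> b * expectation (\<lambda>w. \<bar>V w - V' w\<bar>) + b * expectation (\<lambda>w. \<bar>U w - U' w\<bar>)"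
    proof -
      have "expectation U * expectation V - expectation U' * expectation V'
         = expectation U * (expectation V - expectation V') + expectation V' * (expectation U - expectation U')"
        by (simp add: algebra_simps)
      then have "\<bar>expectation U * expectation V - expectation U' * expectation V'\<bar>
         \<le> \<bar>expectation U\<bar> * \<bar>expectation V - expectation V'\<bar> + \<bar>expectation V'\<bar> * \<bar>expectation U - expectation U'\<bar>"
        by (metis abs_mult abs_triangle_ineq)
      also have "\<dots> \<le> b * expectation (\<lambda>w. \<bar>V w - V' w\<bar>) + b * expectation (\<lambda>w. \<bar>U w - U' w\<bar>)"
        using e1 eU eV b by (intro add_mono mult_mono) auto
      finally show ?thesis .
    qed
    have "b * expectation (\<lambda>w. \<bar>V w - V' w\<bar>) + b * expectation (\<lambda>w. \<bar>U w - U' w\<bar>) \<le> b * (b * card A2 * (3 * s)) + b * (b * card A1 * (3 * s))"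
      using dU dV b by (intro add_mono mult_left_mono) auto
    also have "\<dots> = 3 * b * b * n * s" by (simp add: n_def algebra_simps)
    finally have k: "b * expectation (\<lambda>w. \<bar>V w - V' w\<bar>) + b * expectation (\<lambda>w. \<bar>U w - U' w\<bar>) \<le> 3 * b * b * n * s" .
    have "\<bar>expectation (\<lambda>w. U w * V w) - expectation U * expectation V\<bar> \<le> 3 * b * b * rho r + 2 * (3 * b * b * n * s)"
      using d1 d2 cov k unfolding abs_le_iff by linarith
    also have "\<dots> \<le> 3 * b * b * (rho r + s) + 6 * b * b * n * (rho r + s)"
    proof (rule add_mono)
      have s0: "s \<ge> 0" "rho r \<ge> 0" using rho_pos[of r] by (auto simp: s_def)
      then show "3 * b * b * rho r \<le> 3 * b * b * (rho r + s)" using b by (intro mult_left_mono) auto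
      have "2 * (3 * b * b * n * s) = 6 * b * b * n * s" by simp
      also have "\<dots> \<le> 6 * b * b * n * (rho r + s)" using b s0 by (intro mult_left_mono) (auto simp: n_def)
      finally show "2 * (3 * b * b * n * s) \<le> 6 * b * b * n * (rho r + s)" .
    qed
    also have "\<dots> = C * (rho r + s)" by (simp add: C_def distrib_right)
    finally show ?thesis unfolding U_def V_def s_def using A by (simp add: prod.union_disjoint)
  qed
  show ?thesis by (intro exI[of _ C] conjI C0 allI impI, rule key) auto
qed

text \<open>The class with the largest slope is split off first: all other times stay below
  \<open>(sl b - 1) * t\<close> up to a constant, so the gap grows like \<open>t\<close> and the
  mean factorises in the limit. Inside the split-off class the mean does not depend on
  \<open>t\<close>, by \<open>stat\<close>.\<close>

lemma product_limit:
  fixes cl :: "'i \<Rightarrow> nat" and sl :: "nat \<Rightarrow> nat" and eta :: "'i \<Rightarrow> nat"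
  assumes A: "finite A" and f: "\<And>a. a \<in> A \<Longrightarrow> f a \<in> bounded_lipschitz"
    and sl: "\<And>v. v \<in> cl ` A \<Longrightarrow> sl v \<ge> 1" "\<And>u v. u \<in> cl ` A \<Longrightarrow> v \<in> cl ` A \<Longrightarrow> u < v \<Longrightarrow> sl u < sl v"
    and stat: "\<And>v t. v \<in> cl ` A \<Longrightarrow> expectation (\<lambda>w. \<Prod>a\<in>{a\<in>A. cl a = v}. f a (X (sl v * t + eta a) w)) = e v"
  shows "(\<lambda>t. expectation (\<lambda>w. \<Prod>a\<in>A. f a (X (sl (cl a) * t + eta a) w))) \<longlonglongrightarrow> (\<Prod>v\<in>cl ` A. e v)"
proof -
  have main: "(\<lambda>t. expectation (\<lambda>w. \<Prod>a\<in>{a\<in>A. cl a \<in> S}. f a (X (sl (cl a) * t + eta a) w))) \<longlonglongrightarrow> (\<Prod>v\<in>S. e v)"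
    if "finite S" "S \<subseteq> cl ` A" for S
    using that
  proof (induction S rule: finite_linorder_max_induct)
    case empty
    then show ?case by (simp add: prob_space)
  next
    case (insert b S)
    define A1 where "A1 = {a\<in>A. cl a \<in> S}" define A2 where "A2 = {a\<in>A. cl a = b}"
    have fin: "finite A1" "finite A2" "A1 \<inter> A2 = {}" "A1 \<union> A2 = {a\<in>A. cl a \<in> insert b S}"
      using A insert by (auto simp: A1_def A2_def)
    define c where "c = (\<Sum>a\<in>A. eta a)"
    have eta: "eta a \<le> c" if "a \<in> A" for a unfolding c_def using A that by (intro member_le_sum) auto
    obtain C where C: "C \<ge> 0" "\<And>\<tau> T r. r \<ge> 1 \<Longrightarrow> (\<forall>a\<in>A1. \<tau> a \<le> T) \<Longrightarrow> (\<forall>a\<in>A2. T + 3 * r \<le> \<tau> a) \<Longrightarrow>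
      \<bar>expectation (\<lambda>w. \<Prod>a\<in>A1 \<union> A2. f a (X (\<tau> a) w)) - expectation (\<lambda>w. \<Prod>a\<in>A1. f a (X (\<tau> a) w)) * expectation (\<lambda>w. \<Prod>a\<in>A2. f a (X (\<tau> a) w))\<bar>
      \<le> C * (rho r + rho r powr (1 / delta))"
      using product_mixing[OF fin(1-3), of f] f fin(4) by blast
    define \<tau> where "\<tau> t a = sl (cl a) * t + eta a" for t a
    \<comment> \<open>A third of the guaranteed gap, as \<open>product_mixing\<close> needs room for
      two windows and the mixing distance.\<close>
    define R where "R t = (t - c) div 3" for t
    have Rlim: "filterlim R at_top sequentially"
    proof (subst filterlim_at_top, rule allI)
      fix Z :: nat
      show "\<forall>\<^sub>F t in sequentially. Z \<le> R t"
        using eventually_ge_at_top[of "3 * Z + c"] by eventually_elim (simp add: R_def)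
    qed
    have "(\<lambda>r. C * (rho r + rho r powr (1 / delta))) \<longlonglongrightarrow> C * (0 + 0 powr (1 / delta))"
      using delta_pos by (intro tendsto_intros rho_tendsto_0 tendsto_powr2) (auto simp: rho_pos[THEN less_imp_le])
    then have "(\<lambda>r. C * (rho r + rho r powr (1 / delta))) \<longlonglongrightarrow> 0" using delta_pos by simp
    from filterlim_compose[OF this Rlim]
    have lim0: "(\<lambda>t. C * (rho (R t) + rho (R t) powr (1 / delta))) \<longlonglongrightarrow> 0" .
    have ev: "\<forall>\<^sub>F t in sequentially.
       norm (expectation (\<lambda>w. \<Prod>a\<in>A1 \<union> A2. f a (X (\<tau> t a) w)) - expectation (\<lambda>w. \<Prod>a\<in>A1. f a (X (\<tau> t a) w)) * expectation (\<lambda>w. \<Prod>a\<in>A2. f a (X (\<tau> t a) w)))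
         \<le> C * (rho (R t) + rho (R t) powr (1 / delta))"
      using eventually_ge_at_top[of "c + 3"]
    proof eventually_elim
      case (elim t)
      have R1: "R t \<ge> 1" "c + 3 * R t \<le> t" using elim by (auto simp: R_def)
      have slb: "sl b \<ge> 1" using insert sl(1) by blast
      have 1: "\<forall>a\<in>A1. \<tau> t a \<le> (sl b - 1) * t + c"
      proof
        fix a assume a: "a \<in> A1"
        then have "sl (cl a) < sl b" using insert by (intro sl(2)) (auto simp: A1_def)
        then have "sl (cl a) * t \<le> (sl b - 1) * t" by (intro mult_right_mono) auto
        moreover have "eta a \<le> c" using eta a by (auto simp: A1_def)
        ultimately show "\<tau> t a \<le> (sl b - 1) * t + c" unfolding \<tau>_def by (rule add_mono)
      qed
      have 2: "\<forall>a\<in>A2. (sl b - 1) * t + c + 3 * R t \<le> \<tau> t a"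
      proof
        fix a assume a: "a \<in> A2"
        have "(sl b - 1) * t + t = sl b * t" using slb by (metis add.commute le_add_diff_inverse mult_Suc plus_1_eq_Suc)
        then have "(sl b - 1) * t + c + 3 * R t \<le> sl b * t" using R1(2) by linarith
        then show "(sl b - 1) * t + c + 3 * R t \<le> \<tau> t a" using a by (auto simp: \<tau>_def A2_def)
      qed
      from C(2)[OF R1(1) 1 2] show ?case by simp
    qed
    have diff: "(\<lambda>t. expectation (\<lambda>w. \<Prod>a\<in>A1 \<union> A2. f a (X (\<tau> t a) w)) - expectation (\<lambda>w. \<Prod>a\<in>A1. f a (X (\<tau> t a) w)) * expectation (\<lambda>w. \<Prod>a\<in>A2. f a (X (\<tau> t a) w))) \<longlonglongrightarrow> 0"
      by (rule Lim_null_comparison[OF ev lim0])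
    have e2: "expectation (\<lambda>w. \<Prod>a\<in>A2. f a (X (\<tau> t a) w)) = e b" for t
    proof -
      have "(\<lambda>w. \<Prod>a\<in>A2. f a (X (\<tau> t a) w)) = (\<lambda>w. \<Prod>a\<in>{a\<in>A. cl a = b}. f a (X (sl b * t + eta a) w))"
        unfolding A2_def \<tau>_def by (intro ext prod.cong) auto
      then show ?thesis using stat[of b t] insert by simp
    qed
    have "(\<lambda>t. expectation (\<lambda>w. \<Prod>a\<in>A1. f a (X (\<tau> t a) w)) * e b) \<longlonglongrightarrow> (\<Prod>v\<in>S. e v) * e b"
      using insert unfolding A1_def \<tau>_def by (intro tendsto_mult tendsto_const) auto
    from tendsto_add[OF diff[unfolded e2] this]
    have "(\<lambda>t. expectation (\<lambda>w. \<Prod>a\<in>A1 \<union> A2. f a (X (\<tau> t a) w))) \<longlonglongrightarrow> (\<Prod>v\<in>S. e v) * e b" by simp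
    moreover have "(\<Prod>v\<in>insert b S. e v) = (\<Prod>v\<in>S. e v) * e b"
      using insert by (subst prod.insert) (auto simp: mult.commute)
    ultimately show ?case unfolding fin(4) \<tau>_def by simp
  qed
  have "{a\<in>A. cl a \<in> cl ` A} = A" by auto
  with main[of "cl ` A"] A show ?thesis by simp
qed

end

section \<open>Convergence of means for classes of times with increasing slopes\<close>

lemma integrable_product_sum:
  fixes f :: "('i \<Rightarrow> 'b::{real_normed_vector,second_countable_topology}) \<Rightarrow> real"
  assumes "finite A" "f \<in> product_sums A" "prob_space N" "\<And>a. a \<in> A \<Longrightarrow> (\<lambda>w. z w a) \<in> borel_measurable N"
  shows "integrable N (\<lambda>w. f (z w))"
proof -
  interpret N: prob_space N by (rule assms(3))
  obtain B where B: "\<And>x. \<bar>f x\<bar> \<le> B" using product_sums_bounded[OF assms(2,1)] by blast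
  show ?thesis by (rule N.integrable_const_bound[of _ B]) (use B product_sums_measurable[OF assms(2,4)] in auto)
qed

lemma mean_close:
  fixes H :: "('i::countable \<Rightarrow> real^'d) \<Rightarrow> real"
  assumes A: "finite A" and H: "continuous_on UNIV H"
    and f: "f \<in> product_sums A" and le: "\<And>x. \<bar>H x - f x\<bar> \<le> \<epsilon> * (1 + (\<Sum>a\<in>A. norm (x a) powr m))"
    and N: "prob_space N" and zm: "\<And>a. (\<lambda>w. z w a) \<in> borel_measurable N" and zi: "\<And>a. a \<in> A \<Longrightarrow> integrable N (\<lambda>w. norm (z w a) powr m)"
  shows "\<bar>integral\<^sup>L N (\<lambda>w. H (z w)) - integral\<^sup>L N (\<lambda>w. f (z w))\<bar> \<le> \<epsilon> * (1 + (\<Sum>a\<in>A. integral\<^sup>L N (\<lambda>w. norm (z w a) powr m)))"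
proof -
  interpret N: prob_space N by (rule N)
  have fi: "integrable N (\<lambda>w. f (z w))" by (rule integrable_product_sum[OF A f N zm])
  have Hm: "(\<lambda>w. H (z w)) \<in> borel_measurable N" by (rule measurable_fun_composition[OF H zm])
  have bi: "integrable N (\<lambda>w. \<epsilon> * (1 + (\<Sum>a\<in>A. norm (z w a) powr m)))" using zi by simp
  have di: "integrable N (\<lambda>w. H (z w) - f (z w))"
    by (rule Bochner_Integration.integrable_bound[OF bi]) (use fi Hm order_trans[OF le abs_ge_self] in auto)
  have Hi: "integrable N (\<lambda>w. H (z w))" using Bochner_Integration.integrable_add[OF di fi] by simp
  have "\<bar>integral\<^sup>L N (\<lambda>w. H (z w)) - integral\<^sup>L N (\<lambda>w. f (z w))\<bar> \<le> integral\<^sup>L N (\<lambda>w. \<bar>H (z w) - f (z w)\<bar>)"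
    using integral_abs_bound[of N "\<lambda>w. H (z w) - f (z w)"] Hi fi by simp
  also have "\<dots> \<le> integral\<^sup>L N (\<lambda>w. \<epsilon> * (1 + (\<Sum>a\<in>A. norm (z w a) powr m)))"
    using di bi le by (intro integral_mono) auto
  also have "\<dots> = \<epsilon> * (1 + (\<Sum>a\<in>A. integral\<^sup>L N (\<lambda>w. norm (z w a) powr m)))"
    using zi by (simp add: N.prob_space)
  finally show ?thesis .
qed

text \<open>Shift invariance is required inside one class at a time, where all times move by the
  same amount \<open>sl v * t\<close>. The size of a class is therefore what the stationarity
  assumption on finitely many times has to cover.\<close>

locale slope_classes = mixing_process M Fam X iota kappa p qe delta m
  for M :: "'a measure" and Fam and X :: "nat \<Rightarrow> 'a \<Rightarrow> real^'d" and iota kappa p qe delta m :: real +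
  fixes A :: "'i::countable set" and cl :: "'i \<Rightarrow> nat" and sl :: "nat \<Rightarrow> nat" and eta :: "'i \<Rightarrow> nat"
  assumes A: "finite A"
    and sl: "\<And>v. v \<in> cl ` A \<Longrightarrow> sl v \<ge> 1" "\<And>u v. u \<in> cl ` A \<Longrightarrow> v \<in> cl ` A \<Longrightarrow> u < v \<Longrightarrow> sl u < sl v"
    and stat: "\<And>v t f. v \<in> cl ` A \<Longrightarrow> (\<And>a. a \<in> A \<Longrightarrow> f a \<in> bounded_lipschitz) \<Longrightarrow>
        expectation (\<lambda>w. \<Prod>a\<in>{a\<in>A. cl a = v}. f a (X (sl v * t + eta a) w)) = expectation (\<lambda>w. \<Prod>a\<in>{a\<in>A. cl a = v}. f a (X (eta a) w))"
begin

definition Z :: "nat \<Rightarrow> 'a \<Rightarrow> 'i \<Rightarrow> real^'d" where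
  "Z t w a = (if a \<in> A then X (sl (cl a) * t + eta a) w else 0)"

lemma Z_measurable: "(\<lambda>w. Z t w a) \<in> borel_measurable M"
  by (cases "a \<in> A") (auto simp: Z_def)

lemma Z_moment:
  "integrable M (\<lambda>w. norm (Z t w a) powr m)" "expectation (\<lambda>w. norm (Z t w a) powr m) \<le> expectation (\<lambda>w. norm (X 0 w) powr m)"
proof -
  have "expectation (\<lambda>w. norm (X k w) powr m) = expectation (\<lambda>w. norm (X 0 w) powr m)" for k
    by (rule X_integral_ident(2)) measurable
  note id = this[of "sl (cl a) * t + eta a"]
  show "integrable M (\<lambda>w. norm (Z t w a) powr m)"
    using X_integrable_m by (cases "a \<in> A") (simp_all add: Z_def)
  show "expectation (\<lambda>w. norm (Z t w a) powr m) \<le> expectation (\<lambda>w. norm (X 0 w) powr m)"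
    using id by (cases "a \<in> A") (simp_all add: Z_def integral_nonneg)
qed

lemma product_limit_Z:
  assumes "\<And>a. a \<in> A \<Longrightarrow> g a \<in> bounded_lipschitz"
  shows "(\<lambda>t. expectation (\<lambda>w. c * (\<Prod>a\<in>A. g a (Z t w a))))
     \<longlonglongrightarrow> c * (\<Prod>v\<in>cl ` A. expectation (\<lambda>w. \<Prod>a\<in>{a\<in>A. cl a = v}. g a (X (eta a) w)))"
proof -
  have "(\<lambda>t. expectation (\<lambda>w. \<Prod>a\<in>A. g a (X (sl (cl a) * t + eta a) w))) \<longlonglongrightarrow> (\<Prod>v\<in>cl ` A. expectation (\<lambda>w. \<Prod>a\<in>{a\<in>A. cl a = v}. g a (X (eta a) w)))"
    by (rule product_limit[OF A assms sl stat[OF _ assms]])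
  from tendsto_mult_left[OF this, of c] show ?thesis by (simp add: Z_def)
qed

lemma product_sums_convergent:
  assumes "f \<in> product_sums A"
  shows "convergent (\<lambda>t. expectation (\<lambda>w. f (Z t w)))"
  using assms
proof induction
  case (product g c)
  then show ?case unfolding convergent_def using product_limit_Z[of g c] by blast
next
  case (add f g)
  have "expectation (\<lambda>w. f (Z t w) + g (Z t w)) = expectation (\<lambda>w. f (Z t w)) + expectation (\<lambda>w. g (Z t w))" for t
    using integrable_product_sum[where z="Z t", OF A add.hyps(1) prob_space_axioms Z_measurable]
      integrable_product_sum[where z="Z t", OF A add.hyps(2) prob_space_axioms Z_measurable] by simp
  then show ?case using convergent_add[OF add.IH] by simp
qed

context
  fixes H :: "('i \<Rightarrow> real^'d) \<Rightarrow> real" and C e :: real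
  assumes H: "continuous_on UNIV H" "\<And>x z. (\<And>a. a \<in> A \<Longrightarrow> x a = z a) \<Longrightarrow> H x = H z"
      "\<And>x. \<bar>H x\<bar> \<le> C * (1 + (\<Sum>a\<in>A. norm (x a))) powr e" "C > 0" "0 \<le> e" "e < m"
begin

text \<open>The approximation error is weighted by \<open>m\<close>-th moments, which have a common
  bound for all \<open>t\<close>; hence the error is uniform in \<open>t\<close>.\<close>

lemma Z_approx:
  assumes "\<epsilon> > 0"
  shows "\<exists>f\<in>product_sums A. (\<forall>x. \<bar>H x - f x\<bar> \<le> \<epsilon> * (1 + (\<Sum>a\<in>A. norm (x a) powr m))) \<and>
    (\<forall>t. \<bar>expectation (\<lambda>w. H (Z t w)) - expectation (\<lambda>w. f (Z t w))\<bar> \<le> \<epsilon> * (1 + card A * expectation (\<lambda>w. norm (X 0 w) powr m)))"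
proof -
  obtain f where f: "f \<in> product_sums A" "\<And>x. \<bar>H x - f x\<bar> \<le> \<epsilon> * (1 + (\<Sum>a\<in>A. norm (x a) powr m))"
    using product_sums_dense[OF A H assms] by blast
  have "\<bar>expectation (\<lambda>w. H (Z t w)) - expectation (\<lambda>w. f (Z t w))\<bar> \<le> \<epsilon> * (1 + card A * expectation (\<lambda>w. norm (X 0 w) powr m))" for t
  proof -
    have "\<epsilon> * (1 + (\<Sum>a\<in>A. expectation (\<lambda>w. norm (Z t w a) powr m))) \<le> \<epsilon> * (1 + (\<Sum>a\<in>A. expectation (\<lambda>w. norm (X 0 w) powr m)))"
      using assms by (intro mult_left_mono add_left_mono sum_mono Z_moment) auto
    then show ?thesis using mean_close[where z="Z t", OF A H(1) f prob_space_axioms Z_measurable Z_moment(1)] by simp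
  qed
  with f show ?thesis by blast
qed

lemma moment_const_pos: "1 + card A * expectation (\<lambda>w. norm (X 0 w) powr m) > 0"
  by (intro add_pos_nonneg mult_nonneg_nonneg integral_nonneg) auto

lemma HZ: "H (\<lambda>a. X (sl (cl a) * t + eta a) w) = H (Z t w)"
  by (rule H(2)) (simp add: Z_def)

lemma mean_convergent: "convergent (\<lambda>t. expectation (\<lambda>w. H (\<lambda>a. X (sl (cl a) * t + eta a) w)))"
  unfolding HZ
proof (rule convergent_if_approximable)
  fix \<epsilon> :: real assume e: "\<epsilon> > 0"
  define k where "k = 1 + card A * expectation (\<lambda>w. norm (X 0 w) powr m)"
  have k: "k > 0" unfolding k_def by (rule moment_const_pos)
  have "\<epsilon> / k > 0" using e k by simp
  from Z_approx[OF this] obtain f where f: "f \<in> product_sums A" "\<And>t. \<bar>expectation (\<lambda>w. H (Z t w)) - expectation (\<lambda>w. f (Z t w))\<bar> \<le> \<epsilon> / k * k"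
    unfolding k_def by blast
  then have "\<bar>expectation (\<lambda>w. H (Z t w)) - expectation (\<lambda>w. f (Z t w))\<bar> \<le> \<epsilon>" for t using k by simp
  then show "\<exists>y. convergent y \<and> (\<exists>N0. \<forall>N\<ge>N0. \<bar>expectation (\<lambda>w. H (Z N w)) - y N\<bar> \<le> \<epsilon>)"
    using product_sums_convergent[OF f(1)] by blast
qed

text \<open>On the comparison space \<open>N\<close> the classes are independent and each class keeps its law.\<close>
lemma mean_limit:
  assumes N: "prob_space N" and \<xi>m: "\<And>a. a \<in> A \<Longrightarrow> \<xi> a \<in> borel_measurable N"
    and \<xi>i: "\<And>a. a \<in> A \<Longrightarrow> integrable N (\<lambda>w. norm (\<xi> a w) powr m)"
    and law: "\<And>f. (\<And>a. a \<in> A \<Longrightarrow> f a \<in> bounded_lipschitz) \<Longrightarrow>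
        integral\<^sup>L N (\<lambda>w. \<Prod>a\<in>A. f a (\<xi> a w)) = (\<Prod>v\<in>cl ` A. expectation (\<lambda>w. \<Prod>a\<in>{a\<in>A. cl a = v}. f a (X (eta a) w)))"
  shows "(\<lambda>t. expectation (\<lambda>w. H (\<lambda>a. X (sl (cl a) * t + eta a) w))) \<longlonglongrightarrow> integral\<^sup>L N (\<lambda>w. H (\<lambda>a. \<xi> a w))"
proof -
  interpret N: prob_space N by (rule N)
  define z where "z w a = (if a \<in> A then \<xi> a w else 0)" for w a
  have Hz: "H (\<lambda>a. \<xi> a w) = H (z w)" for w by (rule H(2)) (simp add: z_def)
  have zm: "(\<lambda>w. z w a) \<in> borel_measurable N" for a using \<xi>m by (cases "a \<in> A") (auto simp: z_def)
  have zi: "integrable N (\<lambda>w. norm (z w a) powr m)" if "a \<in> A" for a using \<xi>i[OF that] that by (simp add: z_def)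
  have ps: "(\<lambda>t. expectation (\<lambda>w. f (Z t w))) \<longlonglongrightarrow> integral\<^sup>L N (\<lambda>w. f (z w))" if "f \<in> product_sums A" for f
    using that
  proof induction
    case (product g c)
    have eq: "integral\<^sup>L N (\<lambda>w. c * (\<Prod>a\<in>A. g a (z w a))) = c * (\<Prod>v\<in>cl ` A. expectation (\<lambda>w. \<Prod>a\<in>{a\<in>A. cl a = v}. g a (X (eta a) w)))"
      using law[OF product] by (simp add: z_def)
    show ?case unfolding eq by (rule product_limit_Z[OF product])
  next
    case (add f g)
    have "expectation (\<lambda>w. f (Z t w) + g (Z t w)) = expectation (\<lambda>w. f (Z t w)) + expectation (\<lambda>w. g (Z t w))" for t
      using integrable_product_sum[where z="Z t", OF A add.hyps(1) prob_space_axioms Z_measurable]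
        integrable_product_sum[where z="Z t", OF A add.hyps(2) prob_space_axioms Z_measurable] by simp
    moreover have "integral\<^sup>L N (\<lambda>w. f (z w) + g (z w)) = integral\<^sup>L N (\<lambda>w. f (z w)) + integral\<^sup>L N (\<lambda>w. g (z w))"
      using integrable_product_sum[where z=z, OF A add.hyps(1) N zm]
        integrable_product_sum[where z=z, OF A add.hyps(2) N zm] by simp
    ultimately show ?case using tendsto_add[OF add.IH] by simp
  qed
  define k where "k = 1 + card A * expectation (\<lambda>w. norm (X 0 w) powr m)"
  have k: "k > 0" unfolding k_def by (rule moment_const_pos)
  define k' where "k' = 1 + (\<Sum>a\<in>A. integral\<^sup>L N (\<lambda>w. norm (z w a) powr m))"
  have k': "k' > 0" unfolding k'_def by (intro add_pos_nonneg sum_nonneg integral_nonneg) auto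
  show ?thesis unfolding HZ Hz
  proof (rule LIMSEQ_I)
    fix r :: real assume r: "r > 0"
    define \<epsilon> where "\<epsilon> = r / (3 * (k + k'))"
    have e: "\<epsilon> > 0" using r k k' by (simp add: \<epsilon>_def)
    have ek: "\<epsilon> * k \<le> r / 3" "\<epsilon> * k' \<le> r / 3"
      using r k k' by (auto simp: \<epsilon>_def field_simps)
    obtain f where f: "f \<in> product_sums A" "\<And>x. \<bar>H x - f x\<bar> \<le> \<epsilon> * (1 + (\<Sum>a\<in>A. norm (x a) powr m))"
      "\<And>t. \<bar>expectation (\<lambda>w. H (Z t w)) - expectation (\<lambda>w. f (Z t w))\<bar> \<le> \<epsilon> * k"
      using Z_approx[OF e] unfolding k_def by blast
    have fN: "\<bar>integral\<^sup>L N (\<lambda>w. H (z w)) - integral\<^sup>L N (\<lambda>w. f (z w))\<bar> \<le> \<epsilon> * k'"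
      unfolding k'_def by (rule mean_close[where z=z, OF A H(1) f(1,2) N zm zi])
    obtain t0 where t0: "\<And>t. t \<ge> t0 \<Longrightarrow> norm (expectation (\<lambda>w. f (Z t w)) - integral\<^sup>L N (\<lambda>w. f (z w))) < r / 3"
      using LIMSEQ_D[OF ps[OF f(1)], of "r / 3"] r by auto
    have "norm (expectation (\<lambda>w. H (Z t w)) - integral\<^sup>L N (\<lambda>w. H (z w))) < r" if "t \<ge> t0" for t
      using t0[OF that] f(3)[of t] fN ek unfolding real_norm_def by linarith
    then show "\<exists>no. \<forall>t\<ge>no. norm (expectation (\<lambda>w. H (Z t w)) - integral\<^sup>L N (\<lambda>w. H (z w))) < r" by blast
  qed
qed

end

end

locale stationary_mixing_process = mixing_process M Fam X iota kappa p qe delta m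
  for M :: "'a measure" and Fam and X :: "nat \<Rightarrow> 'a \<Rightarrow> real^'d" and iota kappa p qe delta m :: real +
  fixes Nd :: nat
  assumes X_stat: "\<forall>kk \<le> Nd. \<forall>ns :: nat \<Rightarrow> nat. \<forall>c::nat.
                   (\<forall>j. Suc j < kk \<longrightarrow> ns j \<le> ns (Suc j)) \<longrightarrow>
                   distr M (PiM {..<kk} (\<lambda>_. borel)) (\<lambda>w. \<lambda>j\<in>{..<kk}. X (ns j) w)
                   = distr M (PiM {..<kk} (\<lambda>_. borel)) (\<lambda>w. \<lambda>j\<in>{..<kk}. X (ns j + c) w)"
begin

end

section \<open>Weakly stationary sequences and coboundaries\<close>

lemma (in prob_space) integrable_square_mult:
  fixes f g :: "'a \<Rightarrow> real"
  assumes [measurable]: "f \<in> borel_measurable M" "g \<in> borel_measurable M"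
    and "integrable M (\<lambda>w. (f w)\<^sup>2)" "integrable M (\<lambda>w. (g w)\<^sup>2)"
  shows "integrable M (\<lambda>w. f w * g w)"
proof (rule Bochner_Integration.integrable_bound[where f="\<lambda>w. (f w)\<^sup>2 + (g w)\<^sup>2"])
  have "\<bar>x * y\<bar> \<le> x\<^sup>2 + y\<^sup>2" for x y :: real
  proof -
    have "2 * \<bar>x * y\<bar> \<le> x\<^sup>2 + y\<^sup>2" using sum_squares_bound[of "\<bar>x\<bar>" "\<bar>y\<bar>"] by (simp add: abs_mult)
    then show ?thesis using abs_ge_zero[of "x * y"] by linarith
  qed
  then show "AE w in M. norm (f w * g w) \<le> norm ((f w)\<^sup>2 + (g w)\<^sup>2)" by simp
qed (use assms in auto)

lemma (in prob_space) square_integrable: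
  fixes f :: "'a \<Rightarrow> real"
  assumes "f \<in> borel_measurable M" "integrable M (\<lambda>w. (f w)\<^sup>2)"
  shows "integrable M f"
  using integrable_square_mult[OF assms(1) _ assms(2), of "\<lambda>_. 1"] by simp

lemma (in prob_space) square_integrable_add:
  fixes f g :: "'a \<Rightarrow> real"
  assumes "f \<in> borel_measurable M" "g \<in> borel_measurable M"
    and "integrable M (\<lambda>w. (f w)\<^sup>2)" "integrable M (\<lambda>w. (g w)\<^sup>2)"
  shows "integrable M (\<lambda>w. (f w + g w)\<^sup>2)" "integrable M (\<lambda>w. (f w - g w)\<^sup>2)"
  using integrable_square_mult[OF assms] assms
  by (auto simp: power2_sum power2_diff mult.assoc)

lemma (in prob_space) expectation_mult_tendsto_0:
  fixes f :: "nat \<Rightarrow> 'a \<Rightarrow> real"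
  assumes f: "\<And>n. f n \<in> borel_measurable M" "\<And>n. integrable M (\<lambda>w. (f n w)\<^sup>2)"
    and g: "g \<in> borel_measurable M" "integrable M (\<lambda>w. (g w)\<^sup>2)"
    and lim: "(\<lambda>n. expectation (\<lambda>w. (f n w)\<^sup>2)) \<longlonglongrightarrow> 0"
  shows "(\<lambda>n. expectation (\<lambda>w. f n w * g w)) \<longlonglongrightarrow> 0"
proof (rule LIMSEQ_I)
  fix e :: real assume e: "e > 0"
  define G where "G = expectation (\<lambda>w. (g w)\<^sup>2)"
  have G: "G \<ge> 0" by (simp add: G_def)
  \<comment> \<open>The weight in the inequality between arithmetic and geometric mean, chosen so
    that the contribution of \<open>g\<close> stays below \<open>e / 2\<close>.\<close>
  define l where "l = e / (2 * (G + 1))"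
  have l: "l > 0" using e G by (simp add: l_def)
  have lG: "l * G \<le> e / 2" using e G by (simp add: l_def field_simps)
  obtain N where N: "\<And>n. n \<ge> N \<Longrightarrow> expectation (\<lambda>w. (f n w)\<^sup>2) < l * (e / 2)"
    using LIMSEQ_D[OF lim, of "l * (e / 2)"] l e by auto
  have "norm (expectation (\<lambda>w. f n w * g w) - 0) < e" if "n \<ge> N" for n
  proof -
    have le: "\<bar>f n w * g w\<bar> \<le> (f n w)\<^sup>2 / l + l * (g w)\<^sup>2" for w
    proof -
      have "0 \<le> (\<bar>f n w\<bar> - l * \<bar>g w\<bar>)\<^sup>2" by simp
      then have "2 * l * (\<bar>f n w\<bar> * \<bar>g w\<bar>) \<le> (f n w)\<^sup>2 + l\<^sup>2 * (g w)\<^sup>2"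
        by (simp add: power2_diff power_mult_distrib algebra_simps)
      moreover have "0 \<le> l * (\<bar>f n w\<bar> * \<bar>g w\<bar>)" using l by simp
      ultimately have "l * (\<bar>f n w\<bar> * \<bar>g w\<bar>) \<le> (f n w)\<^sup>2 + l\<^sup>2 * (g w)\<^sup>2" by linarith
      then show ?thesis using l by (simp add: abs_mult field_simps power2_eq_square)
    qed
    have i: "integrable M (\<lambda>w. f n w * g w)" by (rule integrable_square_mult[OF f(1) g(1) f(2) g(2)])
    have "\<bar>expectation (\<lambda>w. f n w * g w)\<bar> \<le> expectation (\<lambda>w. \<bar>f n w * g w\<bar>)" by (rule integral_abs_bound)
    also have "\<dots> \<le> expectation (\<lambda>w. (f n w)\<^sup>2 / l + l * (g w)\<^sup>2)"
      using i f g le by (intro integral_mono) auto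
    also have "\<dots> = expectation (\<lambda>w. (f n w)\<^sup>2) / l + l * G" using f g by (simp add: G_def)
    also have "\<dots> < e"
    proof -
      have "expectation (\<lambda>w. (f n w)\<^sup>2) / l < e / 2" using N[OF that] l by (simp add: divide_less_eq mult.commute)
      then show ?thesis using lG by linarith
    qed
    finally show ?thesis by simp
  qed
  then show "\<exists>no. \<forall>n\<ge>no. norm (expectation (\<lambda>w. f n w * g w) - 0) < e" by blast
qed

text \<open>An L2 Cauchy sequence is L1 Cauchy, so a subsequence converges almost everywhere;
  Fatou's lemma along that subsequence turns closeness among the \<open>f n\<close> into closeness
  to the limit.\<close>

lemma (in prob_space) L2_complete:
  fixes f :: "nat \<Rightarrow> 'a \<Rightarrow> real"
  assumes f: "\<And>n. f n \<in> borel_measurable M" "\<And>n. integrable M (\<lambda>w. (f n w)\<^sup>2)"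
    and cauchy: "\<And>e. e > 0 \<Longrightarrow> \<exists>N. \<forall>i\<ge>N. \<forall>j\<ge>N. expectation (\<lambda>w. (f i w - f j w)\<^sup>2) \<le> e"
  shows "\<exists>g. g \<in> borel_measurable M \<and> integrable M (\<lambda>w. (g w)\<^sup>2) \<and> (\<lambda>n. expectation (\<lambda>w. (f n w - g w)\<^sup>2)) \<longlonglongrightarrow> 0"
proof -
  note [measurable] = f(1)
  have d2: "integrable M (\<lambda>w. (f i w - f j w)\<^sup>2)" for i j
    by (rule square_integrable_add(2)[OF f(1) f(1) f(2) f(2)])
  obtain r where r: "strict_mono r" and ae: "AE x in M. Cauchy (\<lambda>i. f (r i) x)"
  proof (rule cauchy_L1_AE_cauchy_subseq)
    show "integrable M (f n)" for n by (rule square_integrable[OF f])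
    fix e :: real assume e: "e > 0"
    obtain N where N: "\<And>i j. i \<ge> N \<Longrightarrow> j \<ge> N \<Longrightarrow> expectation (\<lambda>w. (f i w - f j w)\<^sup>2) \<le> e\<^sup>2 / 8"
      using cauchy[of "e\<^sup>2 / 8"] e by auto
    have "expectation (\<lambda>w. norm (f i w - f j w)) < e" if "i \<ge> N" "j \<ge> N" for i j
    proof -
      have le: "norm (f i w - f j w) \<le> e / 2 + 2 * (f i w - f j w)\<^sup>2 / e" for w
      proof -
        define t where "t = \<bar>f i w - f j w\<bar>"
        have "0 \<le> (e / 2 - t)\<^sup>2" by simp
        then have "e * t \<le> e\<^sup>2 / 4 + t\<^sup>2" by (simp add: power2_diff power_divide)
        also have "\<dots> \<le> e\<^sup>2 / 2 + 2 * t\<^sup>2" by simp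
        finally have "t \<le> e / 2 + 2 * t\<^sup>2 / e" using e by (simp add: field_simps power2_eq_square)
        then show ?thesis by (simp add: t_def)
      qed
      have "expectation (\<lambda>w. norm (f i w - f j w)) \<le> expectation (\<lambda>w. e / 2 + 2 * (f i w - f j w)\<^sup>2 / e)"
        using d2 square_integrable[OF f] le by (intro integral_mono) auto
      also have "\<dots> = e / 2 + 2 * expectation (\<lambda>w. (f i w - f j w)\<^sup>2) / e" using d2 by (simp add: prob_space)
      also have "\<dots> \<le> e / 2 + 2 * (e\<^sup>2 / 8) / e" using N[OF that] e by (intro add_left_mono divide_right_mono mult_left_mono) auto
      also have "\<dots> < e" using e by (simp add: power2_eq_square)
      finally show ?thesis .
    qed
    then show "\<exists>N. \<forall>i\<ge>N. \<forall>j\<ge>N. expectation (\<lambda>w. norm (f i w - f j w)) < e" by blast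
  qed
  define g where "g w = lim (\<lambda>i. f (r i) w)" for w
  have [measurable]: "g \<in> borel_measurable M" unfolding g_def by measurable
  have conv: "AE w in M. (\<lambda>i. f (r i) w) \<longlonglongrightarrow> g w"
    using ae by eventually_elim (simp add: g_def Cauchy_convergent_iff convergent_LIMSEQ_iff)
  have fat: "integrable M (\<lambda>w. (f n w - g w)\<^sup>2) \<and> expectation (\<lambda>w. (f n w - g w)\<^sup>2) \<le> e"
    if e: "e > 0" and N: "\<And>i j. i \<ge> N \<Longrightarrow> j \<ge> N \<Longrightarrow> expectation (\<lambda>w. (f i w - f j w)\<^sup>2) \<le> e" and n: "n \<ge> N" for e N n
  proof -
    have "(\<integral>\<^sup>+w. ennreal ((f n w - g w)\<^sup>2) \<partial>M) = (\<integral>\<^sup>+w. liminf (\<lambda>k. ennreal ((f n w - f (r k) w)\<^sup>2)) \<partial>M)"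
    proof (intro nn_integral_cong_AE, use conv in eventually_elim)
      case (elim w)
      have "(\<lambda>k. ennreal ((f n w - f (r k) w)\<^sup>2)) \<longlonglongrightarrow> ennreal ((f n w - g w)\<^sup>2)"
        by (intro tendsto_intros elim)
      then show ?case by (intro lim_imp_Liminf[symmetric]) auto
    qed
    also have "\<dots> \<le> liminf (\<lambda>k. \<integral>\<^sup>+w. ennreal ((f n w - f (r k) w)\<^sup>2) \<partial>M)"
      by (rule nn_integral_liminf) measurable
    also have "\<dots> \<le> liminf (\<lambda>k. ennreal e)"
    proof (rule Liminf_mono)
      show "\<forall>\<^sub>F k in sequentially. (\<integral>\<^sup>+w. ennreal ((f n w - f (r k) w)\<^sup>2) \<partial>M) \<le> ennreal e"
        using eventually_ge_at_top[of N]
      proof eventually_elim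
        case (elim k)
        have "r k \<ge> N" using elim seq_suble[OF r, of k] by linarith
        have "(\<integral>\<^sup>+w. ennreal ((f n w - f (r k) w)\<^sup>2) \<partial>M) = ennreal (expectation (\<lambda>w. (f n w - f (r k) w)\<^sup>2))"
          by (rule nn_integral_eq_integral[OF d2]) auto
        also have "\<dots> \<le> ennreal e" by (intro ennreal_leI N n \<open>r k \<ge> N\<close>)
        finally show ?case .
      qed
    qed
    also have "\<dots> = ennreal e" by (simp add: Liminf_const)
    finally have le: "(\<integral>\<^sup>+w. ennreal ((f n w - g w)\<^sup>2) \<partial>M) \<le> ennreal e" .
    have i: "integrable M (\<lambda>w. (f n w - g w)\<^sup>2)"
      by (rule integrableI_nonneg) (use le in \<open>auto intro: le_less_trans\<close>)
    have "ennreal (expectation (\<lambda>w. (f n w - g w)\<^sup>2)) \<le> ennreal e"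
      using le nn_integral_eq_integral[OF i] by simp
    with i e show ?thesis by simp
  qed
  obtain N1 where N1: "\<And>i j. i \<ge> N1 \<Longrightarrow> j \<ge> N1 \<Longrightarrow> expectation (\<lambda>w. (f i w - f j w)\<^sup>2) \<le> 1"
    using cauchy[of 1] by auto
  have "integrable M (\<lambda>w. (f N1 w - (f N1 w - g w))\<^sup>2)"
    by (rule square_integrable_add(2)) (use f fat[OF _ N1, of N1] in auto)
  then have g2: "integrable M (\<lambda>w. (g w)\<^sup>2)" by simp
  have "(\<lambda>n. expectation (\<lambda>w. (f n w - g w)\<^sup>2)) \<longlonglongrightarrow> 0"
  proof (rule LIMSEQ_I)
    fix e :: real assume e: "e > 0"
    obtain N where N: "\<And>i j. i \<ge> N \<Longrightarrow> j \<ge> N \<Longrightarrow> expectation (\<lambda>w. (f i w - f j w)\<^sup>2) \<le> e / 2"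
      using cauchy[of "e / 2"] e by auto
    have "norm (expectation (\<lambda>w. (f n w - g w)\<^sup>2) - 0) < e" if "n \<ge> N" for n
      using fat[OF _ N that] e by (simp add: integral_nonneg)
    then show "\<exists>no. \<forall>n\<ge>no. norm (expectation (\<lambda>w. (f n w - g w)\<^sup>2) - 0) < e" by blast
  qed
  with g2 show ?thesis by (intro exI[of _ g]) auto
qed

locale weakly_stationary_process = prob_space N for N :: "'b measure" +
  fixes Z :: "nat \<Rightarrow> 'b \<Rightarrow> real" and \<gamma> :: "nat \<Rightarrow> real"
  assumes Zm [measurable]: "\<And>n. Z n \<in> borel_measurable N" and Z2: "\<And>n. integrable N (\<lambda>w. (Z n w)\<^sup>2)"
    and Z0: "\<And>n. expectation (Z n) = 0" and cov: "\<And>n h. expectation (\<lambda>w. Z n w * Z (n + h) w) = \<gamma> h"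
    and \<gamma>: "summable (\<lambda>h. real h * \<bar>\<gamma> h\<bar>)"
begin

definition S :: "nat \<Rightarrow> 'b \<Rightarrow> real" where "S n w = (\<Sum>i<n. Z i w)"
text \<open>The variance of \<open>n\<close> consecutive terms, as a sum of increments: the term
  following \<open>k\<close> others adds its own variance and twice its covariances with
  these.\<close>

definition v :: "nat \<Rightarrow> real" where "v n = (\<Sum>k<n. \<gamma> 0 + 2 * (\<Sum>h=1..k. \<gamma> h))"
definition df :: "nat \<Rightarrow> nat \<Rightarrow> nat" where "df i j = (i - j) + (j - i)"

lemma \<gamma>_summable: "summable \<gamma>"
  by (rule summable_of_weighted[OF \<gamma>])

lemma ZZ: "integrable N (\<lambda>w. Z i w * Z j w)"
  by (rule integrable_square_mult[OF Zm Zm Z2 Z2])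

lemma block_sum_square:
  "integrable N (\<lambda>w. (\<Sum>i=k..<k+n. Z i w)\<^sup>2)" "expectation (\<lambda>w. (\<Sum>i=k..<k+n. Z i w)\<^sup>2) = v n"
proof -
  have "integrable N (\<lambda>w. (\<Sum>i=k..<k+n. Z i w)\<^sup>2) \<and> expectation (\<lambda>w. (\<Sum>i=k..<k+n. Z i w)\<^sup>2) = v n"
  proof (induction n)
    case 0 then show ?case by (simp add: v_def)
  next
    case (Suc n)
    have eq: "(\<Sum>i=k..<k+Suc n. Z i w)\<^sup>2 = (\<Sum>i=k..<k+n. Z i w)\<^sup>2 + (2 * (\<Sum>i=k..<k+n. Z i w * Z (k + n) w) + Z (k + n) w * Z (k + n) w)" for w
      by (simp add: power2_sum sum_distrib_left sum_distrib_right power2_eq_square algebra_simps)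
    have "(\<Sum>i=k..<k+n. expectation (\<lambda>w. Z i w * Z (k + n) w)) = (\<Sum>h=1..n. \<gamma> h)"
    proof (rule sum.reindex_bij_witness[where i="\<lambda>h. k + n - h" and j="\<lambda>i. k + n - i"])
      fix i assume "i \<in> {k..<k + n}"
      then show "\<gamma> (k + n - i) = expectation (\<lambda>w. Z i w * Z (k + n) w)" using cov[of i "k + n - i"] by simp
    qed auto
    moreover have "expectation (\<lambda>w. Z (k + n) w * Z (k + n) w) = \<gamma> 0" using cov[of "k + n" 0] by simp
    ultimately show ?case unfolding eq using Suc ZZ by (simp add: v_def)
  qed
  then show "integrable N (\<lambda>w. (\<Sum>i=k..<k+n. Z i w)\<^sup>2)" "expectation (\<lambda>w. (\<Sum>i=k..<k+n. Z i w)\<^sup>2) = v n" by auto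
qed

lemma S_measurable [measurable]: "S n \<in> borel_measurable N" unfolding S_def by measurable
lemma S_square: "integrable N (\<lambda>w. (S n w)\<^sup>2)" "expectation (\<lambda>w. (S n w)\<^sup>2) = v n"
  using block_sum_square[of 0 n] by (auto simp: S_def atLeast0LessThan)
lemma S_mean: "expectation (S n) = 0"
  unfolding S_def using square_integrable[OF Zm Z2] Z0 by simp

lemma S_diff_square: "expectation (\<lambda>w. (S i w - S j w)\<^sup>2) = v (df i j)"
proof -
  have *: "expectation (\<lambda>w. (S i w - S j w)\<^sup>2) = v (i - j)" if "j \<le> i" for i j
  proof -
    have "S i w - S j w = (\<Sum>k=j..<j+(i-j). Z k w)" for w
    proof -
      have "(\<Sum>k\<in>{0..<j}. Z k w) + (\<Sum>k\<in>{j..<i}. Z k w) = (\<Sum>k\<in>{0..<i}. Z k w)"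
        using that by (intro sum.atLeastLessThan_concat) auto
      then show ?thesis using that by (simp add: S_def atLeast0LessThan)
    qed
    then show ?thesis using block_sum_square(2)[of j "i - j"] by simp
  qed
  show ?thesis
  proof (cases "j \<le> i")
    case True then show ?thesis using * by (simp add: df_def)
  next
    case False then show ?thesis using *[of i j] by (simp add: df_def power2_commute)
  qed
qed

lemma SS: "integrable N (\<lambda>w. S i w * S j w)" "expectation (\<lambda>w. S i w * S j w) = (v i + v j - v (df i j)) / 2"
proof -
  show i: "integrable N (\<lambda>w. S i w * S j w)" by (rule integrable_square_mult[OF S_measurable S_measurable S_square(1) S_square(1)])
  have "expectation (\<lambda>w. (S i w - S j w)\<^sup>2) = expectation (\<lambda>w. (S i w)\<^sup>2 + (S j w)\<^sup>2 - 2 * (S i w * S j w))"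
    by (simp add: power2_diff mult.assoc)
  also have "\<dots> = v i + v j - 2 * expectation (\<lambda>w. S i w * S j w)" using S_square i by simp
  finally show "expectation (\<lambda>w. S i w * S j w) = (v i + v j - v (df i j)) / 2" using S_diff_square[of i j] by simp
qed

definition s2 :: real where "s2 = \<gamma> 0 + 2 * (\<Sum>h. \<gamma> (Suc h))"

lemma increments_tendsto: "(\<lambda>k. \<gamma> 0 + 2 * (\<Sum>h=1..k. \<gamma> h)) \<longlonglongrightarrow> s2"
proof -
  have "summable (\<lambda>h. \<gamma> (Suc h))" using \<gamma>_summable by (simp add: summable_Suc_iff)
  then have "(\<lambda>k. \<Sum>h<k. \<gamma> (Suc h)) \<longlonglongrightarrow> (\<Sum>h. \<gamma> (Suc h))" by (simp add: summable_LIMSEQ)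
  then have "(\<lambda>k. \<Sum>h=1..k. \<gamma> h) \<longlonglongrightarrow> (\<Sum>h. \<gamma> (Suc h))"
    by (simp add: sum.atLeast1_atMost_eq)
  then show ?thesis unfolding s2_def by (intro tendsto_intros)
qed

lemma v_average: "(\<lambda>n. v n / real n) \<longlonglongrightarrow> s2"
proof -
  define a where "a n = \<gamma> 0 + 2 * (\<Sum>h=1..n. \<gamma> h) " for n
  have "(\<lambda>n. a (n - 1) - s2) \<longlonglongrightarrow> 0"
  proof (rule LIMSEQ_imp_Suc)
    show "(\<lambda>n. a (Suc n - 1) - s2) \<longlonglongrightarrow> 0" using increments_tendsto unfolding a_def by (simp add: LIM_zero_iff)
  qed
  from cesaro_null[OF this] have "(\<lambda>n. (\<Sum>k=1..n. a (k - 1) - s2) / real n + s2) \<longlonglongrightarrow> 0 + s2" by (intro tendsto_intros)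
  moreover have "\<forall>\<^sub>F n in sequentially. (\<Sum>k=1..n. a (k - 1) - s2) / real n + s2 = v n / real n"
    using eventually_ge_at_top[of 1]
  proof eventually_elim
    case (elim n)
    have "v n = (\<Sum>k=1..n. a (k - 1))" by (simp add: v_def a_def sum.atLeast1_atMost_eq)
    then show ?case using elim by (simp add: sum_subtractf field_simps)
  qed
  ultimately show ?thesis using Lim_transform_eventually by fastforce
qed

lemma variance_average:
  "(\<lambda>n. var N (\<lambda>w. \<Sum>i=1..n. Z i w) / real n) \<longlonglongrightarrow> s2"
proof -
  have "var N (\<lambda>w. \<Sum>i=1..n. Z i w) = v n" for n
  proof -
    have "expectation (\<lambda>w. \<Sum>i=1..n. Z i w) = 0" using square_integrable[OF Zm Z2] Z0 by simp
    moreover have "{1..n} = {1..<1 + n}" by auto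
    ultimately show ?thesis unfolding var_def using block_sum_square(2)[of 1 n] by simp
  qed
  then show ?thesis using v_average by simp
qed

lemma s2_nonneg: "s2 \<ge> 0"
proof (rule LIMSEQ_le_const[OF v_average])
  have "0 \<le> expectation (\<lambda>w. (S n w)\<^sup>2)" for n by simp
  then have "v n \<ge> 0" for n unfolding S_square(2) .
  then show "\<exists>N. \<forall>n\<ge>N. 0 \<le> v n / real n" by simp
qed

lemma v_explicit: "v n = real n * (\<gamma> 0 + 2 * (\<Sum>h\<in>{1..<n}. \<gamma> h)) - 2 * (\<Sum>h<n. real h * \<gamma> h)"
proof (induction n)
  case 0 then show ?case by (simp add: v_def)
next
  case (Suc n)
  have "v (Suc n) = v n + (\<gamma> 0 + 2 * (\<Sum>h=1..n. \<gamma> h))" by (simp add: v_def)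
  moreover have "{1..<Suc n} = {1..n}" by auto
  moreover have "real n * (\<Sum>h\<in>{1..n}. \<gamma> h) = real n * (\<Sum>h\<in>{1..<n}. \<gamma> h) + real n * \<gamma> n"
  proof (cases n)
    case (Suc k)
    have "{1..n} = insert n {1..<n}" using Suc by auto
    then show ?thesis by (simp add: distrib_left)
  qed simp
  ultimately show ?case using Suc by (simp add: algebra_simps)
qed

text \<open>If \<open>s2 = 0\<close>, the coefficient of \<open>n\<close> in
  \<open>v_explicit\<close> is minus twice the tail of \<open>\<gamma>\<close> from \<open>n\<close>
  on, and \<open>n\<close> times this tail is dominated by the tail of the weighted series. The
  weight in the summability of \<open>\<gamma>\<close> is used here: the variances converge, and do
  not merely grow slower than \<open>n\<close>.\<close>

lemma v_tendsto:
  assumes "s2 = 0"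
  shows "v \<longlonglongrightarrow> - 2 * (\<Sum>h. real h * \<gamma> h)"
proof -
  have sg: "summable (\<lambda>h. real h * \<gamma> h)"
    by (rule summable_rabs_cancel) (use \<gamma> in \<open>simp add: abs_mult\<close>)
  have tail: "\<gamma> 0 + 2 * (\<Sum>h\<in>{1..<n}. \<gamma> h) = - 2 * (\<Sum>h. \<gamma> (h + n))" if n: "n \<ge> 1" for n
  proof -
    have "(\<Sum>h. \<gamma> (Suc h)) = (\<Sum>h. \<gamma> (Suc (h + (n - 1)))) + (\<Sum>h<n - 1. \<gamma> (Suc h))"
      using \<gamma>_summable by (intro suminf_split_initial_segment) (simp add: summable_Suc_iff)
    moreover have "(\<Sum>h<n - 1. \<gamma> (Suc h)) = (\<Sum>h\<in>{1..<n}. \<gamma> h)"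
      using n by (intro sum.reindex_bij_witness[where i="\<lambda>h. h - 1" and j=Suc]) auto
    moreover have "(\<lambda>h. \<gamma> (Suc (h + (n - 1)))) = (\<lambda>h. \<gamma> (h + n))" using n by (auto simp: fun_eq_iff)
    ultimately show ?thesis using assms by (simp add: s2_def)
  qed
  have "(\<lambda>n. real n * (\<gamma> 0 + 2 * (\<Sum>h\<in>{1..<n}. \<gamma> h))) \<longlonglongrightarrow> 0"
  proof (rule Lim_null_comparison)
    show "(\<lambda>n. 2 * (\<Sum>h. real (h + n) * \<bar>\<gamma> (h + n)\<bar>)) \<longlonglongrightarrow> 0"
      using tendsto_mult_left[OF suminf_exist_split2[OF \<gamma>], of 2] by simp
    show "\<forall>\<^sub>F n in sequentially. norm (real n * (\<gamma> 0 + 2 * (\<Sum>h\<in>{1..<n}. \<gamma> h))) \<le> 2 * (\<Sum>h. real (h + n) * \<bar>\<gamma> (h + n)\<bar>)"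
      using eventually_ge_at_top[of 1]
    proof eventually_elim
      case (elim n)
      have s1: "summable (\<lambda>h. real (h + n) * \<bar>\<gamma> (h + n)\<bar>)" using \<gamma> summable_iff_shift[of "\<lambda>h. real h * \<bar>\<gamma> h\<bar>" n] by simp
      have le: "\<bar>real n * \<gamma> (h + n)\<bar> \<le> real (h + n) * \<bar>\<gamma> (h + n)\<bar>" for h
        unfolding abs_mult by (intro mult_right_mono) auto
      have s2: "summable (\<lambda>h. \<bar>real n * \<gamma> (h + n)\<bar>)"
        by (rule summable_comparison_test'[OF s1, of 0]) (use le in auto)
      have s3: "summable (\<lambda>h. \<gamma> (h + n))" using \<gamma>_summable by (simp add: summable_iff_shift)
      have "\<bar>real n * (\<Sum>h. \<gamma> (h + n))\<bar> = \<bar>\<Sum>h. real n * \<gamma> (h + n)\<bar>" using s3 by (simp add: suminf_mult)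
      also have "\<dots> \<le> (\<Sum>h. \<bar>real n * \<gamma> (h + n)\<bar>)" by (rule summable_rabs[OF s2])
      also have "\<dots> \<le> (\<Sum>h. real (h + n) * \<bar>\<gamma> (h + n)\<bar>)" by (rule suminf_le[OF le s2 s1])
      finally show ?case unfolding tail[OF elim] by (simp add: abs_mult)
    qed
  qed
  moreover have "(\<lambda>n. \<Sum>h<n. real h * \<gamma> h) \<longlonglongrightarrow> (\<Sum>h. real h * \<gamma> h)" by (rule summable_LIMSEQ[OF sg])
  ultimately have "(\<lambda>n. real n * (\<gamma> 0 + 2 * (\<Sum>h\<in>{1..<n}. \<gamma> h)) - 2 * (\<Sum>h<n. real h * \<gamma> h)) \<longlonglongrightarrow> 0 - 2 * (\<Sum>h. real h * \<gamma> h)"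
    by (intro tendsto_intros)
  then show ?thesis unfolding v_explicit[symmetric] by simp
qed

text \<open>Averages are taken because the partial sums need not converge in L2 themselves: two of
  them remain at squared distance \<open>v (df i j)\<close>.\<close>

definition Av :: "nat \<Rightarrow> 'b \<Rightarrow> real" where "Av n w = (\<Sum>j=1..n. S j w) / real n"

lemma Av_measurable [measurable]: "Av n \<in> borel_measurable N" unfolding Av_def by measurable

lemma AvAv: "integrable N (\<lambda>w. Av i w * Av j w)"
  "expectation (\<lambda>w. Av i w * Av j w) = (\<Sum>a=1..i. \<Sum>b=1..j. (v a + v b - v (df a b)) / 2) / (real i * real j)"
proof -
  have eq: "Av i w * Av j w = (\<Sum>a=1..i. \<Sum>b=1..j. S a w * S b w) / (real i * real j)" for w
    by (simp add: Av_def sum_product)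
  show "integrable N (\<lambda>w. Av i w * Av j w)" unfolding eq using SS(1) by auto
  show "expectation (\<lambda>w. Av i w * Av j w) = (\<Sum>a=1..i. \<Sum>b=1..j. (v a + v b - v (df a b)) / 2) / (real i * real j)"
    unfolding eq by (simp add: SS(1) SS(2))
qed

lemma Av_square: "integrable N (\<lambda>w. (Av n w)\<^sup>2)" using AvAv(1)[of n n] by (simp add: power2_eq_square)

lemma AvS: "expectation (\<lambda>w. Av i w * S n w) = (\<Sum>a=1..i. (v a + v n - v (df a n)) / 2) / real i"
proof -
  have eq: "Av i w * S n w = (\<Sum>a=1..i. S a w * S n w) / real i" for w
    by (simp add: Av_def sum_distrib_right)
  show ?thesis unfolding eq by (simp add: SS(1) SS(2))
qed

lemma diagonal_sum_le:
  assumes om: "\<And>h. om h \<ge> (0::real)" and ij: "i \<le> j"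
  shows "(\<Sum>a=1..i. \<Sum>b=1..j. om (df a b)) \<le> real i * (2 * (\<Sum>h<j. om h))"
proof -
  have "(\<Sum>b=1..j. om (df a b)) \<le> 2 * (\<Sum>h<j. om h)" if a: "a \<in> {1..i}" for a
  proof -
    have "(\<Sum>b=1..j. om (df a b)) = (\<Sum>b=1..a. om (df a b)) + (\<Sum>b\<in>{a<..j}. om (df a b))"
      by (subst sum.union_disjoint[symmetric]) (use a ij in \<open>auto intro!: sum.cong\<close>)
    also have "(\<Sum>b=1..a. om (df a b)) = sum om ((\<lambda>b. a - b) ` {1..a})"
      by (subst sum.reindex) (auto simp: inj_on_def df_def)
    also have "\<dots> \<le> (\<Sum>h<j. om h)" using a ij om by (intro sum_mono2) auto
    also have "(\<Sum>b\<in>{a<..j}. om (df a b)) = sum om ((\<lambda>b. b - a) ` {a<..j})"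
      by (subst sum.reindex) (auto simp: inj_on_def df_def)
    also have "\<dots> \<le> (\<Sum>h<j. om h)" using a ij om by (intro sum_mono2) auto
    finally show ?thesis by simp
  qed
  then have "(\<Sum>a=1..i. \<Sum>b=1..j. om (df a b)) \<le> (\<Sum>a=1..i. 2 * (\<Sum>h<j. om h))" by (intro sum_mono)
  then show ?thesis by simp
qed

lemma df_commute: "df a b = df b a" by (simp add: df_def add.commute)

lemma average_df_le:
  assumes om: "\<And>h. om h \<ge> (0::real)" and "i \<ge> 1" "j \<ge> 1"
  shows "(\<Sum>a=1..i. \<Sum>b=1..j. om (df a b)) / (real i * real j) \<le> 2 * (\<Sum>h<max i j. om h) / real (max i j)"
proof (cases "i \<le> j")
  case True
  then show ?thesis using diagonal_sum_le[of om i j] assms by (simp add: field_simps max_absorb2)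
next
  case False
  have "(\<Sum>a=1..i. \<Sum>b=1..j. om (df a b)) = (\<Sum>b=1..j. \<Sum>a=1..i. om (df b a))"
    by (subst sum.swap) (simp add: df_commute)
  then show ?thesis using False diagonal_sum_le[of om j i] assms by (simp add: field_simps max_absorb1)
qed

context
  assumes s20: "s2 = 0"
begin

definition vinf :: real where "vinf = - 2 * (\<Sum>h. real h * \<gamma> h)"

lemma v_lim: "(\<lambda>n. v n - vinf) \<longlonglongrightarrow> 0"
  unfolding vinf_def by (rule LIM_zero[OF v_tendsto[OF s20]])

lemma v_cesaro: "(\<lambda>n. (\<Sum>a=1..n. v a - vinf) / real n) \<longlonglongrightarrow> 0"
  by (rule cesaro_null[OF v_lim])

text \<open>The inner product of \<open>S a\<close> and \<open>S b\<close> is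
  \<open>(v a + v b - v (df a b)) / 2\<close>, close to \<open>vinf / 2\<close> unless one of
  \<open>a\<close>, \<open>b\<close>, \<open>df a b\<close> is small. Such pairs have vanishing
  density in a large rectangle.\<close>

lemma Av_inner:
  assumes e: "e > 0"
  shows "\<exists>N. \<forall>i\<ge>N. \<forall>j\<ge>N. \<bar>expectation (\<lambda>w. Av i w * Av j w) - vinf / 2\<bar> \<le> e"
proof -
  define om where "om h = \<bar>v h - vinf\<bar>" for h
  have om0: "om \<longlonglongrightarrow> 0" unfolding om_def by (intro tendsto_rabs_zero v_lim)
  have "(\<lambda>n. om (n - 1)) \<longlonglongrightarrow> 0" by (rule LIMSEQ_imp_Suc) (use om0 in simp)
  from cesaro_null[OF this]
  have c1: "(\<lambda>n. (\<Sum>h<n. om h) / real n) \<longlonglongrightarrow> 0" by (simp add: sum.atLeast1_atMost_eq)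
  obtain N1 where N1: "\<And>n. n \<ge> N1 \<Longrightarrow> \<bar>(\<Sum>h<n. om h) / real n\<bar> < e / 2"
    using LIMSEQ_D[OF c1, of "e / 2"] e by auto
  obtain N2 where N2: "\<And>n. n \<ge> N2 \<Longrightarrow> \<bar>(\<Sum>a=1..n. v a - vinf) / real n\<bar> < e / 2"
    using LIMSEQ_D[OF v_cesaro, of "e / 2"] e by auto
  have "\<bar>expectation (\<lambda>w. Av i w * Av j w) - vinf / 2\<bar> \<le> e" if i: "i \<ge> max 1 (max N1 N2)" and j: "j \<ge> max 1 (max N1 N2)" for i j
  proof -
    have ij: "i \<ge> 1" "j \<ge> 1" using i j by auto
    define D where "D = (\<Sum>a=1..i. \<Sum>b=1..j. v (df a b) - vinf) / (real i * real j)"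
    have "(\<Sum>a=1..i. \<Sum>b=1..j. (v a + v b - v (df a b)) / 2)
       = (real j * (\<Sum>a=1..i. v a - vinf) + real i * (\<Sum>b=1..j. v b - vinf) - (\<Sum>a=1..i. \<Sum>b=1..j. v (df a b) - vinf) + real i * real j * vinf) / 2"
      by (simp add: sum.distrib sum_subtractf sum_divide_distrib[symmetric] sum_distrib_left[symmetric] algebra_simps)
    moreover have "(real j * P + real i * Q - R + real i * real j * x) / 2 / (real i * real j) = (P / real i + Q / real j - R / (real i * real j) + x) / 2" for P Q R x
      using ij by (simp add: field_simps)
    ultimately have "expectation (\<lambda>w. Av i w * Av j w)
      = ((\<Sum>a=1..i. v a - vinf) / real i + (\<Sum>b=1..j. v b - vinf) / real j - D + vinf) / 2"
      unfolding AvAv(2) D_def by (simp only:)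
    moreover have "\<bar>D\<bar> \<le> e"
    proof -
      have "\<bar>D\<bar> \<le> (\<Sum>a=1..i. \<Sum>b=1..j. om (df a b)) / (real i * real j)"
        unfolding D_def abs_divide om_def by (intro divide_mono order_trans[OF sum_abs sum_mono] sum_abs) (use ij in auto)
      also have "\<dots> \<le> 2 * (\<Sum>h<max i j. om h) / real (max i j)"
        by (rule average_df_le) (use ij in \<open>auto simp: om_def\<close>)
      also have "\<dots> \<le> e"
      proof -
        have "\<bar>(\<Sum>h<max i j. om h) / real (max i j)\<bar> < e / 2" by (rule N1) (use i in \<open>simp add: le_max_iff_disj\<close>)
        then have "2 * ((\<Sum>h<max i j. om h) / real (max i j)) \<le> e" by linarith
        then show ?thesis by simp
      qed
      finally show ?thesis .
    qed
    moreover have "\<bar>(\<Sum>a=1..i. v a - vinf) / real i\<bar> < e / 2" "\<bar>(\<Sum>a=1..j. v a - vinf) / real j\<bar> < e / 2"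
      using N2 i j by auto
    moreover have "\<bar>E - w / 2\<bar> \<le> e" if "E = (x + y - D + w) / 2" "\<bar>D\<bar> \<le> e" "\<bar>x\<bar> < e / 2" "\<bar>y\<bar> < e / 2" for E w x y D :: real
    proof -
      have "- e \<le> D" "D \<le> e" "- (e / 2) < x" "x < e / 2" "- (e / 2) < y" "y < e / 2"
        using that(2-4) by linarith+
      then show ?thesis unfolding that(1) abs_le_iff by (simp add: field_simps)
    qed
    ultimately show ?thesis by blast
  qed
  then show ?thesis by blast
qed

lemma Av_cauchy:
  assumes e: "e > 0"
  shows "\<exists>N. \<forall>i\<ge>N. \<forall>j\<ge>N. expectation (\<lambda>w. (Av i w - Av j w)\<^sup>2) \<le> e"
proof -
  obtain n0 where n0: "\<And>i j. i \<ge> n0 \<Longrightarrow> j \<ge> n0 \<Longrightarrow> \<bar>expectation (\<lambda>w. Av i w * Av j w) - vinf / 2\<bar> \<le> e / 4"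
    using Av_inner[of "e / 4"] e by auto
  have "expectation (\<lambda>w. (Av i w - Av j w)\<^sup>2) \<le> e" if "i \<ge> n0" "j \<ge> n0" for i j
  proof -
    have "(Av i w - Av j w)\<^sup>2 = Av i w * Av i w + Av j w * Av j w - 2 * (Av i w * Av j w)" for w
      by (simp add: power2_eq_square algebra_simps)
    then have "expectation (\<lambda>w. (Av i w - Av j w)\<^sup>2) = expectation (\<lambda>w. Av i w * Av i w) + expectation (\<lambda>w. Av j w * Av j w) - 2 * expectation (\<lambda>w. Av i w * Av j w)"
      using AvAv(1) by simp
    then show ?thesis using n0[OF that] n0[OF that(1,1)] n0[OF that(2,2)] by linarith
  qed
  then show ?thesis by blast
qed

text \<open>With \<open>A\<close> the L2 limit of the averages and \<open>V n = S n - A\<close>, the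
  inner products of \<open>A\<close> with \<open>S n\<close> and with itself are
  \<open>v n / 2\<close> and \<open>vinf / 2\<close>. Hence the covariance of \<open>V i\<close> and
  \<open>V j\<close> is \<open>(vinf - v (df i j)) / 2\<close>, a function of the distance alone.
  The increments of \<open>V\<close> are those of \<open>S\<close>, at every sample point.\<close>

lemma coboundary: "\<exists>V. weakly_stationary N V \<and> (\<forall>n w. Z n w = V (n + 1) w - V n w)"
proof -
  obtain A where A[measurable]: "A \<in> borel_measurable N" and A2: "integrable N (\<lambda>w. (A w)\<^sup>2)"
    and lim: "(\<lambda>n. expectation (\<lambda>w. (Av n w - A w)\<^sup>2)) \<longlonglongrightarrow> 0"
    using L2_complete[OF Av_measurable Av_square Av_cauchy] by blast
  define V where "V n w = S n w - A w" for n w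
  have dm: "(\<lambda>w. Av n w - A w) \<in> borel_measurable N" "integrable N (\<lambda>w. (Av n w - A w)\<^sup>2)" for n
    using square_integrable_add(2)[OF Av_measurable A Av_square A2] by auto
  have AvY: "(\<lambda>n. expectation (\<lambda>w. Av n w * Y w)) \<longlonglongrightarrow> expectation (\<lambda>w. A w * Y w)"
    if Y: "Y \<in> borel_measurable N" "integrable N (\<lambda>w. (Y w)\<^sup>2)" for Y
  proof -
    have "(\<lambda>n. expectation (\<lambda>w. (Av n w - A w) * Y w)) \<longlonglongrightarrow> 0"
      by (rule expectation_mult_tendsto_0[OF dm Y lim])
    moreover have "expectation (\<lambda>w. (Av n w - A w) * Y w) = expectation (\<lambda>w. Av n w * Y w) - expectation (\<lambda>w. A w * Y w)" for n
      using integrable_square_mult[OF Av_measurable Y(1) Av_square Y(2)] integrable_square_mult[OF A Y(1) A2 Y(2)]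
      by (simp add: left_diff_distrib)
    ultimately show ?thesis by (simp add: LIM_zero_iff)
  qed
  have EA: "expectation A = 0"
  proof -
    have "expectation (\<lambda>w. Av n w * 1) = 0" for n
      unfolding Av_def using S_mean square_integrable[OF S_measurable S_square(1)] by simp
    with AvY[of "\<lambda>_. 1"] show ?thesis by (simp add: LIMSEQ_const_iff)
  qed
  \<comment> \<open>In the average of \<open>(v a + v n - v (df a n)) / 2\<close> over
    \<open>a\<close> the first and the last term have the same limit and cancel.\<close>
  have AS: "expectation (\<lambda>w. A w * S n w) = v n / 2" for n
  proof (rule LIMSEQ_unique[OF AvY[OF S_measurable S_square(1)]])
    have "(\<lambda>a. (v a - v (df a n)) / 2) \<longlonglongrightarrow> 0"
    proof -
      have "filterlim (\<lambda>a. df a n) at_top sequentially"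
        unfolding filterlim_at_top
      proof
        fix Z' show "\<forall>\<^sub>F a in sequentially. Z' \<le> df a n"
          using eventually_ge_at_top[of "Z' + n"] by eventually_elim (simp add: df_def)
      qed
      from filterlim_compose[OF v_lim this] v_lim
      have "(\<lambda>a. ((v a - vinf) - (v (df a n) - vinf)) / 2) \<longlonglongrightarrow> (0 - 0) / 2" by (intro tendsto_intros) auto
      then show ?thesis by simp
    qed
    from cesaro_null[OF this] have "(\<lambda>i. (\<Sum>a=1..i. (v a - v (df a n)) / 2) / real i + v n / 2) \<longlonglongrightarrow> 0 + v n / 2"
      by (intro tendsto_intros)
    moreover have "\<forall>\<^sub>F i in sequentially. (\<Sum>a=1..i. (v a - v (df a n)) / 2) / real i + v n / 2 = expectation (\<lambda>w. Av i w * S n w)"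
      using eventually_ge_at_top[of 1]
    proof eventually_elim
      case (elim i)
      have "(\<Sum>a=1..i. (v a + v n - v (df a n)) / 2) = (\<Sum>a=1..i. (v a - v (df a n)) / 2) + real i * (v n / 2)"
        by (simp add: sum.distrib sum_subtractf sum_divide_distrib[symmetric] field_simps)
      then show ?case using elim by (simp add: AvS field_simps)
    qed
    ultimately show "(\<lambda>i. expectation (\<lambda>w. Av i w * S n w)) \<longlonglongrightarrow> v n / 2"
      by (auto intro: Lim_transform_eventually)
  qed
  define a2 where "a2 = expectation (\<lambda>w. A w * A w)"
  have a2: "a2 = vinf / 2"
  proof -
    have Ai: "expectation (\<lambda>w. A w * Av i w) = expectation (\<lambda>w. Av i w * A w)" for i by (simp add: mult.commute)
    have "(\<lambda>i. expectation (\<lambda>w. Av i w * A w)) \<longlonglongrightarrow> a2" unfolding a2_def by (rule AvY[OF A A2])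
    moreover have "(\<lambda>i. expectation (\<lambda>w. Av i w * A w)) \<longlonglongrightarrow> vinf / 2"
    proof (rule LIMSEQ_I)
      fix r :: real assume r: "r > 0"
      obtain n0 where n0: "\<And>i j. i \<ge> n0 \<Longrightarrow> j \<ge> n0 \<Longrightarrow> \<bar>expectation (\<lambda>w. Av i w * Av j w) - vinf / 2\<bar> \<le> r / 2"
        using Av_inner[of "r / 2"] r by auto
      have bd: "\<bar>expectation (\<lambda>w. Av i w * A w) - vinf / 2\<bar> \<le> r / 2" if i: "i \<ge> n0" for i
      proof -
        have "(\<lambda>j. \<bar>expectation (\<lambda>w. Av j w * Av i w) - vinf / 2\<bar>) \<longlonglongrightarrow> \<bar>expectation (\<lambda>w. A w * Av i w) - vinf / 2\<bar>"
          by (intro tendsto_intros AvY[OF Av_measurable Av_square])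
        then show ?thesis unfolding Ai by (rule LIMSEQ_le_const2) (use n0 i in auto)
      qed
      have "norm (expectation (\<lambda>w. Av i w * A w) - vinf / 2) < r" if "i \<ge> n0" for i
        using bd[OF that] r unfolding real_norm_def by linarith
      then show "\<exists>no. \<forall>n\<ge>no. norm (expectation (\<lambda>w. Av n w * A w) - vinf / 2) < r" by blast
    qed
    ultimately show ?thesis by (rule LIMSEQ_unique)
  qed
  have Vm: "V n \<in> borel_measurable N" "integrable N (\<lambda>w. (V n w)\<^sup>2)" for n
    unfolding V_def using square_integrable_add(2)[OF S_measurable A S_square(1) A2] by auto
  have V0: "expectation (V n) = 0" for n
    unfolding V_def using square_integrable[OF S_measurable S_square(1)] square_integrable[OF A A2] S_mean EA by simp
  have VV: "expectation (\<lambda>w. V i w * V j w) = (vinf - v (df i j)) / 2" for i j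
  proof -
    have "V i w * V j w = S i w * S j w - A w * S i w - A w * S j w + A w * A w" for w
      by (simp add: V_def algebra_simps)
    then have "expectation (\<lambda>w. V i w * V j w) = expectation (\<lambda>w. S i w * S j w) - expectation (\<lambda>w. A w * S i w) - expectation (\<lambda>w. A w * S j w) + a2"
      using SS(1) integrable_square_mult[OF A S_measurable A2 S_square(1)] integrable_square_mult[OF A A A2 A2]
      by (simp add: a2_def)
    then show ?thesis by (simp add: SS(2) AS a2 field_simps)
  qed
  have "weakly_stationary N V"
    unfolding weakly_stationary_def cov_def V0 using Vm by (auto simp: VV df_def)
  moreover have "Z n w = V (n + 1) w - V n w" for n w by (simp add: V_def S_def)
  ultimately show ?thesis by blast
qed

end

text \<open>Partial sums telescope to \<open>V n - V 0\<close>, whose second moment stays bounded by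
  weak stationarity.\<close>

lemma coboundary_imp_s2_zero:
  assumes V: "weakly_stationary N V" and eq: "\<And>n. AE w in N. Z n w = V (n + 1) w - V n w"
  shows "s2 = 0"
proof -
  have Vm[measurable]: "V n \<in> borel_measurable N" and V2: "integrable N (\<lambda>w. (V n w)\<^sup>2)" for n
    using V by (auto simp: weakly_stationary_def)
  define b where "b = expectation (\<lambda>w. (V 0 w)\<^sup>2)"
  define mu where "mu = expectation (V 0)"
  have mean: "expectation (V n) = mu" for n using V by (simp add: weakly_stationary_def mu_def)
  have sq: "expectation (\<lambda>w. (V n w)\<^sup>2) = b" for n
  proof -
    have c: "cov N (V n) (V n) = expectation (\<lambda>w. (V n w)\<^sup>2) - mu\<^sup>2" for n
    proof -
      have "(V n w - mu) * (V n w - mu) = (V n w)\<^sup>2 - 2 * mu * V n w + mu\<^sup>2" for w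
        by (simp add: power2_eq_square algebra_simps)
      then show ?thesis
        unfolding cov_def mean using V2 square_integrable[OF Vm V2] mean[of n]
        by (simp add: prob_space power2_eq_square)
    qed
    have "cov N (V (0 + n)) (V (0 + n)) = cov N (V 0) (V 0)" using V unfolding weakly_stationary_def by blast
    then show ?thesis using c[of n] c[of 0] by (simp add: b_def)
  qed
  have "v n \<le> 4 * b" for n
  proof -
    have "AE w in N. \<forall>i<n. Z i w = V (i + 1) w - V i w" using eq by (auto simp: AE_all_countable)
    then have ae: "AE w in N. (S n w)\<^sup>2 = (V n w - V 0 w)\<^sup>2"
    proof eventually_elim
      case (elim w)
      have "S n w = (\<Sum>i<n. V (Suc i) w - V i w)" unfolding S_def using elim by (intro sum.cong) auto
      then show ?case by (simp only: sum_lessThan_telescope[of "\<lambda>i. V i w"])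
    qed
    have i: "integrable N (\<lambda>w. (V n w - V 0 w)\<^sup>2)" by (rule square_integrable_add(2)[OF Vm Vm V2 V2])
    have "v n = expectation (\<lambda>w. (V n w - V 0 w)\<^sup>2)"
      unfolding S_square(2)[symmetric] by (rule integral_cong_AE) (use ae in auto)
    also have "\<dots> \<le> expectation (\<lambda>w. 2 * (V n w)\<^sup>2 + 2 * (V 0 w)\<^sup>2)"
    proof (rule integral_mono[OF i])
      fix w
      have "0 \<le> (V n w + V 0 w)\<^sup>2" by simp
      then show "(V n w - V 0 w)\<^sup>2 \<le> 2 * (V n w)\<^sup>2 + 2 * (V 0 w)\<^sup>2" by (simp add: power2_sum power2_diff)
    qed (use V2 in simp)
    also have "\<dots> = 4 * b" using V2 sq by simp
    finally show ?thesis .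
  qed
  then have "s2 \<le> 0"
  proof -
    assume vb: "\<And>n. v n \<le> 4 * b"
    show ?thesis
    proof (rule LIMSEQ_le[OF v_average lim_const_over_n[of "4 * b"]])
      show "\<exists>N. \<forall>n\<ge>N. v n / real n \<le> 4 * b / real n" using vb by (auto intro!: divide_right_mono)
    qed
  qed
  with s2_nonneg show ?thesis by simp
qed

lemma s2_pos_iff:
  "s2 > 0 \<longleftrightarrow> \<not> (\<exists>V. weakly_stationary N V \<and> (\<forall>n. AE w in N. Z n w = V (n + 1) w - V n w))"
proof
  assume "s2 > 0"
  then show "\<not> (\<exists>V. weakly_stationary N V \<and> (\<forall>n. AE w in N. Z n w = V (n + 1) w - V n w))"
    using coboundary_imp_s2_zero by fastforce
next
  assume n: "\<not> (\<exists>V. weakly_stationary N V \<and> (\<forall>n. AE w in N. Z n w = V (n + 1) w - V n w))"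
  have "s2 \<noteq> 0"
  proof
    assume "s2 = 0"
    from coboundary[OF this] n show False by auto
  qed
  with s2_nonneg show "s2 > 0" by simp
qed

end

section \<open>Blocks of linear polynomials\<close>

lemma lead_coeff_nonneg:
  fixes p :: "real poly"
  assumes "eventually (\<lambda>n::nat. poly p (real n) \<ge> 0) sequentially"
  shows "lead_coeff p \<ge> 0"
proof (rule ccontr)
  assume "\<not> lead_coeff p \<ge> 0"
  then have "lead_coeff (- p) > 0" by simp
  from poly_pinfty_gt_lc[OF this] obtain x0 where x0: "\<And>x. x \<ge> x0 \<Longrightarrow> poly (- p) x \<ge> lead_coeff (- p)" by blast
  obtain N1 where N1: "\<And>n. n \<ge> N1 \<Longrightarrow> poly p (real n) \<ge> 0" using assms unfolding eventually_sequentially by blast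
  obtain n :: nat where n: "x0 \<le> real n" using real_arch_simple by blast
  have "poly (- p) (real (max n N1)) \<ge> lead_coeff (- p)" by (rule x0) (use n in simp)
  moreover have "poly p (real (max n N1)) \<ge> 0" by (rule N1) simp
  ultimately show False using \<open>lead_coeff (- p) > 0\<close> by simp
qed

locale poly_blocks =
  fixes q :: "nat \<Rightarrow> real poly" and l k :: nat
  assumes l_pos: "l \<ge> 1"
    and q_nonconst: "\<forall>i\<in>{1..l}. degree (q i) \<ge> 1"
    and q_nat: "\<forall>i\<in>{1..l}. \<forall>n::nat. poly (q i) (real n) \<in> \<nat>"
    and q_incr: "eventually (\<lambda>n::nat. \<forall>i\<in>{1..<l}. poly (q i) (real n) < poly (q (i+1)) (real n)) sequentially"
    and q1_lin: "degree (q 1) = 1"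
    and k_pos: "k \<ge> 1"
    and rk: "rr q l k = Max {i\<in>{1..l}. degree (q i) = 1}"
begin

definition L :: nat where "L = rr q l k"
definition c :: nat where "c = card (Rset q l)"

lemma finite_Rset: "finite (Rset q l)"
  by (rule finite_subset[of _ "{..l}"]) (auto simp: Rset_def)

lemma lhat_c: "lhat q l = c + 1" by (simp add: lhat_def c_def)

lemma rr_in_Rset: "1 \<le> s \<Longrightarrow> s \<le> c \<Longrightarrow> rr q l s \<in> Rset q l"
proof -
  assume s: "1 \<le> s" "s \<le> c"
  then have "sorted_list_of_set (Rset q l) ! (s - 1) \<in> set (sorted_list_of_set (Rset q l))"
    by (intro nth_mem) (auto simp: c_def)
  then show ?thesis using s finite_Rset by (simp add: rr_def c_def)
qed

lemma Rset_rr: "j \<in> Rset q l \<Longrightarrow> \<exists>s. 1 \<le> s \<and> s \<le> c \<and> rr q l s = j"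
proof -
  assume "j \<in> Rset q l"
  then have "j \<in> set (sorted_list_of_set (Rset q l))" using finite_Rset by simp
  then obtain i where i: "i < c" "sorted_list_of_set (Rset q l) ! i = j"
    by (auto simp: in_set_conv_nth c_def)
  then show ?thesis by (intro exI[of _ "i + 1"]) (auto simp: rr_def c_def)
qed

lemma rr_0: "rr q l 0 = 0" by (simp add: rr_def)
lemma rr_big: "s > c \<Longrightarrow> rr q l s = l" by (simp add: rr_def c_def)

lemma rr_Suc_less: "s \<le> c \<Longrightarrow> rr q l s < rr q l (Suc s)"
proof -
  assume s: "s \<le> c"
  consider "s = 0" "c = 0" | "s = 0" "c > 0" | "s \<ge> 1" "s = c" | "s \<ge> 1" "s < c" using s by linarith
  then show ?thesis
  proof cases
    case 1 then show ?thesis using l_pos rr_big[of 1] by (simp add: rr_0)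
  next
    case 2 then show ?thesis using rr_in_Rset[of 1] by (auto simp: rr_0 Rset_def)
  next
    case 3 then show ?thesis using rr_in_Rset[of s] rr_big[of "Suc s"] by (auto simp: Rset_def)
  next
    case 4
    have "sorted_list_of_set (Rset q l) ! (s - 1) < sorted_list_of_set (Rset q l) ! s"
      by (rule sorted_wrt_nth_less[OF strict_sorted_list_of_set]) (use 4 in \<open>auto simp: c_def\<close>)
    then show ?thesis using 4 by (simp add: rr_def c_def)
  qed
qed

lemma rr_less: "s < s' \<Longrightarrow> s' \<le> c + 1 \<Longrightarrow> rr q l s < rr q l s'"
proof (induction s' rule: nat_induct)
  case (Suc s')
  then show ?case using rr_Suc_less[of s'] by (cases "s = s'") (auto simp: less_Suc_eq)
qed simp

lemma rr_mono: "s \<le> s' \<Longrightarrow> rr q l s \<le> rr q l s'"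
proof -
  assume s: "s \<le> s'"
  have le: "rr q l s \<le> l" for s using rr_less[of s "c + 1"] rr_big[of s] rr_big[of "c + 1"] by (cases "s \<le> c") auto
  show ?thesis
  proof (cases "s' \<le> c + 1")
    case True then show ?thesis using rr_less[of s s'] s by (cases "s = s'") auto
  next
    case False then show ?thesis using rr_big[of s'] le by simp
  qed
qed

lemma L_Max: "L \<in> {i\<in>{1..l}. degree (q i) = 1}"
  unfolding L_def rk by (rule Max_in) (use q1_lin l_pos in auto)

lemma L_range: "1 \<le> L" "L \<le> l" and deg_L: "degree (q L) = 1" using L_Max by auto

lemma lc_nonneg: "i \<in> {1..l} \<Longrightarrow> lead_coeff (q i) \<ge> 0"
  by (intro lead_coeff_nonneg always_eventually allI) (metis Nats_cases of_nat_0_le_iff q_nat)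

lemma q_less: "i \<in> {1..<l} \<Longrightarrow> eventually (\<lambda>n::nat. poly (q i) (real n) < poly (q (i+1)) (real n)) sequentially"
  using q_incr by eventually_elim auto

text \<open>Downwards from \<open>L\<close>: if \<open>q n\<close> had a larger degree than the
  linear \<open>q (Suc n)\<close>, the leading coefficient of their difference would be minus that
  of \<open>q n\<close>, against the eventual order.\<close>

lemma degree_one: "i \<in> {1..L} \<Longrightarrow> degree (q i) = 1"
proof -
  assume i: "i \<in> {1..L}"
  have "i \<le> L" using i by simp
  then have "1 \<le> i \<Longrightarrow> degree (q i) = 1"
  proof (induction i rule: inc_induct)
    case base show ?case by (rule deg_L)
  next
    case (step n)
    have n: "n \<in> {1..<l}" using step L_range by auto
    show ?case
    proof (rule ccontr)
      assume ne: "degree (q n) \<noteq> 1"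
      have d2: "degree (q n) > 1" using q_nonconst n ne by force
      have d1: "degree (q (Suc n)) = 1" using step by simp
      have "eventually (\<lambda>m::nat. poly (q (Suc n) - q n) (real m) \<ge> 0) sequentially"
        using q_less[OF n] by eventually_elim simp
      from lead_coeff_nonneg[OF this]
      have "lead_coeff (q (Suc n) - q n) \<ge> 0" .
      moreover have "degree (q (Suc n) - q n) = degree (q n)"
        using degree_add_eq_right[of "q (Suc n)" "- q n"] d1 d2 by simp
      ultimately have "coeff (q n) (degree (q n)) \<le> 0" using d1 d2 by (simp add: coeff_eq_0)
      moreover have "lead_coeff (q n) \<ge> 0" using lc_nonneg n by simp
      ultimately have "lead_coeff (q n) = 0" by simp
      then show False using d2 by auto
    qed
  qed
  then show ?thesis using i by simp
qed

definition a :: "nat \<Rightarrow> nat" where "a j = nat \<lfloor>coeff (q j) 1\<rfloor>"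
definition b :: "nat \<Rightarrow> nat" where "b j = nat \<lfloor>coeff (q j) 0\<rfloor>"

lemma poly_linear:
  assumes j: "j \<in> {1..L}"
  shows "poly (q j) x = coeff (q j) 0 + coeff (q j) 1 * x"
  using degree_one[OF j] by (simp add: poly_altdef)

text \<open>The intercept is the value at 0 and the slope a difference of values at 1 and 0, so both
  are integers and the floors in \<open>a\<close> and \<open>b\<close> lose nothing.\<close>

lemma ab:
  assumes j: "j \<in> {1..L}"
  shows "real (a j) = coeff (q j) 1" "real (b j) = coeff (q j) 0" "a j \<ge> 1"
proof -
  have jl: "j \<in> {1..l}" using j L_range by auto
  have c0: "coeff (q j) 0 \<in> \<nat>" using q_nat[rule_format, OF jl, of 0] poly_linear[OF j, of 0] by simp
  have c01: "coeff (q j) 0 + coeff (q j) 1 \<in> \<nat>" using q_nat[rule_format, OF jl, of 1] poly_linear[OF j, of 1] by simp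
  obtain u v where u: "coeff (q j) 0 = real u" and v: "coeff (q j) 0 + coeff (q j) 1 = real v"
    using c0 c01 by (auto simp: Nats_def)
  have "coeff (q j) 1 \<ge> 0" using lc_nonneg[OF jl] degree_one[OF j] by simp
  moreover have "coeff (q j) 1 \<noteq> 0" using degree_one[OF j] by (metis leading_coeff_0_iff degree_0 zero_neq_one)
  ultimately have pos: "coeff (q j) 1 > 0" by simp
  have c1: "coeff (q j) 1 = real (v - u)" using u v pos by auto
  show "real (b j) = coeff (q j) 0" using u by (simp add: b_def)
  show "real (a j) = coeff (q j) 1" using c1 by (simp add: a_def)
  then show "a j \<ge> 1" using pos by (simp add: Suc_le_eq)
qed

lemma qv_eq: "j \<in> {1..L} \<Longrightarrow> qv (q j) n = a j * n + b j"
proof -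
  assume j: "j \<in> {1..L}"
  have "poly (q j) (real n) = real (a j * n + b j)" using poly_linear[OF j, of "real n"] ab[OF j] by simp
  then show ?thesis by (simp only: qv_def floor_of_nat nat_int)
qed

text \<open>The difference of neighbours is affine and eventually positive. It tends to infinity
  exactly when the slopes differ; otherwise the intercepts must differ.\<close>

lemma step_cases:
  assumes j: "1 \<le> j" "j < L"
  shows "j \<in> Rset q l \<Longrightarrow> a j < a (Suc j)" "j \<notin> Rset q l \<Longrightarrow> a j = a (Suc j) \<and> b j < b (Suc j)"
proof -
  have jL: "j \<in> {1..L}" "Suc j \<in> {1..L}" "j \<in> {1..<l}" using j L_range by auto
  have df: "poly (q (Suc j)) (real n) - poly (q j) (real n) = (real (a (Suc j)) - real (a j)) * real n + (real (b (Suc j)) - real (b j))" for n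
    using poly_linear[OF jL(1)] poly_linear[OF jL(2)] ab[OF jL(1)] ab[OF jL(2)] by (simp add: algebra_simps)
  have ev: "eventually (\<lambda>n::nat. (real (a (Suc j)) - real (a j)) * real n + (real (b (Suc j)) - real (b j)) > 0) sequentially"
    using q_less[OF jL(3)] unfolding df[symmetric] by eventually_elim simp
  have ge: "a j \<le> a (Suc j)"
  proof (rule ccontr)
    assume "\<not> a j \<le> a (Suc j)"
    then have lt: "real (a (Suc j)) - real (a j) \<le> - 1" by linarith
    have "eventually (\<lambda>n::nat. False) sequentially"
      using ev eventually_ge_at_top[of "b (Suc j)"]
    proof eventually_elim
      case (elim n)
      have "(real (a (Suc j)) - real (a j)) * real n \<le> - 1 * real n" using lt by (intro mult_right_mono) auto
      moreover have "real (b (Suc j)) \<le> real n" using elim by simp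
      ultimately show ?case using elim by linarith
    qed
    then show False by simp
  qed
  have R: "j \<in> Rset q l \<longleftrightarrow> filterlim (\<lambda>n::nat. (real (a (Suc j)) - real (a j)) * real n + (real (b (Suc j)) - real (b j))) at_top sequentially"
    using jL unfolding Rset_def mem_Collect_eq Suc_eq_plus1[symmetric] df by auto
  have iff: "j \<in> Rset q l \<longleftrightarrow> a j < a (Suc j)"
  proof
    assume "j \<in> Rset q l"
    then have fl: "filterlim (\<lambda>n::nat. (real (a (Suc j)) - real (a j)) * real n + (real (b (Suc j)) - real (b j))) at_top sequentially" using R by simp
    show "a j < a (Suc j)"
    proof (rule ccontr)
      assume "\<not> a j < a (Suc j)"
      with ge have "a j = a (Suc j)" by simp
      with fl have "filterlim (\<lambda>n::nat. real (b (Suc j)) - real (b j)) at_top sequentially" by simp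
      then have "eventually (\<lambda>n::nat. real (b (Suc j)) - real (b j) + 1 \<le> real (b (Suc j)) - real (b j)) sequentially"
        unfolding filterlim_at_top by blast
      then show False by simp
    qed
  next
    assume lt: "a j < a (Suc j)"
    have "filterlim (\<lambda>n::nat. real n + (real (b (Suc j)) - real (b j))) at_top sequentially"
      using filterlim_tendsto_add_at_top[OF tendsto_const filterlim_real_sequentially, of "real (b (Suc j)) - real (b j)"]
      by (simp add: add.commute)
    then show "j \<in> Rset q l" unfolding R
    proof (rule filterlim_at_top_mono, intro always_eventually allI)
      fix n :: nat
      show "real n + (real (b (Suc j)) - real (b j)) \<le> (real (a (Suc j)) - real (a j)) * real n + (real (b (Suc j)) - real (b j))"
      using mult_right_mono[of 1 "real (a (Suc j)) - real (a j)" "real n"] lt by simp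
    qed
  qed
  show "j \<in> Rset q l \<Longrightarrow> a j < a (Suc j)" using iff by simp
  assume "j \<notin> Rset q l"
  then have e: "a j = a (Suc j)" using iff ge by simp
  then have "b j < b (Suc j)" using ev by auto
  with e show "a j = a (Suc j) \<and> b j < b (Suc j)" by simp
qed

lemma blk_props:
  assumes j: "1 \<le> j" "j \<le> l"
  shows "rr q l (blk q l j - 1) < j" "j \<le> rr q l (blk q l j)" "1 \<le> blk q l j" "blk q l j \<le> c + 1"
proof -
  have ex: "j \<le> rr q l (c + 1)" using j rr_big[of "c + 1"] by simp
  show le: "j \<le> rr q l (blk q l j)" unfolding blk_def by (rule LeastI[where P="\<lambda>s. j \<le> rr q l s", OF ex])
  show "blk q l j \<le> c + 1" unfolding blk_def by (rule Least_le[where P="\<lambda>s. j \<le> rr q l s", OF ex])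
  show g1: "1 \<le> blk q l j"
  proof (rule ccontr)
    assume "\<not> 1 \<le> blk q l j"
    then have "blk q l j = 0" by simp
    then show False using le j by (simp add: rr_0)
  qed
  have "\<not> j \<le> rr q l (blk q l j - 1)"
    using not_less_Least[of "blk q l j - 1" "\<lambda>s. j \<le> rr q l s"] g1 unfolding blk_def by simp
  then show "rr q l (blk q l j - 1) < j" by simp
qed

lemma blk_eqI:
  assumes "rr q l (s - 1) < j" "j \<le> rr q l s" "1 \<le> s"
  shows "blk q l j = s"
  unfolding blk_def
proof (rule Least_equality)
  fix y assume y: "j \<le> rr q l y"
  show "s \<le> y"
  proof (rule ccontr)
    assume "\<not> s \<le> y"
    then have "rr q l y \<le> rr q l (s - 1)" by (intro rr_mono) simp
    then show False using y assms by linarith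
  qed
qed (rule assms)

lemma Bl_iff: "j \<in> Bl q l s \<longleftrightarrow> rr q l (s - 1) < j \<and> j \<le> rr q l s"
  by (auto simp: Bl_def)

text \<open>\<open>rr q l s\<close> is \<open>l\<close> for every large \<open>s\<close>, so
  \<open>rr q l k = L\<close> does not determine \<open>k\<close> when all polynomials are linear.
  \<open>k'\<close> is the least index with this value, and the blocks strictly after
  \<open>k'\<close> up to \<open>k\<close> are empty.\<close>

definition k' :: nat where "k' = blk q l L"

lemma rr_le_l: "rr q l s \<le> l"
  using rr_mono[of s "max s (c + 1)"] rr_big[of "max s (c + 1)"] by simp

lemma k'_props: "1 \<le> k'" "k' \<le> c + 1" "rr q l k' = L" "k' \<le> k"
proof -
  note bp = blk_props[OF L_range]
  show "1 \<le> k'" "k' \<le> c + 1" using bp by (auto simp: k'_def)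
  show kk: "k' \<le> k" unfolding k'_def blk_def by (rule Least_le) (simp add: L_def)
  have "rr q l k' \<le> rr q l k" by (rule rr_mono[OF kk])
  then show "rr q l k' = L" using bp(2) by (simp add: k'_def L_def)
qed

lemma blk_range: "j \<in> {1..L} \<Longrightarrow> 1 \<le> blk q l j \<and> blk q l j \<le> k' \<and> j \<in> Bl q l (blk q l j)"
proof -
  assume j: "j \<in> {1..L}"
  have bp: "rr q l (blk q l j - 1) < j" "j \<le> rr q l (blk q l j)" "1 \<le> blk q l j" using blk_props[of j] j L_range by auto
  have "blk q l j \<le> k'"
  proof (rule ccontr)
    assume "\<not> blk q l j \<le> k'"
    then have "rr q l k' \<le> rr q l (blk q l j - 1)" by (intro rr_mono) simp
    then show False using bp k'_props j by simp
  qed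
  with bp show ?thesis by (simp add: Bl_iff)
qed

lemma blk_Bl: "j \<in> Bl q l s \<Longrightarrow> 1 \<le> s \<Longrightarrow> blk q l j = s"
  using blk_eqI by (simp add: Bl_iff)

lemma Bl_subset: "s \<le> k' \<Longrightarrow> Bl q l s \<subseteq> {1..L}"
  using rr_mono[of s k'] k'_props by (auto simp: Bl_iff)

definition fst_idx :: "nat \<Rightarrow> nat" where "fst_idx s = rr q l (s - 1) + 1"
definition slope :: "nat \<Rightarrow> nat" where "slope s = a (fst_idx s)"

lemma fst_idx_Bl: "1 \<le> s \<Longrightarrow> s \<le> k' \<Longrightarrow> fst_idx s \<in> Bl q l s"
  using rr_less[of "s - 1" s] k'_props by (auto simp: Bl_iff fst_idx_def)

lemma not_Rset_inside: "1 \<le> s \<Longrightarrow> s \<le> k' \<Longrightarrow> rr q l (s - 1) < j \<Longrightarrow> j < rr q l s \<Longrightarrow> j \<notin> Rset q l"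
proof
  assume s: "1 \<le> s" "s \<le> k'" "rr q l (s - 1) < j" "j < rr q l s" "j \<in> Rset q l"
  obtain t where t: "1 \<le> t" "t \<le> c" "rr q l t = j" using Rset_rr[OF s(5)] by blast
  consider "t \<le> s - 1" | "s \<le> t" using s by linarith
  then show False using s t rr_mono[of t "s - 1"] rr_mono[of s t] by cases auto
qed

text \<open>Inside a block no index belongs to \<open>Rset q l\<close>, so the slope is constant and
  the integer intercept grows by at least one per step. Injectivity of \<open>b\<close> on a block,
  which follows, is what bounds the size of the block.\<close>

lemma block_affine:
  assumes s: "1 \<le> s" "s \<le> k'" and j: "j \<in> Bl q l s" and i: "i \<in> Bl q l s" and ij: "i \<le> j"
  shows "a j = a i \<and> b i + (j - i) \<le> b j"
  using ij j
proof (induction j rule: dec_induct)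
  case (step n)
  have n: "n \<in> Bl q l s" "1 \<le> n" "n < rr q l s" using step i by (auto simp: Bl_iff)
  have nL: "n < L" using Bl_subset[OF s(2)] step by auto
  have "n \<notin> Rset q l" using not_Rset_inside[OF s] n by (auto simp: Bl_iff)
  from step_cases(2)[OF n(2) nL this] step.IH[OF n(1)] step.hyps show ?case by auto
qed simp

lemma slope_eq: "1 \<le> s \<Longrightarrow> s \<le> k' \<Longrightarrow> j \<in> Bl q l s \<Longrightarrow> a j = slope s"
  using block_affine[of s j "fst_idx s"] fst_idx_Bl[of s] by (auto simp: slope_def fst_idx_def Bl_iff)

lemma doff_eq:
  assumes s: "1 \<le> s" "s \<le> k'" and j: "j \<in> Bl q l s"
  shows "b (fst_idx s) + doff q l j = b j"
proof -
  have jL: "j \<in> {1..L}" "fst_idx s \<in> {1..L}" using Bl_subset[OF s(2)] j fst_idx_Bl[OF s] by auto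
  have le: "b (fst_idx s) \<le> b j" using block_affine[OF s j fst_idx_Bl[OF s]] j by (auto simp: fst_idx_def Bl_iff)
  have "poly (q j - q (fst_idx s)) 0 = real (b j) - real (b (fst_idx s))"
    using poly_linear[OF jL(1), of 0] poly_linear[OF jL(2), of 0] ab[OF jL(1)] ab[OF jL(2)] by simp
  also have "\<dots> = real (b j - b (fst_idx s))" using le by simp
  finally have "doff q l j = b j - b (fst_idx s)"
    unfolding doff_def blk_Bl[OF j s(1)] fst_idx_def[symmetric] by simp
  then show ?thesis using le by simp
qed

lemma qv_first: "1 \<le> s \<Longrightarrow> s \<le> k' \<Longrightarrow> qv (q (fst_idx s)) n = slope s * n + b (fst_idx s)"
  using qv_eq[of "fst_idx s" n] fst_idx_Bl[of s] Bl_subset[of s] by (auto simp: slope_def)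

lemma slope_pos: "1 \<le> s \<Longrightarrow> s \<le> k' \<Longrightarrow> slope s \<ge> 1"
  using ab(3)[of "fst_idx s"] fst_idx_Bl[of s] Bl_subset[of s] by (auto simp: slope_def)

lemma slope_Suc: "1 \<le> s \<Longrightarrow> Suc s \<le> k' \<Longrightarrow> slope s < slope (Suc s)"
proof -
  assume s: "1 \<le> s" "Suc s \<le> k'"
  have sc: "s \<le> c" using s k'_props by simp
  define j where "j = rr q l s"
  have jR: "j \<in> Rset q l" unfolding j_def by (rule rr_in_Rset[OF s(1) sc])
  have jB: "j \<in> Bl q l s" using rr_less[of "s - 1" s] s sc by (auto simp: Bl_iff j_def)
  have j1: "1 \<le> j" using jR by (auto simp: Rset_def)
  have jL: "j < L" using rr_less[of s k'] s k'_props by (auto simp: j_def)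
  have "a j < a (Suc j)" by (rule step_cases(1)[OF j1 jL jR])
  moreover have "a j = slope s" using slope_eq[OF s(1) _ jB] s by simp
  moreover have "Suc j = fst_idx (Suc s)" by (simp add: fst_idx_def j_def)
  ultimately show ?thesis by (simp add: slope_def)
qed

lemma slope_less: "1 \<le> s \<Longrightarrow> s < s' \<Longrightarrow> s' \<le> k' \<Longrightarrow> slope s < slope s'"
proof (induction s' rule: nat_induct)
  case (Suc s')
  then show ?case using slope_Suc[of s'] by (cases "s = s'") auto
qed simp

lemma finite_Dhat: "finite (Dhat q l)"
proof (rule finite_subset)
  show "Dhat q l \<subseteq> (\<lambda>(s, i). poly (q i - q (rr q l s + 1)) 0) ` ({..lhat q l} \<times> {..l})"
    using rr_le_l by (fastforce simp: Dhat_def image_iff intro: order_trans)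
qed simp

text \<open>Different members of a block have different offsets from its first member, and all these
  offsets belong to \<open>Dhat q l\<close>.\<close>

lemma card_Bl: "1 \<le> s \<Longrightarrow> s \<le> k' \<Longrightarrow> card (Bl q l s) \<le> card (Dhat q l)"
proof -
  assume s: "1 \<le> s" "s \<le> k'"
  define f where "f j = poly (q j - q (rr q l (s - 1) + 1)) 0" for j
  have fb: "f j = real (b j) - real (b (fst_idx s))" if j: "j \<in> Bl q l s" for j
  proof -
    have jL: "j \<in> {1..L}" "fst_idx s \<in> {1..L}" using Bl_subset[OF s(2)] j fst_idx_Bl[OF s] by auto
    show ?thesis unfolding f_def fst_idx_def[symmetric]
      using poly_linear[OF jL(1), of 0] poly_linear[OF jL(2), of 0] ab[OF jL(1)] ab[OF jL(2)] by simp
  qed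
  show ?thesis
  proof (rule card_inj_on_le)
    show "inj_on f (Bl q l s)"
    proof (rule inj_onI)
      fix i j assume ij: "i \<in> Bl q l s" "j \<in> Bl q l s" "f i = f j"
      then have "b i = b j" using fb by simp
      show "i = j"
      proof (cases "i \<le> j")
        case True
        have "b i + (j - i) \<le> b j" using block_affine[OF s ij(2,1) True] by simp
        then show ?thesis using \<open>b i = b j\<close> True by linarith
      next
        case False
        have "b j + (i - j) \<le> b i" using block_affine[OF s ij(1,2)] False by simp
        then show ?thesis using \<open>b i = b j\<close> False by linarith
      qed
    qed
    show "f ` Bl q l s \<subseteq> Dhat q l"
    proof
      fix y assume "y \<in> f ` Bl q l s"
      then obtain j where j: "j \<in> Bl q l s" "y = f j" by blast
      then show "y \<in> Dhat q l" unfolding Dhat_def f_def lhat_c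
        using s k'_props by (intro CollectI exI[of _ "s - 1"] exI[of _ j]) (auto simp: Bl_iff)
    qed
  qed (rule finite_Dhat)
qed

text \<open>At most \<open>lhat q l - 1\<close> blocks precede block \<open>s\<close>. Multiplied by
  \<open>CARD('d)\<close>, the bound is the dimension that appears in the assumption on
  \<open>delta\<close>.\<close>

lemma card_earlier: "s \<le> k' \<Longrightarrow> card {j\<in>{1..L}. blk q l j < s} \<le> (lhat q l - 1) * card (Dhat q l)"
proof -
  assume s: "s \<le> k'"
  have "{j\<in>{1..L}. blk q l j < s} \<subseteq> (\<Union>t\<in>{1..<s}. Bl q l t)" using blk_range by fastforce
  then have "card {j\<in>{1..L}. blk q l j < s} \<le> card (\<Union>t\<in>{1..<s}. Bl q l t)"
    by (intro card_mono) (auto simp: Bl_def)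
  also have "\<dots> \<le> (\<Sum>t\<in>{1..<s}. card (Bl q l t))" by (rule card_UN_le) simp
  also have "\<dots> \<le> (\<Sum>t\<in>{1..<s}. card (Dhat q l))" using s by (intro sum_mono card_Bl) auto
  also have "\<dots> = (s - 1) * card (Dhat q l)" by simp
  also have "\<dots> \<le> (lhat q l - 1) * card (Dhat q l)" using s k'_props by (intro mult_right_mono) (auto simp: lhat_c)
  finally show ?thesis .
qed

end

section \<open>Sums over blocks\<close>

text \<open>\<open>g s n\<close> depends on times up to about \<open>A s * n\<close> and is nearly centred given the times that
  are well before \<open>A s * n\<close>.\<close>
locale block_sums = prob_space M for M :: "'a measure" +
  fixes g :: "nat \<Rightarrow> nat \<Rightarrow> 'a \<Rightarrow> real" and kk :: nat and A :: "nat \<Rightarrow> nat" and k0 :: "nat \<Rightarrow> real"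
  assumes gm [measurable]: "\<And>s n. g s n \<in> borel_measurable M" and g2: "\<And>s n. integrable M (\<lambda>w. (g s n w)\<^sup>2)"
    and A_pos: "\<And>s. s \<in> {1..kk} \<Longrightarrow> A s > 0" and A_less: "\<And>s s'. s \<in> {1..kk} \<Longrightarrow> s' \<in> {1..kk} \<Longrightarrow> s < s' \<Longrightarrow> A s < A s'"
    and k0_nonneg: "\<And>u. k0 u \<ge> 0" and k0_sum: "summable (\<lambda>u. real u * k0 u)"
    and bound: "\<And>s s' n m. s \<in> {1..kk} \<Longrightarrow> s' \<in> {1..kk} \<Longrightarrow> A s' * m \<le> A s * n \<Longrightarrow>
        \<bar>expectation (\<lambda>w. g s n w * g s' m w)\<bar> \<le> k0 (A s * n - A s' * m) + k0 n"
    and mean_bound: "\<And>s n. s \<in> {1..kk} \<Longrightarrow> \<bar>expectation (g s n)\<bar> \<le> k0 n"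
    and conv: "\<And>s s' n m. s \<in> {1..kk} \<Longrightarrow> s' \<in> {1..kk} \<Longrightarrow> s \<le> s' \<Longrightarrow>
        convergent (\<lambda>t. expectation (\<lambda>w. g s (n + A s' * t) w * g s' (m + A s * t) w))"
begin

definition c :: "nat \<Rightarrow> nat \<Rightarrow> nat \<Rightarrow> nat \<Rightarrow> real" where
  "c s s' n m = expectation (\<lambda>w. g s n w * g s' m w)"
definition S :: "nat \<Rightarrow> nat \<Rightarrow> 'a \<Rightarrow> real" where "S s N w = (\<Sum>n=1..N. g s n w)"
definition x :: "nat \<Rightarrow> nat \<Rightarrow> nat \<Rightarrow> real" where
  "x s s' N = (\<Sum>n=1..N. \<Sum>m=1..N. c s s' n m) / real N"

lemma gg: "integrable M (\<lambda>w. g s n w * g s' m w)"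
  by (rule integrable_square_mult[OF gm gm g2 g2])

lemma array: "s \<in> {1..kk} \<Longrightarrow> s' \<in> {1..kk} \<Longrightarrow> decaying_array (c s s') (A s) (A s') k0"
proof
  assume s: "s \<in> {1..kk}" "s' \<in> {1..kk}"
  show "\<bar>c s s' n m\<bar> \<le> k0 (A s * n - A s' * m) + k0 n" if "A s' * m \<le> A s * n" for n m
    unfolding c_def by (rule bound[OF s that])
  show "\<bar>c s s' n m\<bar> \<le> k0 (A s' * m - A s * n) + k0 m" if "A s * n \<le> A s' * m" for n m
    using bound[OF s(2,1) that] by (simp add: c_def mult.commute)
qed (use A_pos k0_nonneg k0_sum in auto)

text \<open>With periods \<open>P = A s'\<close> and \<open>P' = A s\<close> both times advance by
  \<open>A s * A s' * t\<close>, which keeps their separation. \<open>average_convergent\<close>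
  wants the smaller slope first, hence the reduction to \<open>s <= s'\<close>.\<close>

lemma x_convergent: "s \<in> {1..kk} \<Longrightarrow> s' \<in> {1..kk} \<Longrightarrow> convergent (x s s')"
proof (induction s s' rule: linorder_wlog)
  case (le s s')
  have "A s \<le> A s'" using A_less[OF le(2,3)] le(1) by (cases "s = s'") auto
  then show ?case unfolding x_def
    by (rule decaying_array.average_convergent[OF array[OF le(2,3)] _ mult.commute A_pos[OF le(2)]])
       (use conv[OF le(2,3,1)] in \<open>simp add: c_def\<close>)
next
  case (sym s s')
  have "x s' s = x s s'"
  proof
    fix N
    have "(\<Sum>n=1..N. \<Sum>m=1..N. c s' s n m) = (\<Sum>n=1..N. \<Sum>m=1..N. c s s' n m)"
      by (subst sum.swap) (simp add: c_def mult.commute)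
    then show "x s' s N = x s s' N" by (simp add: x_def)
  qed
  with sym show ?case by simp
qed

definition D :: "nat \<Rightarrow> real" where "D s = lim (x s s)"

lemma D_lim: "s \<in> {1..kk} \<Longrightarrow> x s s \<longlonglongrightarrow> D s"
  unfolding D_def using x_convergent[of s s] by (simp add: convergent_LIMSEQ_iff)

lemma S_measurable [measurable]: "S s N \<in> borel_measurable M" unfolding S_def by measurable

lemma SS: "integrable M (\<lambda>w. S s N w * S s' N' w)" "expectation (\<lambda>w. S s N w * S s' N' w) = (\<Sum>n=1..N. \<Sum>m=1..N'. c s s' n m)"
proof -
  have eq: "S s N w * S s' N' w = (\<Sum>n=1..N. \<Sum>m=1..N'. g s n w * g s' m w)" for w
    by (simp add: S_def sum_product)
  show "integrable M (\<lambda>w. S s N w * S s' N' w)" unfolding eq using gg by auto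
  show "expectation (\<lambda>w. S s N w * S s' N' w) = (\<Sum>n=1..N. \<Sum>m=1..N'. c s s' n m)"
    unfolding eq using gg by (simp add: c_def)
qed

lemma S_square: "integrable M (\<lambda>w. (S s N w)\<^sup>2)" "expectation (\<lambda>w. (S s N w)\<^sup>2) / real N = x s s N"
  using SS[of s N s N] by (auto simp: power2_eq_square x_def)

lemma D_nonneg: "s \<in> {1..kk} \<Longrightarrow> D s \<ge> 0"
proof (rule LIMSEQ_le_const[OF D_lim])
  have "x s s N \<ge> 0" for N unfolding S_square(2)[symmetric] by simp
  then show "\<exists>N. \<forall>n\<ge>N. 0 \<le> x s s n" by blast
qed

definition R :: "nat \<Rightarrow> nat \<Rightarrow> 'a \<Rightarrow> real" where "R j N w = (\<Sum>s=1..j. S s N w)"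

lemma R_measurable [measurable]: "R j N \<in> borel_measurable M" unfolding R_def by measurable

lemma R_square: "integrable M (\<lambda>w. (R j N w)\<^sup>2)" "expectation (\<lambda>w. (R j N w)\<^sup>2) = (\<Sum>s=1..j. \<Sum>s'=1..j. expectation (\<lambda>w. S s N w * S s' N w))"
proof -
  have eq: "(R j N w)\<^sup>2 = (\<Sum>s=1..j. \<Sum>s'=1..j. S s N w * S s' N w)" for w
    by (simp add: R_def power2_eq_square sum_product)
  show "integrable M (\<lambda>w. (R j N w)\<^sup>2)" unfolding eq using SS(1) by auto
  show "expectation (\<lambda>w. (R j N w)\<^sup>2) = (\<Sum>s=1..j. \<Sum>s'=1..j. expectation (\<lambda>w. S s N w * S s' N w))"
    unfolding eq using SS(1) by simp
qed

definition sigma2 :: real where "sigma2 = (\<Sum>s=1..kk. \<Sum>s'=1..kk. lim (x s s'))"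

lemma R_lim: "(\<lambda>N. expectation (\<lambda>w. (R kk N w)\<^sup>2) / real N) \<longlonglongrightarrow> sigma2"
proof -
  have "expectation (\<lambda>w. (R kk N w)\<^sup>2) / real N = (\<Sum>s=1..kk. \<Sum>s'=1..kk. x s s' N)" for N
    unfolding R_square(2) SS(2) x_def by (simp add: sum_divide_distrib)
  moreover have "(\<lambda>N. \<Sum>s=1..kk. \<Sum>s'=1..kk. x s s' N) \<longlonglongrightarrow> sigma2"
    unfolding sigma2_def using x_convergent by (intro tendsto_sum) (simp add: convergent_LIMSEQ_iff)
  ultimately show ?thesis by simp
qed

text \<open>The summands are only asymptotically centred, but their means are summable, so the
  squared mean of the total is bounded and disappears after division by \<open>N\<close>.\<close>

lemma variance_lim: "(\<lambda>N. var M (\<lambda>w. \<Sum>n=1..N. \<Sum>s=1..kk. g s n w) / real N) \<longlonglongrightarrow> sigma2"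
proof -
  have R: "(\<lambda>w. \<Sum>n=1..N. \<Sum>s=1..kk. g s n w) = R kk N" for N
    unfolding R_def S_def by (intro ext) (rule sum.swap)
  have Ri: "integrable M (R kk N)" for N by (rule square_integrable[OF R_measurable R_square(1)])
  have v: "var M (R kk N) = expectation (\<lambda>w. (R kk N w)\<^sup>2) - (expectation (R kk N))\<^sup>2" for N
    unfolding var_def using variance_eq[OF Ri R_square(1)] .
  define K where "K = real kk * suminf k0"
  have sk: "summable k0" by (rule summable_of_weighted) (use k0_sum in \<open>simp add: k0_nonneg\<close>)
  have mb: "\<bar>expectation (R kk N)\<bar> \<le> K" for N
  proof -
    have gi: "integrable M (g s n)" for s n by (rule square_integrable[OF gm g2])
    have eq: "expectation (R kk N) = (\<Sum>s=1..kk. \<Sum>n=1..N. expectation (g s n))"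
      unfolding R_def S_def using gi by simp
    have "\<bar>expectation (R kk N)\<bar> \<le> (\<Sum>s=1..kk. \<Sum>n=1..N. \<bar>expectation (g s n)\<bar>)"
      unfolding eq by (rule order_trans[OF sum_abs sum_mono[OF sum_abs]])
    also have "\<dots> \<le> (\<Sum>s=1..kk. suminf k0)"
    proof (rule sum_mono)
      fix s assume s: "s \<in> {1..kk}"
      have "(\<Sum>n=1..N. \<bar>expectation (g s n)\<bar>) \<le> (\<Sum>n=1..N. k0 n)" by (intro sum_mono mean_bound s)
      also have "\<dots> \<le> suminf k0" using k0_nonneg by (intro sum_le_suminf sk) auto
      finally show "(\<Sum>n=1..N. \<bar>expectation (g s n)\<bar>) \<le> suminf k0" .
    qed
    finally show ?thesis by (simp add: K_def)
  qed
  have "(\<lambda>N. (expectation (R kk N))\<^sup>2 / real N) \<longlonglongrightarrow> 0"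
  proof (rule Lim_null_comparison)
    show "\<forall>\<^sub>F N in sequentially. norm ((expectation (R kk N))\<^sup>2 / real N) \<le> K\<^sup>2 / real N"
    proof (rule always_eventually, rule allI)
      fix N
      have "(expectation (R kk N))\<^sup>2 \<le> K\<^sup>2" using power_mono[OF mb[of N], of 2] by simp
      then show "norm ((expectation (R kk N))\<^sup>2 / real N) \<le> K\<^sup>2 / real N" by (simp add: divide_right_mono)
    qed
    show "(\<lambda>N. K\<^sup>2 / real N) \<longlonglongrightarrow> 0" by (rule lim_const_over_n)
  qed
  from tendsto_diff[OF R_lim this] show ?thesis unfolding R v by (simp add: diff_divide_distrib)
qed

lemma sigma2_nonneg: "sigma2 \<ge> 0"
  by (rule LIMSEQ_le_const[OF R_lim]) auto

text \<open>The square of a sum of \<open>kk\<close> terms is at most \<open>kk\<close> times the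
  sum of the squares.\<close>

lemma sigma2_zero_if: 
  assumes "\<And>s. s \<in> {1..kk} \<Longrightarrow> D s = 0"
  shows "sigma2 = 0"
proof -
  have "sigma2 \<le> 0"
  proof (rule LIMSEQ_le[OF R_lim])
    have "(\<lambda>N. (\<Sum>s=1..kk. x s s N) * real kk) \<longlonglongrightarrow> (\<Sum>s=1..kk. 0) * real kk"
      using D_lim assms by (intro tendsto_intros) fastforce
    then show "(\<lambda>N. (\<Sum>s=1..kk. x s s N) * real kk) \<longlonglongrightarrow> 0" by simp
    show "\<exists>N. \<forall>n\<ge>N. expectation (\<lambda>w. (R kk n w)\<^sup>2) / real n \<le> (\<Sum>s=1..kk. x s s n) * real kk"
    proof (intro exI allI impI)
      fix N
      have "expectation (\<lambda>w. (R kk N w)\<^sup>2) \<le> expectation (\<lambda>w. (\<Sum>s=1..kk. (S s N w)\<^sup>2) * real kk)"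
      proof (rule integral_mono)
        show "(R kk N w)\<^sup>2 \<le> (\<Sum>s=1..kk. (S s N w)\<^sup>2) * real kk" for w
          unfolding R_def using sum_squared_le_sum_of_squares[of "\<lambda>s. S s N w" "{1..kk}"] by simp
      qed (use R_square S_square in auto)
      also have "\<dots> = (\<Sum>s=1..kk. expectation (\<lambda>w. (S s N w)\<^sup>2)) * real kk" using S_square by simp
      finally have "expectation (\<lambda>w. (R kk N w)\<^sup>2) / real N \<le> (\<Sum>s=1..kk. expectation (\<lambda>w. (S s N w)\<^sup>2)) * real kk / real N"
        by (rule divide_right_mono) simp
      also have "\<dots> = (\<Sum>s=1..kk. x s s N) * real kk"
        unfolding S_square(2)[symmetric] by (simp add: sum_divide_distrib sum_distrib_right)
      finally show "expectation (\<lambda>w. (R kk N w)\<^sup>2) / real N \<le> (\<Sum>s=1..kk. x s s N) * real kk" .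
    qed
  qed
  with sigma2_nonneg show ?thesis by simp
qed

definition Kc :: real where "Kc = (\<Sum>s=1..kk. (1 + real (A s)) * (\<Sum>u. real u * k0 u))"

lemma cross_bounded:
  assumes s: "s \<in> {1..kk}" "s' \<in> {1..kk}" and sep: "A s' * N' \<le> A s * n1" and le: "n1 \<le> N"
  shows "\<bar>expectation (\<lambda>w. (S s N w - S s n1 w) * S s' N' w)\<bar> \<le> Kc"
proof -
  interpret ar: decaying_array "c s s'" "A s" "A s'" k0 by (rule array[OF s])
  have "S s N w - S s n1 w = (\<Sum>n\<in>{n1<..N}. g s n w)" for w
  proof -
    have "(\<Sum>n=1..N. g s n w) = (\<Sum>n=1..n1. g s n w) + (\<Sum>n\<in>{n1<..N}. g s n w)"
      by (subst sum.union_disjoint[symmetric]) (use le in \<open>auto intro!: sum.cong\<close>)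
    then show ?thesis by (simp add: S_def)
  qed
  then have eq: "(S s N w - S s n1 w) * S s' N' w = (\<Sum>n\<in>{n1<..N}. \<Sum>m=1..N'. g s n w * g s' m w)" for w
    by (simp add: S_def sum_product)
  have "\<bar>expectation (\<lambda>w. (S s N w - S s n1 w) * S s' N' w)\<bar> = \<bar>\<Sum>n\<in>{n1<..N}. \<Sum>m=1..N'. c s s' n m\<bar>"
    unfolding eq using gg by (simp add: c_def)
  also have "\<dots> \<le> (\<Sum>n\<in>{n1<..N}. \<Sum>m=1..N'. \<bar>c s s' n m\<bar>)"
    by (rule order_trans[OF sum_abs sum_mono[OF sum_abs]])
  also have "\<dots> \<le> (1 + real (A s)) * (\<Sum>u. real u * k0 u)" using ar.cross_sum_bounded[OF sep] by simp
  also have "\<dots> \<le> Kc"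
  proof -
    have "0 \<le> (\<Sum>u. real u * k0 u)" using k0_nonneg by (intro suminf_nonneg k0_sum) auto
    then show ?thesis unfolding Kc_def using s(1)
      by (intro member_le_sum[of s "{1..kk}" "\<lambda>s. (1 + real (A s)) * (\<Sum>u. real u * k0 u)"]) auto
  qed
  finally show ?thesis .
qed

text \<open>The summands of \<open>S j\<close> whose times lie beyond all times entering the other sums are almost
  uncorrelated with the rest, so a degenerate total forces \<open>S j\<close> to be degenerate.\<close>
lemma degenerate_step:
  assumes j: "j \<in> {1..kk}" and deg: "(\<lambda>N. expectation (\<lambda>w. (R j N w)\<^sup>2) / real N) \<longlonglongrightarrow> 0"
  shows "D j = 0" "(\<lambda>N. expectation (\<lambda>w. (R (j - 1) N w)\<^sup>2) / real N) \<longlonglongrightarrow> 0"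
proof -
  \<comment> \<open>The largest slope below \<open>A j\<close>. For \<open>j = 1\<close> nothing has
    to be avoided, and the value 0 makes \<open>T t\<close> the whole sum.\<close>
  define a' where "a' = (if j = 1 then 0 else A (j - 1))"
  have Aj: "A j > 0" by (rule A_pos[OF j])
  have a'less: "a' < A j" using Aj A_less[of "j - 1" j] j by (auto simp: a'_def)
  have a'ge: "A s \<le> a'" if "s \<in> {1..j - 1}" for s
  proof (cases "s = j - 1")
    case False
    with that j have "A s < A (j - 1)" by (intro A_less) auto
    with that j show ?thesis by (auto simp: a'_def)
  qed (use that j in \<open>auto simp: a'_def\<close>)
  \<comment> \<open>The indices run over \<open>a' * t < n <= A j * t\<close>: their times exceed
    \<open>A j * a' * t\<close>, which is at least every time \<open>A s * m\<close> with
    \<open>s < j\<close> and \<open>m <= A j * t\<close>.\<close>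
  define T where "T t w = S j (A j * t) w - S j (a' * t) w" for t w
  have Tm[measurable]: "T t \<in> borel_measurable M" for t unfolding T_def by measurable
  have T2: "integrable M (\<lambda>w. (T t w)\<^sup>2)" for t unfolding T_def by (rule square_integrable_add(2)[OF S_measurable S_measurable S_square(1) S_square(1)])
  have TS: "integrable M (\<lambda>w. T t w * S s N w)" for t s N by (rule integrable_square_mult[OF Tm S_measurable T2 S_square(1)])
  have le: "a' * t \<le> A j * t" for t using a'less by simp
  have cr1: "\<bar>expectation (\<lambda>w. T t w * S j (a' * t) w)\<bar> \<le> Kc" for t
    unfolding T_def by (rule cross_bounded[OF j j _ le]) simp
  have cr2: "\<bar>expectation (\<lambda>w. T t w * S s (A j * t) w)\<bar> \<le> Kc" if s: "s \<in> {1..j - 1}" for s t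
  proof -
    have sk: "s \<in> {1..kk}" using s j by auto
    have "A s * (A j * t) \<le> a' * (A j * t)" using a'ge[OF s] by (rule mult_right_mono) simp
    then have "A s * (A j * t) \<le> A j * (a' * t)" by (simp add: mult.left_commute mult.commute)
    then show ?thesis unfolding T_def by (rule cross_bounded[OF j sk _ le])
  qed
  define rest where "rest t w = S j (a' * t) w + R (j - 1) (A j * t) w" for t w
  have restm[measurable]: "rest t \<in> borel_measurable M" for t unfolding rest_def by measurable
  have rest2: "integrable M (\<lambda>w. (rest t w)\<^sup>2)" for t
    unfolding rest_def by (rule square_integrable_add(1)[OF S_measurable R_measurable S_square(1) R_square(1)])
  have Rj: "R j N w = S j N w + R (j - 1) N w" for N w
  proof -
    have "{1..j} = insert j {1..j - 1}" using j by auto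
    then have "R j N w = (\<Sum>s\<in>insert j {1..j - 1}. S s N w)" by (simp only: R_def)
    also have "\<dots> = S j N w + R (j - 1) N w" unfolding R_def using j by (subst sum.insert) auto
    finally show ?thesis .
  qed
  have RT: "R j (A j * t) w = T t w + rest t w" for t w by (simp add: Rj T_def rest_def)
  have crest: "\<bar>expectation (\<lambda>w. T t w * rest t w)\<bar> \<le> real j * Kc" for t
  proof -
    have "T t w * rest t w = T t w * S j (a' * t) w + (\<Sum>s=1..j - 1. T t w * S s (A j * t) w)" for w
      by (simp add: rest_def R_def distrib_left sum_distrib_left)
    then have eq: "expectation (\<lambda>w. T t w * rest t w) = expectation (\<lambda>w. T t w * S j (a' * t) w) + (\<Sum>s=1..j - 1. expectation (\<lambda>w. T t w * S s (A j * t) w))"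
      using TS by simp
    have "\<bar>expectation (\<lambda>w. T t w * rest t w)\<bar> \<le> \<bar>expectation (\<lambda>w. T t w * S j (a' * t) w)\<bar> + (\<Sum>s=1..j - 1. \<bar>expectation (\<lambda>w. T t w * S s (A j * t) w)\<bar>)"
      unfolding eq by (rule order_trans[OF abs_triangle_ineq add_left_mono[OF sum_abs]])
    also have "\<dots> \<le> Kc + (\<Sum>s=1..j - 1. Kc)" using cr1 cr2 by (intro add_mono sum_mono) auto
    also have "\<dots> = real j * Kc" using j by (simp add: of_nat_diff algebra_simps)
    finally show ?thesis .
  qed
  have Tle: "expectation (\<lambda>w. (T t w)\<^sup>2) \<le> expectation (\<lambda>w. (R j (A j * t) w)\<^sup>2) + 2 * (real j * Kc)" for t
  proof -
    have "(R j (A j * t) w)\<^sup>2 = (T t w)\<^sup>2 + 2 * (T t w * rest t w) + (rest t w)\<^sup>2" for w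
      unfolding RT by (simp add: power2_sum)
    then have "expectation (\<lambda>w. (R j (A j * t) w)\<^sup>2) = expectation (\<lambda>w. (T t w)\<^sup>2) + 2 * expectation (\<lambda>w. T t w * rest t w) + expectation (\<lambda>w. (rest t w)\<^sup>2)"
      using T2 rest2 integrable_square_mult[OF Tm restm T2 rest2] by simp
    moreover have "expectation (\<lambda>w. (rest t w)\<^sup>2) \<ge> 0" by simp
    ultimately show ?thesis using crest[of t] by linarith
  qed
  have sub: "filterlim (\<lambda>t. A j * t) at_top sequentially"
    using Aj by (intro filterlim_subseq) (simp add: strict_mono_def)
  have degt: "(\<lambda>t. expectation (\<lambda>w. (R j (A j * t) w)\<^sup>2) / real t) \<longlonglongrightarrow> 0"
  proof -
    have "(\<lambda>t. real (A j) * (expectation (\<lambda>w. (R j (A j * t) w)\<^sup>2) / real (A j * t))) \<longlonglongrightarrow> real (A j) * 0"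
      by (intro tendsto_mult_left filterlim_compose[OF deg sub])
    then show ?thesis using Aj by simp
  qed
  have Tlim: "(\<lambda>t. expectation (\<lambda>w. (T t w)\<^sup>2) / real t) \<longlonglongrightarrow> 0"
  proof (rule Lim_null_comparison)
    show "\<forall>\<^sub>F t in sequentially. norm (expectation (\<lambda>w. (T t w)\<^sup>2) / real t)
        \<le> expectation (\<lambda>w. (R j (A j * t) w)\<^sup>2) / real t + 2 * (real j * Kc) / real t"
      using Tle by (intro always_eventually allI) (simp add: add_divide_distrib[symmetric] divide_right_mono)
    show "(\<lambda>t. expectation (\<lambda>w. (R j (A j * t) w)\<^sup>2) / real t + 2 * (real j * Kc) / real t) \<longlonglongrightarrow> 0"
      using tendsto_add[OF degt lim_const_over_n[of "2 * (real j * Kc)"]] by simp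
  qed
  have xs: "(\<lambda>t. expectation (\<lambda>w. (S j (a * t) w)\<^sup>2) / real t) \<longlonglongrightarrow> real a * D j" for a
  proof (cases "a = 0")
    case False
    have "filterlim (\<lambda>t. a * t) at_top sequentially"
      using False by (intro filterlim_subseq) (simp add: strict_mono_def)
    then have "(\<lambda>t. real a * x j j (a * t)) \<longlonglongrightarrow> real a * D j"
      by (intro tendsto_mult_left filterlim_compose[OF D_lim[OF j]])
    then show ?thesis unfolding S_square(2)[symmetric] using False by simp
  qed (simp add: S_def)
  have eqS: "expectation (\<lambda>w. (S j (A j * t) w)\<^sup>2) / real t = expectation (\<lambda>w. (S j (a' * t) w)\<^sup>2) / real t
      + 2 * expectation (\<lambda>w. T t w * S j (a' * t) w) / real t + expectation (\<lambda>w. (T t w)\<^sup>2) / real t" for t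
  proof -
    have "(S j (A j * t) w)\<^sup>2 = (S j (a' * t) w)\<^sup>2 + 2 * (T t w * S j (a' * t) w) + (T t w)\<^sup>2" for w
      by (simp add: T_def power2_eq_square algebra_simps)
    then have "expectation (\<lambda>w. (S j (A j * t) w)\<^sup>2) = expectation (\<lambda>w. (S j (a' * t) w)\<^sup>2) + 2 * expectation (\<lambda>w. T t w * S j (a' * t) w) + expectation (\<lambda>w. (T t w)\<^sup>2)"
      using T2 TS S_square(1) by simp
    then show ?thesis by (simp add: add_divide_distrib)
  qed
  have mid: "(\<lambda>t. 2 * expectation (\<lambda>w. T t w * S j (a' * t) w) / real t) \<longlonglongrightarrow> 0"
  proof (rule Lim_null_comparison)
    show "\<forall>\<^sub>F t in sequentially. norm (2 * expectation (\<lambda>w. T t w * S j (a' * t) w) / real t) \<le> 2 * Kc / real t"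
      using cr1 by (intro always_eventually allI) (simp add: abs_mult divide_right_mono)
    show "(\<lambda>t. 2 * Kc / real t) \<longlonglongrightarrow> 0" by (rule lim_const_over_n)
  qed
  \<comment> \<open>The second moments of the full sum and of its first \<open>a' * t\<close> terms,
    divided by \<open>t\<close>, tend to \<open>A j * D j\<close> and \<open>a' * D j\<close>.
    \<open>T t\<close> is negligible, so the limits agree.\<close>
  have "real (A j) * D j = real a' * D j + 0 + 0"
    by (rule LIMSEQ_unique[OF xs[of "A j"]]) (unfold eqS, intro tendsto_add xs mid Tlim)
  then have "(real (A j) - real a') * D j = 0" by (simp add: algebra_simps)
  then show D0: "D j = 0" using a'less by simp
  show "(\<lambda>N. expectation (\<lambda>w. (R (j - 1) N w)\<^sup>2) / real N) \<longlonglongrightarrow> 0"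
  proof (rule Lim_null_comparison)
    show "\<forall>\<^sub>F N in sequentially. norm (expectation (\<lambda>w. (R (j - 1) N w)\<^sup>2) / real N)
       \<le> 2 * (expectation (\<lambda>w. (R j N w)\<^sup>2) / real N) + 2 * x j j N"
    proof (intro always_eventually allI)
      fix N
      have "expectation (\<lambda>w. (R (j - 1) N w)\<^sup>2) \<le> expectation (\<lambda>w. 2 * (R j N w)\<^sup>2 + 2 * (S j N w)\<^sup>2)"
      proof (rule integral_mono)
        fix w
        have "0 \<le> (R j N w + S j N w)\<^sup>2" by simp
        moreover have "R (j - 1) N w = R j N w - S j N w" by (simp add: Rj)
        ultimately show "(R (j - 1) N w)\<^sup>2 \<le> 2 * (R j N w)\<^sup>2 + 2 * (S j N w)\<^sup>2"
          by (simp add: power2_sum power2_diff)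
      qed (use R_square S_square in auto)
      also have "\<dots> = 2 * expectation (\<lambda>w. (R j N w)\<^sup>2) + 2 * expectation (\<lambda>w. (S j N w)\<^sup>2)"
        using R_square S_square by simp
      finally have "expectation (\<lambda>w. (R (j - 1) N w)\<^sup>2) / real N
         \<le> (2 * expectation (\<lambda>w. (R j N w)\<^sup>2) + 2 * expectation (\<lambda>w. (S j N w)\<^sup>2)) / real N"
        by (rule divide_right_mono) simp
      then show "norm (expectation (\<lambda>w. (R (j - 1) N w)\<^sup>2) / real N) \<le> 2 * (expectation (\<lambda>w. (R j N w)\<^sup>2) / real N) + 2 * x j j N"
        unfolding S_square(2)[symmetric] by (simp add: add_divide_distrib)
    qed
    show "(\<lambda>N. 2 * (expectation (\<lambda>w. (R j N w)\<^sup>2) / real N) + 2 * x j j N) \<longlonglongrightarrow> 0"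
      using tendsto_add[OF tendsto_mult_left[OF deg, of 2] tendsto_mult_left[OF D_lim[OF j], of 2]] D0 by simp
  qed
qed

text \<open>The forward direction peels off the largest slope repeatedly, each step passing
  degeneracy on to the total of the remaining sums.\<close>

lemma sigma2_zero_iff: "sigma2 = 0 \<longleftrightarrow> (\<forall>s\<in>{1..kk}. D s = 0)"
proof
  assume s0: "sigma2 = 0"
  have "(\<lambda>N. expectation (\<lambda>w. (R (kk - i) N w)\<^sup>2) / real N) \<longlonglongrightarrow> 0" if "i \<le> kk" for i
    using that
  proof (induction i)
    case 0 then show ?case using R_lim s0 by simp
  next
    case (Suc i)
    then have "kk - i \<in> {1..kk}" by auto
    from degenerate_step(2)[OF this Suc.IH] Suc.prems show ?case by simp
  qed
  note deg = this
  show "\<forall>s\<in>{1..kk}. D s = 0"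
  proof
    fix s assume s: "s \<in> {1..kk}"
    then have eq: "kk - (kk - s) = s" by auto
    show "D s = 0" by (rule degenerate_step(1)[OF s]) (use deg[of "kk - s"] eq in simp)
  qed
qed (use sigma2_zero_if in blast)

lemma sigma2_pos_iff: "sigma2 > 0 \<longleftrightarrow> (\<Sum>s=1..kk. D s) > 0"
proof -
  have "(\<Sum>s=1..kk. D s) = 0 \<longleftrightarrow> (\<forall>s\<in>{1..kk}. D s = 0)"
    using D_nonneg by (intro sum_nonneg_eq_0_iff) auto
  moreover have "(\<Sum>s=1..kk. D s) \<ge> 0" using D_nonneg by (intro sum_nonneg)
  ultimately show ?thesis using sigma2_zero_iff sigma2_nonneg by linarith
qed

end

lemma hoelder_growth_mono:
  fixes f :: "(nat \<Rightarrow> real^'d) \<Rightarrow> real"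
  assumes f: "hoelder_growth L K iota kappa f" and le: "K \<le> K'"
  shows "hoelder_growth L K' iota kappa f"
  unfolding hoelder_growth_def
proof safe
  fix x z :: "nat \<Rightarrow> real^'d"
  define u where "u = 1 + (\<Sum>i=1..L. norm (x i) powr iota + norm (z i) powr iota)"
  define v where "v = (\<Sum>i=1..L. norm (x i - z i) powr kappa)"
  have uv: "u \<ge> 0" "v \<ge> 0" unfolding u_def v_def by (auto intro!: add_nonneg_nonneg sum_nonneg)
  have "\<bar>f x - f z\<bar> \<le> K * u * v" using f unfolding hoelder_growth_def u_def v_def by blast
  also have "\<dots> \<le> K' * u * v" using le uv by (intro mult_right_mono) auto
  finally show "\<bar>f x - f z\<bar> \<le> K' * (1 + (\<Sum>i=1..L. norm (x i) powr iota + norm (z i) powr iota)) * (\<Sum>i=1..L. norm (x i - z i) powr kappa)"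
    unfolding u_def v_def .
  define t where "t = 1 + (\<Sum>i=1..L. norm (x i) powr iota)"
  have t: "t \<ge> 0" unfolding t_def by (auto intro!: add_nonneg_nonneg sum_nonneg)
  have "\<bar>f x\<bar> \<le> K * t" using f unfolding hoelder_growth_def t_def by blast
  also have "\<dots> \<le> K' * t" using le t by (intro mult_right_mono) auto
  finally show "\<bar>f x\<bar> \<le> K' * (1 + (\<Sum>i=1..L. norm (x i) powr iota))" unfolding t_def .
qed

lemma hoelder_growth_diff:
  fixes f g :: "(nat \<Rightarrow> real^'d) \<Rightarrow> real"
  assumes f: "hoelder_growth L K iota kappa f" and g: "hoelder_growth L K iota kappa g"
  shows "hoelder_growth L (2 * K) iota kappa (\<lambda>x. f x - g x)"
  unfolding hoelder_growth_def
proof safe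
  fix x z :: "nat \<Rightarrow> real^'d"
  define u where "u = K * (1 + (\<Sum>i=1..L. norm (x i) powr iota + norm (z i) powr iota)) * (\<Sum>i=1..L. norm (x i - z i) powr kappa)"
  have "\<bar>f x - f z\<bar> \<le> u" "\<bar>g x - g z\<bar> \<le> u" using f g unfolding hoelder_growth_def u_def by blast+
  then have "\<bar>f x - g x - (f z - g z)\<bar> \<le> 2 * u" by linarith
  then show "\<bar>f x - g x - (f z - g z)\<bar> \<le> 2 * K * (1 + (\<Sum>i=1..L. norm (x i) powr iota + norm (z i) powr iota)) * (\<Sum>i=1..L. norm (x i - z i) powr kappa)"
    unfolding u_def by (simp only: mult.assoc)
  define t where "t = K * (1 + (\<Sum>i=1..L. norm (x i) powr iota))"
  have "\<bar>f x\<bar> \<le> t" "\<bar>g x\<bar> \<le> t" using f g unfolding hoelder_growth_def t_def by blast+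
  then have "\<bar>f x - g x\<bar> \<le> 2 * t" by linarith
  then show "\<bar>f x - g x\<bar> \<le> 2 * K * (1 + (\<Sum>i=1..L. norm (x i) powr iota))" unfolding t_def by (simp only: mult.assoc)
qed

lemma hoelder_growth_one: "hoelder_growth L 1 iota kappa (\<lambda>_ :: nat \<Rightarrow> real^'d. 1)"
  unfolding hoelder_growth_def
  by (auto intro!: sum_nonneg mult_nonneg_nonneg add_nonneg_nonneg simp: add_increasing2 sum_nonneg)

lemma summable_div3:
  fixes h :: "nat \<Rightarrow> real"
  assumes h: "\<And>r. h r \<ge> 0" "summable h"
  shows "summable (\<lambda>u. h (u div 3))"
proof (rule bounded_imp_summable)
  fix n
  have "(\<Sum>u\<le>n. h (u div 3)) \<le> (\<Sum>u<Suc n * 3. h (u div 3))"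
    by (rule sum_mono2) (auto intro: h)
  also have "\<dots> = (\<Sum>r<Suc n. \<Sum>u\<in>{r*3..<r*3+3}. h (u div 3))" by (rule sum.nat_group[symmetric])
  also have "\<dots> = (\<Sum>r<Suc n. 3 * h r)"
  proof (rule sum.cong[OF refl])
    fix r
    have "(\<Sum>u\<in>{r*3..<r*3+3}. h (u div 3)) = (\<Sum>u\<in>{r*3..<r*3+3}. h r)"
    proof (rule sum.cong[OF refl])
      fix u assume "u \<in> {r*3..<r*3+3}"
      then have "u div 3 = r" by auto
      then show "h (u div 3) = h r" by simp
    qed
    then show "(\<Sum>u\<in>{r*3..<r*3+3}. h (u div 3)) = 3 * h r" by simp
  qed
  also have "\<dots> \<le> 3 * suminf h" unfolding sum_distrib_left[symmetric]
    by (intro mult_left_mono sum_le_suminf h) (auto intro: h)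
  finally show "(\<Sum>u\<le>n. h (u div 3)) \<le> 3 * suminf h" .
qed (rule h)

context stationary_mixing_process begin

text \<open>Shift invariance is assumed for nondecreasing times, so the index set is first sorted by
  \<open>\<tau>\<close>. Coordinates outside \<open>S\<close> stay frozen at \<open>v\<close>, which
  allows other blocks to act as parameters.\<close>

lemma expectation_shift_continuous:
  fixes \<Phi> :: "('i::countable \<Rightarrow> real^'d) \<Rightarrow> real"
  assumes S: "finite S" "card S \<le> Nd" and \<Phi>: "continuous_on UNIV \<Phi>"
  shows "expectation (\<lambda>w. \<Phi> (\<lambda>a. if a \<in> S then X (c + \<tau> a) w else v a)) = expectation (\<lambda>w. \<Phi> (\<lambda>a. if a \<in> S then X (\<tau> a) w else v a))"
proof -
  obtain ys where ys: "set ys = S" "distinct ys" using finite_distinct_list[OF S(1)] by blast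
  define zs where "zs = sort_key \<tau> ys"
  have zs: "set zs = S" "distinct zs" "sorted (map \<tau> zs)" using ys by (auto simp: zs_def)
  define kk where "kk = length zs"
  have kk: "kk = card S" using zs by (simp add: kk_def distinct_card[symmetric])
  define pos where "pos a = (SOME j. j < kk \<and> zs ! j = a)" for a
  have pos: "pos a < kk" "zs ! pos a = a" if "a \<in> S" for a
  proof -
    have "\<exists>j. j < kk \<and> zs ! j = a" using that zs(1) by (auto simp: in_set_conv_nth kk_def)
    from someI_ex[OF this] show "pos a < kk" "zs ! pos a = a" unfolding pos_def by auto
  qed
  define ns where "ns j = \<tau> (zs ! j)" for j
  have mono: "\<forall>j. Suc j < kk \<longrightarrow> ns j \<le> ns (Suc j)"
    using zs(3) unfolding ns_def kk_def by (auto simp: sorted_iff_nth_mono)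
  define F where "F x = \<Phi> (\<lambda>a. if a \<in> S then x (pos a) else v a)" for x :: "nat \<Rightarrow> real^'d"
  have Fm: "F \<in> borel_measurable (PiM {..<kk} (\<lambda>_. borel))"
    unfolding F_def
  proof (rule measurable_fun_composition[OF \<Phi>])
    fix a
    show "(\<lambda>x. if a \<in> S then x (pos a) else v a) \<in> borel_measurable (PiM {..<kk} (\<lambda>_. borel))"
      using pos(1)[of a] measurable_component_singleton[of "pos a" "{..<kk}" "\<lambda>_. borel :: (real^'d) measure"] by (cases "a \<in> S") auto
  qed
  have Xm: "(\<lambda>w. \<lambda>j\<in>{..<kk}. X (ns j + c) w) \<in> M \<rightarrow>\<^sub>M PiM {..<kk} (\<lambda>_. borel)" for c
    by (intro measurable_restrict) auto
  have eq: "expectation (\<lambda>w. \<Phi> (\<lambda>a. if a \<in> S then X (c + \<tau> a) w else v a)) = integral\<^sup>L (distr M (PiM {..<kk} (\<lambda>_. borel)) (\<lambda>w. \<lambda>j\<in>{..<kk}. X (ns j + c) w)) F" for c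
  proof -
    have "(\<lambda>a. if a \<in> S then X (c + \<tau> a) w else v a) = (\<lambda>a. if a \<in> S then (\<lambda>j\<in>{..<kk}. X (ns j + c) w) (pos a) else v a)" for w
      using pos by (auto simp: ns_def add.commute)
    then have "\<Phi> (\<lambda>a. if a \<in> S then X (c + \<tau> a) w else v a) = F (\<lambda>j\<in>{..<kk}. X (ns j + c) w)" for w
      unfolding F_def by simp
    then show ?thesis by (simp add: integral_distr[OF Xm Fm])
  qed
  have "distr M (PiM {..<kk} (\<lambda>_. borel)) (\<lambda>w. \<lambda>j\<in>{..<kk}. X (ns j + 0) w)
      = distr M (PiM {..<kk} (\<lambda>_. borel)) (\<lambda>w. \<lambda>j\<in>{..<kk}. X (ns j + c) w)"
    using X_stat kk S(2) mono by simp
  with eq[of c] eq[of 0, unfolded add_0] show ?thesis by (simp only:)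
qed

end

section \<open>Decomposition of \<open>G\<close> along the blocks and decay of the resulting
  covariances\<close>

locale linear_averages = stationary_mixing_process M Fam X iota kappa p qe delta m "2 * card (Dhat q l)" + poly_blocks q l k
  for M :: "'a measure" and Fam and X :: "nat \<Rightarrow> 'a \<Rightarrow> real^'d" and iota kappa p qe delta m :: real
    and q :: "nat \<Rightarrow> real poly" and l k :: nat +
  fixes G :: "(nat \<Rightarrow> real^'d) \<Rightarrow> real" and K :: real
  assumes G_hg: "hoelder_growth L K iota kappa G"
    and delta_lt: "delta < kappa - real ((lhat q l - 1) * card (Dhat q l) * CARD('d)) / p"
begin

text \<open>The block is sampled at its intercepts \<open>b j\<close>. By stationarity any common
  shift of the block gives the same mean, provided \<open>f\<close> is continuous and integrable
  enough, so the choice of origin is a normalisation.\<close>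

definition partial_mean :: "nat \<Rightarrow> ((nat \<Rightarrow> real^'d) \<Rightarrow> real) \<Rightarrow> (nat \<Rightarrow> real^'d) \<Rightarrow> real" where
  "partial_mean s f v = expectation (\<lambda>w. f (\<lambda>j. if j \<in> Bl q l s then X (b j) w else v j))"

text \<open>Step \<open>i\<close> integrates out block \<open>k' - i\<close>: the recursion counts
  upwards while the blocks are removed from the last one down.\<close>

primrec HH :: "nat \<Rightarrow> (nat \<Rightarrow> real^'d) \<Rightarrow> real" where
  "HH 0 = G" | "HH (Suc i) = partial_mean (k' - i) (HH i)"

text \<open>\<open>H s\<close> arises from \<open>G\<close> by integrating out the blocks after block \<open>s\<close>, so that the
  \<open>Gs s\<close> are the martingale-type differences of \<open>G\<close> along the blocks.\<close>
definition H :: "nat \<Rightarrow> (nat \<Rightarrow> real^'d) \<Rightarrow> real" where "H s = HH (k' - s)"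
definition Gs :: "nat \<Rightarrow> (nat \<Rightarrow> real^'d) \<Rightarrow> real" where "Gs s x = H s x - H (s - 1) x"

lemma H_k': "H k' = G" by (simp add: H_def)

lemma H_step:
  assumes "1 \<le> s" "s \<le> k'"
  shows "H (s - 1) = partial_mean s (H s)"
proof -
  have "k' - (s - 1) = Suc (k' - s)" using assms by auto
  moreover have "k' - (k' - s) = s" using assms by auto
  ultimately show ?thesis by (simp add: H_def)
qed

lemma G_decomp: "G x = H 0 x + (\<Sum>s=1..k'. Gs s x)"
proof -
  have "H j x = H 0 x + (\<Sum>s=1..j. Gs s x)" for j by (induction j) (auto simp: Gs_def)
  from this[of k'] show ?thesis by (simp add: H_k')
qed

definition Gam :: real where "Gam = expectation (\<lambda>w. norm (X 0 w) powr iota)"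
definition Kb :: real where "Kb = (1 + 2 * real L * Gam) ^ k' * K"

lemma iota_moment: "integrable M (\<lambda>w. norm (X n w) powr iota)" "expectation (\<lambda>w. norm (X n w) powr iota) = Gam"
proof -
  have "integrable M (\<lambda>w. 1 + norm (X n w) powr m)" using X_integrable_m by auto
  then show "integrable M (\<lambda>w. norm (X n w) powr iota)"
  proof (rule Bochner_Integration.integrable_bound)
    have "norm x powr iota \<le> 1 + norm x powr m" for x :: "real^'d"
    proof (cases "norm x \<le> 1")
      case True
      then have "norm x powr iota \<le> 1 powr iota" using iota_pos by (intro powr_mono2) auto
      moreover have "0 \<le> norm x powr m" by (rule powr_ge_zero)
      ultimately show ?thesis unfolding powr_one_eq_one by linarith
    next
      case False
      have "iota \<le> m" using m_ge iota_pos by linarith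
      then have "norm x powr iota \<le> norm x powr m" using False by (intro powr_mono) auto
      then show ?thesis by simp
    qed
    then show "AE w in M. norm (norm (X n w) powr iota) \<le> norm (1 + norm (X n w) powr m)"
      by (intro AE_I2) (simp add: abs_of_nonneg add_nonneg_nonneg)
  qed measurable
  show "expectation (\<lambda>w. norm (X n w) powr iota) = Gam" unfolding Gam_def by (rule X_integral_ident(2)) measurable
qed

lemma Gam_nonneg: "Gam \<ge> 0" unfolding Gam_def by (rule Bochner_Integration.integral_nonneg) simp

lemma partial_mean_hg:
  assumes "hoelder_growth L K' iota kappa f"
  shows "hoelder_growth L ((1 + 2 * real L * Gam) * K') iota kappa (partial_mean s f)"
proof -
  have "hoelder_growth L (K' * (1 + 2 * real L * Gam)) iota kappa (partial_mean s f)"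
    unfolding partial_mean_def
    by (rule hoelder_growth_integral(1)[OF assms iota_pos kappa(1) X_measurable iota_moment(1)]) (simp add: iota_moment(2))
  then show ?thesis by (simp add: mult.commute)
qed

lemma HH_hg: "hoelder_growth L ((1 + 2 * real L * Gam) ^ i * K) iota kappa (HH i)"
proof (induction i)
  case (Suc i) from partial_mean_hg[OF this] show ?case by (simp add: mult.assoc)
qed (simp add: G_hg)

lemma H_hg: "hoelder_growth L Kb iota kappa (H s)"
  unfolding H_def
proof (rule hoelder_growth_mono[OF HH_hg])
  have "(1 + 2 * real L * Gam) ^ (k' - s) \<le> (1 + 2 * real L * Gam) ^ k'"
    using Gam_nonneg by (intro power_increasing) auto
  then show "(1 + 2 * real L * Gam) ^ (k' - s) * K \<le> Kb"
    unfolding Kb_def using hoelder_growth_nonneg[OF G_hg] by (rule mult_right_mono)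
qed

lemma Gs_hg: "hoelder_growth L (2 * Kb) iota kappa (Gs s)"
  unfolding Gs_def[abs_def] by (rule hoelder_growth_diff[OF H_hg H_hg])

definition upto_blk :: "nat \<Rightarrow> nat set" where "upto_blk s = {j\<in>{1..L}. blk q l j \<le> s}"

lemma upto_blk_split:
  assumes "1 \<le> s" "s \<le> k'"
  shows "upto_blk s = {j\<in>{1..L}. blk q l j < s} \<union> Bl q l s" "{j\<in>{1..L}. blk q l j < s} \<inter> Bl q l s = {}"
proof -
  have 1: "blk q l j = s" if "j \<in> Bl q l s" for j by (rule blk_Bl[OF that assms(1)])
  have 2: "j \<in> Bl q l s" if "j \<in> {1..L}" "blk q l j = s" for j using blk_range[OF that(1)] that(2) by blast
  show "{j\<in>{1..L}. blk q l j < s} \<inter> Bl q l s = {}" using 1 by blast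
  show "upto_blk s = {j\<in>{1..L}. blk q l j < s} \<union> Bl q l s"
  proof (intro set_eqI iffI)
    fix j assume "j \<in> upto_blk s"
    then have "j \<in> {1..L}" "blk q l j < s \<or> blk q l j = s" unfolding upto_blk_def by auto
    then show "j \<in> {j\<in>{1..L}. blk q l j < s} \<union> Bl q l s" using 2 by blast
  next
    fix j assume j: "j \<in> {j\<in>{1..L}. blk q l j < s} \<union> Bl q l s"
    show "j \<in> upto_blk s"
    proof (cases "j \<in> Bl q l s")
      case True
      then have "j \<in> {1..L}" using Bl_subset[OF assms(2)] by blast
      then show ?thesis unfolding upto_blk_def using 1[OF True] by simp
    qed (use j in \<open>auto simp: upto_blk_def\<close>)
  qed
qed

lemma H_dep:
  assumes "s \<le> k'" "\<And>j. j \<in> upto_blk s \<Longrightarrow> x j = z j"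
  shows "H s x = H s z"
proof -
  have "\<forall>x z. (\<forall>j\<in>upto_blk (k' - i). x j = z j) \<longrightarrow> HH i x = HH i z" if "i \<le> k'" for i
    using that
  proof (induction i)
    case 0
    have "upto_blk k' = {1..L}" unfolding upto_blk_def using blk_range by blast
    note upto = this
    show ?case
    proof (intro allI impI)
      fix x z :: "nat \<Rightarrow> real^'d" assume "\<forall>j\<in>upto_blk (k' - 0). x j = z j"
      then have "x j = z j" if "j \<in> {1..L}" for j using that unfolding diff_zero upto by blast
      then show "HH 0 x = HH 0 z" unfolding HH.simps by (rule hoelder_growth_cong[OF G_hg])
    qed
  next
    case (Suc i)
    show ?case
    proof (intro allI impI)
      fix x z :: "nat \<Rightarrow> real^'d" assume xz: "\<forall>j\<in>upto_blk (k' - Suc i). x j = z j"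
      have "upto_blk (k' - i) \<subseteq> upto_blk (k' - Suc i) \<union> Bl q l (k' - i)"
        using upto_blk_split(1)[of "k' - i"] Suc.prems by (auto simp: upto_blk_def)
      then have "HH i (\<lambda>j. if j \<in> Bl q l (k' - i) then X (b j) w else x j) = HH i (\<lambda>j. if j \<in> Bl q l (k' - i) then X (b j) w else z j)" for w
        using Suc.prems xz by (intro Suc.IH[rule_format]) auto
      then show "HH (Suc i) x = HH (Suc i) z" by (simp add: partial_mean_def)
    qed
  qed
  from this[of "k' - s"] assms show ?thesis by (simp add: H_def)
qed

lemma Gs_dep:
  assumes "s \<le> k'" "\<And>j. j \<in> upto_blk s \<Longrightarrow> x j = z j"
  shows "Gs s x = Gs s z"
proof -
  have "H (s - 1) x = H (s - 1) z" using assms by (intro H_dep) (auto simp: upto_blk_def)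
  then show ?thesis using H_dep[OF assms] by (simp add: Gs_def)
qed

text \<open>With every block integrated out, \<open>H 0\<close> is a constant; the point of
  evaluation is arbitrary. Centring of \<open>G\<close> will make it vanish.\<close>

definition h0 :: real where "h0 = H 0 (\<lambda>_. 0)"
lemma H_0: "H 0 x = h0"
  unfolding h0_def
proof (rule H_dep)
  fix j assume "j \<in> upto_blk 0"
  then show "x j = 0" using blk_range by (fastforce simp: upto_blk_def)
qed simp

text \<open>The mean of \<open>H s\<close> over block \<open>s\<close> is \<open>H (s - 1)\<close>
  by construction, while \<open>H (s - 1)\<close> itself does not depend on block \<open>s\<close>.
  Stationarity admits the shift \<open>t\<close>.\<close>

lemma Gs_centered:
  assumes s: "1 \<le> s" "s \<le> k'"
  shows "expectation (\<lambda>w. Gs s (\<lambda>j. if j \<in> Bl q l s then X (t + b j) w else v j)) = 0"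
proof -
  have int: "integrable M (\<lambda>w. H s' (\<lambda>j. if j \<in> Bl q l s then X (t + b j) w else v j))" for s'
    by (rule hoelder_growth_integral(2)[OF H_hg iota_pos kappa(1) X_measurable iota_moment(1) eq_refl[OF iota_moment(2)]])
  have "card (Bl q l s) \<le> 2 * card (Dhat q l)" using card_Bl[OF s] by simp
  then have "expectation (\<lambda>w. H s (\<lambda>j. if j \<in> Bl q l s then X (t + b j) w else v j)) = H (s - 1) v"
    unfolding H_step[OF s] partial_mean_def
    by (intro expectation_shift_continuous hoelder_growth_continuous[OF H_hg iota_pos kappa(1)]) (simp_all add: Bl_def)
  moreover have "H (s - 1) (\<lambda>j. if j \<in> Bl q l s then X (t + b j) w else v j) = H (s - 1) v" for w
    using upto_blk_split(2)[OF s] s by (intro H_dep) (auto simp: upto_blk_def)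
  ultimately show ?thesis unfolding Gs_def using int prob_space by simp
qed

definition gs :: "nat \<Rightarrow> nat \<Rightarrow> 'a \<Rightarrow> real" where "gs s n w = Gs s (\<lambda>j. X (a j * n + b j) w)"

lemma gs_sample: "s \<le> k' \<Longrightarrow> gs s n w = Gs s (sample (upto_blk s) (\<lambda>j. a j * n + b j) w)"
  unfolding gs_def by (rule Gs_dep) (simp_all add: sample_def)

lemma gs_measurable [measurable]: "gs s n \<in> borel_measurable M"
  unfolding gs_def[abs_def] by (rule hg_measurable[OF Gs_hg]) simp

lemma gs_bound: "\<exists>C\<ge>0. \<forall>s s' n n'. integrable M (\<lambda>w. gs s' n' w * gs s n w) \<and> \<bar>expectation (\<lambda>w. gs s' n' w * gs s n w)\<bar> \<le> C
   \<and> \<bar>expectation (gs s n)\<bar> \<le> C"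
proof -
  have eq: "gs s n w = Gs s (sample {1..L} (\<lambda>j. a j * n + b j) w)" for s n w
    unfolding gs_def by (rule hoelder_growth_cong[OF Gs_hg]) (simp add: sample_def)
  obtain C1 where C1: "C1 \<ge> 0" and C1': "\<And>g W Sw Sg tw tg. hoelder_growth L (2 * Kb) iota kappa g \<Longrightarrow> hoelder_growth L (2 * Kb) iota kappa W \<Longrightarrow>
     integrable M (\<lambda>w. W (sample Sw tw w) * g (sample Sg tg w)) \<and> \<bar>expectation (\<lambda>w. W (sample Sw tw w) * g (sample Sg tg w))\<bar> \<le> C1"
    using trivial_bound[of L "2 * Kb" "2 * Kb"] by blast
  obtain C2 where C2: "C2 \<ge> 0" and C2': "\<And>g W Sw Sg tw tg. hoelder_growth L (2 * Kb) iota kappa g \<Longrightarrow> hoelder_growth L 1 iota kappa W \<Longrightarrow>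
     integrable M (\<lambda>w. W (sample Sw tw w) * g (sample Sg tg w)) \<and> \<bar>expectation (\<lambda>w. W (sample Sw tw w) * g (sample Sg tg w))\<bar> \<le> C2"
    using trivial_bound[of L "2 * Kb" "1"] by blast
  show ?thesis
  proof (intro exI conjI allI)
    show "C1 + C2 \<ge> 0" using C1 C2 by simp
    fix s s' n n'
    note A = C1'[OF Gs_hg Gs_hg, of s' "{1..L}" "\<lambda>j. a j * n' + b j" s "{1..L}" "\<lambda>j. a j * n + b j", folded eq]
    show "integrable M (\<lambda>w. gs s' n' w * gs s n w)" using A by blast
    show "\<bar>expectation (\<lambda>w. gs s' n' w * gs s n w)\<bar> \<le> C1 + C2" using A C2 by linarith
    show "\<bar>expectation (gs s n)\<bar> \<le> C1 + C2"
      using C2'[OF Gs_hg hoelder_growth_one, of s "{1..L}" "\<lambda>j. a j * n + b j", folded eq] C1 by simp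
  qed
qed

lemma gs_square: "integrable M (\<lambda>w. (gs s n w)\<^sup>2)"
proof -
  have "integrable M (\<lambda>w. gs s n w * gs s n w)" using gs_bound by blast
  then show ?thesis by (simp add: power2_eq_square)
qed

definition C0 :: nat where "C0 = (\<Sum>j=1..L. b j)"
text \<open>For \<open>r = 0\<close> no decorrelation is available and the trivial bound
  \<open>Cs\<close> applies, which the value 1 encodes.\<close>

definition rho' :: "nat \<Rightarrow> real" where "rho' r = (if r = 0 then 1 else rho r)"

lemma b_le: "j \<in> {1..L} \<Longrightarrow> b j \<le> C0" unfolding C0_def by (rule member_le_sum) auto

lemma slope_mono: "1 \<le> s \<Longrightarrow> s \<le> s' \<Longrightarrow> s' \<le> k' \<Longrightarrow> slope s \<le> slope s'"
  using slope_less[of s s'] by (cases "s = s'") auto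

lemma a_blk: "j \<in> {1..L} \<Longrightarrow> a j = slope (blk q l j)" using blk_range slope_eq by metis

text \<open>Block \<open>s\<close> at index \<open>n\<close> must lie \<open>3 * r\<close> after
  everything else. The first inequality provides this against the other summand. The second does so
  against the earlier blocks of the same summand, whose times are at most
  \<open>(slope s - 1) * n + C0\<close>; it is the source of the secondary term
  \<open>k0 n\<close>.\<close>

lemma rate_separated:
  "\<exists>C\<ge>0. \<forall>s s' n n' r. s \<in> {1..k'} \<longrightarrow> s' \<in> {1..k'} \<longrightarrow> r \<ge> 1 \<longrightarrow> slope s' * n' + C0 + 3 * r \<le> slope s * n \<longrightarrow> C0 + 3 * r \<le> n \<longrightarrow>
     \<bar>expectation (\<lambda>w. gs s' n' w * gs s n w)\<bar> \<le> C * rho r \<and> \<bar>expectation (gs s n)\<bar> \<le> C * rho r"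
proof -
  define D0 where "D0 = (lhat q l - 1) * card (Dhat q l) * CARD('d)"
  have D0: "real D0 / p < kappa - delta" using delta_lt by (simp add: D0_def)
  obtain C1 where C1: "C1 \<ge> 0" and C1': "\<And>g W Sw P Q tw tg T r. hoelder_growth L (2 * Kb) iota kappa g \<Longrightarrow> hoelder_growth L (2 * Kb) iota kappa W \<Longrightarrow>
     P \<subseteq> {1..L} \<Longrightarrow> card P * CARD('d) \<le> D0 \<Longrightarrow> P \<inter> Q = {} \<Longrightarrow> Q \<subseteq> {1..L} \<Longrightarrow> r \<ge> 1 \<Longrightarrow>
     \<forall>j\<in>Sw. tw j \<le> T \<Longrightarrow> \<forall>j\<in>P. tg j \<le> T \<Longrightarrow> \<forall>j\<in>Q. T + 3 * r \<le> tg j \<Longrightarrow>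
     \<forall>v. expectation (\<lambda>w. g (\<lambda>j. if j \<in> Q then X (tg j) w else if j \<in> P then v j else 0)) = 0 \<Longrightarrow>
     \<bar>expectation (\<lambda>w. W (sample Sw tw w) * g (sample (P \<union> Q) tg w))\<bar> \<le> C1 * rho r"
    using rate_bound[OF D0, of L "2 * Kb" "2 * Kb"] by blast
  obtain C2 where C2: "C2 \<ge> 0" and C2': "\<And>g W Sw P Q tw tg T r. hoelder_growth L (2 * Kb) iota kappa g \<Longrightarrow> hoelder_growth L 1 iota kappa W \<Longrightarrow>
     P \<subseteq> {1..L} \<Longrightarrow> card P * CARD('d) \<le> D0 \<Longrightarrow> P \<inter> Q = {} \<Longrightarrow> Q \<subseteq> {1..L} \<Longrightarrow> r \<ge> 1 \<Longrightarrow>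
     \<forall>j\<in>Sw. tw j \<le> T \<Longrightarrow> \<forall>j\<in>P. tg j \<le> T \<Longrightarrow> \<forall>j\<in>Q. T + 3 * r \<le> tg j \<Longrightarrow>
     \<forall>v. expectation (\<lambda>w. g (\<lambda>j. if j \<in> Q then X (tg j) w else if j \<in> P then v j else 0)) = 0 \<Longrightarrow>
     \<bar>expectation (\<lambda>w. W (sample Sw tw w) * g (sample (P \<union> Q) tg w))\<bar> \<le> C2 * rho r"
    using rate_bound[OF D0, of L "2 * Kb" "1"] by blast
  show ?thesis
  proof (intro exI conjI allI impI)
    show "C1 + C2 \<ge> 0" using C1 C2 by simp
    fix s s' n n' r assume s: "s \<in> {1..k'}" "s' \<in> {1..k'}" and r: "r \<ge> 1"
      and le: "slope s' * n' + C0 + 3 * r \<le> slope s * n" "C0 + 3 * r \<le> n"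
    define P where "P = {j\<in>{1..L}. blk q l j < s}"
    define Q where "Q = Bl q l s"
    define tg where "tg = (\<lambda>j. a j * n + b j)"
    define tw where "tw = (\<lambda>j. a j * n' + b j)"
    define T where "T = slope s * n - 3 * r"
    have T: "T + 3 * r = slope s * n" using le by (simp add: T_def)
    have PQ: "P \<subseteq> {1..L}" "P \<inter> Q = {}" "Q \<subseteq> {1..L}" "P \<union> Q = upto_blk s"
      unfolding P_def Q_def using upto_blk_split[of s] Bl_subset[of s] s by auto
    have cP: "card P * CARD('d) \<le> D0"
      unfolding P_def D0_def using card_earlier[of s] s by (intro mult_right_mono) auto
    have 1: "\<forall>j\<in>upto_blk s'. tw j \<le> T"
    proof
      fix j assume "j \<in> upto_blk s'"
      then have j: "j \<in> {1..L}" "blk q l j \<le> s'" by (auto simp: upto_blk_def)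
      have "a j * n' \<le> slope s' * n'" using a_blk[OF j(1)] slope_mono[OF _ j(2)] blk_range[OF j(1)] s by auto
      then show "tw j \<le> T" using b_le[OF j(1)] le T unfolding tw_def by linarith
    qed
    have 2: "\<forall>j\<in>P. tg j \<le> T"
    proof
      fix j assume "j \<in> P"
      then have j: "j \<in> {1..L}" "blk q l j < s" by (auto simp: P_def)
      have "a j + 1 \<le> slope s" using a_blk[OF j(1)] slope_less[OF _ j(2)] blk_range[OF j(1)] s by auto
      then have "(a j + 1) * n \<le> slope s * n" by (rule mult_right_mono) simp
      then have "a j * n + n \<le> slope s * n" by simp
      then show "tg j \<le> T" using b_le[OF j(1)] le T unfolding tg_def by linarith
    qed
    have 3: "\<forall>j\<in>Q. T + 3 * r \<le> tg j" unfolding T tg_def Q_def using slope_eq s by auto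
    have 4: "\<forall>v. expectation (\<lambda>w. Gs s (\<lambda>j. if j \<in> Q then X (tg j) w else if j \<in> P then v j else 0)) = 0"
    proof
      fix v
      have "(\<lambda>w. Gs s (\<lambda>j. if j \<in> Q then X (tg j) w else if j \<in> P then v j else 0)) = (\<lambda>w. Gs s (\<lambda>j. if j \<in> Bl q l s then X (slope s * n + b j) w else (if j \<in> P then v j else 0)))"
        unfolding Q_def tg_def using slope_eq s by (auto intro!: ext arg_cong[where f="Gs s"])
      then show "expectation (\<lambda>w. Gs s (\<lambda>j. if j \<in> Q then X (tg j) w else if j \<in> P then v j else 0)) = 0"
        using Gs_centered s by simp
    qed
    have "\<bar>expectation (\<lambda>w. Gs s' (sample (upto_blk s') tw w) * Gs s (sample (upto_blk s) tg w))\<bar> \<le> C1 * rho r"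
      using C1'[OF Gs_hg Gs_hg PQ(1) cP PQ(2,3) r 1 2 3 4] unfolding PQ(4) .
    then have "\<bar>expectation (\<lambda>w. gs s' n' w * gs s n w)\<bar> \<le> C1 * rho r" using s by (simp add: gs_sample tw_def tg_def)
    moreover have "\<bar>expectation (\<lambda>w. 1 * Gs s (sample (upto_blk s) tg w))\<bar> \<le> C2 * rho r"
      using C2'[OF Gs_hg hoelder_growth_one PQ(1) cP PQ(2,3) r 1 2 3 4] unfolding PQ(4) .
    then have "\<bar>expectation (\<lambda>w. gs s n w)\<bar> \<le> C2 * rho r" using s by (subst gs_sample) (simp_all add: tg_def)
    moreover have "C1 * rho r \<ge> 0" "C2 * rho r \<ge> 0" using C1 C2 rho_pos[of r] by auto
    ultimately show "\<bar>expectation (\<lambda>w. gs s' n' w * gs s n w)\<bar> \<le> (C1 + C2) * rho r" "\<bar>expectation (gs s n)\<bar> \<le> (C1 + C2) * rho r"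
      unfolding distrib_right by linarith+
  qed
qed

definition decorrelates :: "real \<Rightarrow> bool" where
  "decorrelates C \<longleftrightarrow> C \<ge> 0 \<and> (\<forall>s s' n n'. \<bar>expectation (\<lambda>w. gs s' n' w * gs s n w)\<bar> \<le> C \<and> \<bar>expectation (gs s n)\<bar> \<le> C) \<and>
     (\<forall>s s' n n' r. s \<in> {1..k'} \<longrightarrow> s' \<in> {1..k'} \<longrightarrow> r \<ge> 1 \<longrightarrow> slope s' * n' + C0 + 3 * r \<le> slope s * n \<longrightarrow> C0 + 3 * r \<le> n \<longrightarrow>
     \<bar>expectation (\<lambda>w. gs s' n' w * gs s n w)\<bar> \<le> C * rho r \<and> \<bar>expectation (gs s n)\<bar> \<le> C * rho r)"
definition Cs :: real where
  "Cs = (SOME C. decorrelates C)"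

lemma Cs: "Cs \<ge> 0" "\<bar>expectation (\<lambda>w. gs s' n' w * gs s n w)\<bar> \<le> Cs" "\<bar>expectation (gs s n)\<bar> \<le> Cs"
  "s \<in> {1..k'} \<Longrightarrow> s' \<in> {1..k'} \<Longrightarrow> r \<ge> 1 \<Longrightarrow> slope s' * n' + C0 + 3 * r \<le> slope s * n \<Longrightarrow> C0 + 3 * r \<le> n \<Longrightarrow>
     \<bar>expectation (\<lambda>w. gs s' n' w * gs s n w)\<bar> \<le> Cs * rho r \<and> \<bar>expectation (gs s n)\<bar> \<le> Cs * rho r"
proof -
  obtain C1 where C1: "C1 \<ge> 0" "\<And>s s' n n'. \<bar>expectation (\<lambda>w. gs s' n' w * gs s n w)\<bar> \<le> C1" "\<And>s n. \<bar>expectation (gs s n)\<bar> \<le> C1"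
    using gs_bound by blast
  obtain C2 where C2: "C2 \<ge> 0" "\<And>s s' n n' r. s \<in> {1..k'} \<Longrightarrow> s' \<in> {1..k'} \<Longrightarrow> r \<ge> 1 \<Longrightarrow> slope s' * n' + C0 + 3 * r \<le> slope s * n \<Longrightarrow> C0 + 3 * r \<le> n \<Longrightarrow>
     \<bar>expectation (\<lambda>w. gs s' n' w * gs s n w)\<bar> \<le> C2 * rho r \<and> \<bar>expectation (gs s n)\<bar> \<le> C2 * rho r"
    using rate_separated by blast
  have "\<exists>C. decorrelates C"
    unfolding decorrelates_def
  proof (intro exI[of _ "C1 + C2"] conjI allI impI)
    show "C1 + C2 \<ge> 0" using C1(1) C2(1) by simp
    show "\<bar>expectation (\<lambda>w. gs s' n' w * gs s n w)\<bar> \<le> C1 + C2" "\<bar>expectation (gs s n)\<bar> \<le> C1 + C2" for s s' n n'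
      using C1(2)[of s' n' s n] C1(3)[of s n] C2(1) by linarith+
    fix s s' n n' r assume A: "s \<in> {1..k'}" "s' \<in> {1..k'}" "1 \<le> r" "slope s' * n' + C0 + 3 * r \<le> slope s * n" "C0 + 3 * r \<le> n"
    have "C1 * rho r \<ge> 0" using C1(1) rho_pos[of r] by auto
    with C2(2)[OF A] show "\<bar>expectation (\<lambda>w. gs s' n' w * gs s n w)\<bar> \<le> (C1 + C2) * rho r" "\<bar>expectation (gs s n)\<bar> \<le> (C1 + C2) * rho r"
      unfolding distrib_right by linarith+
  qed
  from someI_ex[OF this, folded Cs_def, unfolded decorrelates_def]
  show "Cs \<ge> 0" "\<bar>expectation (\<lambda>w. gs s' n' w * gs s n w)\<bar> \<le> Cs" "\<bar>expectation (gs s n)\<bar> \<le> Cs"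
    "s \<in> {1..k'} \<Longrightarrow> s' \<in> {1..k'} \<Longrightarrow> r \<ge> 1 \<Longrightarrow> slope s' * n' + C0 + 3 * r \<le> slope s * n \<Longrightarrow> C0 + 3 * r \<le> n \<Longrightarrow>
     \<bar>expectation (\<lambda>w. gs s' n' w * gs s n w)\<bar> \<le> Cs * rho r \<and> \<bar>expectation (gs s n)\<bar> \<le> Cs * rho r"
    by blast+
qed

text \<open>The argument of \<open>rho'\<close> is the largest \<open>r\<close> with
  \<open>C0 + 3 * r <= u\<close>, or 0 if there is none.\<close>

definition k0 :: "nat \<Rightarrow> real" where "k0 u = Cs * rho' ((u - C0) div 3)"

lemma rho'_nonneg: "rho' r \<ge> 0" unfolding rho'_def using rho_pos[of r] by auto
lemma k0_nonneg: "k0 u \<ge> 0" unfolding k0_def using Cs(1) rho'_nonneg by (rule mult_nonneg_nonneg)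

text \<open>After a shift by \<open>C0\<close> the function is constant on runs of three, and
  \<open>u <= 3 * (u div 3) + 2\<close> converts the weight \<open>u\<close> into the weight of
  \<open>rho_summable\<close>.\<close>

lemma k0_summable: "summable (\<lambda>u. real u * k0 u)"
proof -
  define h where "h r = Cs * ((3 * real r + 2 + real C0) * rho' r)" for r
  have hn: "h r \<ge> 0" for r unfolding h_def using Cs(1) rho'_nonneg by (intro mult_nonneg_nonneg) auto
  have "summable (\<lambda>r. Cs * (3 * (real r * rho r) + (2 + real C0) * rho r))"
    by (intro summable_mult summable_add rho_summable rho_summable')
  then have "summable h"
  proof (rule summable_comparison_test_ev[rotated])
    show "\<forall>\<^sub>F r in sequentially. norm (h r) \<le> Cs * (3 * (real r * rho r) + (2 + real C0) * rho r)"
      using eventually_ge_at_top[of 1]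
    proof eventually_elim
      case (elim r)
      then have "h r = Cs * (3 * (real r * rho r) + (2 + real C0) * rho r)" by (simp add: h_def rho'_def algebra_simps)
      then show ?case using hn[of r] by simp
    qed
  qed
  from summable_div3[OF hn this] have S: "summable (\<lambda>u. h (u div 3))" .
  have "summable (\<lambda>u. real (u + C0) * k0 (u + C0))"
  proof (rule summable_comparison_test'[OF S])
    fix u :: nat
    have "u \<le> 3 * (u div 3) + 2" by presburger
    then have "real (u + C0) \<le> 3 * real (u div 3) + 2 + real C0" by linarith
    then have "real (u + C0) * (Cs * rho' (u div 3)) \<le> (3 * real (u div 3) + 2 + real C0) * (Cs * rho' (u div 3))"
      using Cs(1) rho'_nonneg by (intro mult_right_mono mult_nonneg_nonneg)
    then show "norm (real (u + C0) * k0 (u + C0)) \<le> h (u div 3)"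
      using k0_nonneg[of "u + C0"] by (simp add: h_def k0_def mult.left_commute)
  qed
  then show ?thesis unfolding summable_iff_shift[of "\<lambda>u. real u * k0 u"] .
qed

text \<open>Both distances limit the admissible \<open>r\<close>, so the smaller one decides; as it
  is one of the two, the sum of both \<open>k0\<close> terms is an upper bound. No monotonicity of
  \<open>rho\<close> is required.\<close>

lemma k0_min: 
  assumes "x' \<ge> 0" "\<And>r. r \<ge> 1 \<Longrightarrow> C0 + 3 * r \<le> u \<Longrightarrow> C0 + 3 * r \<le> v \<Longrightarrow> x' \<le> Cs * rho r" "x' \<le> Cs"
  shows "x' \<le> k0 u + k0 v"
proof -
  have "x' \<le> k0 (min u v)"
  proof (cases "(min u v - C0) div 3 = 0")
    case True then show ?thesis using assms(3) unfolding k0_def rho'_def by simp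
  next
    case False
    define r where "r = (min u v - C0) div 3"
    have "3 * r \<le> min u v - C0" unfolding r_def by simp
    moreover have r: "r \<ge> 1" using False by (simp add: r_def)
    ultimately have "C0 + 3 * r \<le> u" "C0 + 3 * r \<le> v" by (auto simp: min_def split: if_splits)
    from assms(2)[OF r this] show ?thesis unfolding k0_def rho'_def using False by (simp add: r_def)
  qed
  then show ?thesis using k0_nonneg[of u] k0_nonneg[of v] by (auto simp: min_def split: if_splits)
qed

lemma gs_rate:
  assumes s: "s \<in> {1..k'}" "s' \<in> {1..k'}" and le: "slope s' * n' \<le> slope s * n"
  shows "\<bar>expectation (\<lambda>w. gs s n w * gs s' n' w)\<bar> \<le> k0 (slope s * n - slope s' * n') + k0 n"
proof (rule k0_min)
  show "\<bar>expectation (\<lambda>w. gs s n w * gs s' n' w)\<bar> \<le> Cs" by (rule Cs(2))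
  fix r assume r: "1 \<le> r" "C0 + 3 * r \<le> slope s * n - slope s' * n'" "C0 + 3 * r \<le> n"
  then have "slope s' * n' + C0 + 3 * r \<le> slope s * n" using le by linarith
  from Cs(4)[OF s r(1) this r(3)] show "\<bar>expectation (\<lambda>w. gs s n w * gs s' n' w)\<bar> \<le> Cs * rho r" by (simp add: mult.commute)
qed simp

lemma gs_mean_rate:
  assumes s: "s \<in> {1..k'}"
  shows "\<bar>expectation (gs s n)\<bar> \<le> 2 * k0 n"
proof -
  have "\<bar>expectation (gs s n)\<bar> \<le> k0 n + k0 n"
  proof (rule k0_min)
    show "\<bar>expectation (gs s n)\<bar> \<le> Cs" by (rule Cs(3))
    fix r assume r: "1 \<le> r" "C0 + 3 * r \<le> n"
    have "1 * n \<le> slope s * n" using slope_pos[of s] s by (intro mult_right_mono) auto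
    then have "slope s * 0 + C0 + 3 * r \<le> slope s * n" using r by linarith
    from Cs(4)[OF s s r(1) this r(2)] show "\<bar>expectation (gs s n)\<bar> \<le> Cs * rho r" by simp
  qed simp
  then show ?thesis by simp
qed

end

section \<open>Limits of covariances of the block summands\<close>

lemma continuous_on_fun_reindex:
  fixes f :: "('j \<Rightarrow> 'b::topological_space) \<Rightarrow> 'c::topological_space"
  assumes "continuous_on UNIV f"
  shows "continuous_on UNIV (\<lambda>x. f (\<lambda>j. x (r j)))"
proof (rule continuous_on_compose2[OF assms])
  show "continuous_on UNIV (\<lambda>x j. x (r j))"
    by (rule continuous_on_coordinatewise_then_product) (rule continuous_on_product_coordinates)
qed simp

context linear_averages begin

text \<open>Two copies of the coordinates, one for each factor of a product taken at two indices, so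
  that a covariance becomes the mean of one function of a single family.\<close>

definition A2 :: "(nat \<times> bool) set" where "A2 = {1..L} \<times> UNIV"

lemma finite_A2: "finite A2" unfolding A2_def by (intro finite_cartesian_product finite_atLeastAtMost finite)

text \<open>Within one copy the growth rate determines the slope, and slopes determine blocks. A
  class therefore consists of at most one block from each copy, which matches the number of times in
  the stationarity assumption.\<close>

lemma card_slope_class:
  assumes "c1 \<ge> 1" "c2 \<ge> 1"
  shows "card {x\<in>A2. a (fst x) * (if snd x then c1 else c2) = v} \<le> 2 * card (Dhat q l)"
proof -
  define J where "J c' = {j\<in>{1..L}. a j * c' = v}" for c'
  have J: "card (J c') \<le> card (Dhat q l)" if c': "c' \<ge> 1" for c'
  proof (cases "J c' = {}")
    case False
    then obtain i where i: "i \<in> {1..L}" "a i * c' = v" by (auto simp: J_def)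
    have bi: "1 \<le> blk q l i" "blk q l i \<le> k'" using blk_range[OF i(1)] by auto
    have "J c' \<subseteq> Bl q l (blk q l i)"
    proof
      fix j assume "j \<in> J c'"
      then have j: "j \<in> {1..L}" "a j * c' = v" by (auto simp: J_def)
      have bj: "1 \<le> blk q l j" "blk q l j \<le> k'" using blk_range[OF j(1)] by auto
      have "a j = a i" using j(2) i(2) c' by auto
      then have "slope (blk q l j) = slope (blk q l i)" by (simp add: a_blk[OF i(1)] a_blk[OF j(1)])
      then have "blk q l j = blk q l i"
        using slope_less[OF bj(1) _ bi(2)] slope_less[OF bi(1) _ bj(2)] by (metis less_irrefl linorder_cases)
      then show "j \<in> Bl q l (blk q l i)" using blk_range[OF j(1)] by simp
    qed
    then have "card (J c') \<le> card (Bl q l (blk q l i))" by (intro card_mono) (auto simp: Bl_def)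
    also have "\<dots> \<le> card (Dhat q l)" by (rule card_Bl[OF bi])
    finally show ?thesis .
  qed simp
  have "card {x\<in>A2. a (fst x) * (if snd x then c1 else c2) = v} \<le> card (J c1 \<times> {True} \<union> J c2 \<times> {False})"
    by (rule card_mono) (auto simp: J_def A2_def split: if_splits)
  also have "\<dots> \<le> card (J c1 \<times> {True}) + card (J c2 \<times> {False})" by (rule card_Un_le)
  also have "\<dots> = card (J c1) + card (J c2)" by (simp add: card_cartesian_product)
  finally show ?thesis using J[OF assms(1)] J[OF assms(2)] by linarith
qed

lemma card_blk_class:
  assumes v: "v \<in> {1..k'}"
  shows "card {x\<in>A2. blk q l (fst x) = v} \<le> 2 * card (Dhat q l)"
proof -
  have "card {x\<in>A2. blk q l (fst x) = v} \<le> card (Bl q l v \<times> (UNIV :: bool set))"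
    using blk_range by (intro card_mono) (auto simp: A2_def Bl_def)
  also have "\<dots> = 2 * card (Bl q l v)" by (simp add: card_cartesian_product)
  also have "\<dots> \<le> 2 * card (Dhat q l)" using card_Bl[of v] v by simp
  finally show ?thesis .
qed

lemma continuous_prod_BL:
  fixes f :: "'i \<Rightarrow> real^'d \<Rightarrow> real"
  assumes "\<And>x. x \<in> S \<Longrightarrow> f x \<in> bounded_lipschitz"
  shows "continuous_on UNIV (\<lambda>y. \<Prod>x\<in>S. f x (y x))"
proof (rule continuous_on_prod)
  fix x assume "x \<in> S"
  then show "continuous_on UNIV (\<lambda>y. f x (y x))"
    by (rule continuous_on_compose2[OF bounded_lipschitz_continuous[OF assms] continuous_on_product_coordinates]) simp
qed

lemma shift_prod:
  fixes f :: "nat \<times> bool \<Rightarrow> real^'d \<Rightarrow> real"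
  assumes S: "S \<subseteq> A2" "card S \<le> 2 * card (Dhat q l)" and f: "\<And>x. x \<in> S \<Longrightarrow> f x \<in> bounded_lipschitz"
  shows "expectation (\<lambda>w. \<Prod>x\<in>S. f x (X (t + \<tau> x) w)) = expectation (\<lambda>w. \<Prod>x\<in>S. f x (X (\<tau> x) w))"
proof -
  have c: "continuous_on UNIV (\<lambda>y. \<Prod>x\<in>S. f x (y x))" by (rule continuous_prod_BL[OF f])
  show ?thesis
    using expectation_shift_continuous[OF finite_subset[OF S(1) finite_A2] S(2) c, where c=t and \<tau>=\<tau>] by simp
qed

context
  fixes f g :: "(nat \<Rightarrow> real^'d) \<Rightarrow> real" and Kf Kg :: real
  assumes f: "hoelder_growth L Kf iota kappa f" and g: "hoelder_growth L Kg iota kappa g"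
begin

definition pair_fun :: "(nat \<times> bool \<Rightarrow> real^'d) \<Rightarrow> real" where
  "pair_fun x = f (\<lambda>j. x (j, True)) * g (\<lambda>j. x (j, False))"

lemma pair_fun_continuous: "continuous_on UNIV pair_fun"
  unfolding pair_fun_def
  by (rule continuous_on_mult[OF continuous_on_fun_reindex[OF hoelder_growth_continuous[OF f iota_pos kappa(1)], of "\<lambda>j. (j, True)"]
    continuous_on_fun_reindex[OF hoelder_growth_continuous[OF g iota_pos kappa(1)], of "\<lambda>j. (j, False)"]])

lemma pair_fun_cong:
  assumes "\<And>a. a \<in> A2 \<Longrightarrow> x a = z a" shows "pair_fun x = pair_fun z"
proof -
  have "f (\<lambda>j. x (j, True)) = f (\<lambda>j. z (j, True))" by (rule hoelder_growth_cong[OF f]) (simp add: assms A2_def)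
  moreover have "g (\<lambda>j. x (j, False)) = g (\<lambda>j. z (j, False))" by (rule hoelder_growth_cong[OF g]) (simp add: assms A2_def)
  ultimately show ?thesis by (simp add: pair_fun_def)
qed

definition pair_const :: real where "pair_const = Kf * (1 + real L) * (Kg * (1 + real L)) + 1"

lemma pair_fun_bound:
  "\<bar>pair_fun x\<bar> \<le> pair_const * (1 + (\<Sum>a\<in>A2. norm (x a))) powr (2 * iota)"
proof -
  define B where "B = 1 + (\<Sum>a\<in>A2. norm (x a))"
  have B: "B \<ge> 1" unfolding B_def by (simp add: sum_nonneg)
  have le: "norm (x a) \<le> B" if "a \<in> A2" for a
    using member_le_sum[OF that, of "\<lambda>a. norm (x a)"] finite_A2 unfolding B_def by simp
  have F: "\<bar>f (\<lambda>j. x (j, True))\<bar> \<le> Kf * (1 + real L) * B powr iota"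
    by (rule hoelder_growth_bound[OF f iota_pos B]) (auto intro: le simp: A2_def)
  have G: "\<bar>g (\<lambda>j. x (j, False))\<bar> \<le> Kg * (1 + real L) * B powr iota"
    by (rule hoelder_growth_bound[OF g iota_pos B]) (auto intro: le simp: A2_def)
  have "\<bar>pair_fun x\<bar> = \<bar>f (\<lambda>j. x (j, True))\<bar> * \<bar>g (\<lambda>j. x (j, False))\<bar>" by (simp add: pair_fun_def abs_mult)
  also have "\<dots> \<le> (Kf * (1 + real L) * B powr iota) * (Kg * (1 + real L) * B powr iota)"
    by (rule mult_mono'[OF F G]) auto
  also have "\<dots> = (Kf * (1 + real L) * (Kg * (1 + real L))) * (B powr iota * B powr iota)" by (simp add: ac_simps)
  also have "B powr iota * B powr iota = B powr (2 * iota)" by (simp add: powr_add[symmetric])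
  also have "(Kf * (1 + real L) * (Kg * (1 + real L))) * B powr (2 * iota) \<le> pair_const * B powr (2 * iota)"
    unfolding pair_const_def by (rule mult_right_mono) auto
  finally show ?thesis unfolding B_def .
qed

lemma pair_const_pos: "pair_const > 0"
  unfolding pair_const_def using hoelder_growth_nonneg[OF f] hoelder_growth_nonneg[OF g]
  by (intro add_nonneg_pos mult_nonneg_nonneg) auto

lemma iota2_less_m: "0 \<le> 2 * iota" "2 * iota < m" using m_ge iota_pos by linarith+

lemmas pair_fun_props = pair_fun_continuous pair_fun_cong pair_fun_bound pair_const_pos iota2_less_m

text \<open>The coordinates move at the rates \<open>a j * c1\<close> and \<open>a j * c2\<close>,
  so different blocks of the two factors may move together. The class of a coordinate is its rate,
  and the slope of a class is the class itself. No value of the limit is claimed.\<close>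

lemma pair_convergent:
  assumes c12: "c1 \<ge> 1" "c2 \<ge> 1"
  shows "convergent (\<lambda>t. expectation (\<lambda>w. f (\<lambda>j. X (a j * (n + c1 * t) + b j) w) * g (\<lambda>j. X (a j * (n' + c2 * t) + b j) w)))"
proof -
  define cl where "cl x = a (fst x) * (if snd x then c1 else c2)" for x :: "nat \<times> bool"
  define eta where "eta x = a (fst x) * (if snd x then n else n') + b (fst x)" for x :: "nat \<times> bool"
  interpret sc: slope_classes M Fam X iota kappa p qe delta m A2 cl "\<lambda>v. v" eta
  proof unfold_locales
    show "finite A2" by (rule finite_A2)
    show "v \<ge> 1" if v: "v \<in> cl ` A2" for v
    proof -
      obtain x where x: "x \<in> A2" "v = cl x" using v by blast
      then have "a (fst x) \<ge> 1" using ab(3)[of "fst x"] by (auto simp: A2_def)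
      then show ?thesis using c12 unfolding x(2) cl_def by (cases "snd x") auto
    qed
    show "expectation (\<lambda>w. \<Prod>x\<in>{x\<in>A2. cl x = v}. h x (X (v * t + eta x) w)) = expectation (\<lambda>w. \<Prod>x\<in>{x\<in>A2. cl x = v}. h x (X (eta x) w))"
      if "\<And>x. x \<in> A2 \<Longrightarrow> h x \<in> bounded_lipschitz" for v t h
      by (rule shift_prod) (use card_slope_class[OF c12, of v] that in \<open>auto simp: cl_def\<close>)
  qed
  have eq: "pair_fun (\<lambda>x. X (cl x * t + eta x) w) = f (\<lambda>j. X (a j * (n + c1 * t) + b j) w) * g (\<lambda>j. X (a j * (n' + c2 * t) + b j) w)" for t w
    unfolding pair_fun_def cl_def eta_def by (simp add: algebra_simps)
  show ?thesis using sc.mean_convergent[OF pair_fun_props] unfolding eq .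
qed

text \<open>Both indices advance by the same \<open>t\<close>, so rates coincide exactly within a
  block and the classes are the blocks with their two copies; this makes the limit computable from
  independent blocks.\<close>

lemma pair_limit:
  assumes P: "prob_space P"
    and \<xi>m: "\<And>x. x \<in> A2 \<Longrightarrow> \<xi> x \<in> borel_measurable P" and \<xi>i: "\<And>x. x \<in> A2 \<Longrightarrow> integrable P (\<lambda>w. norm (\<xi> x w) powr m)"
    and law: "\<And>h. (\<And>x. x \<in> A2 \<Longrightarrow> h x \<in> bounded_lipschitz) \<Longrightarrow> integral\<^sup>L P (\<lambda>w. \<Prod>x\<in>A2. h x (\<xi> x w))
        = (\<Prod>v\<in>(\<lambda>x. blk q l (fst x)) ` A2. expectation (\<lambda>w. \<Prod>x\<in>{x\<in>A2. blk q l (fst x) = v}. h x (X (a (fst x) * (if snd x then n else n') + b (fst x)) w)))"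
  shows "(\<lambda>t. expectation (\<lambda>w. f (\<lambda>j. X (a j * (n + t) + b j) w) * g (\<lambda>j. X (a j * (n' + t) + b j) w)))
    \<longlonglongrightarrow> integral\<^sup>L P (\<lambda>w. f (\<lambda>j. \<xi> (j, True) w) * g (\<lambda>j. \<xi> (j, False) w))"
proof -
  define cl where "cl x = blk q l (fst x)" for x :: "nat \<times> bool"
  define eta where "eta x = a (fst x) * (if snd x then n else n') + b (fst x)" for x :: "nat \<times> bool"
  have cl: "v \<in> {1..k'}" if "v \<in> cl ` A2" for v using that blk_range by (auto simp: cl_def A2_def)
  interpret sc: slope_classes M Fam X iota kappa p qe delta m A2 cl slope eta
  proof unfold_locales
    show "finite A2" by (rule finite_A2)
    show "slope v \<ge> 1" if "v \<in> cl ` A2" for v using slope_pos cl[OF that] by auto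
    show "slope u < slope v" if "u \<in> cl ` A2" "v \<in> cl ` A2" "u < v" for u v
      using slope_less[OF _ that(3)] cl[OF that(1)] cl[OF that(2)] by auto
    show "expectation (\<lambda>w. \<Prod>x\<in>{x\<in>A2. cl x = v}. h x (X (slope v * t + eta x) w)) = expectation (\<lambda>w. \<Prod>x\<in>{x\<in>A2. cl x = v}. h x (X (eta x) w))"
      if "v \<in> cl ` A2" "\<And>x. x \<in> A2 \<Longrightarrow> h x \<in> bounded_lipschitz" for v t h
      by (rule shift_prod) (use card_blk_class[OF cl[OF that(1)]] that in \<open>auto simp: cl_def\<close>)
  qed
  have eq: "pair_fun (\<lambda>x. X (slope (cl x) * t + eta x) w) = f (\<lambda>j. X (a j * (n + t) + b j) w) * g (\<lambda>j. X (a j * (n' + t) + b j) w)" for t w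
  proof -
    have "pair_fun (\<lambda>x. X (slope (cl x) * t + eta x) w) = pair_fun (\<lambda>x. X (a (fst x) * ((if snd x then n else n') + t) + b (fst x)) w)"
      by (rule pair_fun_cong) (auto simp: A2_def cl_def eta_def a_blk algebra_simps)
    then show ?thesis by (simp add: pair_fun_def)
  qed
  have "(\<lambda>t. expectation (\<lambda>w. pair_fun (\<lambda>x. X (slope (cl x) * t + eta x) w))) \<longlonglongrightarrow> integral\<^sup>L P (\<lambda>w. pair_fun (\<lambda>x. \<xi> x w))"
    by (rule sc.mean_limit[OF pair_fun_props P \<xi>m \<xi>i]) (use law in \<open>simp_all add: cl_def[abs_def] eta_def\<close>)
  then show ?thesis unfolding eq by (simp add: pair_fun_def)
qed

end

text \<open>The factor 2 in front of \<open>k0\<close> accommodates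
  \<open>gs_mean_rate\<close>.\<close>

lemma block_sums_gs: "block_sums M gs k' slope (\<lambda>u. 2 * k0 u)"
proof unfold_locales
  show "gs s n \<in> borel_measurable M" for s n by (rule gs_measurable)
  show "integrable M (\<lambda>w. (gs s n w)\<^sup>2)" for s n by (rule gs_square)
  show "0 < slope s" if "s \<in> {1..k'}" for s using slope_pos[of s] that by auto
  show "slope s < slope s'" if "s \<in> {1..k'}" "s' \<in> {1..k'}" "s < s'" for s s' using slope_less[of s s'] that by auto
  show "0 \<le> 2 * k0 u" for u using k0_nonneg[of u] by simp
  show "summable (\<lambda>u. real u * (2 * k0 u))" using summable_mult[OF k0_summable, of 2] by (simp add: mult.left_commute)
next
  fix s s' n n' assume s: "s \<in> {1..k'}" "s' \<in> {1..k'}" "slope s' * n' \<le> slope s * n"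
  show "\<bar>expectation (\<lambda>w. gs s n w * gs s' n' w)\<bar> \<le> 2 * k0 (slope s * n - slope s' * n') + 2 * k0 n"
    using gs_rate[OF s] k0_nonneg[of n] k0_nonneg[of "slope s * n - slope s' * n'"] by linarith
next
  fix s n assume s: "s \<in> {1..k'}"
  show "\<bar>expectation (gs s n)\<bar> \<le> 2 * k0 n" by (rule gs_mean_rate[OF s])
next
  fix s s' n n' assume "s \<in> {1..k'}" "s' \<in> {1..k'}"
  then have c: "slope s' \<ge> 1" "slope s \<ge> 1" using slope_pos by auto
  show "convergent (\<lambda>t. expectation (\<lambda>w. gs s (n + slope s' * t) w * gs s' (n' + slope s * t) w))"
    unfolding gs_def by (rule pair_convergent[OF Gs_hg Gs_hg c])
qed

end

section \<open>The independent block processes\<close>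

locale block_processes = linear_averages M Fam X iota kappa p qe delta m q l k G K + N: prob_space N
  for M :: "'a measure" and Fam and X :: "nat \<Rightarrow> 'a \<Rightarrow> real^'d" and iota kappa p qe delta m :: real
    and q :: "nat \<Rightarrow> real poly" and l k :: nat and G and K and N :: "'b measure" +
  fixes Y :: "nat \<Rightarrow> nat \<Rightarrow> 'b \<Rightarrow> (nat \<Rightarrow> real^'d)"
  assumes Y_indep: "N.indep_vars (\<lambda>s. PiM UNIV (\<lambda>_. PiM (Bl q l s) (\<lambda>_. borel))) (\<lambda>s w. \<lambda>n. Y s n w) {1..k}"
    and Y_law: "\<forall>s\<in>{1..k}.
                  distr N (PiM UNIV (\<lambda>_. PiM (Bl q l s) (\<lambda>_. borel))) (\<lambda>w n. Y s n w)
                = distr M (PiM UNIV (\<lambda>_. PiM (Bl q l s) (\<lambda>_. borel)))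
                          (\<lambda>w n. \<lambda>j\<in>Bl q l s. X (n + doff q l j) w)"
begin

abbreviation path_space :: "nat \<Rightarrow> (nat \<Rightarrow> nat \<Rightarrow> real^'d) measure" where
  "path_space s \<equiv> PiM UNIV (\<lambda>_. PiM (Bl q l s) (\<lambda>_. borel))"

lemma Y_path: "s \<in> {1..k} \<Longrightarrow> (\<lambda>w n. Y s n w) \<in> N \<rightarrow>\<^sub>M path_space s"
  using Y_indep unfolding N.indep_vars_def by blast

lemma X_path: "(\<lambda>w n. \<lambda>j\<in>Bl q l s. X (n + doff q l j) w) \<in> M \<rightarrow>\<^sub>M path_space s"
proof -
  have "(\<lambda>w. \<lambda>n\<in>UNIV. \<lambda>j\<in>Bl q l s. X (n + doff q l j) w) \<in> M \<rightarrow>\<^sub>M path_space s"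
    by (intro measurable_restrict) auto
  then show ?thesis by (simp only: restrict_UNIV)
qed

lemma path_integral:
  assumes s: "s \<in> {1..k}" and F: "F \<in> borel_measurable (path_space s)"
  shows "integral\<^sup>L N (\<lambda>w. F (\<lambda>n. Y s n w)) = expectation (\<lambda>w. F (\<lambda>n. \<lambda>j\<in>Bl q l s. X (n + doff q l j) w) :: real)"
    "integrable N (\<lambda>w. F (\<lambda>n. Y s n w)) \<longleftrightarrow> integrable M (\<lambda>w. F (\<lambda>n. \<lambda>j\<in>Bl q l s. X (n + doff q l j) w))"
proof -
  note eq = Y_law[rule_format, OF s]
  show "integral\<^sup>L N (\<lambda>w. F (\<lambda>n. Y s n w)) = expectation (\<lambda>w. F (\<lambda>n. \<lambda>j\<in>Bl q l s. X (n + doff q l j) w))"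
    unfolding integral_distr[OF Y_path[OF s] F, symmetric] integral_distr[OF X_path F, symmetric] eq ..
  show "integrable N (\<lambda>w. F (\<lambda>n. Y s n w)) \<longleftrightarrow> integrable M (\<lambda>w. F (\<lambda>n. \<lambda>j\<in>Bl q l s. X (n + doff q l j) w))"
    unfolding integrable_distr_eq[OF Y_path[OF s] F, symmetric] integrable_distr_eq[OF X_path F, symmetric] eq ..
qed

lemma coord_measurable: "j \<in> Bl q l s \<Longrightarrow> (\<lambda>y. y n j) \<in> borel_measurable (path_space s)"
  using measurable_compose[OF measurable_component_singleton[of n UNIV "\<lambda>_. PiM (Bl q l s) (\<lambda>_. borel)"]
    measurable_component_singleton[of j "Bl q l s" "\<lambda>_. borel"]] by simp

lemma blk_k: "j \<in> {1..L} \<Longrightarrow> blk q l j \<in> {1..k}" using blk_range[of j] k'_props(4) by auto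

text \<open>\<open>\<tau>\<close> assigns a time to each block: \<open>tm n\<close> produces the
  arguments of \<open>Z n\<close>, and the constant 0 the random vector behind the product of the
  \<open>nu\<close>.\<close>

definition zeta :: "(nat \<Rightarrow> nat) \<Rightarrow> 'b \<Rightarrow> nat \<Rightarrow> real^'d" where
  "zeta \<tau> w j = (if j \<in> {1..L} then Y (blk q l j) (\<tau> (blk q l j)) w j else 0)"

lemma zeta_measurable: "(\<lambda>w. zeta \<tau> w j) \<in> borel_measurable N"
proof (cases "j \<in> {1..L}")
  case True
  then show ?thesis unfolding zeta_def
    using measurable_compose[OF Y_path[OF blk_k[OF True]] coord_measurable[of j "blk q l j" "\<tau> (blk q l j)"]] blk_range by simp
next
  case False
  then have "(\<lambda>w. zeta \<tau> w j) = (\<lambda>_. 0)" by (simp only: zeta_def if_False)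
  then show ?thesis by simp
qed

lemma zeta_moment: "integrable N (\<lambda>w. norm (zeta \<tau> w j) powr m)"
proof (cases "j \<in> {1..L}")
  case True
  have j: "j \<in> Bl q l (blk q l j)" using blk_range[OF True] by simp
  define F where "F y = norm (y (\<tau> (blk q l j)) j) powr m" for y :: "nat \<Rightarrow> nat \<Rightarrow> real^'d"
  have F: "F \<in> borel_measurable (path_space (blk q l j))"
    unfolding F_def using coord_measurable[OF j] by measurable
  have "integrable N (\<lambda>w. F (\<lambda>n. Y (blk q l j) n w))"
    unfolding path_integral(2)[OF blk_k[OF True] F] using j X_integrable_m by (simp add: F_def)
  then show ?thesis using True by (simp add: zeta_def F_def)
next
  case False
  then have "zeta \<tau> w j = 0" for w by (simp only: zeta_def if_False)
  then show ?thesis by simp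
qed

text \<open>Both copies of a block are read off the same path \<open>Y v\<close>, at the times
  \<open>\<tau> True v\<close> and \<open>\<tau> False v\<close>. Independence of the paths
  factorises the mean over blocks, and the law of each path brings the factors back to
  \<open>X\<close>.\<close>

lemma zeta_law:
  fixes h :: "nat \<times> bool \<Rightarrow> real^'d \<Rightarrow> real"
  assumes h: "\<And>x. x \<in> A2 \<Longrightarrow> h x \<in> bounded_lipschitz"
  shows "integral\<^sup>L N (\<lambda>w. \<Prod>x\<in>A2. h x (zeta (\<tau> (snd x)) w (fst x)))
    = (\<Prod>v\<in>(\<lambda>x. blk q l (fst x)) ` A2. expectation (\<lambda>w. \<Prod>x\<in>{x\<in>A2. blk q l (fst x) = v}. h x (X (\<tau> (snd x) v + doff q l (fst x)) w)))"
proof -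
  define I where "I = (\<lambda>x. blk q l (fst x)) ` A2"
  define cls where "cls v = {x\<in>A2. blk q l (fst x) = v}" for v
  define F where "F v y = (\<Prod>x\<in>cls v. h x (y (\<tau> (snd x) v) (fst x)))" for v :: nat and y :: "nat \<Rightarrow> nat \<Rightarrow> real^'d"
  have I: "I \<subseteq> {1..k}" "finite I" unfolding I_def using finite_A2 blk_k by (simp_all only: A2_def) fastforce+
  have cls: "fst x \<in> Bl q l v" "x \<in> A2" if "x \<in> cls v" for x v
    using that blk_range[of "fst x"] by (auto simp: cls_def A2_def)
  have F: "F v \<in> borel_measurable (path_space v)" for v
    unfolding F_def
  proof (rule borel_measurable_prod)
    fix x assume x: "x \<in> cls v"
    show "(\<lambda>y. h x (y (\<tau> (snd x) v) (fst x))) \<in> borel_measurable (path_space v)"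
      using measurable_compose[OF coord_measurable[OF cls(1)[OF x]] bounded_lipschitz_measurable[OF h[OF cls(2)[OF x]]]] .
  qed
  have ind: "N.indep_vars (\<lambda>_. borel) (\<lambda>v w. F v (\<lambda>n. Y v n w)) I"
    by (rule N.indep_vars_compose2[OF N.indep_vars_subset[OF Y_indep I(1)] F])
  have int: "integrable N (\<lambda>w. F v (\<lambda>n. Y v n w))" if v: "v \<in> I" for v
  proof -
    have "finite (cls v)" using finite_A2 by (simp add: cls_def)
    from prod_lipschitz_diff[OF this, of h] obtain B where "\<And>z. \<bar>\<Prod>x\<in>cls v. h x (z x)\<bar> \<le> B"
      using h cls(2) by blast
    then have "\<bar>F v y\<bar> \<le> B" for y unfolding F_def .
    moreover have "(\<lambda>w. F v (\<lambda>n. Y v n w)) \<in> borel_measurable N"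
      using v I(1) by (intro measurable_compose[OF Y_path F]) auto
    ultimately show ?thesis by (intro N.integrable_const_bound[where B=B]) auto
  qed
  have "(\<Prod>x\<in>A2. h x (zeta (\<tau> (snd x)) w (fst x))) = (\<Prod>v\<in>I. F v (\<lambda>n. Y v n w))" for w
    unfolding prod.image_gen[OF finite_A2, of _ "\<lambda>x. blk q l (fst x)"] I_def[symmetric]
    unfolding F_def cls_def by (intro prod.cong refl) (auto simp: zeta_def A2_def)
  then have "integral\<^sup>L N (\<lambda>w. \<Prod>x\<in>A2. h x (zeta (\<tau> (snd x)) w (fst x))) = (\<Prod>v\<in>I. integral\<^sup>L N (\<lambda>w. F v (\<lambda>n. Y v n w)))"
    using N.indep_vars_lebesgue_integral[OF I(2) ind int] by simp
  also have "\<dots> = (\<Prod>v\<in>I. expectation (\<lambda>w. \<Prod>x\<in>cls v. h x (X (\<tau> (snd x) v + doff q l (fst x)) w)))"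
  proof (rule prod.cong[OF refl])
    fix v assume "v \<in> I"
    then have "v \<in> {1..k}" using I(1) by auto
    from path_integral(1)[OF this F[of v]] show "integral\<^sup>L N (\<lambda>w. F v (\<lambda>n. Y v n w)) = expectation (\<lambda>w. \<Prod>x\<in>cls v. h x (X (\<tau> (snd x) v + doff q l (fst x)) w))"
      using cls(1) by (simp add: F_def)
  qed
  finally show ?thesis unfolding I_def cls_def .
qed

definition tm :: "nat \<Rightarrow> nat \<Rightarrow> nat" where "tm n v = slope v * n + b (fst_idx v)"

context
  fixes f g :: "(nat \<Rightarrow> real^'d) \<Rightarrow> real" and Kf Kg :: real
  assumes f: "hoelder_growth L Kf iota kappa f" and g: "hoelder_growth L Kg iota kappa g"
begin

lemma zeta_limit:
  assumes eq: "\<And>v h. v \<in> {1..k'} \<Longrightarrow> (\<And>x. x \<in> A2 \<Longrightarrow> h x \<in> bounded_lipschitz) \<Longrightarrow>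
     expectation (\<lambda>w. \<Prod>x\<in>{x\<in>A2. blk q l (fst x) = v}. h x (X (\<tau> (snd x) v + doff q l (fst x)) w))
     = expectation (\<lambda>w. \<Prod>x\<in>{x\<in>A2. blk q l (fst x) = v}. h x (X (a (fst x) * (if snd x then n else n') + b (fst x)) w))"
  shows "(\<lambda>t. expectation (\<lambda>w. f (\<lambda>j. X (a j * (n + t) + b j) w) * g (\<lambda>j. X (a j * (n' + t) + b j) w)))
    \<longlonglongrightarrow> integral\<^sup>L N (\<lambda>w. f (zeta (\<tau> True) w) * g (zeta (\<tau> False) w))"
proof -
  define \<xi> where "\<xi> x w = zeta (\<tau> (snd x)) w (fst x)" for x :: "nat \<times> bool" and w
  have "(\<lambda>t. expectation (\<lambda>w. f (\<lambda>j. X (a j * (n + t) + b j) w) * g (\<lambda>j. X (a j * (n' + t) + b j) w)))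
    \<longlonglongrightarrow> integral\<^sup>L N (\<lambda>w. f (\<lambda>j. \<xi> (j, True) w) * g (\<lambda>j. \<xi> (j, False) w))"
  proof (rule pair_limit[OF f g N.prob_space_axioms])
    show "\<xi> x \<in> borel_measurable N" for x unfolding \<xi>_def[abs_def] by (rule zeta_measurable)
    show "integrable N (\<lambda>w. norm (\<xi> x w) powr m)" for x unfolding \<xi>_def by (rule zeta_moment)
    fix h :: "nat \<times> bool \<Rightarrow> real^'d \<Rightarrow> real" assume h: "\<And>x. x \<in> A2 \<Longrightarrow> h x \<in> bounded_lipschitz"
    have "integral\<^sup>L N (\<lambda>w. \<Prod>x\<in>A2. h x (\<xi> x w)) = (\<Prod>v\<in>(\<lambda>x. blk q l (fst x)) ` A2. expectation (\<lambda>w. \<Prod>x\<in>{x\<in>A2. blk q l (fst x) = v}. h x (X (\<tau> (snd x) v + doff q l (fst x)) w)))"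
      unfolding \<xi>_def by (rule zeta_law[OF h])
    also have "\<dots> = (\<Prod>v\<in>(\<lambda>x. blk q l (fst x)) ` A2. expectation (\<lambda>w. \<Prod>x\<in>{x\<in>A2. blk q l (fst x) = v}. h x (X (a (fst x) * (if snd x then n else n') + b (fst x)) w)))"
    proof (rule prod.cong[OF refl])
      fix v assume "v \<in> (\<lambda>x. blk q l (fst x)) ` A2"
      then have "v \<in> {1..k'}" using blk_range by (auto simp: A2_def)
      then show "expectation (\<lambda>w. \<Prod>x\<in>{x\<in>A2. blk q l (fst x) = v}. h x (X (\<tau> (snd x) v + doff q l (fst x)) w))
         = expectation (\<lambda>w. \<Prod>x\<in>{x\<in>A2. blk q l (fst x) = v}. h x (X (a (fst x) * (if snd x then n else n') + b (fst x)) w))" by (rule eq[OF _ h])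
    qed
    finally show "integral\<^sup>L N (\<lambda>w. \<Prod>x\<in>A2. h x (\<xi> x w)) = (\<Prod>v\<in>(\<lambda>x. blk q l (fst x)) ` A2. expectation (\<lambda>w. \<Prod>x\<in>{x\<in>A2. blk q l (fst x) = v}. h x (X (a (fst x) * (if snd x then n else n') + b (fst x)) w)))" .
  qed
  then show ?thesis unfolding \<xi>_def by simp
qed

text \<open>The time \<open>tm n v\<close> plus the offset \<open>doff\<close> of a member
  \<open>j\<close> of block \<open>v\<close> is \<open>a j * n + b j\<close>, so the within-block
  means agree without any shift.\<close>

lemma zeta_limit_times:
  "(\<lambda>t. expectation (\<lambda>w. f (\<lambda>j. X (a j * (n + t) + b j) w) * g (\<lambda>j. X (a j * (n' + t) + b j) w)))
    \<longlonglongrightarrow> integral\<^sup>L N (\<lambda>w. f (zeta (tm n) w) * g (zeta (tm n') w))"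
proof -
  define \<tau> where "\<tau> \<beta> = tm (if \<beta> then n else n')" for \<beta>
  have eq: "\<tau> (snd x) v + doff q l (fst x) = a (fst x) * (if snd x then n else n') + b (fst x)"
    if "v \<in> {1..k'}" "x \<in> {x\<in>A2. blk q l (fst x) = v}" for x v
  proof -
    have j: "fst x \<in> {1..L}" "blk q l (fst x) = v" using that(2) by (auto simp: A2_def)
    then have B: "fst x \<in> Bl q l v" using blk_range[OF j(1)] by simp
    show ?thesis using doff_eq[OF _ _ B] slope_eq[OF _ _ B] that(1) by (simp add: \<tau>_def tm_def)
  qed
  have "(\<lambda>t. expectation (\<lambda>w. f (\<lambda>j. X (a j * (n + t) + b j) w) * g (\<lambda>j. X (a j * (n' + t) + b j) w)))
    \<longlonglongrightarrow> integral\<^sup>L N (\<lambda>w. f (zeta (\<tau> True) w) * g (zeta (\<tau> False) w))"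
    by (rule zeta_limit) (auto intro!: Bochner_Integration.integral_cong prod.cong simp: eq)
  then show ?thesis by (simp add: \<tau>_def)
qed

text \<open>At time 0 a block is sampled at its offsets \<open>doff\<close> instead of its
  intercepts \<open>b j\<close>; the shift by \<open>b (fst_idx v)\<close> inside each block
  reconciles them by stationarity. With \<open>g = 1\<close> this presents the mean of
  \<open>f\<close> under independent blocks as a limit of means along the process.\<close>

lemma zeta_limit_origin:
  "(\<lambda>t. expectation (\<lambda>w. f (\<lambda>j. X (a j * (0 + t) + b j) w) * g (\<lambda>j. X (a j * (0 + t) + b j) w)))
    \<longlonglongrightarrow> integral\<^sup>L N (\<lambda>w. f (zeta (\<lambda>_. 0) w) * g (zeta (\<lambda>_. 0) w))"
proof (rule zeta_limit)
  fix v and h :: "nat \<times> bool \<Rightarrow> real^'d \<Rightarrow> real" assume v: "v \<in> {1..k'}" and h: "\<And>x. x \<in> A2 \<Longrightarrow> h x \<in> bounded_lipschitz"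
  define S where "S = {x\<in>A2. blk q l (fst x) = v}"
  have S: "S \<subseteq> A2" "card S \<le> 2 * card (Dhat q l)" using card_blk_class[OF v] by (auto simp: S_def)
  have hS: "h x \<in> bounded_lipschitz" if "x \<in> S" for x using h that S(1) by blast
  have d: "b (fst_idx v) + doff q l (fst x) = b (fst x)" if "x \<in> S" for x
  proof -
    have "fst x \<in> Bl q l v" using that blk_range[of "fst x"] by (auto simp: S_def A2_def)
    then show ?thesis using doff_eq v by simp
  qed
  have "expectation (\<lambda>w. \<Prod>x\<in>S. h x (X (b (fst_idx v) + doff q l (fst x)) w)) = expectation (\<lambda>w. \<Prod>x\<in>S. h x (X (doff q l (fst x)) w))"
    by (rule shift_prod[OF S hS])
  then have "expectation (\<lambda>w. \<Prod>x\<in>S. h x (X (doff q l (fst x)) w)) = expectation (\<lambda>w. \<Prod>x\<in>S. h x (X (b (fst x)) w))"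
    using d by simp
  then show "expectation (\<lambda>w. \<Prod>x\<in>{x\<in>A2. blk q l (fst x) = v}. h x (X (0 + doff q l (fst x)) w))
     = expectation (\<lambda>w. \<Prod>x\<in>{x\<in>A2. blk q l (fst x) = v}. h x (X (a (fst x) * (if snd x then 0 else 0) + b (fst x)) w))"
    unfolding S_def by simp
qed

end

definition zs :: "nat \<Rightarrow> nat \<Rightarrow> 'b \<Rightarrow> real" where "zs s n w = Gs s (zeta (tm n) w)"

lemma zs_measurable [measurable]: "zs s n \<in> borel_measurable N"
  unfolding zs_def[abs_def] by (rule hg_measurable[OF Gs_hg zeta_measurable])

lemma zs_square: "integrable N (\<lambda>w. (zs s n w)\<^sup>2)"
proof (rule Bochner_Integration.integrable_bound)
  define c1 where "c1 = (2 * Kb * (1 + real L))\<^sup>2 * (1 + real (card {1..L})) powr m"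
  show "integrable N (\<lambda>w. c1 * (1 + (\<Sum>j=1..L. norm (zeta (tm n) w j) powr m)))" using zeta_moment by auto
  show "AE w in N. norm ((zs s n w)\<^sup>2) \<le> norm (c1 * (1 + (\<Sum>j=1..L. norm (zeta (tm n) w j) powr m)))"
  proof (rule AE_I2)
    fix w
    define B where "B = 1 + (\<Sum>j=1..L. norm (zeta (tm n) w j))"
    have B: "B \<ge> 1" unfolding B_def by (simp add: sum_nonneg)
    have le: "norm (zeta (tm n) w j) \<le> B" if "j \<in> {1..L}" for j
      using member_le_sum[OF that, of "\<lambda>j. norm (zeta (tm n) w j)"] unfolding B_def by simp
    have "\<bar>zs s n w\<bar> \<le> 2 * Kb * (1 + real L) * B powr iota"
      unfolding zs_def by (rule hoelder_growth_bound[OF Gs_hg iota_pos B le])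
    then have "\<bar>zs s n w\<bar>\<^sup>2 \<le> (2 * Kb * (1 + real L) * B powr iota)\<^sup>2" by (rule power_mono) simp
    also have "\<dots> = (2 * Kb * (1 + real L))\<^sup>2 * (B powr iota * B powr iota)" by (simp add: power2_eq_square)
    also have "B powr iota * B powr iota = B powr (2 * iota)" by (simp add: powr_add[symmetric])
    also have "B powr (2 * iota) \<le> B powr m" using B m_ge iota_pos by (intro powr_mono) auto
    also have "B powr m \<le> (1 + real (card {1..L})) powr m * (1 + (\<Sum>j=1..L. norm (zeta (tm n) w j) powr m))"
      unfolding B_def using powr_one_plus_sum_le[of "{1..L}" "\<lambda>j. norm (zeta (tm n) w j)" m] m_pos by simp
    finally have "\<bar>zs s n w\<bar>\<^sup>2 \<le> c1 * (1 + (\<Sum>j=1..L. norm (zeta (tm n) w j) powr m))"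
      unfolding c1_def by (simp add: mult_left_mono mult.assoc)
    then show "norm ((zs s n w)\<^sup>2) \<le> norm (c1 * (1 + (\<Sum>j=1..L. norm (zeta (tm n) w j) powr m)))" by simp
  qed
qed measurable

lemma zs_integrable: "integrable N (zs s n)"
  by (rule N.square_integrable[OF zs_measurable zs_square])

lemma zszs: "integrable N (\<lambda>w. zs s n w * zs s' n' w)"
  by (rule N.integrable_square_mult[OF zs_measurable zs_measurable zs_square zs_square])

text \<open>Far along the process the blocks become independent. Centring, orthogonality,
  stationarity and decay of the \<open>zs\<close> are all read off the \<open>gs\<close> through
  this limit.\<close>

lemma zs_limit: "(\<lambda>t. expectation (\<lambda>w. gs s (n + t) w * gs s' (n' + t) w)) \<longlonglongrightarrow> N.expectation (\<lambda>w. zs s n w * zs s' n' w)"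
  unfolding gs_def zs_def by (rule zeta_limit_times[OF Gs_hg Gs_hg])

lemma k0_tendsto: "k0 \<longlonglongrightarrow> 0"
  by (rule summable_LIMSEQ_zero, rule summable_of_weighted) (use k0_summable k0_nonneg in simp)

lemma gs_mean_tendsto: "s \<in> {1..k'} \<Longrightarrow> (\<lambda>t. expectation (gs s t)) \<longlonglongrightarrow> 0"
proof (rule Lim_null_comparison)
  assume s: "s \<in> {1..k'}"
  show "\<forall>\<^sub>F n in sequentially. norm (expectation (gs s n)) \<le> 2 * k0 n" using gs_mean_rate[OF s] by simp
  show "(\<lambda>n. 2 * k0 n) \<longlonglongrightarrow> 0" using tendsto_mult_left[OF k0_tendsto, of 2] by simp
qed

lemma zs_mean:
  assumes s: "s \<in> {1..k'}" shows "N.expectation (zs s n) = 0"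
proof -
  have "(\<lambda>t. expectation (gs s (n + t))) \<longlonglongrightarrow> N.expectation (zs s n)"
    using zeta_limit_times[OF Gs_hg hoelder_growth_one, of s n] by (simp add: gs_def[abs_def] zs_def[abs_def])
  moreover have "(\<lambda>t. expectation (gs s (n + t))) \<longlonglongrightarrow> 0"
    using LIMSEQ_ignore_initial_segment[OF gs_mean_tendsto[OF s], of n] by (simp add: add.commute)
  ultimately show ?thesis by (rule LIMSEQ_unique)
qed

text \<open>As \<open>t\<close> grows, the times of the two blocks drift apart at the speed
  \<open>slope s - slope s'\<close>, so the rate of \<open>gs_rate\<close> tends to zero along the
  limit in \<open>zs_limit\<close>.\<close>

lemma zs_orthogonal:
  assumes s: "s \<in> {1..k'}" "s' \<in> {1..k'}" "s' < s"
  shows "N.expectation (\<lambda>w. zs s n w * zs s' n' w) = 0"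
proof (rule LIMSEQ_unique[OF zs_limit])
  have sl: "slope s' < slope s" using slope_less[of s' s] s by auto
  have lim: "(\<lambda>t. k0 (slope s * (n + t) - slope s' * (n' + t)) + k0 (n + t)) \<longlonglongrightarrow> 0 + 0"
  proof (intro tendsto_add filterlim_compose[OF k0_tendsto])
    show "filterlim (\<lambda>t. n + t) sequentially sequentially"
      by (rule filterlim_at_top_mono[OF filterlim_ident]) simp
    show "filterlim (\<lambda>t. slope s * (n + t) - slope s' * (n' + t)) sequentially sequentially"
    proof (rule filterlim_at_top_mono)
      show "filterlim (\<lambda>t. t - slope s' * n') sequentially sequentially" by (rule filterlim_minus_const_nat_at_top)
      show "\<forall>\<^sub>F t in sequentially. t - slope s' * n' \<le> slope s * (n + t) - slope s' * (n' + t)"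
      proof (intro always_eventually allI)
        fix t
        have "(slope s' + 1) * t \<le> slope s * t" using sl by (intro mult_right_mono) auto
        then show "t - slope s' * n' \<le> slope s * (n + t) - slope s' * (n' + t)" by (simp add: algebra_simps)
      qed
    qed
  qed
  show "(\<lambda>t. expectation (\<lambda>w. gs s (n + t) w * gs s' (n' + t) w)) \<longlonglongrightarrow> 0"
  proof (rule Lim_null_comparison)
    show "\<forall>\<^sub>F t in sequentially. norm (expectation (\<lambda>w. gs s (n + t) w * gs s' (n' + t) w)) \<le> k0 (slope s * (n + t) - slope s' * (n' + t)) + k0 (n + t)"
      using eventually_ge_at_top[of "slope s' * n'"]
    proof eventually_elim
      case (elim t)
      have "(slope s' + 1) * t \<le> slope s * t" using sl by (intro mult_right_mono) auto
      then have "slope s' * (n' + t) \<le> slope s * (n + t)" using elim by (simp add: algebra_simps)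
      from gs_rate[OF s(1,2) this] show ?case by simp
    qed
  qed (use lim in simp)
qed

definition gam :: "nat \<Rightarrow> nat \<Rightarrow> real" where "gam s h = N.expectation (\<lambda>w. zs s 0 w * zs s h w)"

lemma zs_cov: "N.expectation (\<lambda>w. zs s n w * zs s (n + h) w) = gam s h"
proof (rule LIMSEQ_unique)
  show "(\<lambda>t. expectation (\<lambda>w. gs s (n + t) w * gs s (n + h + t) w)) \<longlonglongrightarrow> N.expectation (\<lambda>w. zs s n w * zs s (n + h) w)"
    by (rule zs_limit)
  have "(\<lambda>t. expectation (\<lambda>w. gs s (0 + t) w * gs s (h + t) w)) \<longlonglongrightarrow> gam s h" unfolding gam_def by (rule zs_limit)
  from LIMSEQ_ignore_initial_segment[OF this, of n]
  show "(\<lambda>t. expectation (\<lambda>w. gs s (n + t) w * gs s (n + h + t) w)) \<longlonglongrightarrow> gam s h" by (simp add: ac_simps)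
qed

text \<open>The secondary term of \<open>gs_rate\<close> is evaluated at an index going to infinity
  and disappears in the limit.\<close>

lemma gam_bound:
  assumes s: "s \<in> {1..k'}" shows "\<bar>gam s h\<bar> \<le> k0 (slope s * h)"
proof (rule LIMSEQ_le)
  have "(\<lambda>t. expectation (\<lambda>w. gs s (0 + t) w * gs s (h + t) w)) \<longlonglongrightarrow> gam s h" unfolding gam_def by (rule zs_limit)
  then show "(\<lambda>t. \<bar>expectation (\<lambda>w. gs s (0 + t) w * gs s (h + t) w)\<bar>) \<longlonglongrightarrow> \<bar>gam s h\<bar>" by (rule tendsto_rabs)
  have "(\<lambda>t. k0 (slope s * h) + k0 (t + h)) \<longlonglongrightarrow> k0 (slope s * h) + 0"
    by (intro tendsto_intros LIMSEQ_ignore_initial_segment[OF k0_tendsto])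
  then show "(\<lambda>t. k0 (slope s * h) + k0 (t + h)) \<longlonglongrightarrow> k0 (slope s * h)" by simp
  show "\<exists>t0. \<forall>t\<ge>t0. \<bar>expectation (\<lambda>w. gs s (0 + t) w * gs s (h + t) w)\<bar> \<le> k0 (slope s * h) + k0 (t + h)"
  proof (intro exI allI impI)
    fix t
    have "slope s * t \<le> slope s * (h + t)" by simp
    moreover have "slope s * (h + t) - slope s * t = slope s * h" by (simp add: algebra_simps)
    ultimately show "\<bar>expectation (\<lambda>w. gs s (0 + t) w * gs s (h + t) w)\<bar> \<le> k0 (slope s * h) + k0 (t + h)"
      using gs_rate[OF s s, of t "h + t"] by (simp add: mult.commute add.commute)
  qed
qed

definition Z :: "nat \<Rightarrow> 'b \<Rightarrow> real" where "Z n w = (\<Sum>s=1..k'. zs s n w)"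

lemma ZZ: "N.expectation (\<lambda>w. Z n w * Z (n + h) w) = (\<Sum>s=1..k'. gam s h)"
proof -
  have "N.expectation (\<lambda>w. Z n w * Z (n + h) w) = (\<Sum>s=1..k'. \<Sum>s'=1..k'. N.expectation (\<lambda>w. zs s n w * zs s' (n + h) w))"
    unfolding Z_def sum_product using zszs by simp
  also have "\<dots> = (\<Sum>s=1..k'. \<Sum>s'=1..k'. if s = s' then gam s h else 0)"
  proof (intro sum.cong refl)
    fix s s' assume s: "s \<in> {1..k'}" "s' \<in> {1..k'}"
    show "N.expectation (\<lambda>w. zs s n w * zs s' (n + h) w) = (if s = s' then gam s h else 0)"
    proof (cases s s' rule: linorder_cases)
      case less then show ?thesis using zs_orthogonal[OF s(2,1) less, of "n + h" n] by (simp add: mult.commute)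
    next
      case equal then show ?thesis using zs_cov by simp
    next
      case greater then show ?thesis using zs_orthogonal[OF s greater] by simp
    qed
  qed
  also have "\<dots> = (\<Sum>s=1..k'. gam s h)" by simp
  finally show ?thesis .
qed

lemma weakly_stationary_Z: "weakly_stationary_process N Z (\<lambda>h. \<Sum>s=1..k'. gam s h)"
proof unfold_locales
  show "Z n \<in> borel_measurable N" for n unfolding Z_def[abs_def] by measurable
  have "(Z n w)\<^sup>2 = (\<Sum>s=1..k'. \<Sum>s'=1..k'. zs s n w * zs s' n w)" for n w
    unfolding Z_def power2_eq_square by (rule sum_product)
  then show "integrable N (\<lambda>w. (Z n w)\<^sup>2)" for n using zszs by simp
  show "N.expectation (Z n) = 0" for n unfolding Z_def[abs_def] using zs_integrable zs_mean by simp
  show "N.expectation (\<lambda>w. Z n w * Z (n + h) w) = (\<Sum>s=1..k'. gam s h)" for n h by (rule ZZ)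
  show "summable (\<lambda>h. real h * \<bar>\<Sum>s=1..k'. gam s h\<bar>)"
  proof (rule summable_comparison_test')
    show "summable (\<lambda>h. \<Sum>s=1..k'. real (slope s * h) * k0 (slope s * h))"
    proof (rule summable_sum)
      fix s assume s: "s \<in> {1..k'}"
      have "inj (\<lambda>h. slope s * h)" using slope_pos[of s] s by (intro injI) auto
      from summable_reindex[OF k0_summable this] show "summable (\<lambda>h. real (slope s * h) * k0 (slope s * h))"
        using k0_nonneg by (simp add: o_def)
    qed
    fix h
    have "real h * \<bar>\<Sum>s=1..k'. gam s h\<bar> \<le> real h * (\<Sum>s=1..k'. \<bar>gam s h\<bar>)" by (intro mult_left_mono sum_abs) simp
    also have "\<dots> = (\<Sum>s=1..k'. real h * \<bar>gam s h\<bar>)" by (rule sum_distrib_left)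
    also have "\<dots> \<le> (\<Sum>s=1..k'. real (slope s * h) * k0 (slope s * h))"
    proof (rule sum_mono)
      fix s assume s: "s \<in> {1..k'}"
      have "1 * h \<le> slope s * h" using slope_pos[of s] s by (intro mult_right_mono) auto
      then have "real h \<le> real (slope s * h)" by (simp only: mult_1 of_nat_le_iff)
      then show "real h * \<bar>gam s h\<bar> \<le> real (slope s * h) * k0 (slope s * h)"
        using gam_bound[OF s, of h] k0_nonneg by (intro mult_mono) auto
    qed
    finally show "norm (real h * \<bar>\<Sum>s=1..k'. gam s h\<bar>) \<le> (\<Sum>s=1..k'. real (slope s * h) * k0 (slope s * h))" by simp
  qed
qed

end

section \<open>Comparison of the two limiting variances\<close>

context block_processes begin

interpretation bs: block_sums M gs k' slope "\<lambda>u. 2 * k0 u" by (rule block_sums_gs)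
interpretation ws: weakly_stationary_process N Z "\<lambda>h. \<Sum>s=1..k'. gam s h" by (rule weakly_stationary_Z)

lemma zs_cov_df: "N.expectation (\<lambda>w. zs s n w * zs s n' w) = gam s (ws.df n n')"
proof (cases "n \<le> n'")
  case True
  then have eq: "n + ws.df n n' = n'" by (simp add: ws.df_def)
  show ?thesis using zs_cov[of s n "ws.df n n'"] unfolding eq .
next
  case False
  then have eq: "n' + ws.df n n' = n" by (simp add: ws.df_def)
  show ?thesis using zs_cov[of s n' "ws.df n n'"] unfolding eq by (simp add: mult.commute)
qed

text \<open>Both covariance arrays decay with the separation, and their difference tends to zero
  along each diagonal by \<open>zs_limit\<close>, so \<open>average_null\<close> applies.\<close>

lemma average_difference:
  assumes s: "s \<in> {1..k'}"
  shows "(\<lambda>NN. bs.x s s NN - (\<Sum>n=1..NN. \<Sum>n'=1..NN. gam s (ws.df n n')) / real NN) \<longlonglongrightarrow> 0"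
proof -
  define e where "e n n' = bs.c s s n n' - gam s (ws.df n n')" for n n'
  have eb: "\<bar>e n n'\<bar> \<le> 3 * k0 (slope s * n - slope s * n') + 3 * k0 n" if le: "slope s * n' \<le> slope s * n" for n n'
  proof -
    have "n' \<le> n" using le slope_pos[of s] s by simp
    then have "slope s * ws.df n n' = slope s * n - slope s * n'" by (simp add: ws.df_def diff_mult_distrib2)
    then have "\<bar>gam s (ws.df n n')\<bar> \<le> k0 (slope s * n - slope s * n')" using gam_bound[OF s, of "ws.df n n'"] by simp
    then show ?thesis using bs.bound[OF s s le] k0_nonneg[of n] unfolding e_def bs.c_def by linarith
  qed
  have sym: "e n n' = e n' n" for n n'
    unfolding e_def bs.c_def by (simp add: mult.commute ws.df_commute)
  interpret ar: decaying_array e "slope s" "slope s" "\<lambda>u. 3 * k0 u"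
  proof
    show "\<bar>e n n'\<bar> \<le> 3 * k0 (slope s * n - slope s * n') + 3 * k0 n" if "slope s * n' \<le> slope s * n" for n n'
      by (rule eb[OF that])
    show "\<bar>e n n'\<bar> \<le> 3 * k0 (slope s * n' - slope s * n) + 3 * k0 n'" if "slope s * n \<le> slope s * n'" for n n'
      unfolding sym[of n] by (rule eb[OF that])
    show "summable (\<lambda>u. real u * (3 * k0 u))" using summable_mult[OF k0_summable, of 3] by (simp add: mult.left_commute)
  qed (use slope_pos[of s] s k0_nonneg in auto)
  have "(\<lambda>t. e (n + t) (n' + t)) \<longlonglongrightarrow> 0" for n n'
  proof -
    have "(\<lambda>t. bs.c s s (n + t) (n' + t) - gam s (ws.df n n')) \<longlonglongrightarrow> gam s (ws.df n n') - gam s (ws.df n n')"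
      unfolding bs.c_def using zs_limit[of s n s n'] unfolding zs_cov_df by (intro tendsto_intros)
    moreover have "ws.df (n + t) (n' + t) = ws.df n n'" for t by (simp add: ws.df_def)
    ultimately show ?thesis by (simp add: e_def)
  qed
  from ar.average_null[OF refl this]
  show ?thesis unfolding e_def bs.x_def by (simp add: sum_subtractf diff_divide_distrib)
qed

text \<open>On \<open>N\<close> the covariances between different blocks vanish exactly, so
  \<open>ws.v\<close> is a sum of diagonal contributions only, and each has the same average limit
  as its counterpart on \<open>M\<close>.\<close>

lemma s2_eq: "ws.s2 = (\<Sum>s=1..k'. bs.D s)"
proof -
  have v: "ws.v NN = (\<Sum>s=1..k'. \<Sum>n=1..NN. \<Sum>n'=1..NN. gam s (ws.df n n'))" for NN
  proof -
    have "ws.v NN = N.expectation (\<lambda>w. (\<Sum>i=1..<1+NN. Z i w)\<^sup>2)" by (rule ws.block_sum_square(2)[symmetric])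
    also have "\<dots> = N.expectation (\<lambda>w. \<Sum>n=1..NN. \<Sum>n'=1..NN. Z n w * Z n' w)"
      by (simp add: power2_eq_square sum_product atLeastLessThanSuc_atLeastAtMost)
    also have "\<dots> = (\<Sum>n=1..NN. \<Sum>n'=1..NN. N.expectation (\<lambda>w. Z n w * Z n' w))"
      using ws.ZZ by simp
    also have "\<dots> = (\<Sum>n=1..NN. \<Sum>n'=1..NN. \<Sum>s=1..k'. gam s (ws.df n n'))"
    proof (intro sum.cong refl)
      fix n n'
      show "N.expectation (\<lambda>w. Z n w * Z n' w) = (\<Sum>s=1..k'. gam s (ws.df n n'))"
      proof (cases "n \<le> n'")
        case True
        then have eq: "n + ws.df n n' = n'" by (simp add: ws.df_def)
        show ?thesis using ZZ[of n "ws.df n n'"] unfolding eq .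
      next
        case False
        then have eq: "n' + ws.df n n' = n" by (simp add: ws.df_def)
        show ?thesis using ZZ[of n' "ws.df n n'"] unfolding eq by (simp add: mult.commute)
      qed
    qed
    also have "\<dots> = (\<Sum>n=1..NN. \<Sum>s=1..k'. \<Sum>n'=1..NN. gam s (ws.df n n'))" by (intro sum.cong refl sum.swap)
    also have "\<dots> = (\<Sum>s=1..k'. \<Sum>n=1..NN. \<Sum>n'=1..NN. gam s (ws.df n n'))" by (rule sum.swap)
    finally show ?thesis .
  qed
  have "(\<lambda>NN. \<Sum>s=1..k'. bs.x s s NN - (\<Sum>n=1..NN. \<Sum>n'=1..NN. gam s (ws.df n n')) / real NN) \<longlonglongrightarrow> (\<Sum>s=1..k'. 0)"
    by (intro tendsto_sum average_difference)
  then have "(\<lambda>NN. (\<Sum>s=1..k'. bs.x s s NN) - ws.v NN / real NN) \<longlonglongrightarrow> 0"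
    unfolding v by (simp add: sum_subtractf sum_divide_distrib)
  from tendsto_add[OF this ws.v_average] have "(\<lambda>NN. \<Sum>s=1..k'. bs.x s s NN) \<longlonglongrightarrow> ws.s2" by simp
  moreover have "(\<lambda>NN. \<Sum>s=1..k'. bs.x s s NN) \<longlonglongrightarrow> (\<Sum>s=1..k'. bs.D s)" by (intro tendsto_sum bs.D_lim)
  ultimately show ?thesis by (rule LIMSEQ_unique)
qed

lemma nu_eq:
  assumes s: "s \<in> {1..k}"
  shows "nu M X q l s = distr N (PiM (Bl q l s) (\<lambda>_. borel)) (\<lambda>w. Y s 0 w)"
proof -
  have 0: "(\<lambda>y. y 0) \<in> path_space s \<rightarrow>\<^sub>M PiM (Bl q l s) (\<lambda>_. borel :: (real^'d) measure)"
    by (rule measurable_component_singleton) simp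
  have "distr N (PiM (Bl q l s) (\<lambda>_. borel)) (\<lambda>w. Y s 0 w) = distr (distr N (path_space s) (\<lambda>w n. Y s n w)) (PiM (Bl q l s) (\<lambda>_. borel)) (\<lambda>y. y 0)"
    by (subst distr_distr[OF 0 Y_path[OF s]]) (simp add: o_def)
  also have "\<dots> = nu M X q l s"
    unfolding Y_law[rule_format, OF s] by (subst distr_distr[OF 0 X_path]) (simp add: o_def nu_def)
  finally show ?thesis ..
qed

text \<open>By independence, the values of the block processes at time 0 have the product of the
  \<open>nu\<close> as their joint law.\<close>

lemma integral_nu:
  "(\<integral>y. G (\<lambda>j. y (blk q l j) j) \<partial>(PiM {1..k} (\<lambda>s. nu M X q l s))) = N.expectation (\<lambda>w. G (zeta (\<lambda>_. 0) w))"
proof -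
  define P where "P s = PiM (Bl q l s) (\<lambda>_. borel :: (real^'d) measure)" for s
  define F where "F y = G (\<lambda>j. if j \<in> {1..L} then y (blk q l j) j else 0)" for y :: "nat \<Rightarrow> nat \<Rightarrow> real^'d"
  have Y0: "(\<lambda>w. Y s 0 w) \<in> N \<rightarrow>\<^sub>M P s" if s: "s \<in> {1..k}" for s
    using measurable_compose[OF Y_path[OF s] measurable_component_singleton[of 0 UNIV]] unfolding P_def by simp
  have ind: "N.indep_vars P (\<lambda>s w. Y s 0 w) {1..k}"
    unfolding P_def by (rule N.indep_vars_compose2[OF Y_indep, where Y="\<lambda>_ y. y 0"]) (rule measurable_component_singleton, simp)
  have ne: "{1..k} \<noteq> {}" using k_pos by simp
  have "PiM {1..k} (\<lambda>s. nu M X q l s) = PiM {1..k} (\<lambda>s. distr N (P s) (\<lambda>w. Y s 0 w))"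
    unfolding P_def by (rule PiM_cong[OF refl]) (rule nu_eq)
  also have "\<dots> = distr N (PiM {1..k} P) (\<lambda>w. \<lambda>s\<in>{1..k}. Y s 0 w)"
    using N.indep_vars_iff_distr_eq_PiM'[where X="\<lambda>s w. Y s 0 w", OF ne Y0] ind by simp
  finally have PiM_eq: "PiM {1..k} (\<lambda>s. nu M X q l s) = distr N (PiM {1..k} P) (\<lambda>w. \<lambda>s\<in>{1..k}. Y s 0 w)" .
  have Fm: "F \<in> borel_measurable (PiM {1..k} P)"
    unfolding F_def
  proof (rule hg_measurable[OF G_hg])
    fix j
    show "(\<lambda>y. if j \<in> {1..L} then y (blk q l j) j else 0) \<in> borel_measurable (PiM {1..k} P)"
    proof (cases "j \<in> {1..L}")
      case True
      have "j \<in> Bl q l (blk q l j)" using blk_range[OF True] by simp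
      then have "(\<lambda>y. y j) \<in> borel_measurable (P (blk q l j))" unfolding P_def by (rule measurable_component_singleton)
      from measurable_compose[OF measurable_component_singleton[OF blk_k[OF True], of P] this] show ?thesis using True by simp
    next
      case False then show ?thesis by (simp only: if_False) simp
    qed
  qed
  have "(\<integral>y. G (\<lambda>j. y (blk q l j) j) \<partial>(PiM {1..k} (\<lambda>s. nu M X q l s))) = (\<integral>y. F y \<partial>(PiM {1..k} (\<lambda>s. nu M X q l s)))"
    unfolding F_def by (intro Bochner_Integration.integral_cong refl hoelder_growth_cong[OF G_hg]) simp
  also have "\<dots> = N.expectation (\<lambda>w. F (\<lambda>s\<in>{1..k}. Y s 0 w))"
    unfolding PiM_eq by (rule integral_distr[OF measurable_restrict[OF Y0] Fm])
  also have "\<dots> = N.expectation (\<lambda>w. G (zeta (\<lambda>_. 0) w))"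
    unfolding F_def zeta_def using blk_k by (intro Bochner_Integration.integral_cong refl arg_cong[where f=G]) auto
  finally show ?thesis .
qed

text \<open>The means of \<open>G\<close> along the process have two limits: \<open>h0\<close>,
  because the means of the \<open>gs s\<close> vanish asymptotically, and the integral of
  \<open>G\<close> over the product of the \<open>nu\<close>.\<close>

lemma h0_zero:
  assumes "(\<integral>y. G (\<lambda>j. y (blk q l j) j) \<partial>(PiM {1..k} (\<lambda>s. nu M X q l s))) = 0"
  shows "h0 = 0"
proof (rule LIMSEQ_unique)
  have G: "expectation (\<lambda>w. G (\<lambda>j. X (a j * t + b j) w)) = h0 + (\<Sum>s=1..k'. expectation (gs s t))" for t
  proof -
    have "G (\<lambda>j. X (a j * t + b j) w) = h0 + (\<Sum>s=1..k'. gs s t w)" for w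
      by (simp add: G_decomp[of "\<lambda>j. X (a j * t + b j) w"] H_0 gs_def)
    moreover have "integrable M (gs s t)" for s by (rule square_integrable[OF gs_measurable gs_square])
    ultimately show ?thesis using prob_space by simp
  qed
  have "(\<lambda>t. h0 + (\<Sum>s=1..k'. expectation (gs s t))) \<longlonglongrightarrow> h0 + (\<Sum>s=1..k'. 0)"
    by (intro tendsto_intros tendsto_sum gs_mean_tendsto)
  then show "(\<lambda>t. expectation (\<lambda>w. G (\<lambda>j. X (a j * t + b j) w))) \<longlonglongrightarrow> h0" unfolding G by simp
  show "(\<lambda>t. expectation (\<lambda>w. G (\<lambda>j. X (a j * t + b j) w))) \<longlonglongrightarrow> 0"
    using zeta_limit_origin[OF G_hg hoelder_growth_one] assms unfolding integral_nu by simp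
qed

text \<open>With \<open>h0 = 0\<close> the decomposition has no constant term, so the original
  summand is pointwise the sum of the \<open>gs s n\<close> and the summand of the independent
  processes is pointwise \<open>Z n\<close>. Positivity on both sides is then positivity of the sum
  of the \<open>D s\<close>.\<close>

lemma variance_dichotomy:
  assumes G0: "(\<integral>y. G (\<lambda>j. y (blk q l j) j) \<partial>(PiM {1..k} (\<lambda>s. nu M X q l s))) = 0"
  shows "\<exists>sigma2 s2.
     ((\<lambda>NN. var M (\<lambda>w. \<Sum>n=1..NN. G (\<lambda>j. X (qv (q j) n) w)) / real NN) \<longlonglongrightarrow> sigma2) \<and>
     ((\<lambda>NN. var N (\<lambda>w. \<Sum>n=1..NN. G (\<lambda>j. Y (blk q l j) (qv (q (rr q l (blk q l j - 1) + 1)) n) w j))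
              / real NN) \<longlonglongrightarrow> s2) \<and>
     (sigma2 > 0 \<longleftrightarrow> s2 > 0) \<and>
     (s2 > 0 \<longleftrightarrow>
        \<not> (\<exists>V :: nat \<Rightarrow> 'b \<Rightarrow> real. weakly_stationary N V \<and>
              (\<forall>n. AE w in N. G (\<lambda>j. Y (blk q l j) (qv (q (rr q l (blk q l j - 1) + 1)) n) w j)
                               = V (n + 1) w - V n w)))"
proof -
  have GX: "G (\<lambda>j. X (qv (q j) n) w) = (\<Sum>s=1..k'. gs s n w)" for n w
  proof -
    have "G (\<lambda>j. X (qv (q j) n) w) = G (\<lambda>j. X (a j * n + b j) w)"
      by (rule hoelder_growth_cong[OF G_hg]) (simp add: qv_eq)
    then show ?thesis by (simp add: G_decomp[of "\<lambda>j. X (a j * n + b j) w"] H_0 gs_def h0_zero[OF G0])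
  qed
  have GY: "G (\<lambda>j. Y (blk q l j) (qv (q (rr q l (blk q l j - 1) + 1)) n) w j) = Z n w" for n w
  proof -
    have "G (\<lambda>j. Y (blk q l j) (qv (q (rr q l (blk q l j - 1) + 1)) n) w j) = G (zeta (tm n) w)"
    proof (rule hoelder_growth_cong[OF G_hg])
      fix j assume j: "j \<in> {1..L}"
      have "qv (q (fst_idx (blk q l j))) n = tm n (blk q l j)"
        unfolding tm_def using blk_range[OF j] by (intro qv_first) auto
      then show "Y (blk q l j) (qv (q (rr q l (blk q l j - 1) + 1)) n) w j = zeta (tm n) w j"
        using j by (simp add: zeta_def fst_idx_def)
    qed
    then show ?thesis by (simp add: G_decomp[of "zeta (tm n) w"] H_0 Z_def zs_def h0_zero[OF G0])
  qed
  show ?thesis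
    unfolding GX GY
    using bs.variance_lim ws.variance_average bs.sigma2_pos_iff ws.s2_pos_iff unfolding s2_eq[symmetric] by blast
qed

end

theorem theorem2p4:
  fixes M :: "'a measure"
    and Fam :: "ereal \<Rightarrow> ereal \<Rightarrow> 'a measure"
    and X :: "nat \<Rightarrow> 'a \<Rightarrow> real ^ 'd"
    and l :: nat and q :: "nat \<Rightarrow> real poly"
    and F :: "(nat \<Rightarrow> real ^ 'd) \<Rightarrow> real"
    and G :: "(nat \<Rightarrow> real ^ 'd) \<Rightarrow> real"
    and K iota kappa p qe delta m :: real
    and k :: nat
    and N :: "'b measure"
    and Y :: "nat \<Rightarrow> nat \<Rightarrow> 'b \<Rightarrow> (nat \<Rightarrow> real ^ 'd)"
  assumes M: "prob_space M"
    and Fam_sub: "\<forall>a\<in>idx. \<forall>b\<in>idx. a \<le> b \<longrightarrow> subalgebra M (Fam a b)"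
    and Fam_mono: "\<forall>a\<in>idx. \<forall>b\<in>idx. \<forall>a'\<in>idx. \<forall>b'\<in>idx.
                     a' \<le> a \<longrightarrow> a \<le> b \<longrightarrow> b \<le> b' \<longrightarrow> sets (Fam a b) \<subseteq> sets (Fam a' b')"
    and X_meas: "\<forall>n. X n \<in> borel_measurable M"
    (* the polynomials q_1, ..., q_l *)
    and l_pos: "l \<ge> 1"
    and q_nonconst: "\<forall>i\<in>{1..l}. degree (q i) \<ge> 1"
    and q_nat: "\<forall>i\<in>{1..l}. \<forall>n::nat. poly (q i) (real n) \<in> \<nat>"
    and q_incr: "eventually (\<lambda>n::nat. \<forall>i\<in>{1..<l}. poly (q i) (real n) < poly (q (i+1)) (real n)) sequentially"
    (* stationarity *)
    and X_ident: "\<forall>n. distr M borel (X n) = distr M borel (X 0)"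
    and X_stat: "\<forall>kk \<le> 2 * card (Dhat q l). \<forall>ns :: nat \<Rightarrow> nat. \<forall>c::nat.
                   (\<forall>j. Suc j < kk \<longrightarrow> ns j \<le> ns (Suc j)) \<longrightarrow>
                   distr M (PiM {..<kk} (\<lambda>_. borel)) (\<lambda>w. \<lambda>j\<in>{..<kk}. X (ns j) w)
                   = distr M (PiM {..<kk} (\<lambda>_. borel)) (\<lambda>w. \<lambda>j\<in>{..<kk}. X (ns j + c) w)"
    (* the function F of the general setup *)
    and K_pos: "K > 0" and iota_pos: "iota > 0" and kappa: "0 < kappa" "kappa \<le> 1"
    and F_hg: "hoelder_growth l K iota kappa F"
    (* Assumption 2.1, with the strengthened summability conditions *)
    and pq: "1 \<le> p" "1 \<le> qe"
    and delta_pos: "delta > 0" and m_pos: "m > 0"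
    and delta_lt: "delta < kappa - real ((lhat q l - 1) * card (Dhat q l) * CARD('d)) / p"
    and sum_varpi: "(\<Sum>n. ennreal (real n) * varpi M Fam qe p n) < \<top>"
    and sum_beta: "(\<Sum>r. ennreal (real r) * enn_powr (beta M Fam X qe r) delta) < \<top>"
    and gamma_m: "lpnorm M m (X 0) < \<top>"
    and gamma_2qi: "lpnorm M (2 * qe * iota) (X 0) < \<top>"
    and exps: "1 / 2 \<ge> 1 / p + (iota + 2) / m + delta / qe"
    (* q_1 linear; k with r_k = i_1 *)
    and q1_lin: "degree (q 1) = 1"
    and k_pos: "k \<ge> 1"
    and rk: "rr q l k = Max {i\<in>{1..l}. degree (q i) = 1}"
    (* the function G *)
    and G_hg: "hoelder_growth (rr q l k) K iota kappa G"
    and G_centered: "(\<integral>y. G (\<lambda>j. y (blk q l j) j) \<partial>(PiM {1..k} (\<lambda>s. nu M X q l s))) = 0"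
    (* the independent block processes Y^(1), ..., Y^(k) *)
    and N: "prob_space N"
    and Y_indep: "prob_space.indep_vars N (\<lambda>s. PiM UNIV (\<lambda>_. PiM (Bl q l s) (\<lambda>_. borel)))
                    (\<lambda>s w. \<lambda>n. Y s n w) {1..k}"
    and Y_law: "\<forall>s\<in>{1..k}.
                  distr N (PiM UNIV (\<lambda>_. PiM (Bl q l s) (\<lambda>_. borel))) (\<lambda>w n. Y s n w)
                = distr M (PiM UNIV (\<lambda>_. PiM (Bl q l s) (\<lambda>_. borel)))
                          (\<lambda>w n. \<lambda>j\<in>Bl q l s. X (n + doff q l j) w)"
  shows "\<exists>sigma2 s2.
     ((\<lambda>NN. var M (\<lambda>w. \<Sum>n=1..NN. G (\<lambda>j. X (qv (q j) n) w)) / real NN) \<longlonglongrightarrow> sigma2) \<and>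
     ((\<lambda>NN. var N (\<lambda>w. \<Sum>n=1..NN. G (\<lambda>j. Y (blk q l j) (qv (q (rr q l (blk q l j - 1) + 1)) n) w j))
              / real NN) \<longlonglongrightarrow> s2) \<and>
     (sigma2 > 0 \<longleftrightarrow> s2 > 0) \<and>
     (s2 > 0 \<longleftrightarrow>
        \<not> (\<exists>V :: nat \<Rightarrow> 'b \<Rightarrow> real. weakly_stationary N V \<and>
              (\<forall>n. AE w in N. G (\<lambda>j. Y (blk q l j) (qv (q (rr q l (blk q l j - 1) + 1)) n) w j)
                               = V (n + 1) w - V n w)))"
proof -
  interpret M: prob_space M by (rule M)
  interpret pb: poly_blocks q l k
    using l_pos q_nonconst q_nat q_incr q1_lin k_pos rk by unfold_locales
  have "real ((lhat q l - 1) * card (Dhat q l) * CARD('d)) / p \<ge> 0" using pq by simp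
  then have dk: "delta < kappa" using delta_lt by linarith
  interpret mp: mixing_process M Fam X iota kappa p qe delta m
    using Fam_sub Fam_mono X_meas X_ident iota_pos kappa pq delta_pos m_pos dk sum_varpi sum_beta gamma_m gamma_2qi exps
    by unfold_locales
  interpret sm: stationary_mixing_process M Fam X iota kappa p qe delta m "2 * card (Dhat q l)"
    by unfold_locales (rule X_stat)
  interpret la: linear_averages M Fam X iota kappa p qe delta m q l k G K
    using G_hg delta_lt by unfold_locales (simp_all add: pb.L_def)
  interpret NN: prob_space N by (rule N)
  interpret bp: block_processes M Fam X iota kappa p qe delta m q l k G K N Y
    using Y_indep Y_law by unfold_locales
  show ?thesis by (rule bp.variance_dichotomy[OF G_centered])
qed

end
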